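(* Let $\Gamma$ be a $C^2$ smooth Jordan curve in the plane and let $Z\subset\overline{\mathbb C}\setminus\Gamma$ be a non-empty closed set. Let $\{a_{1,n},\ldots,a_{n,n}\}$, $n=1,2,\ldots$, be an array of points from $Z$ and let $z_0\in\Gamma$. Then there are non-zero rational functions $R_n$, $n=1,2,\dots$, of total degree $n+o(n)$ (as $n\to\infty$) such that $a_{1,n},\ldots,a_{n,n}$ are among the poles of $R_n$ (if a point $a\in Z$ appears $k$ times in $\{a_{1,n},\ldots,a_{n,n}\}$, this means that $R_n$ has a pole of order $k$ at $a$) and $$|R_n'(z_0)|\ge (1-o(1))\,\|R_n\|_{\Gamma}\,\max\left(\sum_{a_{j,n}\in G_+}\frac{\partial g_{G_+}(z_0,a_{j,n})}{\partial \mathbf n_+},\ \sum_{a_{j,n}\in G_-}\frac{\partial g_{G_-}(z_0,a_{j,n})}{\partial \mathbf n_-}\right),$$ where $o(1)$ denotes a quantity tending to $0$ as $n\to\infty$, and the sums are over the indices $1\le j\le n$ with $a_{j,n}\in G_+$, respectively $a_{j,n}\in G_-$.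
   Context: $\overline{\mathbb C}=\mathbb C\cup\{\infty\}$. A Jordan curve is a homeomorphic image of a circle; it is $C^2$ smooth if it has a twice continuously differentiable parametrization over the unit circle with nowhere vanishing derivative. $G_-$ and $G_+$ denote the bounded and the unbounded component of $\overline{\mathbb C}\setminus\Gamma$ (so $\infty\in G_+$). At $z\in\Gamma$, $\mathbf n_-$ and $\mathbf n_+$ are the unit normals to $\Gamma$ pointing towards $G_-$ and $G_+$ respectively. $g_G(z,a)$ is the Green's function of the domain $G$ with pole at $a\in G$, and $\partial g_{G_\pm}(z_0,a)/\partial\mathbf n_\pm$ is its (one-sided) directional derivative at the boundary point $z_0$ in the direction $\mathbf n_\pm(z_0)$. The total degree of a rational function is the sum of the orders of its poles, including a possible pole at $\infty$. $\|f\|_\Gamma=\sup_{z\in\Gamma}|f(z)|$ (equal to $+\infty$ if $f$ has a pole on $\Gamma$). *)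

theory Defs
  imports
    "HOL-Analysis.Analysis"
    "HOL-Library.Landau_Symbols"
    "HOL-Computational_Algebra.Computational_Algebra"
    "HOL-Computational_Algebra.Field_as_Ring"
begin

text \<open>
  The extended plane is the one-point compactification of the complex plane, with points of
  type \<^typ>\<open>complex option\<close>: \<^const>\<open>None\<close> is the point at infinity.
\<close>

abbreviation extended_plane :: "complex option topology" where
  "extended_plane \<equiv> Alexandroff_compactification (euclidean :: complex topology)"


section \<open>Smooth Jordan curves\<close>

text \<open>
  A parametrization over the unit circle is differentiated with respect to the angle.
\<close>

definition C2_parametrization :: "(complex \<Rightarrow> complex) \<Rightarrow> complex set \<Rightarrow> bool" where
  "C2_parametrization \<phi> \<Gamma> \<longleftrightarrow>
     (\<exists>\<psi>. homeomorphism (sphere 0 1) \<Gamma> \<phi> \<psi>) \<and>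
     (\<exists>\<phi>' \<phi>''.
        (\<forall>t::real. ((\<lambda>s. \<phi> (cis s)) has_vector_derivative \<phi>' t) (at t)) \<and>
        (\<forall>t::real. (\<phi>' has_vector_derivative \<phi>'' t) (at t)) \<and>
        continuous_on UNIV \<phi>'' \<and>
        (\<forall>t. \<phi>' t \<noteq> 0))"

definition C2_Jordan_curve :: "complex set \<Rightarrow> bool" where
  "C2_Jordan_curve \<Gamma> \<longleftrightarrow> (\<exists>\<phi>. C2_parametrization \<phi> \<Gamma>)"

text \<open>
  For a Jordan curve, \<^const>\<open>inside\<close> and \<^const>\<open>outside\<close> are the bounded and the unbounded
  component of the complement in the plane; the latter is completed by the point at infinity.
\<close>

definition G_minus :: "complex set \<Rightarrow> complex option set" where
  "G_minus \<Gamma> = Some ` inside \<Gamma>"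

definition G_plus :: "complex set \<Rightarrow> complex option set" where
  "G_plus \<Gamma> = insert None (Some ` outside \<Gamma>)"

definition is_unit_normal_towards ::
    "complex set \<Rightarrow> complex option set \<Rightarrow> complex \<Rightarrow> complex \<Rightarrow> bool" where
  "is_unit_normal_towards \<Gamma> G z n \<longleftrightarrow>
     norm n = 1 \<and>
     (\<exists>\<phi> t d. C2_parametrization \<phi> \<Gamma> \<and> \<phi> (cis t) = z \<and>
        ((\<lambda>s. \<phi> (cis s)) has_vector_derivative d) (at t) \<and> n \<bullet> d = 0) \<and>
     (\<forall>\<^sub>F s in at_right 0. Some (z + of_real s * n) \<in> G)"

definition unit_normal :: "complex set \<Rightarrow> complex option set \<Rightarrow> complex \<Rightarrow> complex" where
  "unit_normal \<Gamma> G z = (THE n. is_unit_normal_towards \<Gamma> G z n)"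


section \<open>Green's functions\<close>

definition harmonic_on :: "(complex \<Rightarrow> real) \<Rightarrow> complex set \<Rightarrow> bool" where
  "harmonic_on u S \<longleftrightarrow> open S \<and>
     (\<exists>ux uy uxx uxy uyx uyy :: complex \<Rightarrow> real.
        (\<forall>z\<in>S.
           (u has_derivative (\<lambda>h. ux z * Re h + uy z * Im h)) (at z) \<and>
           (ux has_derivative (\<lambda>h. uxx z * Re h + uxy z * Im h)) (at z) \<and>
           (uy has_derivative (\<lambda>h. uyx z * Re h + uyy z * Im h)) (at z) \<and>
           uxx z + uyy z = 0) \<and>
        continuous_on S uxx \<and> continuous_on S uxy \<and>
        continuous_on S uyx \<and> continuous_on S uyy)"

text \<open>The chart of the extended plane around infinity, \<open>w \<mapsto> 1 / w\<close>.\<close>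

definition inversion_chart :: "complex \<Rightarrow> complex option" where
  "inversion_chart w = (if w = 0 then None else Some (1 / w))"

definition harmonic_on_extended :: "(complex option \<Rightarrow> real) \<Rightarrow> complex option set \<Rightarrow> bool" where
  "harmonic_on_extended u G \<longleftrightarrow>
     harmonic_on (u \<circ> Some) (Some -` G) \<and>
     harmonic_on (u \<circ> inversion_chart) (inversion_chart -` G)"

text \<open>
  The Green's function of a domain all of whose boundary points are regular (such as a Jordan
  domain), so that the boundary values are 0 everywhere. Outside the domain and at the pole,
  where it is \<open>+\<infinity>\<close>, the function is set to 0; this makes it unique as a total function, and
  is the continuous extension to the boundary.
\<close>

definition is_Green_function ::
    "complex option set \<Rightarrow> complex option \<Rightarrow> (complex option \<Rightarrow> real) \<Rightarrow> bool" where
  "is_Green_function G a g \<longleftrightarrow>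
     harmonic_on_extended g (G - {a}) \<and>
     (case a of
        Some w \<Rightarrow> (\<lambda>z. g (Some z) + ln (norm (z - w))) \<in> O[at w](\<lambda>_. 1)
      | None \<Rightarrow> (\<lambda>z. g (Some z) - ln (norm z)) \<in> O[at_infinity](\<lambda>_. 1)) \<and>
     (\<forall>\<zeta> \<in> extended_plane frontier_of G. (g \<longlongrightarrow> 0) (atin_within extended_plane \<zeta> G)) \<and>
     (\<forall>z. z \<notin> G - {a} \<longrightarrow> g z = 0)"

definition Green_function :: "complex option set \<Rightarrow> complex option \<Rightarrow> complex option \<Rightarrow> real" where
  "Green_function G a = (THE g. is_Green_function G a g)"

text \<open>
  The one-sided derivative of \<open>g\<^sub>G(\<cdot>, a)\<close> at a point \<open>z\<close> of the curve in the direction of the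
  unit normal pointing towards \<open>G\<close>.
\<close>

definition Green_normal_derivative ::
    "complex set \<Rightarrow> complex option set \<Rightarrow> complex option \<Rightarrow> complex \<Rightarrow> real" where
  "Green_normal_derivative \<Gamma> G a z =
     vector_derivative (\<lambda>s. Green_function G a (Some (z + of_real s * unit_normal \<Gamma> G z)))
       (at 0 within {0..})"


section \<open>Rational functions\<close>

text \<open>
  Rational functions are elements of the fraction field of the polynomial ring. Since
  \<^const>\<open>quot_of_fract\<close> yields coprime polynomials, zeros of the denominator are poles.
\<close>

definition rat_num :: "complex poly fract \<Rightarrow> complex poly" where
  "rat_num R = fst (quot_of_fract R)"

definition rat_den :: "complex poly fract \<Rightarrow> complex poly" where
  "rat_den R = snd (quot_of_fract R)"

definition rat_eval :: "complex poly fract \<Rightarrow> complex \<Rightarrow> complex" where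
  "rat_eval R z = poly (rat_num R) z / poly (rat_den R) z"

text \<open>The order of the pole at a point of the extended plane; 0 if there is no pole.
  At infinity the subtraction is truncated.\<close>

definition pole_order :: "complex poly fract \<Rightarrow> complex option \<Rightarrow> nat" where
  "pole_order R a =
     (case a of
        Some w \<Rightarrow> order w (rat_den R)
      | None \<Rightarrow> degree (rat_num R) - degree (rat_den R))"

definition total_degree :: "complex poly fract \<Rightarrow> nat" where
  "total_degree R = (\<Sum>a | pole_order R a > 0. pole_order R a)"

definition rat_sup_norm :: "complex set \<Rightarrow> complex poly fract \<Rightarrow> ereal" where
  "rat_sup_norm \<Gamma> R =
     (SUP z\<in>\<Gamma>. if pole_order R (Some z) > 0 then \<infinity> else ereal (norm (rat_eval R z)))"

end

theory Submission
  imports Defs "HOL-Complex_Analysis.Complex_Analysis"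
begin

text \<open>
  Fix one side \<open>G\<close> of the curve. A Moebius map with its pole on the other side carries \<open>G\<close> to a
  bounded, simply connected domain \<open>D\<close> in the upper half-plane which touches the real axis at 0,
  the image of \<open>z0\<close>; there \<open>- ln |b a|\<close>, with \<open>b a\<close> the Blaschke factor of \<open>D\<close>, is Green's function, and
  its slope \<open>M a\<close> at 0 along the imaginary axis is the normal derivative in question.

  Enlarge \<open>D\<close> by a square of side \<open>2\<delta>\<close> at 0 and by the mirror image of \<open>D\<close>, and let \<open>\<beta> a\<close> be the
  Blaschke factor of this domain \<open>U\<close> and \<open>\<beta>r a\<close> its reflection in the real axis. Then
  \<open>\<beta>r a / \<beta> a\<close> has a simple pole at \<open>a\<close>, modulus 1 on the real axis, and, after multiplication by
  \<open>exp (- \<kappa> peak \<delta>)\<close>, modulus at most 1 on the frontier of \<open>D\<close>, while its logarithmic derivative at 0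
  is \<open>- \<i> (M a + O \<delta>)\<close>. Over the poles \<open>a\<close> under consideration it is bounded by some \<open>q < 1\<close> near the boundary of
  the upper half of \<open>U\<close> united with a small disc at 0. So a product of \<open>m\<close> such factors differs from
  its principal part, a rational function \<open>L / \<Prod> (z - a)\<close>, by a holomorphic function of size
  \<open>O (q ^ m)\<close>. This rational function is bounded by \<open>1 + \<epsilon>\<close> on the frontier of \<open>D\<close>, and its derivative
  at 0 is at least \<open>(1 - \<epsilon>) \<Sum> M a\<close> in modulus. Pulled back by the Moebius map, with the poles on the other side added
  with a tiny coefficient, it has total degree exactly \<open>n\<close>.
\<close>

section \<open>Complex analysis in the plane\<close>

text \<open>A \<open>C^2\<close> boundary need not let Green's function continue harmonically past
  \<open>z0\<close>. A Cauchy integral over a contour inside \<open>D\<close> would leave a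
  remainder holomorphic only on \<open>D\<close>, with no control of its derivative at
  \<open>z0\<close>. Hence factors are wanted that live on a full neighbourhood of
  \<open>z0\<close>, yet are bounded by 1 on the curve and have nearly the right derivative.
  Reflection in the tangent gives unimodularity on the tangent only; the curve departs from it by
  \<open>O (|\<xi>|^2)\<close>, so on the curve the excess of
  \<open>ln |\<beta>r a / \<beta> a|\<close> is \<open>O (|\<xi>|^2)\<close> too. This is the order
  which \<open>Re (peak \<delta>)\<close> dominates, with a constant \<open>\<kappa>\<close>
  independent of \<open>\<delta>\<close>, at a cost of \<open>\<kappa> \<delta>\<close> in the slope
  at 0. On a compact set of poles the slopes are bounded below by some \<open>c > 0\<close> (Hopf's
  lemma), so \<open>\<kappa> \<delta>\<close> small against \<open>c\<close> makes the accumulated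
  loss a small fraction of \<open>\<Sum> M a\<close>. The slopes are bounded above as well, so the
  side with the larger sum carries at least a fixed proportion of the \<open>n\<close> poles, and
  \<open>q ^ m\<close> tends to 0.\<close>

lemma maximum_modulus_limsup:
  assumes "open S" "bounded S" "f holomorphic_on S"
    and lim: "\<And>\<xi> e. \<lbrakk>\<xi> \<in> frontier S; e > 0\<rbrakk> \<Longrightarrow>
      \<exists>d>0. \<forall>z\<in>S. dist z \<xi> < d \<longrightarrow> norm (f z) < B + e"
    and "z \<in> S"
  shows "norm (f z) \<le> B"
proof (rule ccontr)
  assume "\<not> norm (f z) \<le> B"
  then obtain e where e: "e > 0" "B + e < norm (f z)"
    by (metis add.commute add_less_cancel_right diff_add_cancel diff_gt_0_iff_gt dense not_le)
  \<comment> \<open>The hypothesis on \<open>frontier S\<close> keeps \<open>closure T\<close>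
    inside \<open>S\<close>, so \<open>f\<close> is continuous up to the frontier of
    \<open>T\<close>, where its modulus is at most \<open>B + e\<close>.\<close>
  define T where "T = {w \<in> S. norm (f w) > B + e}"
  have contf: "continuous_on S f"
    by (simp add: assms holomorphic_on_imp_continuous_on)
  have "open T"
  proof -
    have "T = S \<inter> (\<lambda>w. norm (f w)) -` {B + e<..}" by (auto simp: T_def)
    then show ?thesis
      using continuous_open_preimage[OF continuous_on_norm[OF contf] \<open>open S\<close>] by simp
  qed
  have clT: "closure T \<subseteq> S"
  proof
    fix \<xi> assume \<xi>: "\<xi> \<in> closure T"
    show "\<xi> \<in> S"
    proof (rule ccontr)
      assume "\<xi> \<notin> S"
      moreover have "\<xi> \<in> closure S"
        using \<xi> closure_mono[of T S] by (auto simp: T_def)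
      ultimately have "\<xi> \<in> frontier S"
        using \<open>open S\<close> by (simp add: frontier_def interior_open)
      then obtain d where d: "d > 0" "\<And>z. \<lbrakk>z \<in> S; dist z \<xi> < d\<rbrakk> \<Longrightarrow> norm (f z) < B + e"
        using lim e by blast
      obtain w where "w \<in> T" "dist w \<xi> < d"
        using \<xi> d(1) closure_approachable by blast
      then show False
        using d(2)[of w] by (auto simp: T_def)
    qed
  qed
  have "norm (f z) \<le> B + e"
  proof (rule maximum_modulus_frontier[where S = T and f = f and \<xi> = z])
    show "f holomorphic_on interior T"
      using assms(3) by (rule holomorphic_on_subset) (use interior_subset T_def in auto)
    show "continuous_on (closure T) f"
      using contf clT continuous_on_subset by blast
    show "bounded T"
      by (rule bounded_subset[OF \<open>bounded S\<close>]) (auto simp: T_def)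
    show "z \<in> T" using e \<open>z \<in> S\<close> T_def by auto
    fix w assume "w \<in> frontier T"
    then have "w \<in> S" "w \<notin> T"
      using clT \<open>open T\<close> by (auto simp: frontier_def interior_open)
    then show "norm (f w) \<le> B + e" by (auto simp: T_def)
  qed
  with e show False by simp
qed

text \<open>By the criterion of global primitives: primitives on \<open>S\<close> and on
  \<open>T\<close> differ by a constant on the connected overlap, and one of them is shifted so that
  they glue.\<close>

lemma simply_connected_Un_open:
  fixes S T :: "complex set"
  assumes "open S" "open T" "simply_connected S" "simply_connected T"
    and conn: "connected (S \<inter> T)" and ne: "S \<inter> T \<noteq> {}"
  shows "simply_connected (S \<union> T)"
proof (subst simply_connected_eq_global_primitive)
  show "open (S \<union> T)" using assms by blast
  have "connected (S \<union> T)"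
    using assms by (simp add: connected_Un simply_connected_imp_connected)
  moreover have "\<exists>h. \<forall>z. z \<in> S \<union> T \<longrightarrow> (h has_field_derivative f z) (at z)"
    if f: "f holomorphic_on S \<union> T" for f
  proof -
    obtain h where h: "\<And>z. z \<in> S \<Longrightarrow> (h has_field_derivative f z) (at z)"
      using f assms(1,3) holomorphic_on_subset[OF f, of S]
      by (auto simp: simply_connected_eq_global_primitive)
    obtain k where k: "\<And>z. z \<in> T \<Longrightarrow> (k has_field_derivative f z) (at z)"
      using f assms(2,4) holomorphic_on_subset[OF f, of T]
      by (auto simp: simply_connected_eq_global_primitive)
    have "((\<lambda>z. h z - k z) has_field_derivative 0) (at z)" if "z \<in> S \<inter> T" for z
      using h[of z] k[of z] that by (auto intro!: derivative_eq_intros)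
    then have "(\<lambda>z. h z - k z) constant_on (S \<inter> T)"
      using conn assms(1,2) by (intro has_field_derivative_0_imp_constant_on) auto
    then obtain c where c: "\<And>z. z \<in> S \<inter> T \<Longrightarrow> h z - k z = c"
      unfolding constant_on_def by blast
    define p where "p = (\<lambda>z. if z \<in> S then h z else k z + c)"
    have "(p has_field_derivative f z) (at z)" if "z \<in> S" for z
      using h[OF that] by (rule has_field_derivative_transform_within_open[OF _ \<open>open S\<close> that])
         (auto simp: p_def)
    moreover have "(p has_field_derivative f z) (at z)" if "z \<in> T" for z
    proof -
      have "((\<lambda>z. k z + c) has_field_derivative f z) (at z)"
        using k[OF that] by (auto intro!: derivative_eq_intros)
      then show ?thesis
        by (rule has_field_derivative_transform_within_open[OF _ \<open>open T\<close> that])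
           (use c in \<open>auto simp: p_def algebra_simps\<close>)
    qed
    ultimately show ?thesis by blast
  qed
  ultimately show "connected (S \<union> T) \<and> (\<forall>f. f holomorphic_on S \<union> T \<longrightarrow>
      (\<exists>h. \<forall>z. z \<in> S \<union> T \<longrightarrow> (h has_field_derivative f z) (at z)))" by blast
qed

definition diff_quot :: "(complex \<Rightarrow> complex) \<Rightarrow> complex \<Rightarrow> complex \<Rightarrow> complex" where
  "diff_quot f a z = (if z = a then deriv f a else (f z - f a) / (z - a))"

lemma diff_quot_holomorphic:
  assumes "f holomorphic_on S" "open S"
  shows "diff_quot f a holomorphic_on S"
  using pole_lemma_open[OF assms, of a] unfolding diff_quot_def .

lemma diff_quot_mult: "(z - a) * diff_quot f a z = f z - f a"
  by (auto simp: diff_quot_def)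

lemma diff_quot_nonzero:
  assumes "f holomorphic_on S" "open S" "inj_on f S" "a \<in> S" "z \<in> S"
  shows "diff_quot f a z \<noteq> 0"
  using assms holomorphic_injective_imp_regular[OF assms(1-4)]
  by (auto simp: diff_quot_def inj_on_def)


section \<open>Principal parts as Cauchy integrals\<close>

definition root_poly :: "complex list \<Rightarrow> complex poly" where
  "root_poly as = (\<Prod>a\<leftarrow>as. [:- a, 1:])"

lemma root_poly_simps [simp]:
  "root_poly [] = 1" "root_poly (a # as) = [:- a, 1:] * root_poly as"
  by (simp_all add: root_poly_def)

lemma poly_root_poly: "poly (root_poly as) z = (\<Prod>a\<leftarrow>as. z - a)"
  by (induction as) (auto simp: algebra_simps)

lemma poly_root_poly_eq_0 [simp]: "poly (root_poly as) z = 0 \<longleftrightarrow> z \<in> set as"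
  by (induction as) auto

lemma root_poly_nonzero [simp]: "root_poly as \<noteq> 0"
  by (auto simp: root_poly_def prod_list_zero_iff)

lemma degree_root_poly [simp]: "degree (root_poly as) = length as"
  by (induction as) (auto simp: degree_mult_eq simp del: mult_pCons_left)

text \<open>Conformal coordinates on \<open>\<Omega>\<close>: images under \<open>\<Psi>\<close> of
  circles of radius close to 1 serve as contours near the boundary, and integrals over them become
  integrals over circles in the disc.\<close>

locale disc_chart =
  fixes \<Omega> :: "complex set" and \<Psi> \<Theta> :: "complex \<Rightarrow> complex"
  assumes open_Omega: "open \<Omega>"
    and \<Psi>_hol: "\<Psi> holomorphic_on ball 0 1" and \<Theta>_hol: "\<Theta> holomorphic_on \<Omega>"
    and \<Psi>: "\<And>v. norm v < 1 \<Longrightarrow> \<Psi> v \<in> \<Omega> \<and> \<Theta> (\<Psi> v) = v"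
    and \<Theta>: "\<And>z. z \<in> \<Omega> \<Longrightarrow> norm (\<Theta> z) < 1 \<and> \<Psi> (\<Theta> z) = z"
begin

lemma inj_\<Psi>: "inj_on \<Psi> (ball 0 1)"
  by (metis \<Psi> inj_onI mem_ball_0)

lemma image_\<Psi>_eq: "r \<le> 1 \<Longrightarrow> \<Psi> ` ball 0 r = {z \<in> \<Omega>. norm (\<Theta> z) < r}"
  using \<Psi> \<Theta> by (force simp: image_iff)

text \<open>Since \<open>\<Psi>\<close> is injective, \<open>(\<Psi> v - \<Psi> w) / (v - w)\<close>
  never vanishes on the disc. Splitting off \<open>v - w\<close> leaves an integrand covered by the
  Cauchy formula for the circle; at \<open>w\<close> the quotient is \<open>deriv \<Psi> w\<close>,
  which cancels the derivative in the numerator.\<close>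

lemma cauchy_inside:
  assumes H: "H holomorphic_on \<Omega>" and "norm w < \<rho>" "\<rho> < 1"
  shows "((\<lambda>v. H (\<Psi> v) * deriv \<Psi> v / (\<Psi> v - \<Psi> w)) has_contour_integral 
           2 * of_real pi * \<i> * H (\<Psi> w)) (circlepath 0 \<rho>)"
proof -
  define G where "G = (\<lambda>v. H (\<Psi> v) * deriv \<Psi> v / diff_quot \<Psi> w v)"
  have w1: "norm w < 1" and "\<rho> > 0"
    using assms norm_ge_zero[of w] by linarith+
  have nz: "diff_quot \<Psi> w v \<noteq> 0" if "v \<in> ball 0 1" for v
    using diff_quot_nonzero[OF \<Psi>_hol open_ball inj_\<Psi>] that w1 by simp
  have "G holomorphic_on ball 0 1"
    unfolding G_def using \<Psi>
    by (intro holomorphic_intros \<Psi>_hol open_ball diff_quot_holomorphic nz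
         holomorphic_on_compose_gen[OF _ H, unfolded o_def]) auto
  then have *: "continuous_on (cball 0 \<rho>) G" "G holomorphic_on ball 0 \<rho>"
    using assms by (auto intro!: holomorphic_on_imp_continuous_on elim!: holomorphic_on_subset)
  have "((\<lambda>v. G v / (v - w)) has_contour_integral 2 * of_real pi * \<i> * G w) (circlepath 0 \<rho>)"
    using Cauchy_integral_circlepath[OF *] assms by simp
  moreover have "G w = H (\<Psi> w)"
    using nz[of w] w1 by (auto simp: G_def diff_quot_def)
  moreover have "G v / (v - w) = H (\<Psi> v) * deriv \<Psi> v / (\<Psi> v - \<Psi> w)"
    if "v \<in> path_image (circlepath 0 \<rho>)" for v
    using that diff_quot_mult[of v w \<Psi>] assms by (auto simp: G_def mult.commute)
  ultimately show ?thesis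
    using has_contour_integral_eq by fastforce
qed

lemma cauchy_outside:
  assumes H: "H holomorphic_on \<Omega>" and \<rho>: "0 < \<rho>" "\<rho> < 1" and z: "z \<notin> \<Psi> ` cball 0 \<rho>"
  shows "((\<lambda>v. H (\<Psi> v) * deriv \<Psi> v / (\<Psi> v - z)) has_contour_integral 0) (circlepath 0 \<rho>)"
proof -
  have *: "open {v \<in> ball 0 1. \<Psi> v \<noteq> z}"
    using continuous_open_preimage[OF holomorphic_on_imp_continuous_on[OF \<Psi>_hol] open_ball, of "- {z}"]
    by (simp add: Int_def open_Compl)
  have **: "cball 0 \<rho> \<subseteq> {v \<in> ball 0 1. \<Psi> v \<noteq> z}"
    using z \<rho> by auto
  \<comment> \<open>Cauchy's theorem is applied on an open disc: by compactness,
    \<open>\<Psi>\<close> still avoids \<open>z\<close> on a slightly larger disc than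
    \<open>cball 0 \<rho>\<close>.\<close>
  obtain r where r: "\<rho> < r" "ball 0 r \<subseteq> {v \<in> ball 0 1. \<Psi> v \<noteq> z}"
  proof -
    obtain e where e: "e > 0" "(\<Union>x\<in>cball 0 \<rho>. ball x e) \<subseteq> {v \<in> ball 0 1. \<Psi> v \<noteq> z}"
      using compact_subset_open_imp_ball_epsilon_subset[OF compact_cball * **] by metis
    have "ball (0::complex) (\<rho> + e) \<subseteq> (\<Union>x\<in>cball 0 \<rho>. ball x e)"
    proof
      fix y assume y: "y \<in> ball (0::complex) (\<rho> + e)"
      show "y \<in> (\<Union>x\<in>cball 0 \<rho>. ball x e)"
      proof (cases "norm y \<le> \<rho>")
        case True then show ?thesis using e(1) by force
      next
        case False
        define x where "x = of_real (\<rho> / norm y) * y"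
        have "norm x = \<rho>" using False \<rho> by (auto simp: x_def norm_mult norm_divide)
        moreover have "dist x y = norm y - \<rho>"
        proof -
          have "x - y = of_real (\<rho> / norm y - 1) * y" by (simp add: x_def algebra_simps)
          then have "dist x y = \<bar>\<rho> / norm y - 1\<bar> * norm y"
            by (metis dist_norm norm_mult norm_of_real)
          also have "\<dots> = norm y - \<rho>" using False \<rho> by (auto simp: abs_if field_simps)
          finally show ?thesis .
        qed
        ultimately show ?thesis using y by (intro UN_I[of x]) auto
      qed
    qed
    then show thesis using that[of "\<rho> + e"] e by auto
  qed
  have "(\<lambda>v. H (\<Psi> v) * deriv \<Psi> v / (\<Psi> v - z)) holomorphic_on ball 0 r"
    using r(2) \<Psi>
    by (intro holomorphic_intros holomorphic_on_subset[OF holomorphic_deriv[OF \<Psi>_hol open_ball] ]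
          holomorphic_on_subset[OF \<Psi>_hol] holomorphic_on_compose_gen[OF _ H, unfolded o_def]) auto
  then show ?thesis
    using r \<rho> by (intro Cauchy_theorem_disc_simple[where a = 0 and e = r]) auto
qed


text \<open>The integrand of Hermite's remainder formula, \<open>H\<close> divided by the node
  polynomial and by \<open>\<zeta> - z\<close>, pulled back to the disc by
  \<open>\<zeta> = \<Psi> v\<close>.\<close>

definition cauchy_kernel :: "(complex \<Rightarrow> complex) \<Rightarrow> complex list \<Rightarrow> complex \<Rightarrow> complex \<Rightarrow> complex" where
  "cauchy_kernel H as z v = H (\<Psi> v) * deriv \<Psi> v / poly (root_poly as) (\<Psi> v) / (\<Psi> v - z)"

text \<open>\<open>L\<close> is the Hermite interpolant of \<open>H\<close> at the listed points
  with multiplicity, and \<open>h\<close> is the remainder divided by the node polynomial. The same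
  contour integral gives \<open>h\<close> inside the contour and minus the principal part
  \<open>L / root_poly as\<close> outside, so both can be estimated from the values of
  \<open>H / root_poly as\<close> on a contour alone.\<close>

definition interpolates ::
    "(complex \<Rightarrow> complex) \<Rightarrow> complex list \<Rightarrow> complex poly \<Rightarrow> (complex \<Rightarrow> complex) \<Rightarrow> bool" where
  "interpolates H as L h \<longleftrightarrow> degree L \<le> length as - 1 \<and> h holomorphic_on \<Omega> \<and>
     (\<forall>z\<in>\<Omega>. H z = poly L z + poly (root_poly as) z * h z) \<and>
     (\<forall>\<rho>. 0 < \<rho> \<longrightarrow> \<rho> < 1 \<longrightarrow> set as \<subseteq> \<Psi> ` ball 0 \<rho> \<longrightarrow>
       (\<forall>z\<in>\<Psi> ` ball 0 \<rho>. (cauchy_kernel H as z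
          has_contour_integral 2 * of_real pi * \<i> * h z) (circlepath 0 \<rho>)) \<and>
       (\<forall>z. z \<notin> \<Psi> ` cball 0 \<rho> \<longrightarrow> (cauchy_kernel H as z
          has_contour_integral - (2 * of_real pi * \<i> * (poly L z / poly (root_poly as) z))) (circlepath 0 \<rho>)))"

text \<open>Induction on the list as in Newton's form: a new point \<open>a\<close> adds
  \<open>h a\<close> times the old node polynomial to \<open>L\<close> and replaces \<open>h\<close>
  by its difference quotient at \<open>a\<close>.\<close>

lemma interpolation:
  assumes H: "H holomorphic_on \<Omega>" and as: "set as \<subseteq> \<Omega>"
  shows "\<exists>L h. interpolates H as L h"
  using as
proof (induction as)
  case Nil
  show ?case
  proof (rule exI[of _ "0 :: complex poly"], rule exI[of _ H], unfold interpolates_def,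
      intro conjI ballI allI impI)
    fix \<rho> :: real and z assume \<rho>: "0 < \<rho>" "\<rho> < 1" and "z \<in> \<Psi> ` ball 0 \<rho>"
    then obtain w where "norm w < \<rho>" "z = \<Psi> w" by auto
    then show "(cauchy_kernel H [] z
          has_contour_integral 2 * of_real pi * \<i> * H z) (circlepath 0 \<rho>)"
      using cauchy_inside[OF H, of w \<rho>] \<rho> by (simp add: cauchy_kernel_def[abs_def])
  next
    fix \<rho> :: real and z assume \<rho>: "0 < \<rho>" "\<rho> < 1" and "z \<notin> \<Psi> ` cball 0 \<rho>"
    then show "(cauchy_kernel H [] z
          has_contour_integral - (2 * of_real pi * \<i> * (poly 0 z / poly (root_poly []) z))) (circlepath 0 \<rho>)"
      using cauchy_outside[OF H \<rho>, of z] by (simp add: cauchy_kernel_def[abs_def])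
  qed (simp_all add: H)
next
  case (Cons a as)
  define q where "q = root_poly as"
  obtain L h where IH: "interpolates H as L h"
    using Cons by auto
  have L: "degree L \<le> length as - 1" and h: "h holomorphic_on \<Omega>"
    and eq: "\<And>z. z \<in> \<Omega> \<Longrightarrow> H z = poly L z + poly q z * h z"
    using IH by (auto simp: interpolates_def q_def)
  have ins: "(cauchy_kernel H as z
          has_contour_integral 2 * of_real pi * \<i> * h z) (circlepath 0 \<rho>)"
    if "0 < \<rho>" "\<rho> < 1" "set as \<subseteq> \<Psi> ` ball 0 \<rho>" "z \<in> \<Psi> ` ball 0 \<rho>" for \<rho> z
    using IH that unfolding interpolates_def by blast
  have out: "(cauchy_kernel H as z
          has_contour_integral - (2 * of_real pi * \<i> * (poly L z / poly q z))) (circlepath 0 \<rho>)"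
    if "0 < \<rho>" "\<rho> < 1" "set as \<subseteq> \<Psi> ` ball 0 \<rho>" "z \<notin> \<Psi> ` cball 0 \<rho>" for \<rho> z
    using IH that unfolding interpolates_def q_def by blast
  have a: "a \<in> \<Omega>" using Cons by simp
  define L' h' where "L' = L + smult (h a) q" and "h' = diff_quot h a"
  define c where "c = 2 * of_real pi * \<i>"
  have q': "poly (root_poly (a # as)) z = (z - a) * poly q z" for z
    by (simp add: q_def algebra_simps)
  \<comment> \<open>Partial fractions in \<open>\<zeta>\<close>: the kernel for
    \<open>a # as\<close> at \<open>z\<close> is the difference of the old kernels at
    \<open>z\<close> and at \<open>a\<close>, divided by \<open>z - a\<close>.\<close>
  have split: "x / ((\<zeta> - a) * y) / (\<zeta> - z) = (x / y / (\<zeta> - z) - x / y / (\<zeta> - a)) / (z - a)"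
    if "\<zeta> \<noteq> a" "\<zeta> \<noteq> z" "z \<noteq> a" for x y \<zeta> z :: complex
    using that by (cases "y = 0") (auto simp: divide_simps, simp add: algebra_simps)
  have holh': "h' holomorphic_on \<Omega>"
    unfolding h'_def by (intro diff_quot_holomorphic h open_Omega)
  have ints: "(cauchy_kernel H (a # as) z
          has_contour_integral (I - c * h a) / (z - a)) (circlepath 0 \<rho>)"
    if \<rho>: "0 < \<rho>" "\<rho> < 1" and as: "set (a # as) \<subseteq> \<Psi> ` ball 0 \<rho>"
      and z: "z \<notin> \<Psi> ` sphere 0 \<rho>" "z \<noteq> a"
      and I: "(cauchy_kernel H as z
          has_contour_integral I) (circlepath 0 \<rho>)" for \<rho> z I
  proof -
    have "(cauchy_kernel H as a
          has_contour_integral c * h a) (circlepath 0 \<rho>)"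
      using ins[of \<rho> a] \<rho> as by (auto simp: c_def)
    then have "((\<lambda>v. (cauchy_kernel H as z v - cauchy_kernel H as a v) / (z - a))
          has_contour_integral (I - c * h a) / (z - a)) (circlepath 0 \<rho>)"
      by (intro has_contour_integral_div has_contour_integral_diff I)
    moreover have "(cauchy_kernel H as z v - cauchy_kernel H as a v) / (z - a) = cauchy_kernel H (a # as) z v"
      if v: "v \<in> path_image (circlepath 0 \<rho>)" for v
    proof -
      have v': "norm v = \<rho>" using v \<rho> by simp
      obtain u where u: "norm u < \<rho>" "a = \<Psi> u" using as by auto
      have "\<Psi> v \<noteq> a" using u v' \<rho> inj_onD[OF inj_\<Psi>, of v u] by auto
      moreover have "\<Psi> v \<noteq> z" using z v' by auto
      ultimately show ?thesis
        unfolding cauchy_kernel_def q' using split[OF _ _ z(2)] by (simp add: q_def)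
    qed
    ultimately show ?thesis using has_contour_integral_eq by fastforce
  qed
  show ?case
  proof (rule exI[of _ L'], rule exI[of _ h'], unfold interpolates_def, intro conjI ballI allI impI)
    show "degree L' \<le> length (a # as) - 1"
      unfolding L'_def by (rule degree_add_le) (use L in \<open>auto simp: q_def intro: order.trans[OF degree_smult_le]\<close>)
    show "h' holomorphic_on \<Omega>" by (rule holh')
    show "H z = poly L' z + poly (root_poly (a # as)) z * h' z" if "z \<in> \<Omega>" for z
    proof -
      have "poly L' z + poly (root_poly (a # as)) z * h' z =
            poly L z + poly q z * (h a + (z - a) * h' z)"
        unfolding L'_def q' by (simp add: algebra_simps)
      then show ?thesis
        using eq[OF that] by (simp add: h'_def diff_quot_mult)
    qed
  next
    fix \<rho> :: real and z
    assume \<rho>: "0 < \<rho>" "\<rho> < 1" "set (a # as) \<subseteq> \<Psi> ` ball 0 \<rho>" and z: "z \<notin> \<Psi> ` cball 0 \<rho>"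
    have "z \<noteq> a" using \<rho> z by auto
    have "z \<notin> set as" using \<rho> z by force
    have "(cauchy_kernel H (a # as) z
          has_contour_integral (- (c * (poly L z / poly q z)) - c * h a) / (z - a)) (circlepath 0 \<rho>)"
      using \<rho> z \<open>z \<noteq> a\<close> out[of \<rho> z] by (intro ints) (auto simp: c_def)
    moreover have "(- (c * (poly L z / poly q z)) - c * h a) / (z - a) =
        - (c * (poly L' z / poly (root_poly (a # as)) z))"
      using \<open>z \<noteq> a\<close> \<open>z \<notin> set as\<close> unfolding L'_def q'
      by (simp add: q_def divide_simps) (simp add: algebra_simps)
    ultimately show "(cauchy_kernel H (a # as) z
          has_contour_integral - (2 * of_real pi * \<i> * (poly L' z / poly (root_poly (a # as)) z))) (circlepath 0 \<rho>)"
      by (simp add: c_def)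
  next
    fix \<rho> :: real and z
    assume \<rho>: "0 < \<rho>" "\<rho> < 1" "set (a # as) \<subseteq> \<Psi> ` ball 0 \<rho>" and z: "z \<in> \<Psi> ` ball 0 \<rho>"
    define G where "G = cauchy_kernel H (a # as)"
    have W: "z \<notin> \<Psi> ` sphere 0 \<rho>" if "z \<in> \<Psi> ` ball 0 \<rho>" for z
      using that \<rho> inj_\<Psi> by (fastforce simp: inj_on_def)
    have ne: "(G z has_contour_integral c * h' z) (circlepath 0 \<rho>)" if "z \<in> \<Psi> ` ball 0 \<rho>" "z \<noteq> a" for z
    proof -
      have "(G z has_contour_integral (c * h z - c * h a) / (z - a)) (circlepath 0 \<rho>)"
        unfolding G_def using \<rho> W that ins[of \<rho> z] by (intro ints) (auto simp: c_def)
      then show ?thesis using that by (simp add: h'_def diff_quot_def right_diff_distrib)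
    qed
    \<comment> \<open>At \<open>z = a\<close> the partial fractions degenerate, so this value is
      obtained as a limit: the kernels converge uniformly on the circle as \<open>z\<close> tends to
      \<open>a\<close>, and \<open>h'\<close> is continuous.\<close>
    have "(G a has_contour_integral c * h' a) (circlepath 0 \<rho>)"
    proof -
      have opW: "open (\<Psi> ` ball 0 \<rho>)"
        using \<rho> \<Psi>_hol inj_\<Psi>
        by (intro open_mapping_thm3) (auto elim!: holomorphic_on_subset inj_on_subset)
      have aW: "a \<in> \<Psi> ` ball 0 \<rho>" using \<rho> by simp
      have ev: "\<forall>\<^sub>F z in at a. z \<in> \<Psi> ` ball 0 \<rho> \<and> z \<noteq> a"
        using eventually_at_in_open[OF opW aW] by eventually_elim auto
      have cont: "continuous_on (sphere 0 \<rho>) \<Psi>" "continuous_on (sphere 0 \<rho>) (deriv \<Psi>)"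
        using \<rho> \<Psi>_hol holomorphic_deriv[OF \<Psi>_hol open_ball]
        by (auto intro!: holomorphic_on_imp_continuous_on elim!: holomorphic_on_subset)
      have nz: "\<Psi> v \<noteq> b" if "v \<in> sphere 0 \<rho>" "b \<in> set (a # as)" for v b
        using that \<rho> W by blast
      define K where "K = (\<lambda>v. H (\<Psi> v) * deriv \<Psi> v / poly (root_poly (a # as)) (\<Psi> v))"
      have contK: "continuous_on (sphere 0 \<rho>) K"
        unfolding K_def
        by (intro continuous_intros cont continuous_on_compose2[OF holomorphic_on_imp_continuous_on[OF H] cont(1)])
           (use \<Psi> \<rho> nz in \<open>auto simp del: root_poly_simps\<close>)
      obtain B where B: "B > 0" "\<And>v. v \<in> sphere 0 \<rho> \<Longrightarrow> norm (K v) \<le> B"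
        using compact_imp_bounded[OF compact_continuous_image[OF contK compact_sphere]]
        by (auto simp: bounded_pos)
      obtain d where d: "d > 0" "\<And>v. v \<in> sphere 0 \<rho> \<Longrightarrow> d \<le> dist a (\<Psi> v)"
      proof -
        have "compact (\<Psi> ` sphere 0 \<rho>)" by (intro compact_continuous_image cont compact_sphere)
        moreover have "a \<notin> \<Psi> ` sphere 0 \<rho>" using W aW by blast
        ultimately show thesis
          using separate_point_closed[of "\<Psi> ` sphere 0 \<rho>" a] that by (auto simp: compact_imp_closed)
      qed
      have "uniform_limit (sphere 0 \<rho>) G (G a) (at a)"
      proof (rule uniform_limitI)
        fix e :: real assume "e > 0"
        define \<delta> where "\<delta> = min (d/2) (e * d\<^sup>2 / (2 * B))"
        have "\<delta> > 0" using d B \<open>e > 0\<close> by (simp add: \<delta>_def)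
        have "\<forall>\<^sub>F z in at a. dist z a < \<delta>"
          using \<open>\<delta> > 0\<close> eventually_at by blast
        then show "\<forall>\<^sub>F z in at a. \<forall>v\<in>sphere 0 \<rho>. dist (G z v) (G a v) < e"
        proof eventually_elim
          case (elim z)
          show ?case
          proof
            fix v :: complex assume v: "v \<in> sphere 0 \<rho>"
            have d1: "d \<le> norm (\<Psi> v - a)" using d(2)[OF v] by (simp add: dist_norm norm_minus_commute)
            have "norm (\<Psi> v - a) \<le> norm (\<Psi> v - z) + dist z a"
              using norm_triangle_ineq[of "\<Psi> v - z" "z - a"] by (simp add: dist_norm)
            then have d2: "d / 2 \<le> norm (\<Psi> v - z)"
              using elim d1 by (simp add: \<delta>_def)
            have nn: "\<Psi> v - a \<noteq> 0" "\<Psi> v - z \<noteq> 0" using d1 d2 d(1) by force+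
            have "G z v - G a v = K v * (z - a) / ((\<Psi> v - z) * (\<Psi> v - a))"
            proof -
              have *: "k / x - k / y = k * (y - x) / (x * y)" if "x \<noteq> 0" "y \<noteq> 0" for k x y :: complex
                using that by (simp add: field_simps)
              have zz: "z - a = (\<Psi> v - a) - (\<Psi> v - z)" by simp
              from *[OF nn(2,1), of "K v"] show ?thesis unfolding G_def cauchy_kernel_def K_def zz .
            qed
            then have "dist (G z v) (G a v) = norm (K v) * dist z a / (norm (\<Psi> v - z) * norm (\<Psi> v - a))"
              by (simp add: dist_norm norm_mult norm_divide)
            also have "\<dots> \<le> B * dist z a / (d / 2 * d)"
              using B v d1 d2 d(1) by (intro frac_le mult_mono mult_nonneg_nonneg) auto
            also have "\<dots> < e"
              using elim d(1) B(1) by (simp add: \<delta>_def field_simps power2_eq_square)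
            finally show "dist (G z v) (G a v) < e" .
          qed
        qed
      qed
      note ul = this
      have int: "\<forall>\<^sub>F z in at a. G z contour_integrable_on circlepath 0 \<rho>"
        using ev by eventually_elim (use ne contour_integrable_on_def in blast)
      have lim: "G a contour_integrable_on circlepath 0 \<rho>"
        "((\<lambda>z. contour_integral (circlepath 0 \<rho>) (G z)) \<longlongrightarrow> contour_integral (circlepath 0 \<rho>) (G a)) (at a)"
        using contour_integral_uniform_limit_circlepath[OF int ul] \<rho> by auto
      have "isCont h' a"
        using holomorphic_on_imp_continuous_on[OF holh'] a open_Omega continuous_on_eq_continuous_at by blast
      then have "((\<lambda>z. c * h' z) \<longlongrightarrow> c * h' a) (at a)"
        by (intro tendsto_intros) (simp add: isCont_def)
      moreover have "\<forall>\<^sub>F z in at a. contour_integral (circlepath 0 \<rho>) (G z) = c * h' z"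
        using ev by eventually_elim (use ne contour_integral_unique in blast)
      ultimately have "contour_integral (circlepath 0 \<rho>) (G a) = c * h' a"
        using lim(2) by (intro tendsto_unique[OF at_neq_bot]) (auto simp: tendsto_cong)
      then show ?thesis using has_contour_integral_integral[OF lim(1)] by simp
    qed
    then have "(G z has_contour_integral c * h' z) (circlepath 0 \<rho>)"
      using ne z by (cases "z = a") auto
    then show "(cauchy_kernel H (a # as) z
          has_contour_integral 2 * of_real pi * \<i> * h' z) (circlepath 0 \<rho>)"
      by (simp add: G_def c_def)
  qed
qed


text \<open>
  The two parts are Cauchy integrals over a fixed curve near the boundary, so the bounds are
  uniform in the list of roots, which may be arbitrarily close to each other or repeated.
\<close>

lemma splitting_bound:
  assumes K: "compact K" "K \<subseteq> \<Omega>"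
  shows "\<exists>C W. C > 0 \<and> open W \<and> K \<subseteq> W \<and> W \<subseteq> \<Omega> \<and>
    (\<forall>H as \<delta>. H holomorphic_on \<Omega> \<longrightarrow> set as \<subseteq> K \<longrightarrow>
       (\<forall>z\<in>\<Omega> - K. norm (H z / poly (root_poly as) z) \<le> \<delta>) \<longrightarrow>
       (\<exists>L h. degree L \<le> length as - 1 \<and> h holomorphic_on \<Omega> \<and>
          (\<forall>z\<in>\<Omega>. H z = poly L z + poly (root_poly as) z * h z) \<and>
          (\<forall>z\<in>W. norm (h z) \<le> C * \<delta>) \<and>
          (\<forall>z. z \<notin> W \<longrightarrow> norm (poly L z / poly (root_poly as) z) \<le> C * \<delta>)))"
proof -
  have "compact (\<Theta> ` K)"
    using K \<Theta>_hol by (meson compact_continuous_image continuous_on_subset holomorphic_on_imp_continuous_on)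
  moreover have "\<Theta> ` K \<subseteq> ball 0 1" using \<Theta> K by auto
  ultimately obtain r where r: "r < 1" "\<And>z. z \<in> K \<Longrightarrow> norm (\<Theta> z) \<le> r"
  proof (cases "K = {}")
    case False
    assume *: "compact (\<Theta> ` K)" "\<Theta> ` K \<subseteq> ball 0 1"
      and thesis: "\<And>r. r < 1 \<Longrightarrow> (\<And>z. z \<in> K \<Longrightarrow> norm (\<Theta> z) \<le> r) \<Longrightarrow> thesis"
    obtain x where "x \<in> \<Theta> ` K" "\<And>y. y \<in> \<Theta> ` K \<Longrightarrow> norm y \<le> norm x"
      using continuous_attains_sup[OF *(1), of norm] False continuous_on_norm_id by blast
    then show thesis using *(2) by (intro thesis[of "norm x"]) auto
  qed (use that[of 0] in auto)
  \<comment> \<open>Three radii between \<open>K\<close> and the unit circle: \<open>W\<close> is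
    the image of the middle disc, the remainder is estimated on \<open>W\<close> by the integral
    over the outer circle, and the principal part off \<open>W\<close> by the integral over the
    inner one.\<close>
  define r1 r2 r3 where "r1 = (3 + max r 0) / 4" and "r2 = (7 + max r 0) / 8" and "r3 = (15 + max r 0) / 16"
  have rr: "r < r1" "0 < r1" "r1 < r2" "r2 < r3" "r3 < 1" using r by (auto simp: r1_def r2_def r3_def)
  define W where "W = \<Psi> ` ball 0 r2"
  have "open W"
    unfolding W_def using rr \<Psi>_hol inj_\<Psi>
    by (intro open_mapping_thm3) (auto elim!: holomorphic_on_subset inj_on_subset)
  have KW: "K \<subseteq> \<Psi> ` ball 0 s" if "r < s" "s \<le> 1" for s
    using r(2) K(2) that by (subst image_\<Psi>_eq) fastforce+
  have W\<Omega>: "W \<subseteq> \<Omega>" unfolding W_def using rr by (subst image_\<Psi>_eq) auto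
  have cont: "continuous_on (cball 0 s) \<Psi>" "continuous_on (cball 0 s) (deriv \<Psi>)" if "s < 1" for s
    using that \<Psi>_hol holomorphic_deriv[OF \<Psi>_hol open_ball]
    by (auto intro!: holomorphic_on_imp_continuous_on elim!: holomorphic_on_subset)
  obtain B where B: "B > 0" "\<And>v. norm v \<le> r3 \<Longrightarrow> norm (deriv \<Psi> v) \<le> B"
    using compact_imp_bounded[OF compact_continuous_image[OF cont(2)[OF rr(5)] compact_cball]]
    by (auto simp: bounded_pos)
  have cs: "compact (\<Psi> ` sphere 0 s)" "compact (\<Psi> ` cball 0 s)" if "s < 1" for s
    using cont(1)[OF that] by (auto intro!: compact_continuous_image elim: continuous_on_subset)
  have disj1: "\<Psi> ` cball 0 r2 \<inter> \<Psi> ` sphere 0 r3 = {}"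
    using rr inj_onD[OF inj_\<Psi>] by fastforce
  have disj2: "\<Psi> ` sphere 0 r1 \<inter> (- W) = {}"
    unfolding W_def using rr by auto
  obtain d1 where d1: "d1 > 0" "\<And>x y. x \<in> \<Psi> ` cball 0 r2 \<Longrightarrow> y \<in> \<Psi> ` sphere 0 r3 \<Longrightarrow> d1 \<le> dist x y"
    using separate_compact_closed[OF cs(2) compact_imp_closed[OF cs(1)] disj1] rr by auto
  obtain d2 where d2: "d2 > 0" "\<And>x y. x \<in> \<Psi> ` sphere 0 r1 \<Longrightarrow> y \<in> - W \<Longrightarrow> d2 \<le> dist x y"
    using separate_compact_closed[OF cs(1) _ disj2] \<open>open W\<close> rr by (auto simp: open_closed)
  define C where "C = B / d1 + B / d2"
  have "C > 0" using B d1 d2 by (simp add: C_def add_pos_pos)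
  have est: "norm X \<le> B / d * \<delta>"
    if X: "(cauchy_kernel H as z has_contour_integral 2 * of_real pi * \<i> * X) (circlepath 0 s)"
      and s: "r < s" "0 < s" "s \<le> r3" and d: "d > 0" "\<And>y. y \<in> \<Psi> ` sphere 0 s \<Longrightarrow> d \<le> dist z y"
      and f: "\<And>z. z \<in> \<Omega> - K \<Longrightarrow> norm (H z / poly (root_poly as) z) \<le> \<delta>"
    for X H as z s d \<delta>
  proof -
    have nK: "\<Psi> v \<in> \<Omega> - K" if "norm v = s" for v
      using that s rr r(2)[of "\<Psi> v"] \<Psi>[of v] by force
    have "0 \<le> \<delta>"
      using nK[of "of_real s"] f[of "\<Psi> (of_real s)"] s norm_ge_zero order_trans by (metis abs_of_pos norm_of_real)
    have "norm (cauchy_kernel H as z v) \<le> \<delta> * B / d" if v: "norm (v - 0) = s" for v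
    proof -
      have "cauchy_kernel H as z v = H (\<Psi> v) / poly (root_poly as) (\<Psi> v) * deriv \<Psi> v / (\<Psi> v - z)"
        by (simp add: cauchy_kernel_def)
      then have "norm (cauchy_kernel H as z v) =
          norm (H (\<Psi> v) / poly (root_poly as) (\<Psi> v)) * norm (deriv \<Psi> v) / norm (\<Psi> v - z)"
        by (simp add: norm_mult norm_divide)
      also have "\<dots> \<le> \<delta> * B / d"
        using f[OF nK[of v]] v B(2)[of v] s d(1) d(2)[of "\<Psi> v"] \<open>0 \<le> \<delta>\<close> B(1)
        by (intro frac_le mult_mono mult_nonneg_nonneg) (auto simp: dist_norm norm_minus_commute)
      finally show ?thesis .
    qed
    then have "norm (2 * of_real pi * \<i> * X) \<le> \<delta> * B / d * (2 * pi * s)"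
      using \<open>0 \<le> \<delta>\<close> B d s by (intro has_contour_integral_bound_circlepath[OF X]) auto
    then have "(2 * pi) * norm X \<le> (2 * pi) * (\<delta> * B / d * s)"
      by (simp add: norm_mult algebra_simps)
    then have "norm X \<le> \<delta> * B / d * s"
      by (subst (asm) mult_le_cancel_left_pos) auto
    also have "\<dots> \<le> \<delta> * B / d * 1"
      using s rr \<open>0 \<le> \<delta>\<close> B d by (intro mult_left_mono) auto
    finally show ?thesis by (simp add: mult.commute)
  qed
  show ?thesis
  proof (intro exI[of _ C] exI[of _ W] conjI allI impI)
    show "C > 0" "open W" "K \<subseteq> W" "W \<subseteq> \<Omega>"
      using \<open>C > 0\<close> \<open>open W\<close> KW[of r2] W\<Omega> rr by (auto simp: W_def)
    fix H as \<delta>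
    assume H: "H holomorphic_on \<Omega>" and as: "set as \<subseteq> K"
      and f: "\<forall>z\<in>\<Omega> - K. norm (H z / poly (root_poly as) z) \<le> \<delta>"
    obtain L h where Lh: "interpolates H as L h"
      using interpolation[OF H, of as] as K by auto
    have sub: "set as \<subseteq> \<Psi> ` ball 0 r1" "set as \<subseteq> \<Psi> ` ball 0 r3"
      using KW[of r1] KW[of r3] as rr by auto
    have nn: "0 \<le> \<delta>"
    proof -
      have "norm (\<Theta> (\<Psi> (of_real r1))) = r1" "\<Psi> (of_real r1) \<in> \<Omega>"
        using \<Psi>[of "of_real r1"] rr by auto
      then have "\<Psi> (of_real r1) \<in> \<Omega> - K" using r(2) rr by force
      then show ?thesis using f norm_ge_zero order_trans by blast
    qed
    show "\<exists>L h. degree L \<le> length as - 1 \<and> h holomorphic_on \<Omega> \<and>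
          (\<forall>z\<in>\<Omega>. H z = poly L z + poly (root_poly as) z * h z) \<and>
          (\<forall>z\<in>W. norm (h z) \<le> C * \<delta>) \<and>
          (\<forall>z. z \<notin> W \<longrightarrow> norm (poly L z / poly (root_poly as) z) \<le> C * \<delta>)"
    proof (intro exI[of _ L] exI[of _ h] conjI ballI allI impI)
      fix z assume z: "z \<in> W"
      have "norm (h z) \<le> B / d1 * \<delta>"
      proof (rule est[where s = r3])
        have "z \<in> \<Psi> ` ball 0 r3" using z rr by (auto simp: W_def)
        then show "(cauchy_kernel H as z has_contour_integral 2 * of_real pi * \<i> * h z) (circlepath 0 r3)"
          using Lh rr sub unfolding interpolates_def by auto
        have "z \<in> \<Psi> ` cball 0 r2" using z by (auto simp: W_def)
        then show "d1 \<le> dist z y" if "y \<in> \<Psi> ` sphere 0 r3" for y using d1(2) that by blast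
      qed (use rr d1 f in auto)
      also have "\<dots> \<le> C * \<delta>" using nn B d2 by (intro mult_right_mono) (auto simp: C_def)
      finally show "norm (h z) \<le> C * \<delta>" .
    next
      fix z assume z: "z \<notin> W"
      have "norm (- (poly L z / poly (root_poly as) z)) \<le> B / d2 * \<delta>"
      proof (rule est[where s = r1])
        have "z \<notin> \<Psi> ` cball 0 r1" using z rr by (auto simp: W_def)
        then show "(cauchy_kernel H as z has_contour_integral
             2 * of_real pi * \<i> * - (poly L z / poly (root_poly as) z)) (circlepath 0 r1)"
          using Lh rr sub unfolding interpolates_def by auto
        show "d2 \<le> dist z y" if "y \<in> \<Psi> ` sphere 0 r1" for y using d2(2)[OF that, of z] z by (metis ComplI dist_commute)
      qed (use rr d2 f in auto)
      also have "\<dots> \<le> C * \<delta>" using nn B d1 by (intro mult_right_mono) (auto simp: C_def)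
      finally show "norm (poly L z / poly (root_poly as) z) \<le> C * \<delta>" by simp
    qed (use Lh in \<open>auto simp: interpolates_def\<close>)
  qed
qed

end

section \<open>Riemann maps and Blaschke factors\<close>

text \<open>Any biholomorphic map onto the unit disc will do: another choice only multiplies each
  \<open>blaschke S a\<close> by a unimodular constant.\<close>

definition riemann_map :: "complex set \<Rightarrow> complex \<Rightarrow> complex" where
  "riemann_map S = (SOME f. f holomorphic_on S \<and> (\<exists>g. g holomorphic_on ball 0 1 \<and>
     (\<forall>z\<in>S. f z \<in> ball 0 1 \<and> g (f z) = z) \<and> (\<forall>z\<in>ball 0 1. g z \<in> S \<and> f (g z) = z)))"

definition blaschke :: "complex set \<Rightarrow> complex \<Rightarrow> complex \<Rightarrow> complex" where
  "blaschke S a z = (riemann_map S z - riemann_map S a) / (1 - cnj (riemann_map S a) * riemann_map S z)"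

text \<open>The Blaschke factor with its zero at \<open>a\<close> divided out. It is holomorphic and
  non-vanishing at \<open>a\<close> too, so quotients of Blaschke factors with a common zero can be
  formed without a removable singularity.\<close>

definition blaschke_cofactor :: "complex set \<Rightarrow> complex \<Rightarrow> complex \<Rightarrow> complex" where
  "blaschke_cofactor S a z = diff_quot (riemann_map S) a z / (1 - cnj (riemann_map S a) * riemann_map S z)"

text \<open>The logarithmic derivative in closed form, from which continuity jointly in
  \<open>a\<close> and \<open>z\<close> can be read off.\<close>

definition blaschke_logderiv :: "complex set \<Rightarrow> complex \<Rightarrow> complex \<Rightarrow> complex" where
  "blaschke_logderiv S a z = deriv (riemann_map S) z * (1 - cnj (riemann_map S a) * riemann_map S a) /
     ((riemann_map S z - riemann_map S a) * (1 - cnj (riemann_map S a) * riemann_map S z))"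

lemma norm_moebius_identity:
  assumes "norm a < 1" "norm z < 1"
  shows "1 - (norm ((z - a) / (1 - cnj a * z)))\<^sup>2 = (1 - (norm a)\<^sup>2) * (1 - (norm z)\<^sup>2) / (norm (1 - cnj a * z))\<^sup>2"
proof -
  have "norm (cnj a * z) < 1"
    using assms mult_strict_mono'[of "norm a" 1 "norm z" 1] by (simp add: norm_mult)
  then have "1 - cnj a * z \<noteq> 0" by auto
  moreover have "(norm (1 - cnj a * z))\<^sup>2 - (norm (z - a))\<^sup>2 = (1 - (norm a)\<^sup>2) * (1 - (norm z)\<^sup>2)"
    unfolding cmod_power2 by (simp add: power2_eq_square algebra_simps)
  ultimately show ?thesis
    by (simp add: norm_divide power_divide field_simps)
qed

locale simply_connected_domain =
  fixes S :: "complex set"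
  assumes open_S: "open S" and simply_S: "simply_connected S" and bounded_S: "bounded S" and S_ne: "S \<noteq> {}"
begin

abbreviation "\<phi> \<equiv> riemann_map S"

definition riemann_inv :: "complex \<Rightarrow> complex" where
  "riemann_inv = (SOME g. g holomorphic_on ball 0 1 \<and>
     (\<forall>z\<in>S. \<phi> z \<in> ball 0 1 \<and> g (\<phi> z) = z) \<and> (\<forall>z\<in>ball 0 1. g z \<in> S \<and> \<phi> (g z) = z))"

lemma riemann_map_aux: "\<phi> holomorphic_on S \<and> (\<exists>g. g holomorphic_on ball 0 1 \<and>
     (\<forall>z\<in>S. \<phi> z \<in> ball 0 1 \<and> g (\<phi> z) = z) \<and> (\<forall>z\<in>ball 0 1. g z \<in> S \<and> \<phi> (g z) = z))"
proof -
  have "S \<noteq> UNIV" using bounded_S not_bounded_UNIV by auto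
  then have "\<exists>f. f holomorphic_on S \<and> (\<exists>g. g holomorphic_on ball 0 1 \<and>
     (\<forall>z\<in>S. f z \<in> ball 0 1 \<and> g (f z) = z) \<and> (\<forall>z\<in>ball 0 1. g z \<in> S \<and> f (g z) = z))"
    using simply_S S_ne simply_connected_eq_biholomorphic_to_disc[OF open_S] by metis
  from someI_ex[OF this] show ?thesis unfolding riemann_map_def .
qed

lemma \<phi>_hol: "\<phi> holomorphic_on S" using riemann_map_aux by blast

lemma riemann_inv_aux: "riemann_inv holomorphic_on ball 0 1 \<and>
     (\<forall>z\<in>S. \<phi> z \<in> ball 0 1 \<and> riemann_inv (\<phi> z) = z) \<and> (\<forall>z\<in>ball 0 1. riemann_inv z \<in> S \<and> \<phi> (riemann_inv z) = z)"
  using someI_ex[OF conjunct2[OF riemann_map_aux]] unfolding riemann_inv_def .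

lemma disc_chart: "disc_chart S riemann_inv \<phi>"
  by unfold_locales (use open_S \<phi>_hol riemann_inv_aux in auto)

lemma norm_\<phi>: "z \<in> S \<Longrightarrow> norm (\<phi> z) < 1" using riemann_inv_aux by auto

lemma inj_\<phi>: "inj_on \<phi> S" using riemann_inv_aux by (metis inj_onI)

lemma cont_\<phi>: "continuous_on S \<phi>" using \<phi>_hol holomorphic_on_imp_continuous_on by blast

lemma denom_nonzero: "\<lbrakk>a \<in> S; z \<in> S\<rbrakk> \<Longrightarrow> 1 - cnj (\<phi> a) * \<phi> z \<noteq> 0"
proof -
  assume "a \<in> S" "z \<in> S"
  then have "norm (cnj (\<phi> a) * \<phi> z) < 1"
    using norm_\<phi>[of a] norm_\<phi>[of z] mult_strict_mono'[of "norm (\<phi> a)" 1 "norm (\<phi> z)" 1] by (simp add: norm_mult)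
  then show ?thesis by auto
qed

lemma denom_neq_1: "\<lbrakk>a \<in> S; z \<in> S\<rbrakk> \<Longrightarrow> cnj (\<phi> a) * \<phi> z \<noteq> 1"
  using denom_nonzero by fastforce

lemma blaschke_holomorphic: "a \<in> S \<Longrightarrow> blaschke S a holomorphic_on S"
  unfolding blaschke_def[abs_def] by (intro holomorphic_intros \<phi>_hol denom_nonzero)

lemma blaschke_cofactor_holomorphic: "a \<in> S \<Longrightarrow> blaschke_cofactor S a holomorphic_on S"
  unfolding blaschke_cofactor_def[abs_def]
  by (intro holomorphic_intros \<phi>_hol denom_nonzero diff_quot_holomorphic open_S)

lemma blaschke_cofactor_nonzero: "\<lbrakk>a \<in> S; z \<in> S\<rbrakk> \<Longrightarrow> blaschke_cofactor S a z \<noteq> 0"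
  using diff_quot_nonzero[OF \<phi>_hol open_S inj_\<phi>] denom_nonzero by (auto simp: blaschke_cofactor_def)

lemma blaschke_eq: "blaschke S a z = (z - a) * blaschke_cofactor S a z"
  by (simp add: blaschke_def blaschke_cofactor_def diff_quot_mult)

lemma blaschke_eq_0_iff: "\<lbrakk>a \<in> S; z \<in> S\<rbrakk> \<Longrightarrow> blaschke S a z = 0 \<longleftrightarrow> z = a"
  using blaschke_cofactor_nonzero by (simp add: blaschke_eq)

lemma norm_blaschke: "\<lbrakk>a \<in> S; z \<in> S\<rbrakk> \<Longrightarrow> norm (blaschke S a z) < 1"
  using Moebius_function_norm_lt_1[OF norm_\<phi> norm_\<phi>, of a z 0]
  by (simp add: Moebius_function_simple blaschke_def)

lemma blaschke_has_derivative:
  assumes "a \<in> S" "z \<in> S" "z \<noteq> a"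
  shows "(blaschke S a has_field_derivative blaschke_logderiv S a z * blaschke S a z) (at z)"
proof -
  have "(\<phi> has_field_derivative deriv \<phi> z) (at z)"
    using \<phi>_hol open_S assms(2) holomorphic_derivI by blast
  note [derivative_intros] = this
  have ne: "1 - cnj (\<phi> a) * \<phi> z \<noteq> 0" "\<phi> z - \<phi> a \<noteq> 0"
    using assms denom_nonzero inj_\<phi> by (auto simp: inj_on_def)
  show ?thesis
    unfolding blaschke_def[abs_def] blaschke_logderiv_def
    by (rule derivative_eq_intros refl ne(1))+ (use ne in \<open>simp add: divide_simps\<close>, simp add: algebra_simps)
qed

lemma blaschke_continuous:
  "continuous_on (S \<times> S) (\<lambda>(a, z). blaschke S a z)"
  unfolding blaschke_def case_prod_beta
  by (intro continuous_intros continuous_on_compose2[OF cont_\<phi>]) (auto simp: denom_neq_1)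

lemma blaschke_logderiv_continuous:
  "continuous_on {(a, z). a \<in> S \<and> z \<in> S \<and> z \<noteq> a} (\<lambda>(a, z). blaschke_logderiv S a z)"
proof -
  have *: "continuous_on S (deriv \<phi>)"
    using \<phi>_hol open_S by (intro holomorphic_on_imp_continuous_on holomorphic_deriv)
  then show ?thesis
    unfolding blaschke_logderiv_def case_prod_beta
    by (intro continuous_intros continuous_on_compose2[OF cont_\<phi>] continuous_on_compose2[OF *])
       (use inj_\<phi> in \<open>auto simp: denom_neq_1 inj_on_def\<close>)
qed

text \<open>\<open>1 - |b|^2\<close> is the product of \<open>1 - |\<phi> a|^2\<close> and
  \<open>1 - |\<phi> z|^2\<close> over \<open>|1 - cnj (\<phi> a) \<phi> z|^2\<close>. For
  \<open>a\<close> in a compact set, \<open>|\<phi> a| \<le> r < 1\<close> keeps the denominator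
  above \<open>(1 - r)^2\<close>, so it is enough that \<open>|\<phi> z|\<close> is close to 1,
  uniformly in \<open>a\<close>.\<close>

lemma blaschke_boundary:
  assumes K: "compact K" "K \<subseteq> S" and e: "e > 0"
  obtains C where "compact C" "C \<subseteq> S" "\<And>a z. \<lbrakk>a \<in> K; z \<in> S - C\<rbrakk> \<Longrightarrow> norm (blaschke S a z) > 1 - e"
proof -
  interpret disc_chart S riemann_inv \<phi> by (rule disc_chart)
  obtain r where r: "0 \<le> r" "r < 1" "\<And>a. a \<in> K \<Longrightarrow> norm (\<phi> a) \<le> r"
  proof (cases "K = {}")
    case False
    have "compact (\<phi> ` K)" using K cont_\<phi> by (meson compact_continuous_image continuous_on_subset)
    from continuous_attains_sup[OF this _ continuous_on_norm_id] False
    obtain x where "x \<in> \<phi> ` K" "\<And>y. y \<in> \<phi> ` K \<Longrightarrow> norm y \<le> norm x" by blast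
    then show thesis using K norm_\<phi> by (intro that[of "norm x"]) auto
  qed (use that[of 0] in auto)
  define \<eta> where "\<eta> = min 1 e * (1 - r)\<^sup>2"
  have \<eta>: "\<eta> > 0" "\<eta> \<le> 1" using e r by (auto simp: \<eta>_def power_le_one mult_le_one)
  define s where "s = sqrt (1 - \<eta> / 2)"
  have s: "0 \<le> s" "s < 1" "s\<^sup>2 = 1 - \<eta> / 2" using \<eta> by (auto simp: s_def)
  define C where "C = riemann_inv ` cball 0 s"
  show thesis
  proof
    show "compact C" unfolding C_def using s \<Psi>_hol
      by (intro compact_continuous_image compact_cball) (auto intro!: holomorphic_on_imp_continuous_on elim!: holomorphic_on_subset)
    show "C \<subseteq> S" unfolding C_def using s \<Psi> by auto
    fix a z assume a: "a \<in> K" and z: "z \<in> S - C"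
    have sz: "s < norm (\<phi> z)"
    proof (rule ccontr)
      assume "\<not> s < norm (\<phi> z)"
      then have "\<phi> z \<in> cball 0 s" by simp
      then have "riemann_inv (\<phi> z) \<in> C" unfolding C_def by (rule imageI)
      then show False using z \<Theta> by simp
    qed
    have "1 - (norm (blaschke S a z))\<^sup>2 = (1 - (norm (\<phi> a))\<^sup>2) * (1 - (norm (\<phi> z))\<^sup>2) / (norm (1 - cnj (\<phi> a) * \<phi> z))\<^sup>2"
      unfolding blaschke_def using a z K norm_\<phi> by (intro norm_moebius_identity) auto
    also have "\<dots> \<le> 1 * (\<eta> / 2) / (1 - r)\<^sup>2"
    proof (intro frac_le mult_mono power_mono)
      show "1 - (norm (\<phi> z))\<^sup>2 \<le> \<eta> / 2"
        using s sz power_strict_mono[of s "norm (\<phi> z)" 2] by auto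
      have "norm (cnj (\<phi> a) * \<phi> z) \<le> r * 1"
        unfolding norm_mult using r a z norm_\<phi>[of z] by (intro mult_mono) auto
      then show "1 - r \<le> norm (1 - cnj (\<phi> a) * \<phi> z)"
        using norm_triangle_ineq2[of 1 "cnj (\<phi> a) * \<phi> z"] by simp
      show "0 \<le> 1 - (norm (\<phi> z))\<^sup>2"
        using norm_\<phi>[of z] z by (simp add: power_le_one)
    qed (use r \<eta> in auto)
    also have "\<dots> \<le> e / 2" using r e by (simp add: \<eta>_def)
    finally have le: "1 - (norm (blaschke S a z))\<^sup>2 \<le> e / 2" .
    have "norm (blaschke S a z) \<le> 1" using norm_blaschke[of a z] a z K by auto
    then have "(norm (blaschke S a z))\<^sup>2 \<le> norm (blaschke S a z)"
      by (simp add: power2_eq_square mult_left_le_one_le)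
    then show "norm (blaschke S a z) > 1 - e" using le e by linarith
  qed
qed

lemma blaschke_frontier:
  assumes K: "compact K" "K \<subseteq> S" and "e > 0" and \<xi>: "\<xi> \<in> frontier S"
  shows "\<exists>d>0. \<forall>a\<in>K. \<forall>z\<in>S. dist z \<xi> < d \<longrightarrow> norm (blaschke S a z) > 1 - e"
proof -
  obtain C where C: "compact C" "C \<subseteq> S" "\<And>a z. \<lbrakk>a \<in> K; z \<in> S - C\<rbrakk> \<Longrightarrow> norm (blaschke S a z) > 1 - e"
    using blaschke_boundary[OF K \<open>e > 0\<close>] by metis
  have "\<xi> \<in> - C" using C \<xi> open_S by (auto simp: frontier_def interior_open)
  then obtain d where "d > 0" "ball \<xi> d \<subseteq> - C"
    using C(1) by (meson compact_imp_closed open_Compl openE)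
  then have "norm (blaschke S a z) > 1 - e" if "a \<in> K" "z \<in> S" "dist z \<xi> < d" for a z
    using C(3)[of a z] that by (auto simp: dist_commute)
  then show ?thesis using \<open>d > 0\<close> by blast
qed

lemma blaschke_inverse_frontier:
  assumes "a \<in> S" "e > 0" "\<xi> \<in> frontier S"
  shows "\<exists>d>0. \<forall>z\<in>S. dist z \<xi> < d \<longrightarrow> 1 / norm (blaschke S a z) < 1 + e"
proof -
  have "1 / (1 + e) < 1" "1 / (1 + e) > 0" using assms by auto
  then obtain d where d: "d > 0" "\<And>z. \<lbrakk>z \<in> S; dist z \<xi> < d\<rbrakk> \<Longrightarrow> norm (blaschke S a z) > 1 - (1 - 1 / (1 + e))"
    using blaschke_frontier[of "{a}" "1 - 1 / (1 + e)" \<xi>] assms by auto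
  show ?thesis
  proof (intro exI[of _ d] conjI ballI impI)
    fix z assume "z \<in> S" "dist z \<xi> < d"
    then have "norm (blaschke S a z) > 1 / (1 + e)" by (auto dest: d(2))
    moreover from this have "norm (blaschke S a z) > 0"
      using \<open>1 / (1 + e) > 0\<close> by linarith
    ultimately show "1 / norm (blaschke S a z) < 1 + e"
      using \<open>e > 0\<close> by (simp add: field_simps)
  qed (use d in auto)
qed

end

section \<open>Domains in the upper half-plane touching the real axis\<close>

lemma isCont_bound:
  fixes f :: "complex \<Rightarrow> complex"
  assumes "isCont f \<xi>" "norm (f \<xi>) \<le> B" "e > 0"
  shows "\<exists>d>0. \<forall>z\<in>S. dist z \<xi> < d \<longrightarrow> norm (f z) < B + e"
proof -
  obtain d where "d > 0" "\<And>z. dist z \<xi> < d \<Longrightarrow> dist (f z) (f \<xi>) < e"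
    using assms(1,3) unfolding continuous_at_eps_delta by (auto simp: dist_commute)
  moreover have "norm (f z) < B + e" if "dist (f z) (f \<xi>) < e" for z
    using that assms(2) norm_triangle_sub[of "f z" "f \<xi>"] by (simp add: dist_norm)
  ultimately show ?thesis by blast
qed

text \<open>Squares rather than discs, because a graph over the real axis cuts a square into two
  parts that are visibly connected by vertical scaling.\<close>

definition open_square :: "real \<Rightarrow> complex set" where
  "open_square \<delta> = {z. \<bar>Re z\<bar> < \<delta> \<and> \<bar>Im z\<bar> < \<delta>}"

lemma open_square_eq: "open_square \<delta> = {z. Re z < \<delta>} \<inter> {z. Re z > -\<delta>} \<inter> {z. Im z < \<delta>} \<inter> {z. Im z > -\<delta>}"
  by (auto simp: open_square_def)

lemma open_open_square: "open (open_square \<delta>)"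
  unfolding open_square_eq
  by (intro open_Int open_halfspace_Re_lt open_halfspace_Re_gt open_halfspace_Im_lt open_halfspace_Im_gt)

lemma convex_open_square: "convex (open_square \<delta>)"
  unfolding open_square_eq
  by (intro convex_Int convex_halfspace_Re_lt convex_halfspace_Re_gt convex_halfspace_Im_lt convex_halfspace_Im_gt)

lemma open_square_subset_ball: "open_square \<delta> \<subseteq> ball 0 (2 * \<delta>)"
proof
  fix z assume "z \<in> open_square \<delta>"
  then show "z \<in> ball 0 (2 * \<delta>)" using cmod_le[of z] by (simp add: open_square_def)
qed

lemma ball_subset_open_square: "ball 0 \<delta> \<subseteq> open_square \<delta>"
proof
  fix z :: complex assume "z \<in> ball 0 \<delta>"
  then show "z \<in> open_square \<delta>" using abs_Re_le_cmod[of z] abs_Im_le_cmod[of z] by (simp add: open_square_def)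
qed

text \<open>
  The peaking function: its real part vanishes at 0, has small normal derivative there, but
  dominates the square of the distance to 0 on the upper half-plane up to distance comparable
  to \<open>\<delta>\<close>.
\<close>

definition peak :: "real \<Rightarrow> complex \<Rightarrow> complex" where
  "peak \<delta> z = \<delta>\<^sup>2 * z / (z + \<i> * \<delta>)"

lemma Re_peak:
  assumes "z \<noteq> - (\<i> * \<delta>)"
  shows "Re (peak \<delta> z) = \<delta>\<^sup>2 * ((norm z)\<^sup>2 + \<delta> * Im z) / ((norm z)\<^sup>2 + 2 * \<delta> * Im z + \<delta>\<^sup>2)"
proof -
  have "z / (z + \<i> * \<delta>) = of_real (1 / (norm (z + \<i> * \<delta>))\<^sup>2) * (z * cnj (z + \<i> * \<delta>))"
    by (subst complex_div_cnj) simp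
  then have "of_real (\<delta>\<^sup>2) * (z / (z + \<i> * \<delta>)) =
      of_real (\<delta>\<^sup>2) * (of_real (1 / (norm (z + \<i> * \<delta>))\<^sup>2) * (z * cnj (z + \<i> * \<delta>)))"
    by (rule arg_cong)
  then have "peak \<delta> z = (\<delta>\<^sup>2 * (1 / (norm (z + \<i> * \<delta>))\<^sup>2)) *\<^sub>R (z * cnj (z + \<i> * \<delta>))"
    by (simp add: peak_def scaleR_conv_of_real)
  then have "Re (peak \<delta> z) = (\<delta>\<^sup>2 * (1 / (norm (z + \<i> * \<delta>))\<^sup>2)) * Re (z * cnj (z + \<i> * \<delta>))"
    by (simp only: scaleR_complex.sel)
  moreover have "Re (z * cnj (z + \<i> * \<delta>)) = (norm z)\<^sup>2 + \<delta> * Im z"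
    unfolding cmod_power2 by (simp add: power2_eq_square algebra_simps)
  moreover have "(norm (z + \<i> * \<delta>))\<^sup>2 = (norm z)\<^sup>2 + 2 * \<delta> * Im z + \<delta>\<^sup>2"
    unfolding cmod_power2 by (simp add: power2_eq_square algebra_simps)
  ultimately show ?thesis by simp
qed

lemma upper_ne:
  assumes "\<delta> > 0" "Im z > -\<delta>" shows "z + \<i> * \<delta> \<noteq> 0" "z \<noteq> - (\<i> * \<delta>)"
  using assms by (auto simp: complex_eq_iff)

lemma peak_nonneg:
  assumes "\<delta> > 0" "Im z \<ge> 0"
  shows "Re (peak \<delta> z) \<ge> 0"
  using assms upper_ne[of \<delta> z] by (subst Re_peak) (auto intro!: divide_nonneg_nonneg mult_nonneg_nonneg add_nonneg_nonneg)

lemma peak_pos: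
  assumes "\<delta> > 0" "Im z \<ge> 0" "z \<noteq> 0"
  shows "Re (peak \<delta> z) > 0"
  using assms upper_ne[of \<delta> z] 
  by (subst Re_peak) (auto intro!: divide_pos_pos mult_pos_pos add_pos_nonneg)

text \<open>For \<open>|z| \<le> 2 \<delta>\<close>, which covers the square of side
  \<open>2 \<delta>\<close>, the denominator in \<open>Re_peak\<close> is at most
  \<open>4 \<delta>^2 + 4 \<delta>^2 + \<delta>^2\<close>; this is the 9.\<close>

lemma peak_lower_bound:
  assumes "\<delta> > 0" "Im z \<ge> 0" "norm z \<le> 2 * \<delta>"
  shows "(norm z)\<^sup>2 / 9 \<le> Re (peak \<delta> z)"
proof -
  have "Im z \<le> 2 * \<delta>" using abs_Im_le_cmod[of z] assms by linarith
  then have "2 * \<delta> * Im z \<le> 2 * \<delta> * (2 * \<delta>)" using assms by (intro mult_left_mono) auto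
  moreover have "(norm z)\<^sup>2 \<le> (2 * \<delta>)\<^sup>2" using assms by (intro power_mono) auto
  ultimately have "(norm z)\<^sup>2 + 2 * \<delta> * Im z + \<delta>\<^sup>2 \<le> 9 * \<delta>\<^sup>2" by (simp add: power2_eq_square)
  then have "\<delta>\<^sup>2 * ((norm z)\<^sup>2 + 0) / (9 * \<delta>\<^sup>2) \<le>
      \<delta>\<^sup>2 * ((norm z)\<^sup>2 + \<delta> * Im z) / ((norm z)\<^sup>2 + 2 * \<delta> * Im z + \<delta>\<^sup>2)"
    using assms by (intro frac_le mult_left_mono mult_nonneg_nonneg add_nonneg_pos add_nonneg_nonneg) auto
  then have "\<delta>\<^sup>2 * ((norm z)\<^sup>2 + 0) / (9 * \<delta>\<^sup>2) \<le> Re (peak \<delta> z)"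
    using Re_peak[of z \<delta>] upper_ne[of \<delta> z] assms by simp
  then show ?thesis using assms by simp
qed

lemma peak_imaginary_axis:
  assumes "\<delta> > 0" "s \<ge> 0"
  shows "Re (peak \<delta> (\<i> * of_real s)) \<le> \<delta> * s"
proof -
  have "Re (peak \<delta> (\<i> * of_real s)) = \<delta>\<^sup>2 * (s * (s + \<delta>)) / (s + \<delta>)\<^sup>2"
    using assms upper_ne[of \<delta> "\<i> * of_real s"] by (subst Re_peak) (auto simp: norm_mult power2_eq_square algebra_simps)
  also have "\<dots> = \<delta> * s * (\<delta> / (s + \<delta>))" using assms by (simp add: power2_eq_square)
  also have "\<dots> \<le> \<delta> * s * 1" using assms by (intro mult_left_mono) auto
  finally show ?thesis by simp
qed

lemma peak_holomorphic:
  assumes "\<And>z. z \<in> A \<Longrightarrow> z + \<i> * \<delta> \<noteq> 0"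
  shows "peak \<delta> holomorphic_on A"
  unfolding peak_def[abs_def] using assms by (intro holomorphic_intros) auto

lemma peak_has_derivative:
  assumes "\<delta> > 0" "z + \<i> * \<delta> \<noteq> 0"
  shows "(peak \<delta> has_field_derivative \<i> * \<delta> ^ 3 / (z + \<i> * \<delta>)\<^sup>2) (at z)"
  unfolding peak_def[abs_def] using assms
  by (auto intro!: derivative_eq_intros simp: power2_eq_square power3_eq_cube divide_simps) (simp add: algebra_simps)

text \<open>The disc touching the real axis at 0 forces points outside \<open>D\<close> to satisfy
  \<open>Im \<xi> \<le> |\<xi>|^2 / (2 \<rho>)\<close>, yields Hopf's lower bound and puts a segment
  of the imaginary axis into \<open>D\<close>. Connectedness of \<open>D\<close> in small squares
  keeps the enlarged domain simply connected.\<close>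

locale half_plane_domain =
  fixes D :: "complex set" and \<rho> :: real
  assumes open_D: "open D" and simply_D: "simply_connected D" and bounded_D: "bounded D"
    and D_upper: "\<And>z. z \<in> D \<Longrightarrow> Im z > 0"
    and closure_D: "\<And>z. \<lbrakk>z \<in> closure D; Im z \<le> 0\<rbrakk> \<Longrightarrow> z = 0"
    and \<rho>: "\<rho> > 0" "ball (\<i> * of_real \<rho>) \<rho> \<subseteq> D"
    and small_squares: "\<exists>\<delta>0>0. \<forall>\<delta>. 0 < \<delta> \<longrightarrow> \<delta> < \<delta>0 \<longrightarrow> connected (D \<inter> open_square \<delta>)"

locale half_plane_patch = half_plane_domain +
  fixes \<delta> :: real
  assumes \<delta>: "\<delta> > 0" "connected (D \<inter> open_square \<delta>)"

context half_plane_domain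
begin

lemma imag_in_D:
  assumes "0 < s" "s < 2 * \<rho>" shows "\<i> * of_real s \<in> D"
proof -
  have "dist (\<i> * of_real \<rho>) (\<i> * of_real s) = norm (\<i> * of_real (\<rho> - s))"
    by (simp add: dist_norm right_diff_distrib)
  also have "\<dots> = \<bar>\<rho> - s\<bar>" by (simp only: norm_mult norm_of_real norm_ii mult_1)
  also have "\<dots> < \<rho>" using assms by auto
  finally show ?thesis using \<rho> by auto
qed

sublocale D: simply_connected_domain D
  by unfold_locales (use open_D simply_D bounded_D imag_in_D[of \<rho>] \<rho> in auto)

lemma frontier_D_Im: "\<xi> \<in> frontier D \<Longrightarrow> Im \<xi> \<ge> 0"
proof -
  assume "\<xi> \<in> frontier D"
  then have "\<xi> \<in> closure D" by (simp add: frontier_def)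
  moreover have "closure D \<subseteq> {z. Im z \<ge> 0}"
    using D_upper by (intro closure_minimal closed_halfspace_Im_ge) (auto intro: less_imp_le)
  ultimately show ?thesis by auto
qed

lemma frontier_D_notin: "\<xi> \<in> frontier D \<Longrightarrow> \<xi> \<notin> D"
  using open_D by (auto simp: frontier_def interior_open)

lemma notin_D_Im: "\<xi> \<notin> D \<Longrightarrow> Im \<xi> \<le> (norm \<xi>)\<^sup>2 / (2 * \<rho>)"
proof -
  assume "\<xi> \<notin> D"
  then have "\<xi> \<notin> ball (\<i> * of_real \<rho>) \<rho>" using \<rho> by blast
  then have "norm (\<xi> - \<i> * of_real \<rho>) \<ge> \<rho>"
    by (simp add: dist_norm norm_minus_commute)
  then have "(norm (\<xi> - \<i> * of_real \<rho>))\<^sup>2 \<ge> \<rho>\<^sup>2" using \<rho> by (intro power_mono) auto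
  then have "2 * \<rho> * Im \<xi> \<le> (norm \<xi>)\<^sup>2"
    unfolding cmod_power2 by (simp add: power2_eq_square algebra_simps)
  then show ?thesis using \<rho> by (simp add: field_simps)
qed

end

section \<open>The symmetric enlargement and comparison of Green's functions\<close>

context half_plane_patch
begin

definition U :: "complex set" where "U = D \<union> cnj ` D \<union> open_square \<delta>"

lemma D_sub_U: "D \<subseteq> U" and square_sub_U: "open_square \<delta> \<subseteq> U"
  by (auto simp: U_def)

lemma cnj_square: "cnj ` open_square \<delta> = open_square \<delta>"
  by (auto simp: open_square_def image_cnj_conv_vimage_cnj)

lemma cnj_U: "z \<in> U \<Longrightarrow> cnj z \<in> U"
  by (auto simp: U_def open_square_def)

lemma (in -) open_cnj: "open A \<Longrightarrow> open (cnj ` A)"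
  unfolding image_cnj_conv_vimage_cnj by (intro open_vimage) (auto intro: continuous_intros)

lemma D_Int_square_ne: "D \<inter> open_square \<delta> \<noteq> {}"
proof -
  define s where "s = min \<rho> (\<delta> / 2)"
  have "\<i> * of_real s \<in> D" using \<rho> \<delta> by (intro imag_in_D) (auto simp: s_def)
  moreover have "\<i> * of_real s \<in> open_square \<delta>" using \<rho> \<delta> by (auto simp: s_def open_square_def)
  ultimately show ?thesis by blast
qed

lemma simply_connected_D_square: "simply_connected (D \<union> open_square \<delta>)"
  by (intro simply_connected_Un_open open_D simply_D open_open_square convex_imp_simply_connected
       convex_open_square \<delta> D_Int_square_ne)

text \<open>Glued in two stages, \<open>D\<close> with the square and then the result with its
  mirror image. The second overlap is the square itself, because \<open>D\<close> does not meet its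
  mirror image.\<close>

sublocale U: simply_connected_domain U
proof
  have U2: "U = (D \<union> open_square \<delta>) \<union> cnj ` (D \<union> open_square \<delta>)"
    using cnj_square by (auto simp: U_def image_Un)
  show "open U" unfolding U_def by (intro open_Un open_D open_cnj open_open_square)
  have int: "(D \<union> open_square \<delta>) \<inter> cnj ` (D \<union> open_square \<delta>) = open_square \<delta>"
  proof -
    have "D \<inter> cnj ` D = {}"
    proof (rule ccontr)
      assume "D \<inter> cnj ` D \<noteq> {}"
      then obtain z where "z \<in> D" "cnj z \<in> D" by auto
      then show False using D_upper[of z] D_upper[of "cnj z"] by simp
    qed
    then show ?thesis using cnj_square by (auto simp: image_Un)
  qed
  have "(D \<union> open_square \<delta>) homeomorphic cnj ` (D \<union> open_square \<delta>)"
    by (intro homeomorphicI[where f = cnj and g = cnj]) (auto intro: continuous_intros simp: image_comp o_def)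
  then have "simply_connected (cnj ` (D \<union> open_square \<delta>))"
    using simply_connected_D_square homeomorphic_simply_connected by blast
  then show "simply_connected U"
    unfolding U2 using int D_Int_square_ne convex_open_square[of \<delta>]
    by (intro simply_connected_Un_open simply_connected_D_square open_cnj open_Un open_D open_open_square)
       (auto simp: convex_connected)
  have "bounded (cnj ` D)"
    using bounded_D by (auto simp: bounded_iff)
  moreover have "bounded (open_square \<delta>)"
    using open_square_subset_ball bounded_ball bounded_subset by blast
  ultimately show "bounded U" unfolding U_def using bounded_D by auto
  show "U \<noteq> {}" using D_Int_square_ne D_sub_U by blast
qed

abbreviation "\<beta> \<equiv> blaschke U"

text \<open>The quotient \<open>\<beta>r a / \<beta> a\<close> is unimodular on the real part of \<open>U\<close>, so it continues the
  inverse of the Blaschke factor of \<open>D\<close> across 0 in modulus, up to a small exponential factor.\<close>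

definition \<beta>r :: "complex \<Rightarrow> complex \<Rightarrow> complex" where
  "\<beta>r a z = cnj (\<beta> a (cnj z))"

lemma norm_\<beta>r: "norm (\<beta>r a z) = norm (\<beta> a (cnj z))"
  by (simp add: \<beta>r_def)

lemma \<beta>r_holomorphic: "a \<in> D \<Longrightarrow> \<beta>r a holomorphic_on U"
proof -
  assume "a \<in> D"
  moreover have "cnj ` U = U" using cnj_U by (auto simp: image_iff) (metis complex_cnj_cnj)
  ultimately have "cnj \<circ> \<beta> a \<circ> cnj holomorphic_on U"
    using D_sub_U by (intro holomorphic_on_compose_cnj_cnj U.open_S) (auto intro: U.blaschke_holomorphic)
  then show ?thesis by (simp add: \<beta>r_def[abs_def] o_def)
qed

lemma a_in: "a \<in> D \<Longrightarrow> a \<in> U" "a \<in> D \<Longrightarrow> Im a > 0"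
  using D_sub_U D_upper by auto

lemma \<beta>r_nonzero: "\<lbrakk>a \<in> D; z \<in> U; Im z \<ge> 0\<rbrakk> \<Longrightarrow> \<beta>r a z \<noteq> 0"
  using U.blaschke_eq_0_iff[of a "cnj z"] cnj_U[of z] a_in[of a] by (auto simp: \<beta>r_def)

lemma \<beta>_nonzero: "\<lbrakk>a \<in> D; z \<in> U; z \<noteq> a\<rbrakk> \<Longrightarrow> \<beta> a z \<noteq> 0"
  using U.blaschke_eq_0_iff[of a z] a_in[of a] by auto

lemma norm_\<beta>r_less: "\<lbrakk>a \<in> D; z \<in> U\<rbrakk> \<Longrightarrow> norm (\<beta>r a z) < 1"
  using U.norm_blaschke[of a "cnj z"] cnj_U[of z] a_in[of a] by (auto simp: \<beta>r_def)

lemma norm_\<beta>_less: "\<lbrakk>a \<in> D; z \<in> U\<rbrakk> \<Longrightarrow> norm (\<beta> a z) < 1"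
  using U.norm_blaschke[of a z] a_in[of a] by auto

lemma isCont_\<beta>: "\<lbrakk>a \<in> D; z \<in> U\<rbrakk> \<Longrightarrow> isCont (\<beta> a) z"
  and isCont_\<beta>r: "\<lbrakk>a \<in> D; z \<in> U\<rbrakk> \<Longrightarrow> isCont (\<beta>r a) z"
  and isCont_cof: "\<lbrakk>a \<in> D; z \<in> U\<rbrakk> \<Longrightarrow> isCont (blaschke_cofactor U a) z"
  using U.blaschke_holomorphic[of a] U.blaschke_cofactor_holomorphic[of a] \<beta>r_holomorphic[of a] a_in[of a] U.open_S
  by (auto dest!: holomorphic_on_imp_continuous_on simp: continuous_on_eq_continuous_at)

lemma on_real_axis: "Im z = 0 \<Longrightarrow> norm (\<beta>r a z) = norm (\<beta> a z)"
proof -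
  assume "Im z = 0"
  then have "cnj z = z" by (simp add: complex_eq_iff)
  then show ?thesis by (simp add: \<beta>r_def)
qed

definition Up :: "complex set" where "Up = U \<inter> {z. Im z > 0}"

lemma open_Up: "open Up" and bounded_Up: "bounded Up"
  unfolding Up_def using U.open_S open_halfspace_Im_gt[of 0] bounded_subset[OF U.bounded_S] by auto

lemma D_sub_Up: "D \<subseteq> Up" using D_sub_U D_upper by (auto simp: Up_def)

text \<open>The behaviour of \<open>\<beta>\<close> is known at \<open>\<xi>\<close> and that of
  \<open>\<beta>r\<close> at \<open>cnj \<xi>\<close>; the symmetry of \<open>U\<close> puts both
  points on its frontier.\<close>

lemma frontier_Up:
  assumes "\<xi> \<in> frontier Up"
  shows "(\<xi> \<in> frontier U \<and> cnj \<xi> \<in> frontier U) \<or> (\<xi> \<in> U \<and> Im \<xi> = 0)"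
proof (cases "\<xi> \<in> U")
  case True
  have "closure Up \<subseteq> {z. Im z \<ge> 0}"
    by (intro closure_minimal closed_halfspace_Im_ge) (auto simp: Up_def intro: less_imp_le)
  then have "Im \<xi> \<ge> 0" "\<xi> \<notin> Up"
    using assms open_Up by (auto simp: frontier_def interior_open)
  then show ?thesis using True by (auto simp: Up_def)
next
  case False
  have "closure Up \<subseteq> closure U" by (intro closure_mono) (auto simp: Up_def)
  then have cl: "\<xi> \<in> closure U" using assms by (auto simp: frontier_def)
  then have "cnj \<xi> \<in> closure U"
    unfolding closure_approachable by (metis cnj_U complex_cnj_diff complex_mod_cnj dist_norm)
  moreover have "cnj \<xi> \<notin> U" using False cnj_U by fastforce
  ultimately show ?thesis using False cl U.open_S by (auto simp: frontier_def interior_open)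
qed

text \<open>In the upper half of a symmetric domain, Green's function with pole \<open>a\<close>
  exceeds the one with the mirrored pole: the two agree on the real axis and both vanish on the rest
  of the frontier.\<close>

lemma \<beta>_le_\<beta>r:
  assumes a: "a \<in> D" and z: "z \<in> Up"
  shows "norm (\<beta> a z) \<le> norm (\<beta>r a z)"
proof -
  have "norm (\<beta> a z / \<beta>r a z) \<le> 1"
  proof (rule maximum_modulus_limsup[OF open_Up bounded_Up _ _ z])
    show "(\<lambda>z. \<beta> a z / \<beta>r a z) holomorphic_on Up"
      using \<beta>r_holomorphic[OF a] U.blaschke_holomorphic[of a] a_in[OF a] \<beta>r_nonzero[OF a]
      by (intro holomorphic_intros) (auto simp: Up_def elim!: holomorphic_on_subset)
    fix \<xi> and e :: real assume "\<xi> \<in> frontier Up" and e: "e > 0"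
    then consider "cnj \<xi> \<in> frontier U" | "\<xi> \<in> U" "Im \<xi> = 0" using frontier_Up by blast
    then show "\<exists>d>0. \<forall>z\<in>Up. dist z \<xi> < d \<longrightarrow> norm (\<beta> a z / \<beta>r a z) < 1 + e"
    proof cases
      case 1
      from U.blaschke_inverse_frontier[OF a_in(1)[OF a] e 1] obtain d where d: "d > 0"
        "\<And>z. \<lbrakk>z \<in> U; dist z (cnj \<xi>) < d\<rbrakk> \<Longrightarrow> 1 / norm (\<beta> a z) < 1 + e" by blast
      show ?thesis
      proof (intro exI[of _ d] conjI ballI impI)
        fix z assume z: "z \<in> Up" "dist z \<xi> < d"
        have "dist (cnj z) (cnj \<xi>) < d"
          using z by (metis complex_cnj_diff complex_mod_cnj dist_norm)
        then have "1 / norm (\<beta>r a z) < 1 + e" using d(2)[of "cnj z"] z cnj_U by (auto simp: norm_\<beta>r Up_def)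
        moreover have "norm (\<beta> a z / \<beta>r a z) \<le> 1 / norm (\<beta>r a z)"
          unfolding norm_divide using norm_\<beta>_less[OF a, of z] z by (intro divide_right_mono) (auto simp: Up_def)
        ultimately show "norm (\<beta> a z / \<beta>r a z) < 1 + e" by simp
      qed (use d in auto)
    next
      case 2
      then show ?thesis using a e isCont_\<beta> isCont_\<beta>r \<beta>r_nonzero on_real_axis
        by (intro isCont_bound) (auto simp: norm_divide)
    qed
  qed
  then show ?thesis using \<beta>r_nonzero[OF a, of z] z by (simp add: norm_divide Up_def divide_le_eq_1)
qed

text \<open>\<open>ln |\<beta>r a / \<beta> a|\<close> is Green's function of \<open>Up\<close>, and
  \<open>ln (|z - cnj a| / |z - a|)\<close> that of the half-plane, so this is monotonicity in the
  domain. The cofactor in \<open>f\<close> removes the common pole at \<open>a\<close>, which lets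
  the maximum principle apply on all of \<open>Up\<close>.\<close>

lemma \<beta>r_half_plane_bound:
  assumes a: "a \<in> D" and z: "z \<in> Up"
  shows "norm (\<beta>r a z) * norm (z - a) \<le> norm (\<beta> a z) * norm (z - cnj a)"
proof -
  define f where "f = (\<lambda>z. \<beta>r a z / (blaschke_cofactor U a z * (z - cnj a)))"
  have ne: "z - cnj a \<noteq> 0" if "Im z \<ge> 0" for z
    using that a_in(2)[OF a] by (auto simp: complex_eq_iff)
  have nf: "norm (f z) = norm (\<beta>r a z) * norm (z - a) / (norm (\<beta> a z) * norm (z - cnj a))" if "z \<noteq> a" for z
    using that by (simp add: f_def U.blaschke_eq norm_mult norm_divide)
  have le: "norm (z - a) \<le> norm (z - cnj a)" if "Im z \<ge> 0" for z
  proof -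
    have "(norm (z - a))\<^sup>2 \<le> (norm (z - cnj a))\<^sup>2"
      using that a_in(2)[OF a] unfolding cmod_power2 by (simp add: power2_eq_square algebra_simps)
    then show ?thesis using power2_le_imp_le norm_ge_zero by blast
  qed
  have "norm (f z) \<le> 1"
  proof (rule maximum_modulus_limsup[OF open_Up bounded_Up _ _ z])
    show "f holomorphic_on Up" unfolding f_def
      using \<beta>r_holomorphic[OF a] U.blaschke_cofactor_holomorphic[of a] a_in[OF a] ne U.blaschke_cofactor_nonzero[of a]
      by (intro holomorphic_intros) (auto simp: Up_def elim!: holomorphic_on_subset)
    fix \<xi> and e :: real assume \<xi>: "\<xi> \<in> frontier Up" and e: "e > 0"
    then consider "\<xi> \<in> frontier U" | "\<xi> \<in> U" "Im \<xi> = 0" using frontier_Up by blast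
    then show "\<exists>d>0. \<forall>z\<in>Up. dist z \<xi> < d \<longrightarrow> norm (f z) < 1 + e"
    proof cases
      case 1
      from U.blaschke_inverse_frontier[OF a_in(1)[OF a] e 1] obtain d where d: "d > 0"
        "\<And>z. \<lbrakk>z \<in> U; dist z \<xi> < d\<rbrakk> \<Longrightarrow> 1 / norm (\<beta> a z) < 1 + e" by blast
      have "\<xi> \<noteq> a" using 1 a_in[OF a] U.open_S by (auto simp: frontier_def interior_open)
      show ?thesis
      proof (intro exI[of _ "min d (dist a \<xi>)"] conjI ballI impI)
        fix z assume z: "z \<in> Up" "dist z \<xi> < min d (dist a \<xi>)"
        have "z \<noteq> a" using z by auto
        then have "norm (f z) = norm (\<beta>r a z) * (norm (z - a) / norm (z - cnj a)) * (1 / norm (\<beta> a z))"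
          using nf by simp
        also have "\<dots> \<le> 1 * 1 * (1 / norm (\<beta> a z))"
          using norm_\<beta>r_less[OF a, of z] le[of z] z ne[of z]
          by (intro mult_mono) (auto simp: Up_def divide_le_eq_1 mult_le_one)
        also have "\<dots> < 1 + e" using d(2)[of z] z by (simp add: Up_def)
        finally show "norm (f z) < 1 + e" .
      qed (use d \<open>\<xi> \<noteq> a\<close> in auto)
    next
      case 2
      then have "\<xi> \<noteq> a" using a_in[OF a] by auto
      have "norm (\<xi> - cnj a) = norm (\<xi> - a)"
        using 2 by (simp add: cmod_def power2_eq_square algebra_simps)
      then have "norm (f \<xi>) \<le> 1" using 2 on_real_axis \<open>\<xi> \<noteq> a\<close> nf by simp
      moreover have "isCont f \<xi>" unfolding f_def
        using 2 a isCont_\<beta>r isCont_cof ne[of \<xi>] U.blaschke_cofactor_nonzero[of a \<xi>] a_in[OF a]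
        by (intro continuous_intros) auto
      ultimately show ?thesis using isCont_bound e by blast
    qed
  qed
  then show ?thesis
    using z \<beta>_nonzero[OF a, of z] ne[of z]
    by (cases "z = a") (auto simp: nf Up_def divide_le_eq_1_pos)
qed

text \<open>Monotonicity again, now for \<open>D\<close> inside \<open>Up\<close>: Green's function
  of \<open>D\<close> is at most \<open>ln |\<beta>r a / \<beta> a|\<close>.\<close>

lemma blaschke_D_lower:
  assumes a: "a \<in> D" and z: "z \<in> D"
  shows "norm (\<beta> a z) \<le> norm (\<beta>r a z) * norm (blaschke D a z)"
proof -
  define f where "f = (\<lambda>z. blaschke_cofactor U a z / (\<beta>r a z * blaschke_cofactor D a z))"
  have nf: "norm (f z) = norm (\<beta> a z) / (norm (\<beta>r a z) * norm (blaschke D a z))" if "z \<noteq> a" for z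
    using that by (simp add: f_def U.blaschke_eq D.blaschke_eq norm_mult norm_divide)
  have "norm (f z) \<le> 1"
  proof (rule maximum_modulus_limsup[OF open_D bounded_D _ _ z])
    have "\<beta>r a z \<noteq> 0" if "z \<in> D" for z using that a_in \<beta>r_nonzero[OF a, of z] by force
    then show "f holomorphic_on D" unfolding f_def
      using \<beta>r_holomorphic[OF a] U.blaschke_cofactor_holomorphic[of a] a_in[OF a] D.blaschke_cofactor_nonzero[of a]
         D_sub_U a
      by (intro holomorphic_intros D.blaschke_cofactor_holomorphic) (auto elim!: holomorphic_on_subset)
    fix \<xi> and e :: real assume \<xi>: "\<xi> \<in> frontier D" and e: "e > 0"
    from D.blaschke_inverse_frontier[OF a e \<xi>] obtain d where d: "d > 0"
      "\<And>z. \<lbrakk>z \<in> D; dist z \<xi> < d\<rbrakk> \<Longrightarrow> 1 / norm (blaschke D a z) < 1 + e" by blast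
    have "\<xi> \<noteq> a" using \<xi> a frontier_D_notin by auto
    show "\<exists>d>0. \<forall>z\<in>D. dist z \<xi> < d \<longrightarrow> norm (f z) < 1 + e"
    proof (intro exI[of _ "min d (dist a \<xi>)"] conjI ballI impI)
      fix z assume z: "z \<in> D" "dist z \<xi> < min d (dist a \<xi>)"
      have "z \<noteq> a" using z by auto
      then have "norm (f z) = norm (\<beta> a z) / norm (\<beta>r a z) * (1 / norm (blaschke D a z))"
        using nf by simp
      also have "\<dots> \<le> 1 * (1 / norm (blaschke D a z))"
        using \<beta>_le_\<beta>r[OF a, of z] D_sub_Up z
        by (intro mult_right_mono) (auto simp: divide_le_eq_1)
      also have "\<dots> < 1 + e" using d(2)[of z] z by simp
      finally show "norm (f z) < 1 + e" .
    qed (use d \<open>\<xi> \<noteq> a\<close> in auto)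
  qed
  then show ?thesis
    using z \<beta>r_nonzero[OF a, of z] a_in[OF z] D.blaschke_eq_0_iff[OF a z] U.blaschke_eq_0_iff[of a z] a_in[OF a]
    by (cases "z = a") (auto simp: nf divide_le_eq_1_pos)
qed

text \<open>The converse comparison, up to the term \<open>\<kappa> Re (peak \<delta>)\<close>. On
  frontier points of \<open>D\<close> outside \<open>U\<close> Green's functions vanish in the
  limit; on those inside \<open>U\<close>, \<open>bd\<close> says that Green's function of
  \<open>Up\<close> is absorbed by the peaking term.\<close>

lemma blaschke_D_upper:
  assumes a: "a \<in> D" and z: "z \<in> D" and \<kappa>: "\<kappa> \<ge> 0"
    and bd: "\<And>\<xi>. \<lbrakk>\<xi> \<in> frontier D; \<xi> \<in> U\<rbrakk> \<Longrightarrow> norm (\<beta>r a \<xi>) \<le> norm (\<beta> a \<xi>) * exp (\<kappa> * Re (peak \<delta> \<xi>))"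
  shows "norm (\<beta>r a z) * norm (blaschke D a z) \<le> norm (\<beta> a z) * exp (\<kappa> * Re (peak \<delta> z))"
proof -
  define f where "f = (\<lambda>z. \<beta>r a z * blaschke_cofactor D a z / blaschke_cofactor U a z * exp (- \<kappa> * peak \<delta> z))"
  have nf: "norm (f z) = norm (\<beta>r a z) * norm (blaschke D a z) / norm (\<beta> a z) * exp (- (\<kappa> * Re (peak \<delta> z)))" if "z \<noteq> a" for z
    using that by (simp add: f_def U.blaschke_eq D.blaschke_eq norm_mult norm_divide)
  have "norm (f z) \<le> 1"
  proof (rule maximum_modulus_limsup[OF open_D bounded_D _ _ z])
    have "z + \<i> * \<delta> \<noteq> 0" if "z \<in> D" for z using upper_ne(1)[OF \<delta>(1), of z] D_upper[OF that] \<delta>(1) by auto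
    then show "f holomorphic_on D" unfolding f_def
      using \<beta>r_holomorphic[OF a] U.blaschke_cofactor_holomorphic[of a] a_in[OF a] U.blaschke_cofactor_nonzero[of a]
         D_sub_U a
      by (intro holomorphic_intros D.blaschke_cofactor_holomorphic peak_holomorphic) (auto elim!: holomorphic_on_subset)
    fix \<xi> and e :: real assume \<xi>: "\<xi> \<in> frontier D" and e: "e > 0"
    have "\<xi> \<noteq> a" using \<xi> a frontier_D_notin by auto
    show "\<exists>d>0. \<forall>z\<in>D. dist z \<xi> < d \<longrightarrow> norm (f z) < 1 + e"
    proof (cases "\<xi> \<in> U")
      case False
      have "\<xi> \<in> frontier U" using False \<xi> closure_mono[OF D_sub_U] U.open_S by (auto simp: frontier_def interior_open)
      from U.blaschke_inverse_frontier[OF a_in(1)[OF a] e this] obtain d where d: "d > 0"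
        "\<And>z. \<lbrakk>z \<in> U; dist z \<xi> < d\<rbrakk> \<Longrightarrow> 1 / norm (\<beta> a z) < 1 + e" by blast
      show ?thesis
      proof (intro exI[of _ "min d (dist a \<xi>)"] conjI ballI impI)
        fix z assume z: "z \<in> D" "dist z \<xi> < min d (dist a \<xi>)"
        have "z \<noteq> a" using z by auto
        then have "norm (f z) = norm (\<beta>r a z) * norm (blaschke D a z) * exp (- (\<kappa> * Re (peak \<delta> z))) * (1 / norm (\<beta> a z))"
          using nf by simp
        also have "\<dots> \<le> 1 * 1 * 1 * (1 / norm (\<beta> a z))"
          using norm_\<beta>r_less[OF a, of z] D.norm_blaschke[OF a, of z] peak_nonneg[OF \<delta>(1), of z] D_upper[of z] D_sub_U z \<kappa>
          by (intro mult_mono mult_le_one) auto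
        also have "\<dots> < 1 + e" using d(2)[of z] z D_sub_U by auto
        finally show "norm (f z) < 1 + e" .
      qed (use d \<open>\<xi> \<noteq> a\<close> in auto)
    next
      case True
      define g where "g = (\<lambda>z. \<beta>r a z / \<beta> a z * exp (- \<kappa> * peak \<delta> z))"
      have "isCont (peak \<delta>) \<xi>"
        using peak_has_derivative[OF \<delta>(1), of \<xi>] upper_ne(1)[OF \<delta>(1), of \<xi>] frontier_D_Im[OF \<xi>] \<delta>(1)
        by (auto intro: DERIV_isCont)
      then have "isCont g \<xi>" unfolding g_def
        using True a isCont_\<beta>r isCont_\<beta> \<beta>_nonzero[OF a True \<open>\<xi> \<noteq> a\<close>] by (intro continuous_intros) auto
      moreover have "norm (g \<xi>) \<le> 1"
        using bd[OF \<xi> True] \<beta>_nonzero[OF a True \<open>\<xi> \<noteq> a\<close>]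
        by (simp add: g_def norm_mult norm_divide exp_minus field_simps)
      ultimately obtain d where d: "d > 0" "\<And>z. \<lbrakk>z \<in> D; dist z \<xi> < d\<rbrakk> \<Longrightarrow> norm (g z) < 1 + e"
        using isCont_bound[OF _ _ e, of \<xi> g 1 D] by blast
      show ?thesis
      proof (intro exI[of _ "min d (dist a \<xi>)"] conjI ballI impI)
        fix z assume z: "z \<in> D" "dist z \<xi> < min d (dist a \<xi>)"
        have "z \<noteq> a" using z by auto
        then have "norm (f z) = norm (g z) * norm (blaschke D a z)"
          using nf by (simp add: g_def norm_mult norm_divide)
        also have "\<dots> \<le> norm (g z) * 1"
          using D.norm_blaschke[OF a, of z] z by (intro mult_left_mono) auto
        also have "\<dots> < 1 + e" using d(2)[of z] z by auto
        finally show "norm (f z) < 1 + e" .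
      qed (use d \<open>\<xi> \<noteq> a\<close> in auto)
    qed
  qed
  then show ?thesis
    using z \<beta>_nonzero[OF a, of z] a_in(1)[OF z] D.blaschke_eq_0_iff[OF a z]
    by (cases "z = a") (auto simp: nf exp_minus field_simps)
qed

end

section \<open>Auxiliary estimates: logarithmic derivatives, limits, a boundary form of
  Schwarz-Pick\<close>

lemma has_real_derivative_ln_norm:
  fixes f :: "complex \<Rightarrow> complex"
  assumes f: "(f has_field_derivative l * f (z + of_real s * w)) (at (z + of_real s * w))"
    and nz: "f (z + of_real s * w) \<noteq> 0"
  shows "((\<lambda>s. ln (norm (f (z + of_real s * w)))) has_real_derivative Re (w * l)) (at s)"
proof -
  define c where "c = f (z + of_real s * w)"
  have "((\<lambda>s. z + of_real s * w) has_vector_derivative w) (at s)"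
    by (auto intro!: derivative_eq_intros)
  from field_vector_diff_chain_at[OF this f]
  have g: "((\<lambda>s. f (z + of_real s * w)) has_vector_derivative w * (l * c)) (at s)"
    by (simp add: o_def c_def)
  have Re: "((\<lambda>s. Re (f (z + of_real s * w))) has_real_derivative Re (w * (l * c))) (at s)"
    and Im: "((\<lambda>s. Im (f (z + of_real s * w))) has_real_derivative Im (w * (l * c))) (at s)"
    using g by (auto simp: has_vector_derivative_complex_iff)
  have pos: "(Re c)\<^sup>2 + (Im c)\<^sup>2 > 0"
    using nz by (simp add: c_def complex_eq_iff sum_power2_gt_zero_iff)
  define x y where "x = (\<lambda>s. Re (f (z + of_real s * w)))" and "y = (\<lambda>s. Im (f (z + of_real s * w)))"
  define X Y where "X = Re (w * (l * c))" and "Y = Im (w * (l * c))"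
  have "(x has_real_derivative X) (at s)" "(y has_real_derivative Y) (at s)" "(x s)\<^sup>2 + (y s)\<^sup>2 > 0"
    using Re Im pos by (simp_all add: x_def y_def X_def Y_def c_def)
  then have "((\<lambda>s. ln ((x s)\<^sup>2 + (y s)\<^sup>2) / 2) has_real_derivative (2 * x s * X + 2 * y s * Y) / ((x s)\<^sup>2 + (y s)\<^sup>2) / 2) (at s)"
    by (auto intro!: derivative_eq_intros simp: field_simps)
  then have "((\<lambda>s. ln ((Re (f (z + of_real s * w)))\<^sup>2 + (Im (f (z + of_real s * w)))\<^sup>2) / 2)
     has_real_derivative (2 * Re c * Re (w * (l * c)) + 2 * Im c * Im (w * (l * c))) / ((Re c)\<^sup>2 + (Im c)\<^sup>2) / 2) (at s)"
    by (simp add: x_def y_def X_def Y_def c_def)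
  moreover have "(2 * Re c * Re (w * (l * c)) + 2 * Im c * Im (w * (l * c))) / ((Re c)\<^sup>2 + (Im c)\<^sup>2) / 2 = Re (w * l)"
  proof -
    have eq: "2 * Re c * Re (w * (l * c)) + 2 * Im c * Im (w * (l * c)) = 2 * Re (w * l) * ((Re c)\<^sup>2 + (Im c)\<^sup>2)"
      by (simp add: power2_eq_square algebra_simps)
    have nz: "(Re c)\<^sup>2 + (Im c)\<^sup>2 \<noteq> 0" using pos by linarith
    show ?thesis unfolding eq by (subst nonzero_mult_div_cancel_right[OF nz]) simp
  qed
  ultimately have *: "((\<lambda>s. ln ((Re (f (z + of_real s * w)))\<^sup>2 + (Im (f (z + of_real s * w)))\<^sup>2) / 2)
     has_real_derivative Re (w * l)) (at s)" by simp
  have ln: "ln (norm u) = ln ((Re u)\<^sup>2 + (Im u)\<^sup>2) / 2" for u :: complex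
    by (cases "u = 0") (auto simp: cmod_def ln_sqrt sum_power2_gt_zero_iff complex_eq_iff)
  show ?thesis unfolding ln by (rule *)
qed

text \<open>The numbers \<open>m\<close> belonging to the tolerances \<open>1 / (n + 1)\<close> form
  a Cauchy sequence, because any two of the approximations hold at a common point.\<close>

lemma real_limit_exists:
  fixes f :: "'a \<Rightarrow> real"
  assumes F: "F \<noteq> bot" and f: "\<And>e. e > 0 \<Longrightarrow> \<exists>m. \<forall>\<^sub>F s in F. \<bar>f s - m\<bar> \<le> e"
  shows "\<exists>L. (f \<longlongrightarrow> L) F"
proof -
  have "\<forall>n. \<exists>m. \<forall>\<^sub>F s in F. \<bar>f s - m\<bar> \<le> 1 / real (Suc n)" using f by simp
  then obtain m where m: "\<And>n. \<forall>\<^sub>F s in F. \<bar>f s - m n\<bar> \<le> 1 / real (Suc n)" by metis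
  have mm: "\<bar>m n - m k\<bar> \<le> 1 / real (Suc n) + 1 / real (Suc k)" for n k
  proof -
    from eventually_happens'[OF F eventually_conj[OF m[of n] m[of k]]]
    show ?thesis by force
  qed
  have "Cauchy m"
  proof (rule metric_CauchyI)
    fix e :: real assume "e > 0"
    then obtain N where N: "1 / real (Suc N) < e / 2" using nat_approx_posE[of "e / 2"] by auto
    show "\<exists>N. \<forall>n\<ge>N. \<forall>k\<ge>N. dist (m n) (m k) < e"
    proof (intro exI[of _ N] allI impI)
      fix n k assume "n \<ge> N" "k \<ge> N"
      then have "1 / real (Suc n) \<le> 1 / real (Suc N)" "1 / real (Suc k) \<le> 1 / real (Suc N)"
        by (auto intro!: divide_left_mono)
      then show "dist (m n) (m k) < e" using mm[of n k] N by (simp add: dist_real_def)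
    qed
  qed
  then obtain L where L: "m \<longlonglongrightarrow> L" using Cauchy_convergent convergent_def by blast
  have mL: "\<bar>m n - L\<bar> \<le> 1 / real (Suc n)" for n
  proof -
    have "(\<lambda>k. \<bar>m n - m k\<bar>) \<longlonglongrightarrow> \<bar>m n - L\<bar>" by (intro tendsto_intros L)
    moreover have "(\<lambda>k. 1 / real (Suc n) + 1 / real (Suc k)) \<longlonglongrightarrow> 1 / real (Suc n) + 0"
      by (intro tendsto_intros LIMSEQ_Suc[OF lim_1_over_n])
    ultimately show ?thesis using LIMSEQ_le mm by fastforce
  qed
  have "(f \<longlongrightarrow> L) F"
  proof (rule tendstoI)
    fix e :: real assume "e > 0"
    then obtain N where N: "1 / real (Suc N) < e / 2" using nat_approx_posE[of "e / 2"] by auto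
    show "\<forall>\<^sub>F x in F. dist (f x) L < e"
      using m[of N] by eventually_elim (use mL[of N] N in \<open>auto simp: dist_real_def\<close>)
  qed
  then show ?thesis ..
qed

text \<open>The maximum over the compact \<open>A\<close> makes the strict inequality at
  \<open>\<xi>\<close> uniform, and uniform continuity on the product carries part of the gap to
  nearby points.\<close>

lemma compact_nbhd_bound:
  fixes G :: "'a::metric_space \<times> complex \<Rightarrow> real"
  assumes A: "compact A" and r: "r > 0" and G: "continuous_on (A \<times> cball \<xi> r) G"
    and less: "\<And>a. a \<in> A \<Longrightarrow> G (a, \<xi>) < m"
  shows "\<exists>d p. 0 < d \<and> d \<le> r \<and> p < m \<and> (\<forall>a\<in>A. \<forall>z\<in>cball \<xi> d. G (a, z) \<le> p)"
proof (cases "A = {}")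
  case False
  have "continuous_on A (\<lambda>a. G (a, \<xi>))"
    using r by (intro continuous_on_compose2[OF G] continuous_intros) auto
  from continuous_attains_sup[OF A False this] obtain a0 where a0: "a0 \<in> A"
    "\<And>a. a \<in> A \<Longrightarrow> G (a, \<xi>) \<le> G (a0, \<xi>)" by blast
  define e where "e = (m - G (a0, \<xi>)) / 2"
  have e: "e > 0" using less[OF a0(1)] by (simp add: e_def)
  have "uniformly_continuous_on (A \<times> cball \<xi> r) G"
    using A by (intro compact_uniformly_continuous G compact_Times) auto
  then obtain d where d: "d > 0" "\<And>x y. \<lbrakk>x \<in> A \<times> cball \<xi> r; y \<in> A \<times> cball \<xi> r; dist y x < d\<rbrakk> \<Longrightarrow> dist (G y) (G x) < e"
    using e unfolding uniformly_continuous_on_def by meson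
  show ?thesis
  proof (rule exI[of _ "min r (d / 2)"], rule exI[of _ "G (a0, \<xi>) + e"], intro conjI ballI)
    fix a z assume a: "a \<in> A" and z: "z \<in> cball \<xi> (min r (d / 2))"
    have "dist (a, z) (a, \<xi>) < d" using z d(1) by (simp add: dist_Pair_Pair dist_commute)
    then have "dist (G (a, z)) (G (a, \<xi>)) < e" using a z r by (intro d(2)) auto
    then show "G (a, z) \<le> G (a0, \<xi>) + e" using a0(2)[OF a] by (simp add: dist_real_def)
  qed (use e d r in \<open>auto simp: e_def field_simps\<close>)
next
  case True
  show ?thesis unfolding True by (rule exI[of _ r], rule exI[of _ "m - 1"]) (use r in simp)
qed

text \<open>A quantitative Hopf lemma in the disc: an automorphism moves \<open>F 0\<close> to 0,
  Schwarz applies, and the identity for \<open>1 - |.|^2\<close> undoes the automorphism. The 8 is 4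
  from the squared denominator, whose modulus is at most 2, times 2 from
  \<open>1 + |F z| \<le> 2\<close>.\<close>

lemma schwarz_pick_boundary:
  assumes F: "F holomorphic_on ball 0 1" "\<And>z. norm z < 1 \<Longrightarrow> norm (F z) < 1" and z: "norm z < 1"
  shows "(1 - norm (F 0)) * (1 - norm z) / 8 \<le> 1 - norm (F z)"
proof -
  define a where "a = F 0"
  have a1: "norm a < 1" using F(2)[of 0] by (simp add: a_def)
  define G where "G = Moebius_function 0 a \<circ> F"
  have "G holomorphic_on ball 0 1" unfolding G_def
    using F by (intro holomorphic_on_compose_gen[OF F(1) Moebius_function_holomorphic[OF a1]]) auto
  moreover have "G 0 = 0" by (simp add: G_def a_def Moebius_function_eq_zero)
  moreover have nG: "norm (G w) < 1" if "norm w < 1" for w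
    using Moebius_function_norm_lt_1[OF a1 F(2)[OF that]] by (simp add: G_def)
  ultimately have Gz: "norm (G z) \<le> norm z" using Schwarz_Lemma(1) z by blast
  have Fz: "F z = (G z - (-a)) / (1 - cnj (-a) * G z)"
    using Moebius_function_compose[of "-a" a "F z"] a1 F(2)[OF z]
    by (simp add: G_def Moebius_function_simple)
  have "1 - (norm (F z))\<^sup>2 = (1 - (norm (-a))\<^sup>2) * (1 - (norm (G z))\<^sup>2) / (norm (1 - cnj (-a) * G z))\<^sup>2"
    unfolding Fz using a1 nG[OF z] by (intro norm_moebius_identity) auto
  also have "\<dots> \<ge> ((1 - norm a) * 1) * ((1 - norm z) * 1) / 2\<^sup>2"
  proof (intro frac_le mult_mono power_mono)
    have *: "1 - x \<le> 1 - x\<^sup>2" if "0 \<le> x" "x \<le> 1" for x :: real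
      using that by (simp add: power2_eq_square mult_left_le)
    show "(1 - norm a) * 1 \<le> 1 - (norm (- a))\<^sup>2" using * a1 by simp
    have "(norm (G z))\<^sup>2 \<le> (norm z)\<^sup>2" using Gz by (intro power_mono) auto
    moreover have "1 - norm z \<le> 1 - (norm z)\<^sup>2" using * z by simp
    ultimately have "(norm (G z))\<^sup>2 \<le> norm z" by linarith
    then show "(1 - norm z) * 1 \<le> 1 - (norm (G z))\<^sup>2" by simp
    have "norm (cnj (-a) * G z) \<le> 1 * 1" unfolding norm_mult using a1 nG[OF z] by (intro mult_mono) auto
    then show "norm (1 - cnj (- a) * G z) \<le> 2" using norm_triangle_ineq4[of 1 "cnj (-a) * G z"] by simp
    have "norm (cnj (-a) * G z) < 1" using a1 nG[OF z] mult_strict_mono'[of "norm a" 1 "norm (G z)" 1] by (simp add: norm_mult)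
    then have "1 - cnj (- a) * G z \<noteq> 0" by (metis eq_iff_diff_eq_0 norm_one less_irrefl)
    then show "0 < (norm (1 - cnj (- a) * G z))\<^sup>2" by simp
    show "0 \<le> (1 - (norm (- a))\<^sup>2) * (1 - (norm (G z))\<^sup>2)"
      using a1 nG[OF z] by (intro mult_nonneg_nonneg) (auto simp: power_le_one)
    show "0 \<le> 1 - (norm (- a))\<^sup>2" using a1 by (auto simp: power_le_one)
  qed (use a1 z in auto)
  finally have "(1 - norm a) * (1 - norm z) / 4 \<le> 1 - (norm (F z))\<^sup>2" by simp
  also have "1 - (norm (F z))\<^sup>2 = (1 - norm (F z)) * (1 + norm (F z))" by (simp add: power2_eq_square algebra_simps)
  also have "\<dots> \<le> (1 - norm (F z)) * 2" using F(2)[OF z] by (intro mult_left_mono) auto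
  finally show ?thesis by (simp add: a_def)
qed

section \<open>Size of the reflected quotient on the curve and its slope at 0\<close>

context half_plane_patch
begin

lemma norm_ratio_le_exp:
  assumes "a \<in> D" "Im z \<ge> 0" "z \<noteq> a"
  shows "norm (z - cnj a) \<le> norm (z - a) * exp (2 * Im z * Im a / (norm (z - a))\<^sup>2)"
proof (rule power2_le_imp_le)
  define N where "N = (norm (z - a))\<^sup>2"
  have N: "N > 0" using assms by (simp add: N_def)
  have "(norm (z - cnj a))\<^sup>2 = N + 4 * Im z * Im a"
    unfolding N_def cmod_power2 by (simp add: power2_eq_square algebra_simps)
  also have "\<dots> = N * (1 + 4 * Im z * Im a / N)" using N by (simp add: field_simps)
  also have "\<dots> \<le> N * exp (4 * Im z * Im a / N)" using N by (intro mult_left_mono exp_ge_add_one_self) auto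
  also have "\<dots> = (norm (z - a) * exp (2 * Im z * Im a / N))\<^sup>2"
    by (simp add: power_mult_distrib N_def flip: exp_double)
  finally show "(norm (z - cnj a))\<^sup>2 \<le> (norm (z - a) * exp (2 * Im z * Im a / (norm (z - a))\<^sup>2))\<^sup>2"
    by (simp add: N_def)
qed auto

lemma \<beta>r_le_exp:
  assumes a: "a \<in> D" and z: "z \<in> Up" "z \<noteq> a"
  shows "norm (\<beta>r a z) \<le> norm (\<beta> a z) * exp (2 * Im z * Im a / (norm (z - a))\<^sup>2)"
proof -
  have "norm (\<beta>r a z) * norm (z - a) \<le> norm (\<beta> a z) * norm (z - cnj a)"
    by (rule \<beta>r_half_plane_bound[OF a z(1)])
  also have "\<dots> \<le> norm (\<beta> a z) * (norm (z - a) * exp (2 * Im z * Im a / (norm (z - a))\<^sup>2))"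
    using norm_ratio_le_exp[OF a _ z(2)] z by (intro mult_left_mono) (auto simp: Up_def)
  finally have "norm (z - a) * norm (\<beta>r a z) \<le> norm (z - a) * (norm (\<beta> a z) * exp (2 * Im z * Im a / (norm (z - a))\<^sup>2))"
    by (simp add: algebra_simps)
  then show ?thesis using z(2) by simp
qed

text \<open>Off the real axis such a \<open>\<xi>\<close> lies in the square. There
  \<open>ln |\<beta>r a / \<beta> a|\<close> is at most \<open>2 Im \<xi> R / \<eta>^2\<close> by
  comparison with the half-plane, \<open>Im \<xi> \<le> |\<xi>|^2 / (2 \<rho>)\<close> by the disc
  in \<open>D\<close>, and \<open>|\<xi>|^2 \<le> 9 Re (peak \<delta> \<xi>)\<close>. The resulting
  constant does not involve \<open>\<delta>\<close>.\<close>

lemma \<beta>r_le_peak: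
  assumes a: "a \<in> D" "Im a \<le> R" and \<eta>: "\<eta> > 0" "\<eta> \<le> norm (\<xi> - a)"
    and \<xi>: "\<xi> \<in> U" "Im \<xi> \<ge> 0" "\<xi> \<notin> D"
  shows "norm (\<beta>r a \<xi>) \<le> norm (\<beta> a \<xi>) * exp (9 * R / (\<eta>\<^sup>2 * \<rho>) * Re (peak \<delta> \<xi>))"
proof -
  have R: "R > 0" using a a_in[of a] by auto
  have ex1: "1 \<le> exp (9 * R / (\<eta>\<^sup>2 * \<rho>) * Re (peak \<delta> \<xi>))"
    using R \<rho> \<eta> peak_nonneg[OF \<delta>(1) \<xi>(2)] by simp
  show ?thesis
  proof (cases "Im \<xi> = 0")
    case True
    then show ?thesis using on_real_axis[OF True] ex1 mult_left_mono[OF ex1, of "norm (\<beta> a \<xi>)"] by simp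
  next
    case False
    then have Up: "\<xi> \<in> Up" using \<xi> by (auto simp: Up_def)
    have "\<xi> \<notin> cnj ` D" using False \<xi> D_upper by force
    then have "\<xi> \<in> open_square \<delta>" using \<xi> by (auto simp: U_def)
    then have "norm \<xi> < 2 * \<delta>" using open_square_subset_ball by fastforce
    then have pk: "(norm \<xi>)\<^sup>2 / 9 \<le> Re (peak \<delta> \<xi>)" using peak_lower_bound[OF \<delta>(1) \<xi>(2)] by simp
    have "2 * Im \<xi> * Im a / (norm (\<xi> - a))\<^sup>2 \<le> 2 * Im \<xi> * R / \<eta>\<^sup>2"
      using \<xi> a \<eta> a_in[of a] by (intro frac_le mult_left_mono power_mono) auto
    also have "\<dots> \<le> 2 * ((norm \<xi>)\<^sup>2 / (2 * \<rho>)) * R / \<eta>\<^sup>2"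
      using notin_D_Im[OF \<xi>(3)] R \<eta> by (intro divide_right_mono mult_right_mono mult_left_mono) auto
    also have "\<dots> = 9 * R / (\<eta>\<^sup>2 * \<rho>) * ((norm \<xi>)\<^sup>2 / 9)" by (simp add: mult.commute)
    also have "\<dots> \<le> 9 * R / (\<eta>\<^sup>2 * \<rho>) * Re (peak \<delta> \<xi>)"
      using pk R \<rho> by (intro mult_left_mono) auto
    finally have "exp (2 * Im \<xi> * Im a / (norm (\<xi> - a))\<^sup>2) \<le> exp (9 * R / (\<eta>\<^sup>2 * \<rho>) * Re (peak \<delta> \<xi>))" by simp
    moreover have "\<xi> \<noteq> a" using \<xi> a by auto
    ultimately show ?thesis
      using \<beta>r_le_exp[OF a(1) Up] mult_left_mono[of _ _ "norm (\<beta> a \<xi>)"] by (meson norm_ge_zero order_trans)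
  qed
qed

lemma zero_in_U: "0 \<in> U" and zero_notin_D: "0 \<notin> D"
  using D_upper[of 0] \<delta> by (auto simp: U_def open_square_def)

text \<open>The derivative of \<open>ln |\<beta>r a| - ln |\<beta> a|\<close> at 0 up the imaginary
  axis. By symmetry the two terms contribute equally, whence the factor 2.\<close>

definition patch_slope :: "complex \<Rightarrow> real" where
  "patch_slope a = 2 * Im (blaschke_logderiv U a 0)"

definition log_ratio :: "complex \<Rightarrow> real \<Rightarrow> real" where
  "log_ratio a s = ln (norm (\<beta>r a (\<i> * of_real s))) - ln (norm (\<beta> a (\<i> * of_real s)))"

lemma log_ratio_tendsto:
  assumes a: "a \<in> D"
  shows "((\<lambda>s. log_ratio a s / s) \<longlongrightarrow> patch_slope a) (at_right 0)"
proof -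
  have a0: "a \<noteq> 0" using zero_notin_D a by auto
  have d: "(\<beta> a has_field_derivative blaschke_logderiv U a 0 * \<beta> a 0) (at 0)"
    using U.blaschke_has_derivative[of a 0] a_in[OF a] zero_in_U a0 by simp
  have nz: "\<beta> a 0 \<noteq> 0" using \<beta>_nonzero[OF a zero_in_U] a0 by simp
  have "((\<lambda>s. ln (norm (\<beta> a (0 + of_real s * w)))) has_real_derivative Re (w * blaschke_logderiv U a 0)) (at 0)" for w
    by (rule has_real_derivative_ln_norm) (use d nz in auto)
  from DERIV_diff[OF this[of "-\<i>"] this[of "\<i>"]]
  have "(log_ratio a has_real_derivative patch_slope a) (at 0)"
    unfolding log_ratio_def[abs_def] patch_slope_def norm_\<beta>r by (simp add: mult.commute)
  moreover have "log_ratio a 0 = 0" by (simp add: log_ratio_def on_real_axis)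
  ultimately have "((\<lambda>s. log_ratio a s / s) \<longlongrightarrow> patch_slope a) (at 0)"
    by (simp add: has_field_derivative_iff)
  then show ?thesis by (rule tendsto_mono[OF at_le, rotated]) auto
qed

lemma green_squeeze:
  assumes a: "a \<in> D" and s: "0 < s" "s < 2 * \<rho>" and ne: "\<i> * of_real s \<noteq> a"
  shows "- ln (norm (blaschke D a (\<i> * of_real s))) \<le> log_ratio a s"
    and "\<lbrakk>\<kappa> \<ge> 0; \<And>\<xi>. \<lbrakk>\<xi> \<in> frontier D; \<xi> \<in> U\<rbrakk> \<Longrightarrow> norm (\<beta>r a \<xi>) \<le> norm (\<beta> a \<xi>) * exp (\<kappa> * Re (peak \<delta> \<xi>))\<rbrakk>
      \<Longrightarrow> log_ratio a s - \<kappa> * \<delta> * s \<le> - ln (norm (blaschke D a (\<i> * of_real s)))"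
proof -
  define z where "z = \<i> * of_real s"
  have z: "z \<in> D" unfolding z_def by (rule imag_in_D[OF s])
  have pos: "norm (\<beta>r a z) > 0" "norm (\<beta> a z) > 0" "norm (blaschke D a z) > 0"
    using \<beta>r_nonzero[OF a, of z] \<beta>_nonzero[OF a, of z] a_in[OF z] D.blaschke_eq_0_iff[OF a z] ne
    by (auto simp: z_def)
  have "ln (norm (\<beta> a z)) \<le> ln (norm (\<beta>r a z) * norm (blaschke D a z))"
    using blaschke_D_lower[OF a z] pos by simp
  also have "\<dots> = ln (norm (\<beta>r a z)) + ln (norm (blaschke D a z))"
    using pos by (simp add: ln_mult)
  finally show "- ln (norm (blaschke D a (\<i> * of_real s))) \<le> log_ratio a s"
    by (simp add: log_ratio_def z_def)
  assume \<kappa>: "\<kappa> \<ge> 0" and bd: "\<And>\<xi>. \<lbrakk>\<xi> \<in> frontier D; \<xi> \<in> U\<rbrakk> \<Longrightarrow> norm (\<beta>r a \<xi>) \<le> norm (\<beta> a \<xi>) * exp (\<kappa> * Re (peak \<delta> \<xi>))"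
  have "norm (\<beta>r a z) * norm (blaschke D a z) \<le> norm (\<beta> a z) * exp (\<kappa> * Re (peak \<delta> z))"
    by (rule blaschke_D_upper[OF a z \<kappa> bd])
  then have "ln (norm (\<beta>r a z) * norm (blaschke D a z)) \<le> ln (norm (\<beta> a z) * exp (\<kappa> * Re (peak \<delta> z)))"
    using pos by (subst ln_le_cancel_iff) auto
  then have "ln (norm (\<beta>r a z)) + ln (norm (blaschke D a z)) \<le> ln (norm (\<beta> a z)) + \<kappa> * Re (peak \<delta> z)"
    using pos by (simp add: ln_mult)
  moreover have "\<kappa> * Re (peak \<delta> z) \<le> \<kappa> * (\<delta> * s)"
    unfolding z_def using peak_imaginary_axis[OF \<delta>(1), of s] s \<kappa> by (intro mult_left_mono) auto
  ultimately show "log_ratio a s - \<kappa> * \<delta> * s \<le> - ln (norm (blaschke D a (\<i> * of_real s)))"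
    by (simp add: log_ratio_def z_def)
qed

end

section \<open>The normal slope of Green's function at 0: existence and uniform bounds\<close>

context half_plane_domain
begin

definition green_slope :: "complex \<Rightarrow> real" where
  "green_slope a = Lim (at_right 0) (\<lambda>s. - ln (norm (blaschke D a (\<i> * of_real s))) / s)"

lemma patch_exists:
  assumes "e > 0" obtains \<delta> where "\<delta> < e" "half_plane_patch D \<rho> \<delta>"
proof -
  obtain \<delta>0 where "\<delta>0 > 0" "\<And>\<delta>. 0 < \<delta> \<Longrightarrow> \<delta> < \<delta>0 \<Longrightarrow> connected (D \<inter> open_square \<delta>)"
    using small_squares by blast
  then show thesis
    using assms by (intro that[of "min e \<delta>0 / 2"])
      (auto simp: half_plane_patch_def half_plane_patch_axioms_def half_plane_domain_axioms)
qed

lemma pole_constants: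
  assumes Z: "compact Z" "Z \<subseteq> D"
  obtains R \<eta> where "R > 0" "\<eta> > 0" "\<And>a. a \<in> Z \<Longrightarrow> Im a \<le> R" "\<And>a \<xi>. a \<in> Z \<Longrightarrow> \<xi> \<notin> D \<Longrightarrow> \<eta> \<le> norm (\<xi> - a)"
proof -
  obtain R where R: "R > 0" "\<And>a. a \<in> Z \<Longrightarrow> norm a \<le> R"
    using compact_imp_bounded[OF Z(1)] by (auto simp: bounded_pos)
  have "Z \<inter> (- D) = {}" "closed (- D)" using Z open_D by auto
  from separate_compact_closed[OF Z(1) this(2,1)] obtain \<eta> where "\<eta> > 0" "\<And>x y. x \<in> Z \<Longrightarrow> y \<notin> D \<Longrightarrow> \<eta> \<le> dist x y"
    by auto
  then show thesis
    using R by (intro that[of R \<eta>]) (auto simp: dist_norm norm_minus_commute intro: order_trans[OF order_trans[OF abs_ge_self abs_Im_le_cmod]])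
qed

text \<open>The order of the quantifiers is the point: \<open>\<kappa>\<close> serves all patches at
  once, so \<open>\<delta>\<close> may be chosen afterwards to make \<open>\<kappa> \<delta>\<close>
  small.\<close>

lemma frontier_bound:
  assumes Z: "compact Z" "Z \<subseteq> D"
  obtains \<kappa> where "\<kappa> > 0" "\<And>\<delta> a \<xi>. \<lbrakk>half_plane_patch D \<rho> \<delta>; a \<in> Z; \<xi> \<in> frontier D; \<xi> \<in> half_plane_patch.U D \<delta>\<rbrakk> \<Longrightarrow>
     norm (half_plane_patch.\<beta>r D \<delta> a \<xi>) \<le> norm (blaschke (half_plane_patch.U D \<delta>) a \<xi>) * exp (\<kappa> * Re (peak \<delta> \<xi>))"
proof -
  obtain R \<eta> where R: "R > 0" "\<eta> > 0" "\<And>a. a \<in> Z \<Longrightarrow> Im a \<le> R" "\<And>a \<xi>. a \<in> Z \<Longrightarrow> \<xi> \<notin> D \<Longrightarrow> \<eta> \<le> norm (\<xi> - a)"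
    using pole_constants[OF Z] by metis
  show thesis
  proof (rule that[of "9 * R / (\<eta>\<^sup>2 * \<rho>)"])
    fix \<delta> a \<xi> assume P: "half_plane_patch D \<rho> \<delta>" and a: "a \<in> Z" and \<xi>: "\<xi> \<in> frontier D" "\<xi> \<in> half_plane_patch.U D \<delta>"
    interpret half_plane_patch D \<rho> \<delta> by (rule P)
    show "norm (\<beta>r a \<xi>) \<le> norm (blaschke U a \<xi>) * exp (9 * R / (\<eta>\<^sup>2 * \<rho>) * Re (peak \<delta> \<xi>))"
      using Z a \<xi> R frontier_D_Im[OF \<xi>(1)] frontier_D_notin[OF \<xi>(1)] by (intro \<beta>r_le_peak) auto
  qed (use R \<rho> in auto)
qed

lemma eventually_imag_axis:
  assumes "a \<in> D"
  shows "\<forall>\<^sub>F s in at_right 0. 0 < s \<and> s < \<rho> \<and> \<i> * of_real s \<noteq> a"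
proof -
  have "\<forall>\<^sub>F s in at_right 0. s \<in> {0<..<min \<rho> (norm a)}"
    using \<rho> D_upper[OF assms] by (intro eventually_at_right_real) auto
  then show ?thesis by eventually_elim (auto simp: norm_mult)
qed

text \<open>On the imaginary axis \<open>- ln |b a|\<close> lies between
  \<open>log_ratio a s - \<kappa> \<delta> s\<close> and \<open>log_ratio a s\<close>, and the
  latter is differentiable at 0. Hence the difference quotients are eventually within any tolerance
  of some \<open>patch_slope a\<close>, without regularity of Green's function up to the boundary
  being known in advance.\<close>

lemma green_slope_tendsto:
  assumes a: "a \<in> D"
  shows "((\<lambda>s. - ln (norm (blaschke D a (\<i> * of_real s))) / s) \<longlongrightarrow> green_slope a) (at_right 0)"
proof -
  define g where "g = (\<lambda>s. - ln (norm (blaschke D a (\<i> * of_real s))) / s)"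
  have "compact {a}" "{a} \<subseteq> D" using a by auto
  from frontier_bound[OF this] obtain \<kappa> where \<kappa>: "\<kappa> > 0"
    "\<And>\<delta> \<xi>. \<lbrakk>half_plane_patch D \<rho> \<delta>; \<xi> \<in> frontier D; \<xi> \<in> half_plane_patch.U D \<delta>\<rbrakk> \<Longrightarrow>
     norm (half_plane_patch.\<beta>r D \<delta> a \<xi>) \<le> norm (blaschke (half_plane_patch.U D \<delta>) a \<xi>) * exp (\<kappa> * Re (peak \<delta> \<xi>))"
    by (metis singletonI)
  have "\<exists>L. (g \<longlongrightarrow> L) (at_right 0)"
  proof (rule real_limit_exists)
    fix e :: real assume e: "e > 0"
    obtain \<delta> where dd: "\<delta> < e / (2 * \<kappa>)" "half_plane_patch D \<rho> \<delta>"
      using patch_exists[of "e / (2 * \<kappa>)"] e \<kappa> by auto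
    interpret half_plane_patch D \<rho> \<delta> by (rule dd)
    have \<kappa>\<delta>: "\<kappa> * \<delta> \<le> e / 2" using dd(1) \<kappa>(1) by (simp add: field_simps)
    have "\<forall>\<^sub>F s in at_right 0. dist (log_ratio a s / s) (patch_slope a) < e / 2"
      using log_ratio_tendsto[OF a] e by (intro tendstoD) auto
    then have "\<forall>\<^sub>F s in at_right 0. \<bar>g s - patch_slope a\<bar> \<le> e"
      using eventually_imag_axis[OF a]
    proof eventually_elim
      case (elim s)
      have sq: "- ln (norm (blaschke D a (\<i> * of_real s))) \<le> log_ratio a s"
        "log_ratio a s - \<kappa> * \<delta> * s \<le> - ln (norm (blaschke D a (\<i> * of_real s)))"
        using elim \<rho> \<kappa> dd(2) by (auto intro!: green_squeeze[OF a])
      have "g s \<le> log_ratio a s / s" unfolding g_def using elim sq by (intro divide_right_mono) auto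
      moreover have "(log_ratio a s - \<kappa> * \<delta> * s) / s \<le> g s" unfolding g_def using elim sq by (intro divide_right_mono) auto
      then have "log_ratio a s / s - \<kappa> * \<delta> \<le> g s" using elim by (simp add: diff_divide_distrib)
      moreover have "log_ratio a s / s - patch_slope a < e / 2" "patch_slope a - log_ratio a s / s < e / 2"
        using elim(1) unfolding dist_real_def by linarith+
      ultimately show ?case using \<kappa>\<delta> unfolding abs_le_iff by linarith
    qed
    then show "\<exists>m. \<forall>\<^sub>F s in at_right 0. \<bar>g s - m\<bar> \<le> e" by blast
  qed auto
  then obtain L where "(g \<longlongrightarrow> L) (at_right 0)" by blast
  moreover from this have "green_slope a = L"
    unfolding green_slope_def g_def by (intro tendsto_Lim) auto
  ultimately show ?thesis by (simp add: g_def)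
qed

text \<open>Hopf's lemma on the disc in \<open>D\<close> that touches the axis at 0. It is uniform
  in \<open>a\<close> because the moduli of the Blaschke factors at the centre \<open>p\<close> have
  a maximum \<open>r < 1\<close> over the compact \<open>Z\<close>.\<close>

lemma green_slope_lower:
  assumes Z: "compact Z" "Z \<subseteq> D"
  obtains c where "c > 0" "\<And>a. a \<in> Z \<Longrightarrow> c \<le> green_slope a"
proof (cases "Z = {}")
  case True then show thesis using that[of 1] by auto
next
  case False
  define p where "p = \<i> * of_real \<rho>"
  have p: "p \<in> D" unfolding p_def using \<rho> by (intro imag_in_D) auto
  have "continuous_on Z (\<lambda>a. norm (case (a, p) of (a, z) \<Rightarrow> blaschke D a z))"
    using Z p by (intro continuous_on_norm continuous_on_compose2[OF D.blaschke_continuous] continuous_intros) auto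
  from continuous_attains_sup[OF Z(1) False this] obtain a0 where a0: "a0 \<in> Z"
    "\<And>a. a \<in> Z \<Longrightarrow> norm (blaschke D a p) \<le> norm (blaschke D a0 p)" by auto
  define r where "r = norm (blaschke D a0 p)"
  have r: "r < 1" unfolding r_def using a0 Z p by (intro D.norm_blaschke) auto
  show thesis
  proof (rule that[of "(1 - r) / (8 * \<rho>)"])
    fix a assume a: "a \<in> Z"
    then have aD: "a \<in> D" using Z by auto
    define F where "F = (\<lambda>w. blaschke D a (p + of_real \<rho> * w))"
    have inD: "p + of_real \<rho> * w \<in> D" if "norm w < 1" for w
      using that \<rho> by (auto simp: p_def dist_norm norm_mult intro!: subsetD[OF \<rho>(2)])
    have F: "F holomorphic_on ball 0 1" unfolding F_def
      by (intro holomorphic_on_compose_gen[OF _ D.blaschke_holomorphic[OF aD], unfolded o_def] holomorphic_intros)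
         (use inD in auto)
    have F1: "norm (F w) < 1" if "norm w < 1" for w
      unfolding F_def by (rule D.norm_blaschke[OF aD inD[OF that]])
    have F0: "norm (F 0) \<le> r" using a0(2)[OF a] by (simp add: F_def r_def)
    have "\<forall>\<^sub>F s in at_right 0. (1 - r) / (8 * \<rho>) \<le> - ln (norm (blaschke D a (\<i> * of_real s))) / s"
      using eventually_imag_axis[OF aD]
    proof eventually_elim
      case (elim s)
      \<comment> \<open>The point of the unit disc that corresponds to \<open>\<i> s\<close> in the
        touching disc; its distance from the unit circle is \<open>s / \<rho>\<close>.\<close>
      define w where "w = - \<i> * of_real (1 - s / \<rho>)"
      have nw: "norm w = 1 - s / \<rho>" using elim \<rho> by (simp add: w_def norm_mult del: of_real_diff of_real_divide)
      have w: "p + of_real \<rho> * w = \<i> * of_real s"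
        using \<rho> by (simp add: p_def w_def algebra_simps)
      have nw1: "norm w < 1" using nw elim \<rho> by simp
      have "(1 - r) * (s / \<rho>) / 8 \<le> (1 - norm (F 0)) * (1 - norm w) / 8"
        using F0 nw elim \<rho> by (intro divide_right_mono mult_mono) (use F1[of 0] in auto)
      also have "\<dots> \<le> 1 - norm (F w)" by (rule schwarz_pick_boundary[OF F F1 nw1])
      also have "\<dots> \<le> - ln (norm (F w))"
      proof -
        have "F w \<noteq> 0" using D.blaschke_eq_0_iff[OF aD inD[OF nw1]] elim by (simp add: F_def w)
        then show ?thesis using ln_le_minus_one[of "norm (F w)"] by simp
      qed
      finally have "(1 - r) * (s / \<rho>) / 8 \<le> - ln (norm (blaschke D a (\<i> * of_real s)))" by (simp add: F_def w)
      then show ?case using elim \<rho> by (simp add: field_simps)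
    qed
    then show "(1 - r) / (8 * \<rho>) \<le> green_slope a"
      by (intro tendsto_lowerbound[OF green_slope_tendsto[OF aD]]) auto
  qed (use r \<rho> in auto)
qed

text \<open>Comparison with the half-plane gives
  \<open>log_ratio a s \<le> 2 s R / |\<i> s - a|^2\<close>. Since 0 is outside \<open>D\<close>,
  the poles have modulus at least \<open>\<eta>\<close>, so for \<open>s < \<eta> / 2\<close> the
  distance in the denominator is at least \<open>\<eta> / 2\<close>.\<close>

lemma green_slope_upper:
  assumes Z: "compact Z" "Z \<subseteq> D"
  obtains C where "\<And>a. a \<in> Z \<Longrightarrow> green_slope a \<le> C"
proof -
  obtain R \<eta> where R: "R > 0" "\<eta> > 0" "\<And>a. a \<in> Z \<Longrightarrow> Im a \<le> R" "\<And>a \<xi>. a \<in> Z \<Longrightarrow> \<xi> \<notin> D \<Longrightarrow> \<eta> \<le> norm (\<xi> - a)"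
    using pole_constants[OF Z] by metis
  obtain \<delta> where dd: "half_plane_patch D \<rho> \<delta>" using patch_exists[of 1] by auto
  interpret half_plane_patch D \<rho> \<delta> by (rule dd)
  show thesis
  proof (rule that[of "2 * R / (\<eta> / 2)\<^sup>2"])
    fix a assume a: "a \<in> Z"
    then have aD: "a \<in> D" using Z by auto
    have "norm a \<ge> \<eta>" using R(4)[OF a zero_notin_D] by simp
    have "\<forall>\<^sub>F s in at_right 0. s < \<eta> / 2" using R by (intro eventually_at_right_less[THEN eventually_mono] eventually_at_rightI[of 0 "\<eta> / 2"]) auto
    then have "\<forall>\<^sub>F s in at_right 0. - ln (norm (blaschke D a (\<i> * of_real s))) / s \<le> 2 * R / (\<eta> / 2)\<^sup>2"
      using eventually_imag_axis[OF aD]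
    proof eventually_elim
      case (elim s)
      define z where "z = \<i> * of_real s"
      have z: "z \<in> D" unfolding z_def using elim \<rho> by (intro imag_in_D) auto
      have ne: "z \<noteq> a" using elim by (simp add: z_def)
      have "norm (z - a) \<ge> \<eta> / 2"
        using norm_triangle_ineq3[of z a] \<open>norm a \<ge> \<eta>\<close> elim by (simp add: z_def norm_mult)
      have "norm (\<beta>r a z) \<le> norm (\<beta> a z) * exp (2 * Im z * Im a / (norm (z - a))\<^sup>2)"
        using D_sub_Up z ne by (intro \<beta>r_le_exp aD) auto
      then have "ln (norm (\<beta>r a z)) \<le> ln (norm (\<beta> a z) * exp (2 * Im z * Im a / (norm (z - a))\<^sup>2))"
        using \<beta>r_nonzero[OF aD, of z] \<beta>_nonzero[OF aD, of z] a_in[OF z] ne by (subst ln_le_cancel_iff) auto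
      then have "log_ratio a s \<le> 2 * Im z * Im a / (norm (z - a))\<^sup>2"
        using \<beta>_nonzero[OF aD, of z] a_in[OF z] ne by (simp add: log_ratio_def ln_mult z_def)
      also have "\<dots> \<le> 2 * s * R / (\<eta> / 2)\<^sup>2"
        using \<open>norm (z - a) \<ge> \<eta> / 2\<close> R(1,2) R(3)[OF a] elim a_in[OF aD] unfolding z_def
        by (intro frac_le mult_left_mono power_mono) auto
      finally have "- ln (norm (blaschke D a (\<i> * of_real s))) \<le> 2 * s * R / (\<eta> / 2)\<^sup>2"
        using green_squeeze(1)[OF aD, of s] elim \<rho> by simp
      then show ?case using elim by (simp add: field_simps)
    qed
    then show "green_slope a \<le> 2 * R / (\<eta> / 2)\<^sup>2"
      by (intro tendsto_upperbound[OF green_slope_tendsto[OF aD]]) auto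
  qed
qed

end

lemma (in half_plane_patch) patch_slope_bounds:
  assumes a: "a \<in> D"
  shows "green_slope a \<le> patch_slope a"
proof (rule tendsto_le[OF _ log_ratio_tendsto[OF a] green_slope_tendsto[OF a]])
  show "\<forall>\<^sub>F s in at_right 0. - ln (norm (blaschke D a (\<i> * of_real s))) / s \<le> log_ratio a s / s"
    using eventually_imag_axis[OF a]
  proof eventually_elim
    case (elim s)
    then show ?case using \<rho>(1) by (intro divide_right_mono green_squeeze(1)[OF a]) auto
  qed
qed auto

section \<open>The damped factors near the boundary of the enlarged domain\<close>

lemma prod_list_has_field_derivative:
  fixes F :: "complex \<Rightarrow> complex \<Rightarrow> complex"
  assumes "\<And>a. a \<in> set as \<Longrightarrow> (F a has_field_derivative l a * F a z) (at z)"
  shows "((\<lambda>z. \<Prod>a\<leftarrow>as. F a z) has_field_derivative (\<Sum>a\<leftarrow>as. l a) * (\<Prod>a\<leftarrow>as. F a z)) (at z)"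
  using assms
proof (induction as)
  case (Cons b as)
  have "((\<lambda>z. F b z * (\<Prod>a\<leftarrow>as. F a z)) has_field_derivative
     F b z * ((\<Sum>a\<leftarrow>as. l a) * (\<Prod>a\<leftarrow>as. F a z)) + l b * F b z * (\<Prod>a\<leftarrow>as. F a z)) (at z)"
    using Cons by (intro DERIV_mult') auto
  then show ?case by (simp add: algebra_simps)
qed simp

lemma norm_prod_list_le:
  fixes F :: "'a \<Rightarrow> complex"
  assumes "\<And>a. a \<in> set as \<Longrightarrow> norm (F a) \<le> q" "0 \<le> q"
  shows "norm (\<Prod>a\<leftarrow>as. F a) \<le> q ^ length as"
  using assms by (induction as) (auto simp: norm_mult intro!: mult_mono)

context half_plane_patch
begin

text \<open>The damping by the peaking function makes the modulus at most 1 on the frontier of \<open>D\<close>, at the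
  cost of a change of order \<open>\<delta>\<close> in the derivative at 0.\<close>

definition Fac :: "real \<Rightarrow> complex \<Rightarrow> complex \<Rightarrow> complex" where
  "Fac \<kappa> a z = \<beta>r a z / \<beta> a z * exp (- of_real \<kappa> * peak \<delta> z)"

definition Num :: "real \<Rightarrow> complex \<Rightarrow> complex \<Rightarrow> complex" where
  "Num \<kappa> a z = \<beta>r a z / blaschke_cofactor U a z * exp (- of_real \<kappa> * peak \<delta> z)"

lemma Num_eq: "\<lbrakk>a \<in> D; z \<in> U; z \<noteq> a\<rbrakk> \<Longrightarrow> Num \<kappa> a z / (z - a) = Fac \<kappa> a z"
  by (simp add: Num_def Fac_def U.blaschke_eq)

lemma norm_Fac: "norm (Fac \<kappa> a z) = norm (\<beta>r a z) / norm (\<beta> a z) * exp (- \<kappa> * Re (peak \<delta> z))"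
  by (simp add: Fac_def norm_mult norm_divide)

lemma Num_holomorphic:
  assumes "a \<in> D" "A \<subseteq> U" "\<And>z. z \<in> A \<Longrightarrow> Im z > - \<delta>"
  shows "Num \<kappa> a holomorphic_on A"
  unfolding Num_def[abs_def]
  using assms a_in[of a] U.blaschke_cofactor_nonzero[of a] upper_ne(1)[OF \<delta>(1)]
  by (intro holomorphic_intros peak_holomorphic holomorphic_on_subset[OF \<beta>r_holomorphic]
       holomorphic_on_subset[OF U.blaschke_cofactor_holomorphic]) auto

lemma Num_nonzero: "\<lbrakk>a \<in> D; z \<in> Up\<rbrakk> \<Longrightarrow> Num \<kappa> a z \<noteq> 0"
  using \<beta>r_nonzero[of a z] U.blaschke_cofactor_nonzero[of a z] a_in[of a] by (auto simp: Num_def Up_def)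

lemma Fac_zero: "a \<in> D \<Longrightarrow> norm (Fac \<kappa> a 0) = 1"
  using \<beta>_nonzero[of a 0] zero_in_U zero_notin_D
  by (auto simp: norm_Fac on_real_axis peak_def)

lemma \<beta>r_has_derivative:
  assumes "a \<in> D" "z \<in> U" "cnj z \<noteq> a"
  shows "(\<beta>r a has_field_derivative cnj (blaschke_logderiv U a (cnj z)) * \<beta>r a z) (at z)"
proof -
  have "(\<beta> a has_field_derivative blaschke_logderiv U a (cnj z) * \<beta> a (cnj z)) (at (cnj z))"
    using assms a_in[of a] cnj_U by (intro U.blaschke_has_derivative) auto
  from has_field_derivative_cnj_cnj[OF this] show ?thesis
    by (simp add: o_def \<beta>r_def[abs_def])
qed

lemma Fac_has_derivative_0:
  assumes a: "a \<in> D"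
  shows "(Fac \<kappa> a has_field_derivative (- \<i> * of_real (patch_slope a - \<kappa> * \<delta>)) * Fac \<kappa> a 0) (at 0)"
proof -
  define l where "l = blaschke_logderiv U a 0"
  have a0: "a \<noteq> 0" using zero_notin_D a by auto
  have nz: "\<beta> a 0 \<noteq> 0" using \<beta>_nonzero[OF a zero_in_U] a0 by simp
  have d1: "(\<beta> a has_field_derivative l * \<beta> a 0) (at 0)"
    unfolding l_def using U.blaschke_has_derivative[of a 0] a_in[OF a] zero_in_U a0 by simp
  have d2: "(\<beta>r a has_field_derivative cnj l * \<beta>r a 0) (at 0)"
    unfolding l_def using \<beta>r_has_derivative[OF a zero_in_U] a0 by auto
  have p: "\<i> * of_real (\<delta> ^ 3) / (0 + \<i> * of_real \<delta>)\<^sup>2 = - \<i> * of_real \<delta>"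
    using \<delta> by (simp add: power2_eq_square power3_eq_cube field_simps)
  have d3: "(peak \<delta> has_field_derivative - \<i> * of_real \<delta>) (at 0)"
    using peak_has_derivative[OF \<delta>(1), of 0] upper_ne(1)[OF \<delta>(1), of 0] \<delta>(1) p by simp
  have "(Fac \<kappa> a has_field_derivative (cnj l - l + \<i> * of_real (\<kappa> * \<delta>)) * Fac \<kappa> a 0) (at 0)"
  proof -
    have "((\<lambda>z. \<beta>r a z / \<beta> a z) has_field_derivative (cnj l - l) * (\<beta>r a 0 / \<beta> a 0)) (at 0)"
      by (rule DERIV_cong[OF DERIV_divide[OF d2 d1 nz]]) (use nz in \<open>simp add: field_simps\<close>)
    moreover have "((\<lambda>z. exp (- of_real \<kappa> * peak \<delta> z)) has_field_derivative
        exp (- of_real \<kappa> * peak \<delta> 0) * (- of_real \<kappa> * (- \<i> * of_real \<delta>))) (at 0)"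
      by (rule DERIV_chain2[OF DERIV_exp DERIV_cmult[OF d3]])
    ultimately show ?thesis unfolding Fac_def[abs_def]
      by (rule DERIV_cong[OF DERIV_mult]) (use nz in \<open>simp add: field_simps\<close>)
  qed
  moreover have "cnj l - l = - \<i> * of_real (patch_slope a)"
    by (simp add: complex_eq_iff patch_slope_def l_def)
  ultimately show ?thesis by (simp add: algebra_simps)
qed

text \<open>On the real axis
  \<open>ln |Fac \<kappa> a| = - \<kappa> Re (peak \<delta>) \<le> 0\<close>. Going down from there
  it decreases: at 0 the downward derivative is
  \<open>\<kappa> \<delta> - patch_slope a < 0\<close>, and compactness of \<open>Z\<close> keeps
  the sign on a small disc.\<close>

lemma Fac_less_below:
  assumes Z: "compact Z" "Z \<subseteq> D" and slope: "\<And>a. a \<in> Z \<Longrightarrow> \<kappa> * \<delta> < patch_slope a" and \<kappa>: "\<kappa> > 0"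
  obtains r where "0 < r" "r < \<delta>"
    "\<And>a z. \<lbrakk>a \<in> Z; norm z \<le> r; Im z < 0\<rbrakk> \<Longrightarrow> norm (Fac \<kappa> a z) < 1"
proof -
  obtain R \<eta> where R: "\<eta> > 0" "\<And>a \<xi>. a \<in> Z \<Longrightarrow> \<xi> \<notin> D \<Longrightarrow> \<eta> \<le> norm (\<xi> - a)"
    using pole_constants[OF Z] by metis
  define s where "s = min (\<delta> / 2) (\<eta> / 2)"
  have s: "0 < s" "s < \<delta>" "s < \<eta>" using \<delta> R by (auto simp: s_def)
  have sU: "z \<in> U" if "norm z \<le> s" for z
    using that s ball_subset_open_square square_sub_U by fastforce
  have away: "z \<noteq> a" if "norm z \<le> s" "a \<in> Z" for z a
    using R(2)[OF that(2) zero_notin_D] that s by auto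
  have aD: "a \<in> D" "a \<in> U" if "a \<in> Z" for a using that Z D_sub_U by auto
  have lower: "z + \<i> * of_real \<delta> \<noteq> 0" if "norm z \<le> s" for z
    using upper_ne(1)[OF \<delta>(1), of z] abs_Im_le_cmod[of z] that s by auto
  define pd where "pd = (\<lambda>z. \<i> * of_real (\<delta> ^ 3) / (z + \<i> * of_real \<delta>)\<^sup>2)"
  \<comment> \<open>\<open>G (a, z)\<close> is the derivative of \<open>ln |Fac \<kappa> a|\<close>
    at \<open>z\<close> in the downward direction.\<close>
  define G where "G = (\<lambda>(a, z). Re (\<i> * blaschke_logderiv U a (cnj z)) + Re (\<i> * blaschke_logderiv U a z) + \<kappa> * Re (\<i> * pd z))"
  have G: "continuous_on (Z \<times> cball 0 s) G"
  proof -
    have "Z \<times> cball 0 s \<subseteq> {(a, z). a \<in> U \<and> z \<in> U \<and> z \<noteq> a}"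
      using aD sU away by force
    from continuous_on_subset[OF U.blaschke_logderiv_continuous this]
    have *: "continuous_on (Z \<times> cball 0 s) (\<lambda>x. blaschke_logderiv U (fst x) (snd x))"
      by (simp add: case_prod_beta)
    have **: "continuous_on (Z \<times> cball 0 s) (\<lambda>x. blaschke_logderiv U (fst x) (cnj (snd x)))"
    proof -
      have c: "continuous_on (Z \<times> cball 0 s) (\<lambda>x. (fst x, cnj (snd x)))" by (intro continuous_intros)
      have "(\<lambda>x. (fst x, cnj (snd x))) ` (Z \<times> cball 0 s) \<subseteq> Z \<times> cball 0 s" by auto
      from continuous_on_compose2[OF * c this] show ?thesis by simp
    qed
    show ?thesis unfolding G_def case_prod_beta pd_def
      by (intro continuous_intros * **) (use lower in auto)
  qed
  have pd0: "pd 0 = - \<i> * of_real \<delta>"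
    unfolding pd_def using \<delta> by (simp add: power2_eq_square power3_eq_cube field_simps)
  have "G (a, 0) < 0" if "a \<in> Z" for a
    using slope[OF that] by (simp add: G_def pd0 patch_slope_def algebra_simps)
  from compact_nbhd_bound[OF Z(1) s(1) G this] obtain r p where r: "0 < r" "r \<le> s" "p < 0"
    "\<And>a z. a \<in> Z \<Longrightarrow> z \<in> cball 0 r \<Longrightarrow> G (a, z) \<le> p" by blast
  show thesis
  proof (rule that[of r])
    show "0 < r" "r < \<delta>" using r s by auto
    fix a z assume a: "a \<in> Z" and z: "norm z \<le> r" "Im z < 0"
    define x where "x = complex_of_real (Re z)"
    define h where "h = (\<lambda>t. ln (norm (\<beta> a (x + of_real t * \<i>))) - ln (norm (\<beta> a (x + of_real t * (-\<i>)))) - \<kappa> * Re (peak \<delta> (x + of_real t * (-\<i>))))"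
    have zx: "z = x + of_real (- Im z) * (-\<i>)" by (simp add: x_def complex_eq_iff)
    have small: "norm (x + of_real t * (-\<i>)) \<le> r" "norm (x + of_real t * \<i>) \<le> r" if "0 \<le> t" "t \<le> - Im z" for t
    proof -
      have "t\<^sup>2 \<le> (- Im z)\<^sup>2" using that by (intro power_mono) auto
      then have "(norm (x + of_real t * (-\<i>)))\<^sup>2 \<le> (norm z)\<^sup>2" "(norm (x + of_real t * \<i>))\<^sup>2 \<le> (norm z)\<^sup>2"
        unfolding cmod_power2 by (simp_all add: x_def)
      then show "norm (x + of_real t * (-\<i>)) \<le> r" "norm (x + of_real t * \<i>) \<le> r"
        using z by (meson norm_ge_zero order_trans power2_le_imp_le)+
    qed
    have "h (- Im z) < h 0"
    proof (rule DERIV_neg_imp_decreasing[where f = h and a = 0 and b = "- Im z"])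
      show "0 < - Im z" using z by simp
      fix t assume t: "0 \<le> t" "t \<le> - Im z"
      define z1 z2 where "z1 = x + of_real t * \<i>" and "z2 = x + of_real t * (-\<i>)"
      have n: "norm z1 \<le> r" "norm z2 \<le> r" using small[OF t] by (auto simp: z1_def z2_def)
      have cz: "cnj z2 = z1" by (simp add: z1_def z2_def x_def complex_eq_iff)
      have D1: "((\<lambda>t. ln (norm (\<beta> a (x + of_real t * \<i>)))) has_real_derivative Re (\<i> * blaschke_logderiv U a z1)) (at t)"
        using n r a aD[OF a] sU away \<beta>_nonzero unfolding z1_def
        by (intro has_real_derivative_ln_norm U.blaschke_has_derivative) auto
      have D2: "((\<lambda>t. ln (norm (\<beta> a (x + of_real t * (-\<i>))))) has_real_derivative Re (-\<i> * blaschke_logderiv U a z2)) (at t)"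
        using n r a aD[OF a] sU away \<beta>_nonzero unfolding z2_def
        by (intro has_real_derivative_ln_norm U.blaschke_has_derivative) auto
      have "((\<lambda>t. x + of_real t * (-\<i>)) has_vector_derivative -\<i>) (at t)"
        by (auto intro!: derivative_eq_intros)
      moreover have "(peak \<delta> has_field_derivative pd z2) (at z2)"
        using peak_has_derivative[OF \<delta>(1), of z2] lower[of z2] n r by (simp add: pd_def)
      ultimately have "((\<lambda>t. peak \<delta> (x + of_real t * (-\<i>))) has_vector_derivative -\<i> * pd z2) (at t)"
        using field_vector_diff_chain_at[of "\<lambda>t. x + of_real t * (-\<i>)" "-\<i>" t "peak \<delta>" "pd z2"] by (simp add: o_def z2_def)
      then have D3: "((\<lambda>t. Re (peak \<delta> (x + of_real t * (-\<i>)))) has_real_derivative Re (-\<i> * pd z2)) (at t)"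
        by (simp only: has_vector_derivative_complex_iff)
      have "(h has_real_derivative Re (\<i> * blaschke_logderiv U a z1) - Re (-\<i> * blaschke_logderiv U a z2) - \<kappa> * Re (-\<i> * pd z2)) (at t)"
        unfolding h_def by (intro DERIV_diff DERIV_cmult D1 D2 D3)
      moreover have "Re (\<i> * blaschke_logderiv U a z1) - Re (-\<i> * blaschke_logderiv U a z2) - \<kappa> * Re (-\<i> * pd z2) = G (a, z2)"
        by (simp add: G_def cz algebra_simps)
      moreover have "G (a, z2) < 0" using r(4)[OF a, of z2] r(3) n by simp
      ultimately show "\<exists>y. (h has_real_derivative y) (at t) \<and> y < 0" by metis
    qed
    also have "h 0 \<le> 0"
      using peak_nonneg[OF \<delta>(1), of x] \<kappa> by (simp add: h_def x_def)
    finally have lt: "h (- Im z) < 0" .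
    have cz: "cnj z = x + of_real (- Im z) * \<i>" by (simp add: x_def complex_eq_iff)
    have nz: "\<beta> a z \<noteq> 0" "\<beta>r a z \<noteq> 0"
      using \<beta>_nonzero[of a z] \<beta>_nonzero[of a "cnj z"] aD[OF a] sU[of z] sU[of "cnj z"] away[of z a] away[of "cnj z" a] z r a
      by (auto simp: \<beta>r_def)
    have "ln (norm (Fac \<kappa> a z)) = ln (norm (\<beta>r a z)) - ln (norm (\<beta> a z)) - \<kappa> * Re (peak \<delta> z)"
      using nz by (simp add: norm_Fac ln_mult ln_div)
    also have "\<dots> = h (- Im z)"
      unfolding h_def zx[symmetric] cz[symmetric] norm_\<beta>r ..
    finally have "ln (norm (Fac \<kappa> a z)) < 0" using lt by simp
    moreover have "norm (Fac \<kappa> a z) > 0" using nz by (simp add: Fac_def)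
    ultimately show "norm (Fac \<kappa> a z) < 1" by simp
  qed
qed

text \<open>The point 0 has to be interior, so that the derivative of the holomorphic remainder at 0
  can be estimated. Below the axis only a small disc is added, since \<open>|Fac| < 1\<close> is
  established only there.\<close>

definition Omega :: "real \<Rightarrow> complex set" where "Omega r = Up \<union> ball 0 r"

lemma Omega_props:
  assumes r: "0 < r" "r < \<delta>"
  shows "simply_connected_domain (Omega r)" "Omega r \<subseteq> U" "\<And>z. z \<in> Omega r \<Longrightarrow> Im z > - r" "Up \<subseteq> Omega r" "0 \<in> Omega r"
proof -
  have bs: "ball 0 r \<subseteq> open_square \<delta>" using r ball_subset_open_square by fastforce
  show sub: "Omega r \<subseteq> U" using bs square_sub_U by (auto simp: Omega_def Up_def)
  show "Up \<subseteq> Omega r" "0 \<in> Omega r" using r by (auto simp: Omega_def)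
  show "Im z > - r" if "z \<in> Omega r" for z
    using that r abs_Im_le_cmod[of z] by (auto simp: Omega_def Up_def)
  have H: "convex {z. Im z > 0}" "open {z. Im z > 0}" by (simp_all add: convex_halfspace_Im_gt open_halfspace_Im_gt)
  have Up_eq: "Up = D \<union> (open_square \<delta> \<inter> {z. Im z > 0})"
    using D_upper by (auto simp: Up_def U_def) force
  have D_int: "D \<inter> (open_square \<delta> \<inter> {z. Im z > 0}) = D \<inter> open_square \<delta>" using D_upper by auto
  have scUp: "simply_connected Up" unfolding Up_eq
    using H D_Int_square_ne \<delta>(2) D_int
    by (intro simply_connected_Un_open open_D simply_D open_Int open_open_square convex_imp_simply_connected
        convex_Int convex_open_square) auto
  have int: "Up \<inter> ball 0 r = ball 0 r \<inter> {z. Im z > 0}" using bs square_sub_U by (auto simp: Up_def)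
  have "\<i> * of_real (r / 2) \<in> ball 0 r \<inter> {z. Im z > 0}" using r by (simp add: norm_mult)
  then have ne: "Up \<inter> ball 0 r \<noteq> {}" unfolding int by blast
  have "connected (Up \<inter> ball 0 r)" unfolding int using H by (intro convex_connected convex_Int) auto
  then have "simply_connected (Omega r)" unfolding Omega_def
    using ne by (intro simply_connected_Un_open open_Up scUp convex_imp_simply_connected convex_ball open_ball)
  then show "simply_connected_domain (Omega r)"
    using open_Up r bounded_subset[OF U.bounded_S sub] by unfold_locales (auto simp: Omega_def)
qed

text \<open>A frontier point inside \<open>U\<close> is either below the axis, where
  \<open>below\<close> applies, or real and non-zero, where \<open>\<beta>r a / \<beta> a\<close> is
  unimodular and the damping is strict. At a frontier point of \<open>U\<close>,
  \<open>|\<beta> a|\<close> tends to 1 uniformly over \<open>Z\<close>, and the damping wins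
  again.\<close>

lemma Fac_frontier_Omega:
  assumes Z: "compact Z" "Z \<subseteq> D" and \<kappa>: "\<kappa> > 0" and r: "0 < r" "r < \<delta>"
    and below: "\<And>a z. \<lbrakk>a \<in> Z; norm z \<le> r; Im z < 0\<rbrakk> \<Longrightarrow> norm (Fac \<kappa> a z) < 1"
    and \<xi>: "\<xi> \<in> frontier (Omega r)"
  shows "\<exists>d q. 0 < d \<and> 0 \<le> q \<and> q < 1 \<and> (\<forall>a\<in>Z. \<forall>z\<in>Omega r. dist z \<xi> < d \<longrightarrow> norm (Fac \<kappa> a z) \<le> q)"
proof -
  interpret O: simply_connected_domain "Omega r" by (rule Omega_props(1)[OF r])
  have notin: "\<xi> \<notin> Omega r" using \<xi> O.open_S by (auto simp: frontier_def interior_open)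
  then have \<xi>0: "\<xi> \<noteq> 0" "norm \<xi> \<ge> r" using r by (auto simp: Omega_def)
  have "closure Up \<subseteq> {z. Im z \<ge> 0}"
    by (intro closure_minimal closed_halfspace_Im_ge) (auto simp: Up_def intro: less_imp_le)
  moreover have "\<xi> \<in> closure Up \<union> closure (ball 0 r)"
    using \<xi> by (auto simp: frontier_def Omega_def)
  ultimately have cases: "Im \<xi> \<ge> 0 \<or> norm \<xi> \<le> r" using r by auto
  have aD: "a \<in> D" "a \<in> U" if "a \<in> Z" for a using that Z D_sub_U by auto
  show ?thesis
  proof (cases "\<xi> \<in> U")
    case True
    have lt: "norm (Fac \<kappa> a \<xi>) < 1" if a: "a \<in> Z" for a
    proof (cases "Im \<xi> < 0")
      case True
      then show ?thesis using below[OF a, of \<xi>] cases by auto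
    next
      case False
      then have "Im \<xi> = 0" using True notin by (auto simp: Omega_def Up_def)
      then have "norm (\<beta>r a \<xi>) = norm (\<beta> a \<xi>)" by (rule on_real_axis)
      moreover have "Re (peak \<delta> \<xi>) > 0" using \<open>Im \<xi> = 0\<close> \<xi>0 by (intro peak_pos \<delta>) auto
      ultimately show ?thesis using \<kappa> by (cases "\<beta> a \<xi> = 0") (simp_all add: norm_Fac)
    qed
    have "Im \<xi> > - \<delta>" using cases abs_Im_le_cmod[of \<xi>] r \<delta>(1) by auto
    then have "\<xi> \<in> U \<inter> {z. Im z > - \<delta>} \<inter> (- Z)"
      using True notin Omega_props(4)[OF r] D_sub_Up Z by auto
    moreover have "open (U \<inter> {z. Im z > - \<delta>} \<inter> (- Z))"
      using U.open_S Z compact_imp_closed by (intro open_Int open_halfspace_Im_gt) auto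
    ultimately obtain s where s: "s > 0" "cball \<xi> s \<subseteq> U \<inter> {z. Im z > - \<delta>} \<inter> (- Z)"
      by (metis open_contains_cball)
    have cont: "continuous_on (Z \<times> cball \<xi> s) (\<lambda>(a, z). norm (Fac \<kappa> a z))"
    proof -
      have sub: "Z \<times> cball \<xi> s \<subseteq> U \<times> U" "(\<lambda>x. (fst x, cnj (snd x))) ` (Z \<times> cball \<xi> s) \<subseteq> U \<times> U"
      proof -
        have "z \<in> U" if "z \<in> cball \<xi> s" for z using subsetD[OF s(2) that] by simp
        then show "Z \<times> cball \<xi> s \<subseteq> U \<times> U" "(\<lambda>x. (fst x, cnj (snd x))) ` (Z \<times> cball \<xi> s) \<subseteq> U \<times> U"
          using aD(2) cnj_U by (auto simp del: mem_cball)
      qed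
      have *: "continuous_on (Z \<times> cball \<xi> s) (\<lambda>x. blaschke U (fst x) (snd x))"
        using continuous_on_subset[OF U.blaschke_continuous sub(1)] by (simp add: case_prod_beta)
      have **: "continuous_on (Z \<times> cball \<xi> s) (\<lambda>x. blaschke U (fst x) (cnj (snd x)))"
        using continuous_on_compose2[OF U.blaschke_continuous _ sub(2)]
        by (simp add: case_prod_beta continuous_intros)
      have nz: "\<beta> (fst x) (snd x) \<noteq> 0" if "x \<in> Z \<times> cball \<xi> s" for x
      proof -
        have "fst x \<in> Z" "snd x \<in> U" "snd x \<notin> Z" using that subsetD[OF s(2), of "snd x"] by auto
        then show ?thesis using \<beta>_nonzero[of "fst x" "snd x"] aD(1)[of "fst x"] by metis
      qed
      have pk: "continuous_on (Z \<times> cball \<xi> s) (\<lambda>x. peak \<delta> (snd x))"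
        unfolding peak_def using upper_ne(1)[OF \<delta>(1)] subsetD[OF s(2)] by (intro continuous_intros) fastforce
      show ?thesis unfolding Fac_def case_prod_beta \<beta>r_def
        by (intro continuous_intros * ** pk) (use nz in auto)
    qed
    have "(case (a, \<xi>) of (a, z) \<Rightarrow> norm (Fac \<kappa> a z)) < 1" if "a \<in> Z" for a using lt[OF that] by simp
    from compact_nbhd_bound[OF Z(1) s(1) cont this] obtain d p where d: "0 < d" "p < 1"
      "\<And>a z. a \<in> Z \<Longrightarrow> z \<in> cball \<xi> d \<Longrightarrow> norm (Fac \<kappa> a z) \<le> p" by auto
    have "norm (Fac \<kappa> a z) \<le> max p 0" if "a \<in> Z" "z \<in> Omega r" "dist z \<xi> < d" for a z
      using d(3)[OF that(1), of z] that by (auto simp: dist_commute)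
    then show ?thesis using d(1,2) by (intro exI[of _ d] exI[of _ "max p 0"]) auto
  next
    case False
    have "\<xi> \<in> frontier U"
      using False \<xi> closure_mono[OF Omega_props(2)[OF r]] U.open_S by (auto simp: frontier_def interior_open)
    have "cball 0 r \<subseteq> U" using r ball_subset_open_square square_sub_U by fastforce
    then have "norm \<xi> > r" using False by (metis linorder_not_le mem_cball_0 subsetD)
    then have Im: "Im \<xi> \<ge> 0" using cases by auto
    define V where "V = Re (peak \<delta> \<xi>)"
    have V: "V > 0" unfolding V_def by (rule peak_pos[OF \<delta>(1) Im \<xi>0(1)])
    \<comment> \<open>Near \<open>\<xi>\<close> the damping is at most \<open>p\<close>, while
      \<open>|\<beta>r a / \<beta> a|\<close> is allowed to grow up to \<open>1 / sqrt p\<close>;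
      the product stays below \<open>sqrt p < 1\<close>.\<close>
    define p where "p = exp (- \<kappa> * (V / 2))"
    have p: "0 < p" "p < 1" using \<kappa> V by (auto simp: p_def)
    have "isCont (peak \<delta>) \<xi>"
      using peak_has_derivative[OF \<delta>(1), of \<xi>] upper_ne(1)[OF \<delta>(1), of \<xi>] Im \<delta>(1) by (auto intro: DERIV_isCont)
    then have "isCont (\<lambda>z. Re (peak \<delta> z)) \<xi>" by (rule isCont_Re)
    then obtain d1 where d1: "d1 > 0" "\<And>z. dist z \<xi> < d1 \<Longrightarrow> dist (Re (peak \<delta> z)) V < V / 2"
      using V half_gt_zero[OF V] unfolding V_def[symmetric] continuous_at_eps_delta by blast
    have "1 - sqrt p > 0" using p by simp
    have ZU: "Z \<subseteq> U" using aD by blast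
    from U.blaschke_frontier[OF Z(1) ZU \<open>1 - sqrt p > 0\<close> \<open>\<xi> \<in> frontier U\<close>] obtain d2 where d2: "d2 > 0"
      "\<And>a z. \<lbrakk>a \<in> Z; z \<in> U; dist z \<xi> < d2\<rbrakk> \<Longrightarrow> norm (\<beta> a z) > sqrt p" by auto
    have "norm (Fac \<kappa> a z) \<le> sqrt p" if z: "a \<in> Z" "z \<in> Omega r" "dist z \<xi> < min d1 d2" for a z
    proof -
      have zU: "z \<in> U" using z Omega_props(2)[OF r] by auto
      have "dist (Re (peak \<delta> z)) V < V / 2" using d1(2)[of z] z by simp
      then have "Re (peak \<delta> z) \<ge> V / 2" unfolding dist_real_def by linarith
      then have "exp (- \<kappa> * Re (peak \<delta> z)) \<le> p" unfolding p_def using \<kappa> by simp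
      moreover have "norm (\<beta>r a z) / norm (\<beta> a z) \<le> 1 / sqrt p"
        using norm_\<beta>r_less[OF aD(1)[OF z(1)] zU] d2(2)[OF z(1) zU] z p by (intro frac_le) auto
      ultimately have "norm (Fac \<kappa> a z) \<le> 1 / sqrt p * p"
        unfolding norm_Fac using p by (intro mult_mono) auto
      also have "\<dots> = sqrt p" using p by (simp add: real_div_sqrt)
      finally show ?thesis .
    qed
    then show ?thesis using d1(1) d2(1) p by (intro exI[of _ "min d1 d2"] exI[of _ "sqrt p"]) auto
  qed
qed

lemma Fac_near_frontier:
  assumes Z: "compact Z" "Z \<subseteq> D" and \<kappa>: "\<kappa> > 0" and r: "0 < r" "r < \<delta>"
    and below: "\<And>a z. \<lbrakk>a \<in> Z; norm z \<le> r; Im z < 0\<rbrakk> \<Longrightarrow> norm (Fac \<kappa> a z) < 1"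
  obtains K q where "compact K" "K \<subseteq> Omega r" "0 \<le> q" "q < 1"
    "\<And>a z. \<lbrakk>a \<in> Z; z \<in> Omega r - K\<rbrakk> \<Longrightarrow> norm (Fac \<kappa> a z) \<le> q"
proof -
  interpret O: simply_connected_domain "Omega r" by (rule Omega_props(1)[OF r])
  have "\<forall>\<xi>\<in>frontier (Omega r). \<exists>d q. 0 < d \<and> 0 \<le> q \<and> q < 1 \<and> (\<forall>a\<in>Z. \<forall>z\<in>Omega r. dist z \<xi> < d \<longrightarrow> norm (Fac \<kappa> a z) \<le> q)"
    using Fac_frontier_Omega[OF Z \<kappa> r below] by blast
  then obtain d q where dq: "\<And>\<xi>. \<xi> \<in> frontier (Omega r) \<Longrightarrow> 0 < d \<xi> \<and> 0 \<le> q \<xi> \<and> q \<xi> < 1 \<and>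
     (\<forall>a\<in>Z. \<forall>z\<in>Omega r. dist z \<xi> < d \<xi> \<longrightarrow> norm (Fac \<kappa> a z) \<le> q \<xi>)" by metis
  have "compact (frontier (Omega r))" using O.bounded_S compact_frontier_bounded by blast
  moreover have "frontier (Omega r) \<subseteq> (\<Union>\<xi>\<in>frontier (Omega r). ball \<xi> (d \<xi>))" using dq by force
  ultimately obtain T where T: "T \<subseteq> frontier (Omega r)" "finite T" "frontier (Omega r) \<subseteq> (\<Union>\<xi>\<in>T. ball \<xi> (d \<xi>))"
    using compactE_image[of "frontier (Omega r)" "frontier (Omega r)" "\<lambda>\<xi>. ball \<xi> (d \<xi>)"] by auto
  define K where "K = closure (Omega r) - (\<Union>\<xi>\<in>T. ball \<xi> (d \<xi>))"
  define Q where "Q = Max (insert 0 (q ` T))"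
  show thesis
  proof (rule that[of K Q])
    show "compact K" unfolding K_def using O.bounded_S by (intro compact_diff) auto
    show "K \<subseteq> Omega r" using T(3) O.open_S by (auto simp: K_def frontier_def interior_open)
    show "0 \<le> Q" unfolding Q_def using T(2) by (intro Max_ge) auto
    show "Q < 1" unfolding Q_def using T(1,2) dq by auto
    fix a z assume a: "a \<in> Z" and z: "z \<in> Omega r - K"
    then have "z \<in> (\<Union>\<xi>\<in>T. ball \<xi> (d \<xi>))" using closure_subset by (auto simp: K_def)
    then obtain \<xi> where \<xi>: "\<xi> \<in> T" "dist z \<xi> < d \<xi>" by (auto simp: dist_commute)
    then have "norm (Fac \<kappa> a z) \<le> q \<xi>" using dq[of \<xi>] T(1) a z by auto
    also have "q \<xi> \<le> Q" unfolding Q_def using T(2) \<xi> by (intro Max_ge) auto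
    finally show "norm (Fac \<kappa> a z) \<le> Q" .
  qed
qed

end

text \<open>The order of choices matters: \<open>\<kappa>\<close> and \<open>c\<close> come from
  \<open>Z\<close> alone, then \<open>\<delta>\<close> makes
  \<open>\<kappa> \<delta> < e c / 2\<close>, and only then \<open>r\<close>, \<open>K\<close>,
  \<open>q\<close>, \<open>C\<close> and the number of factors follow. The derivative loses
  \<open>\<kappa> \<delta>\<close> per factor and at most \<open>e c / 2\<close> from the remainder;
  as the sum of the slopes is at least \<open>c\<close> times the number of factors, each loss is at
  most the fraction \<open>e / 2\<close> of it.\<close>

theorem (in half_plane_domain) near_extremal_principal_parts:
  assumes Z: "compact Z" "Z \<subseteq> D" and \<epsilon>: "\<epsilon> > 0"
  obtains m0 :: nat where "\<And>as. \<lbrakk>set as \<subseteq> Z; length as \<ge> m0\<rbrakk> \<Longrightarrow>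
    \<exists>L. degree L \<le> length as - 1 \<and> (\<forall>a\<in>set as. poly L a \<noteq> 0) \<and>
      (\<forall>\<xi>\<in>frontier D. norm (poly L \<xi> / poly (root_poly as) \<xi>) \<le> 1 + \<epsilon>) \<and>
      (1 - \<epsilon>) * (\<Sum>a\<leftarrow>as. green_slope a) \<le> norm (deriv (\<lambda>z. poly L z / poly (root_poly as) z) 0)"
proof -
  obtain \<kappa> where \<kappa>: "\<kappa> > 0" "\<And>\<delta> a \<xi>. \<lbrakk>half_plane_patch D \<rho> \<delta>; a \<in> Z; \<xi> \<in> frontier D; \<xi> \<in> half_plane_patch.U D \<delta>\<rbrakk> \<Longrightarrow>
     norm (half_plane_patch.\<beta>r D \<delta> a \<xi>) \<le> norm (blaschke (half_plane_patch.U D \<delta>) a \<xi>) * exp (\<kappa> * Re (peak \<delta> \<xi>))"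
    using frontier_bound[OF Z] by metis
  obtain c where c: "c > 0" "\<And>a. a \<in> Z \<Longrightarrow> c \<le> green_slope a" using green_slope_lower[OF Z] by metis
  define e where "e = min \<epsilon> 1"
  have e: "e > 0" "e \<le> 1" "e \<le> \<epsilon>" using \<epsilon> by (auto simp: e_def)
  obtain \<delta> where dd: "\<delta> < e * c / (2 * \<kappa>)" "half_plane_patch D \<rho> \<delta>"
    using patch_exists[of "e * c / (2 * \<kappa>)"] e c \<kappa> by auto
  interpret half_plane_patch D \<rho> \<delta> by (rule dd)
  have \<kappa>\<delta>: "\<kappa> * \<delta> < e / 2 * c" using dd(1) \<kappa>(1) by (simp add: field_simps)
  have "e / 2 * c \<le> 1 * c" using e c by (intro mult_right_mono) auto
  then have slope: "\<kappa> * \<delta> < patch_slope a" if "a \<in> Z" for a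
    using \<kappa>\<delta> c(2)[OF that] patch_slope_bounds[of a] that Z by fastforce
  obtain r where r: "0 < r" "r < \<delta>" "\<And>a z. \<lbrakk>a \<in> Z; norm z \<le> r; Im z < 0\<rbrakk> \<Longrightarrow> norm (Fac \<kappa> a z) < 1"
    using Fac_less_below[OF Z slope \<kappa>(1)] by metis
  obtain K q where K: "compact K" "K \<subseteq> Omega r" "0 \<le> q" "q < 1"
    "\<And>a z. \<lbrakk>a \<in> Z; z \<in> Omega r - K\<rbrakk> \<Longrightarrow> norm (Fac \<kappa> a z) \<le> q"
    using Fac_near_frontier[OF Z \<kappa>(1) r(1,2)] r(3) by metis
  interpret O: simply_connected_domain "Omega r" by (rule Omega_props(1)[OF r(1,2)])
  interpret O: disc_chart "Omega r" O.riemann_inv "riemann_map (Omega r)" by (rule O.disc_chart)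
  have ZO: "Z \<subseteq> Omega r" using Z D_sub_Up Omega_props(4)[OF r(1,2)] by auto
  \<comment> \<open>\<open>Z\<close> is included because it contains the interpolation points, and 0
    so that the neighbourhood \<open>W\<close> on which the remainder is small contains 0.\<close>
  define K' where "K' = insert 0 (K \<union> Z)"
  have K': "compact K'" "K' \<subseteq> Omega r"
    using K Z ZO Omega_props(5)[OF r(1,2)] by (auto simp: K'_def intro!: compact_insert compact_Un)
  obtain C W where C: "C > 0" and W: "open W" "K' \<subseteq> W" "W \<subseteq> Omega r"
    and split: "\<And>H as d. \<lbrakk>H holomorphic_on Omega r; set as \<subseteq> K'; \<And>z. z \<in> Omega r - K' \<Longrightarrow> norm (H z / poly (root_poly as) z) \<le> d\<rbrakk> \<Longrightarrow>
      \<exists>L h. degree L \<le> length as - 1 \<and> h holomorphic_on Omega r \<and>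
          (\<forall>z\<in>Omega r. H z = poly L z + poly (root_poly as) z * h z) \<and>
          (\<forall>z\<in>W. norm (h z) \<le> C * d) \<and>
          (\<forall>z. z \<notin> W \<longrightarrow> norm (poly L z / poly (root_poly as) z) \<le> C * d)"
    using O.splitting_bound[OF K'] by metis
  have "0 \<in> W" using W by (auto simp: K'_def)
  then obtain s where s: "s > 0" "cball 0 s \<subseteq> W" using W(1) open_contains_cball by blast
  \<comment> \<open>The bound \<open>e\<close> serves for the values on the frontier;
    \<open>e / 2 * c * s\<close> makes Cauchy's estimate on a disc of radius \<open>s\<close> bound
    the derivative of the remainder by \<open>e / 2 * c\<close>.\<close>
  define E where "E = min e (e / 2 * c * s)"
  have E: "E > 0" using e c s by (auto simp: E_def)
  have "(\<lambda>n. C * q ^ n) \<longlonglongrightarrow> C * 0" using K by (intro tendsto_intros LIMSEQ_power_zero) auto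
  then have "\<forall>\<^sub>F n in sequentially. C * q ^ n < E" using E by (intro order_tendstoD(2)) auto
  then obtain m0 where m0: "\<And>n. n \<ge> m0 \<Longrightarrow> C * q ^ n < E" by (auto simp: eventually_sequentially)
  show thesis
  \<comment> \<open>At least one factor is needed, so that the sum of the slopes is at least
    \<open>c\<close> and absorbs the derivative of the remainder.\<close>
  proof (rule that[of "max 1 m0"])
    fix as assume as: "set as \<subseteq> Z" and len: "length as \<ge> max 1 m0"
    have asD: "a \<in> D" if "a \<in> set as" for a using that as Z by auto
    define H where "H = (\<lambda>z. \<Prod>a\<leftarrow>as. Num \<kappa> a z)"
    have HF: "H z / poly (root_poly as) z = (\<Prod>a\<leftarrow>as. Fac \<kappa> a z)" if "z \<in> U" "z \<notin> set as" for z
    proof -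
      have "(\<Prod>a\<leftarrow>bs. Num \<kappa> a z) / (\<Prod>a\<leftarrow>bs. z - a) = (\<Prod>a\<leftarrow>bs. Fac \<kappa> a z)" if "set bs \<subseteq> set as" for bs
        using that
      proof (induction bs)
        case (Cons b bs)
        have "Num \<kappa> b z / (z - b) = Fac \<kappa> b z" using Cons \<open>z \<in> U\<close> \<open>z \<notin> set as\<close> asD by (intro Num_eq) auto
        then show ?case using Cons by (simp flip: times_divide_times_eq)
      qed simp
      then show ?thesis by (simp add: H_def poly_root_poly)
    qed
    have Hol: "H holomorphic_on Omega r"
    proof -
      have "(\<lambda>z. \<Prod>a\<leftarrow>bs. Num \<kappa> a z) holomorphic_on Omega r" if "set bs \<subseteq> set as" for bs
        using that
      proof (induction bs)
        case (Cons b bs)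
        have "Im z > - \<delta>" if "z \<in> Omega r" for z
          using Omega_props(3)[OF r(1,2) that] r(2) by linarith
        then have "Num \<kappa> b holomorphic_on Omega r"
          using Cons.prems asD Omega_props(2)[OF r(1,2)] by (intro Num_holomorphic) auto
        then show ?case using Cons by (auto intro!: holomorphic_on_mult)
      qed auto
      then show ?thesis by (simp add: H_def)
    qed
    have bd: "norm (H z / poly (root_poly as) z) \<le> q ^ length as" if z: "z \<in> Omega r - K'" for z
    proof -
      have zz: "z \<in> U" "z \<notin> set as" using z as Omega_props(2)[OF r(1,2)] by (auto simp: K'_def)
      show ?thesis unfolding HF[OF zz] using K(3) z as by (intro norm_prod_list_le K(5)) (auto simp: K'_def)
    qed
    obtain L h where L: "degree L \<le> length as - 1" and h: "h holomorphic_on Omega r"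
      and eq: "\<And>z. z \<in> Omega r \<Longrightarrow> H z = poly L z + poly (root_poly as) z * h z"
      and hW: "\<And>z. z \<in> W \<Longrightarrow> norm (h z) \<le> C * q ^ length as"
      and LW: "\<And>z. z \<notin> W \<Longrightarrow> norm (poly L z / poly (root_poly as) z) \<le> C * q ^ length as"
      using split[OF Hol _ bd] as by (auto simp: K'_def) blast
    have small: "C * q ^ length as < E" using m0 len by simp
    have LF: "poly L z / poly (root_poly as) z = (\<Prod>a\<leftarrow>as. Fac \<kappa> a z) - h z" if "z \<in> Omega r" "z \<notin> set as" for z
    proof -
      have "H z / poly (root_poly as) z = poly L z / poly (root_poly as) z + h z"
        unfolding eq[OF that(1)] using that by (simp add: add_divide_distrib)
      moreover have "z \<in> U" using that Omega_props(2)[OF r(1,2)] by auto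
      ultimately show ?thesis using HF[of z] that(2) by (simp add: eq_diff_eq)
    qed
    \<comment> \<open>At a listed point the interpolant equals \<open>H\<close>, a product of
      numerators that do not vanish there; so no pole order is lost.\<close>
    have 1: "\<forall>a\<in>set as. poly L a \<noteq> 0"
    proof
      fix a assume a: "a \<in> set as"
      have "Num \<kappa> a' a \<noteq> 0" if "a' \<in> set as" for a'
        using Num_nonzero[OF asD[OF that], of a] asD[OF a] D_sub_Up by auto
      then have "H a \<noteq> 0" unfolding H_def by (auto simp: prod_list_zero_iff)
      then show "poly L a \<noteq> 0" using eq[of a] a as ZO by auto
    qed
    \<comment> \<open>On \<open>W\<close> the principal part is the product of factors, of modulus
      at most 1 on \<open>frontier D\<close>, minus the small remainder; off \<open>W\<close> the
      principal part itself is small.\<close>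
    have 2: "norm (poly L \<xi> / poly (root_poly as) \<xi>) \<le> 1 + \<epsilon>" if \<xi>: "\<xi> \<in> frontier D" for \<xi>
    proof (cases "\<xi> \<in> W")
      case True
      then have \<xi>U: "\<xi> \<in> Omega r" "\<xi> \<in> U" using W Omega_props(2)[OF r(1,2)] by auto
      have ns: "\<xi> \<notin> set as" using asD frontier_D_notin[OF \<xi>] by auto
      have "norm (Fac \<kappa> a \<xi>) \<le> 1" if "a \<in> set as" for a
      proof -
        have "norm (\<beta>r a \<xi>) \<le> norm (\<beta> a \<xi>) * exp (\<kappa> * Re (peak \<delta> \<xi>))"
          using \<kappa>(2)[OF dd(2) _ \<xi>, of a] \<xi>U that as by auto
        moreover have "\<beta> a \<xi> \<noteq> 0" using \<beta>_nonzero[OF asD[OF that] \<xi>U(2)] ns that by auto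
        ultimately show ?thesis by (simp add: norm_Fac exp_minus field_simps)
      qed
      then have "norm (\<Prod>a\<leftarrow>as. Fac \<kappa> a \<xi>) \<le> 1 ^ length as" by (intro norm_prod_list_le) auto
      moreover have "norm (h \<xi>) \<le> \<epsilon>" using hW[OF True] small e by (auto simp: E_def)
      ultimately show ?thesis unfolding LF[OF \<xi>U(1) ns]
        using norm_triangle_ineq4[of "\<Prod>a\<leftarrow>as. Fac \<kappa> a \<xi>" "h \<xi>"] by simp
    next
      case False
      then show ?thesis using LW[OF False] small e by (auto simp: E_def)
    qed
    have 3: "(1 - \<epsilon>) * (\<Sum>a\<leftarrow>as. green_slope a) \<le> norm (deriv (\<lambda>z. poly L z / poly (root_poly as) z) 0)"
    proof -
      have 0: "0 \<in> Omega r - set as" using Omega_props(5)[OF r(1,2)] asD zero_notin_D by auto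
      define P where "P = (\<Prod>a\<leftarrow>as. Fac \<kappa> a 0)"
      define S where "S = (\<Sum>a\<leftarrow>as. patch_slope a - \<kappa> * \<delta>)"
      have nP: "norm P = 1"
      proof -
        have "norm (\<Prod>a\<leftarrow>bs. Fac \<kappa> a 0) = 1" if "set bs \<subseteq> D" for bs
          using that by (induction bs) (auto simp: norm_mult Fac_zero)
        then show ?thesis using asD by (auto simp: P_def)
      qed
      have "((\<lambda>z. \<Prod>a\<leftarrow>as. Fac \<kappa> a z) has_field_derivative (\<Sum>a\<leftarrow>as. - \<i> * of_real (patch_slope a - \<kappa> * \<delta>)) * P) (at 0)"
        unfolding P_def by (intro prod_list_has_field_derivative Fac_has_derivative_0 asD)
      moreover have "(\<Sum>a\<leftarrow>bs. - \<i> * of_real (patch_slope a - \<kappa> * \<delta>)) = - \<i> * of_real (\<Sum>a\<leftarrow>bs. patch_slope a - \<kappa> * \<delta>)" for bs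
        by (induction bs) (auto simp: algebra_simps)
      ultimately have dF: "((\<lambda>z. \<Prod>a\<leftarrow>as. Fac \<kappa> a z) has_field_derivative - \<i> * of_real S * P) (at 0)"
        by (simp add: S_def)
      have dh: "(h has_field_derivative deriv h 0) (at 0)"
        using h O.open_S 0 holomorphic_derivI by blast
      have "((\<lambda>z. poly L z / poly (root_poly as) z) has_field_derivative - \<i> * of_real S * P - deriv h 0) (at 0)"
      proof (rule has_field_derivative_transform_within_open[OF DERIV_diff[OF dF dh]])
        show "open (Omega r - set as)" using O.open_S by (intro open_Diff finite_imp_closed) auto
        show "0 \<in> Omega r - set as" by (rule 0)
        show "(\<Prod>a\<leftarrow>as. Fac \<kappa> a z) - h z = poly L z / poly (root_poly as) z" if "z \<in> Omega r - set as" for z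
          using LF[of z] that by simp
      qed
      then have deq: "deriv (\<lambda>z. poly L z / poly (root_poly as) z) 0 = - \<i> * of_real S * P - deriv h 0"
        by (rule DERIV_imp_deriv)
      \<comment> \<open>The remainder is small on a whole disc around 0, so Cauchy's inequality
        controls its derivative at the boundary point 0 of \<open>D\<close>.\<close>
      have "norm ((deriv ^^ 1) h 0) \<le> fact 1 * (C * q ^ length as) / s ^ 1"
        using s hW W(3) by (intro Cauchy_inequality holomorphic_on_subset[OF h]
          continuous_on_subset[OF holomorphic_on_imp_continuous_on[OF h]]) (auto simp: subset_iff dist_norm)
      then have "norm (deriv h 0) \<le> C * q ^ length as / s" by simp
      also have "\<dots> \<le> E / s" using small s by (intro divide_right_mono) auto
      also have "\<dots> \<le> e / 2 * c" using s by (simp add: E_def min_def field_simps)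
      finally have nh: "norm (deriv h 0) \<le> e / 2 * c" .
      have sums: "real (length bs) * c \<le> (\<Sum>a\<leftarrow>bs. green_slope a)"
        "(\<Sum>a\<leftarrow>bs. green_slope a) - real (length bs) * (\<kappa> * \<delta>) \<le> (\<Sum>a\<leftarrow>bs. patch_slope a - \<kappa> * \<delta>)" if "set bs \<subseteq> Z" for bs
        using that
      proof (induction bs)
        case (Cons b bs)
        { case 1 then show ?case using Cons c(2)[of b] by (auto simp: algebra_simps) }
        { case 2 then show ?case using Cons patch_slope_bounds[of b] Z by (force simp: algebra_simps) }
      qed auto
      define M where "M = (\<Sum>a\<leftarrow>as. green_slope a)"
      have l1: "real (length as) \<ge> 1" using len by simp
      have Mc: "real (length as) * c \<le> M" using sums(1)[OF as] by (simp add: M_def)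
      have "c \<le> real (length as) * c" using l1 c by simp
      then have "c \<le> M" using Mc by simp
      have "real (length as) * (\<kappa> * \<delta>) \<le> real (length as) * (e / 2 * c)" using \<kappa>\<delta> by (intro mult_left_mono) auto
      also have "\<dots> = e / 2 * (real (length as) * c)" by simp
      also have "\<dots> \<le> e / 2 * M" using Mc e by (intro mult_left_mono) auto
      finally have "M - e / 2 * M \<le> S" using sums(2)[OF as] by (simp add: M_def S_def)
      moreover have "e / 2 * c \<le> e / 2 * M" using \<open>c \<le> M\<close> e by (intro mult_left_mono) auto
      moreover have "norm (- \<i> * of_real S * P) = \<bar>S\<bar>" using nP by (simp add: norm_mult)
      moreover have "norm (- \<i> * of_real S * P) - norm (deriv h 0) \<le> norm (- \<i> * of_real S * P - deriv h 0)"
        by (rule norm_triangle_ineq2)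
      ultimately have "M - e * M \<le> norm (- \<i> * of_real S * P - deriv h 0)" using nh by linarith
      moreover have "(1 - \<epsilon>) * M \<le> M - e * M"
        using e \<open>c \<le> M\<close> c mult_right_mono[of e \<epsilon> M] by (simp add: algebra_simps)
      ultimately show ?thesis unfolding deq M_def by linarith
    qed
    show "\<exists>L. degree L \<le> length as - 1 \<and> (\<forall>a\<in>set as. poly L a \<noteq> 0) \<and>
      (\<forall>\<xi>\<in>frontier D. norm (poly L \<xi> / poly (root_poly as) \<xi>) \<le> 1 + \<epsilon>) \<and>
      (1 - \<epsilon>) * (\<Sum>a\<leftarrow>as. green_slope a) \<le> norm (deriv (\<lambda>z. poly L z / poly (root_poly as) z) 0)"
      using L 1 2 3 by blast
  qed
qed

section \<open>Local structure of smooth curves\<close>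

locale regular_curve =
  fixes p p' p'' :: "real \<Rightarrow> complex"
  assumes p: "\<And>t. (p has_vector_derivative p' t) (at t)"
    and p': "\<And>t. (p' has_vector_derivative p'' t) (at t)"
    and p'_nonzero: "\<And>t. p' t \<noteq> 0"
    and p_eq_iff: "\<And>s t. p s = p t \<longleftrightarrow> cis s = cis t"
begin

lemma cont_p: "continuous_on A p"
  by (auto intro!: continuous_at_imp_continuous_on has_vector_derivative_continuous[OF p])

lemma periodic_parameter:
  obtains t where "p (t0 + t) = p s" "- \<alpha> \<le> t" "t < 2 * pi - \<alpha>"
proof -
  define k where "k = \<lfloor>(s - t0 + \<alpha>) / (2 * pi)\<rfloor>"
  define t where "t = s - t0 - 2 * pi * of_int k"
  have "of_int k \<le> (s - t0 + \<alpha>) / (2 * pi)" "(s - t0 + \<alpha>) / (2 * pi) < of_int k + 1"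
    unfolding k_def by linarith+
  then have "2 * pi * of_int k \<le> s - t0 + \<alpha>" "s - t0 + \<alpha> < 2 * pi * of_int k + 2 * pi"
    by (simp_all add: field_simps)
  moreover have "cis (t0 + t) = cis s"
  proof -
    have "t0 + t = s - 2 * pi * of_int k" by (simp add: t_def)
    then have "cis (t0 + t) = cis s / cis (2 * pi * of_int k)" by (simp only: cis_divide)
    also have "cis (2 * pi * of_int k) = 1" by (rule cis_multiple_2pi) auto
    finally show ?thesis by simp
  qed
  ultimately show thesis using that[of t] p_eq_iff[of "t0 + t" s] by (auto simp: t_def)
qed

lemma cis_neq:
  assumes "0 < t" "t < 2 * pi" shows "cis (t0 + t) \<noteq> cis t0"
proof
  assume "cis (t0 + t) = cis t0"
  then have "cis t = 1" by (simp add: cis_mult[symmetric])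
  then have "cos t = 1" by (metis cis.sel(1) one_complex.sel(1))
  then obtain n :: int where "t = of_int n * 2 * pi" by (auto simp: cos_one_2pi_int)
  then show False using assms by (auto simp: mult_less_cancel_right1 zero_less_mult_iff)
qed

text \<open>In coordinates with the tangent as real axis, the abscissa \<open>X\<close> is strictly
  increasing for parameters near \<open>t0\<close>, and \<open>h\<close> is \<open>Y\<close>
  composed with the inverse of \<open>X\<close>.\<close>

lemma local_graph:
  fixes t0 :: real
  defines "\<tau> \<equiv> p' t0 / of_real (norm (p' t0))"
  obtains \<delta>0 C h where "\<delta>0 > 0" "C > 0" "continuous_on {-\<delta>0<..<\<delta>0} h"
    "\<And>x. \<bar>x\<bar> < \<delta>0 \<Longrightarrow> \<bar>h x\<bar> \<le> C * x\<^sup>2"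
    "\<And>z. z \<in> open_square \<delta>0 \<Longrightarrow> p t0 + \<tau> * z \<in> range p \<longleftrightarrow> Im z = h (Re z)"
proof -
  define \<sigma> where "\<sigma> = norm (p' t0)"
  have \<sigma>: "\<sigma> > 0" using p'_nonzero by (simp add: \<sigma>_def)
  have \<tau>: "norm \<tau> = 1" "\<tau> \<noteq> 0" "p' t0 = of_real \<sigma> * \<tau>"
    using \<sigma> by (auto simp: \<tau>_def \<sigma>_def norm_divide)
  define q where "q = (\<lambda>t. (p (t0 + t) - p t0) / \<tau>)"
  define X Y where "X = (\<lambda>t. Re (q t))" and "Y = (\<lambda>t. Im (q t))"
  define X' Y' where "X' = (\<lambda>t. Re (p' (t0 + t) / \<tau>))" and "Y' = (\<lambda>t. Im (p' (t0 + t) / \<tau>))"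
  have shift: "((\<lambda>t. f (t0 + t)) has_vector_derivative f' (t0 + t)) (at t)"
    if "\<And>t. (f has_vector_derivative f' t) (at t)" for f f' :: "real \<Rightarrow> complex" and t
  proof -
    have "((+) t0 has_real_derivative 1) (at t)" by (auto intro!: derivative_eq_intros)
    from vector_diff_chain_at[OF this[unfolded has_real_derivative_iff_has_vector_derivative] that[of "t0 + t"]]
    show ?thesis by (simp add: o_def)
  qed
  have dq: "(q has_vector_derivative p' (t0 + t) / \<tau>) (at t)" for t
    unfolding q_def by (intro has_vector_derivative_divide) (use shift[of p p'] p in \<open>auto intro!: derivative_eq_intros\<close>)
  have dX: "(X has_real_derivative X' t) (at t)" and dY: "(Y has_real_derivative Y' t) (at t)" for t
    using dq[of t] by (auto simp: has_vector_derivative_complex_iff X_def Y_def X'_def Y'_def)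
  have "((\<lambda>t. p' (t0 + t) / \<tau>) has_vector_derivative p'' (t0 + t) / \<tau>) (at t)" for t
    by (intro has_vector_derivative_divide shift p')
  then have dX': "(X' has_real_derivative Re (p'' (t0 + t) / \<tau>)) (at t)"
    and dY': "(Y' has_real_derivative Im (p'' (t0 + t) / \<tau>)) (at t)" for t
    by (auto simp: has_vector_derivative_complex_iff X'_def Y'_def)
  have X'0: "X' 0 = \<sigma>" and Y'0: "Y' 0 = 0" and q0: "q 0 = 0"
    using \<tau> by (auto simp: X'_def Y'_def q_def)
  have "isCont X' 0" using dX' DERIV_isCont by blast
  from this[unfolded continuous_at_eps_delta, rule_format, OF half_gt_zero[OF \<sigma>]]
  obtain \<alpha>1 where \<alpha>1: "\<alpha>1 > 0" "\<And>t. \<bar>t\<bar> < \<alpha>1 \<Longrightarrow> \<bar>X' t - \<sigma>\<bar> < \<sigma> / 2"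
    unfolding X'0 dist_real_def by auto
  define K where "K = \<bar>Im (p'' t0 / \<tau>)\<bar> + 1"
  have "((\<lambda>t. Y' t / t) \<longlongrightarrow> Im (p'' t0 / \<tau>)) (at 0)"
    using dY'[of 0] by (simp add: has_field_derivative_iff Y'0)
  from tendstoD[OF this, of 1] obtain \<alpha>2 where \<alpha>2: "\<alpha>2 > 0"
    "\<And>t. t \<noteq> 0 \<Longrightarrow> \<bar>t\<bar> < \<alpha>2 \<Longrightarrow> \<bar>Y' t / t - Im (p'' t0 / \<tau>)\<bar> < 1"
    unfolding eventually_at by (auto simp: dist_real_def)
  \<comment> \<open>\<open>Y' 0 = 0\<close> because \<open>\<tau>\<close> is the tangent direction;
    differentiability of \<open>p'\<close> then makes \<open>Y'\<close> at most linear, and hence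
    \<open>Y\<close> at most quadratic.\<close>
  have Y'K: "\<bar>Y' t\<bar> \<le> K * \<bar>t\<bar>" if "\<bar>t\<bar> < \<alpha>2" for t
  proof (cases "t = 0")
    case False
    have "\<bar>Y' t / t\<bar> \<le> K" using \<alpha>2(2)[OF False that] unfolding K_def by linarith
    then show ?thesis using False by (simp add: abs_divide field_simps)
  qed (simp add: Y'0)
  define \<alpha> where "\<alpha> = min (min \<alpha>1 \<alpha>2) pi / 2"
  have \<alpha>: "\<alpha> > 0" "\<alpha> < \<alpha>1" "\<alpha> < \<alpha>2" "\<alpha> < pi" using \<alpha>1 \<alpha>2 by (auto simp: \<alpha>_def min_def)
  have X'_pos: "X' t > \<sigma> / 2" if "\<bar>t\<bar> \<le> \<alpha>" for t
    using \<alpha>1(2)[of t] that \<alpha> by linarith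
  have incr: "X b - X a \<ge> \<sigma> / 2 * (b - a)" if ab: "-\<alpha> \<le> a" "a < b" "b \<le> \<alpha>" for a b
  proof -
    obtain z where z: "a < z" "z < b" "X b - X a = (b - a) * X' z"
      using MVT2[OF ab(2), of X X'] dX by auto
    have "X' z \<ge> \<sigma> / 2" using X'_pos[of z] z ab by (simp add: abs_le_iff)
    then have "(b - a) * X' z \<ge> (b - a) * (\<sigma> / 2)" using ab by (intro mult_left_mono) auto
    then show ?thesis unfolding z(3) by (simp add: mult.commute)
  qed
  have X0: "X 0 = 0" and Y0: "Y 0 = 0" by (auto simp: X_def Y_def q0)
  have Xt: "\<bar>X t\<bar> \<ge> \<sigma> / 2 * \<bar>t\<bar>" if "\<bar>t\<bar> \<le> \<alpha>" for t
    using incr[of 0 t] incr[of t 0] that X0 \<alpha> by (cases t "0::real" rule: linorder_cases) auto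
  have Yt: "\<bar>Y t\<bar> \<le> K * t\<^sup>2" if "\<bar>t\<bar> \<le> \<alpha>" for t
  proof -
    have *: "\<exists>z. \<bar>z\<bar> \<le> \<bar>t\<bar> \<and> Y t = t * Y' z"
    proof (cases t "0::real" rule: linorder_cases)
      case less
      then obtain z where "t < z" "z < 0" "Y 0 - Y t = (0 - t) * Y' z" using MVT2[OF less, of Y Y'] dY by auto
      then show ?thesis using Y0 by (intro exI[of _ z]) auto
    next
      case greater
      then obtain z where "0 < z" "z < t" "Y t - Y 0 = (t - 0) * Y' z" using MVT2[OF greater, of Y Y'] dY by auto
      then show ?thesis using Y0 by (intro exI[of _ z]) auto
    qed (use Y0 in auto)
    then obtain z where z: "\<bar>z\<bar> \<le> \<bar>t\<bar>" "Y t = t * Y' z" by blast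
    have "\<bar>Y' z\<bar> \<le> K * \<bar>t\<bar>"
      using Y'K[of z] z that \<alpha> mult_left_mono[OF z(1), of K] by (auto simp: K_def)
    then have "\<bar>t\<bar> * \<bar>Y' z\<bar> \<le> \<bar>t\<bar> * (K * \<bar>t\<bar>)" by (intro mult_left_mono) auto
    then show ?thesis unfolding z(2) by (simp add: abs_mult power2_eq_square mult.left_commute)
  qed
  \<comment> \<open>The rest of the curve is compact and misses \<open>p t0\<close>, so a small
    square meets the curve only at parameters near \<open>t0\<close>.\<close>
  define far where "far = p ` {t0 + \<alpha>..t0 + 2 * pi - \<alpha>}"
  have "compact far" unfolding far_def by (intro compact_continuous_image cont_p compact_Icc)
  moreover have "p t0 \<notin> far"
  proof
    assume "p t0 \<in> far"
    then obtain s where s: "t0 + \<alpha> \<le> s" "s \<le> t0 + 2 * pi - \<alpha>" "p t0 = p s" by (auto simp: far_def)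
    have "cis (t0 + (s - t0)) \<noteq> cis t0" using s \<alpha> by (intro cis_neq) auto
    then show False using s(3) p_eq_iff[of t0 s] by simp
  qed
  ultimately obtain \<eta> where \<eta>: "\<eta> > 0" "\<And>x. x \<in> far \<Longrightarrow> \<eta> \<le> dist (p t0) x"
    using separate_point_closed[of far "p t0"] compact_imp_closed by blast
  \<comment> \<open>\<open>\<eta> / 2\<close> keeps the square away from \<open>far\<close>;
    \<open>\<sigma> / 2 * \<alpha>\<close> is the range of \<open>X\<close> guaranteed by
    \<open>incr\<close>, so every abscissa in the square is attained.\<close>
  define \<delta>0 where "\<delta>0 = min (\<eta> / 2) (\<sigma> / 2 * \<alpha>)"
  have \<delta>0: "\<delta>0 > 0" "2 * \<delta>0 \<le> \<eta>" "\<delta>0 \<le> \<sigma> / 2 * \<alpha>" using \<eta> \<sigma> \<alpha> by (auto simp: \<delta>0_def)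
  define I where "I = {-\<alpha>..\<alpha>}"
  have contX: "continuous_on I X" and contY: "continuous_on I Y"
    by (auto intro!: continuous_at_imp_continuous_on DERIV_isCont[OF dX] DERIV_isCont[OF dY])
  have injX: "inj_on X I"
  proof (rule linorder_inj_onI)
    fix a b assume "a < b" "a \<in> I" "b \<in> I"
    then show "X a \<noteq> X b" using incr[of a b] \<sigma> by (auto simp: I_def mult_le_0_iff)
  qed auto
  have surj: "x \<in> X ` I" if "\<bar>x\<bar> < \<delta>0" for x
  proof -
    have "X (-\<alpha>) \<le> x" "x \<le> X \<alpha>" using incr[of "-\<alpha>" 0] incr[of 0 \<alpha>] that \<delta>0 \<alpha> X0 by auto
    then show ?thesis using IVT'[of X "-\<alpha>" x \<alpha>] contX \<alpha> by (auto simp: I_def)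
  qed
  define T where "T = inv_into I X"
  have TI: "T x \<in> I" and XT: "X (T x) = x" if "\<bar>x\<bar> < \<delta>0" for x
    using surj[OF that] unfolding T_def by (auto intro: inv_into_into f_inv_into_f)
  have contT: "continuous_on {-\<delta>0<..<\<delta>0} T"
  proof -
    have "continuous_on (X ` I) T" unfolding T_def
      by (rule continuous_on_inv[OF contX]) (auto simp: I_def inv_into_f_f[OF injX[unfolded I_def]])
    then show ?thesis by (rule continuous_on_subset) (use surj in auto)
  qed
  show thesis
  proof (rule that[of \<delta>0 "4 * K / \<sigma>\<^sup>2" "\<lambda>x. Y (T x)"])
    show "\<delta>0 > 0" by (rule \<delta>0)
    show "4 * K / \<sigma>\<^sup>2 > 0" using \<sigma> by (simp add: K_def add_nonneg_pos)
    show "continuous_on {-\<delta>0<..<\<delta>0} (\<lambda>x. Y (T x))"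
      using TI by (intro continuous_on_compose2[OF contY contT]) auto
    fix x assume x: "\<bar>x\<bar> < \<delta>0"
    have "\<bar>T x\<bar> \<le> \<alpha>" using TI[OF x] by (auto simp: I_def)
    have "\<sigma> / 2 * \<bar>T x\<bar> \<le> \<bar>x\<bar>" using Xt[OF \<open>\<bar>T x\<bar> \<le> \<alpha>\<close>] XT[OF x] by simp
    then have "(\<sigma> / 2 * \<bar>T x\<bar>)\<^sup>2 \<le> \<bar>x\<bar>\<^sup>2" using \<sigma> by (intro power_mono) auto
    then have "(T x)\<^sup>2 \<le> 4 / \<sigma>\<^sup>2 * x\<^sup>2" using \<sigma> by (simp add: power_mult_distrib power_divide field_simps)
    then have "K * (T x)\<^sup>2 \<le> K * (4 / \<sigma>\<^sup>2 * x\<^sup>2)" by (intro mult_left_mono) (auto simp: K_def)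
    moreover have "K * (4 / \<sigma>\<^sup>2 * x\<^sup>2) = 4 * K / \<sigma>\<^sup>2 * x\<^sup>2" by (simp add: field_simps)
    ultimately show "\<bar>Y (T x)\<bar> \<le> 4 * K / \<sigma>\<^sup>2 * x\<^sup>2" using Yt[OF \<open>\<bar>T x\<bar> \<le> \<alpha>\<close>] by linarith
  next
    fix z assume z: "z \<in> open_square \<delta>0"
    then have Re: "\<bar>Re z\<bar> < \<delta>0" by (simp add: open_square_def)
    have qp: "p (t0 + t) = p t0 + \<tau> * q t" for t using \<tau> by (simp add: q_def)
    show "p t0 + \<tau> * z \<in> range p \<longleftrightarrow> Im z = Y (T (Re z))"
    proof
      assume "p t0 + \<tau> * z \<in> range p"
      then obtain s where "p t0 + \<tau> * z = p s" by auto
      moreover obtain t where t: "p (t0 + t) = p s" "- \<alpha> \<le> t" "t < 2 * pi - \<alpha>" by (rule periodic_parameter)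
      ultimately have zt: "p t0 + \<tau> * z = p (t0 + t)" by simp
      have "t \<le> \<alpha>"
      proof (rule ccontr)
        assume "\<not> t \<le> \<alpha>"
        then have "p (t0 + t) \<in> far" unfolding far_def using t by (intro imageI) auto
        then have "\<eta> \<le> dist (p t0) (p t0 + \<tau> * z)" unfolding zt by (rule \<eta>(2))
        then have "\<eta> \<le> norm (\<tau> * z)" by (simp add: dist_norm)
        moreover have "norm z < 2 * \<delta>0" using z open_square_subset_ball by fastforce
        ultimately show False using \<tau> \<delta>0 by (simp add: norm_mult)
      qed
      then have tI: "t \<in> I" using t by (simp add: I_def)
      have "z = q t" using zt qp \<tau> by simp
      then have "Re z = X t" "Im z = Y t" by (auto simp: X_def Y_def)
      moreover have "T (Re z) = t" unfolding T_def \<open>Re z = X t\<close> by (rule inv_into_f_f[OF injX tI])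
      ultimately show "Im z = Y (T (Re z))" by simp
    next
      assume "Im z = Y (T (Re z))"
      then have "z = q (T (Re z))" using XT[OF Re] by (simp add: complex_eq_iff X_def Y_def)
      then have "p t0 + \<tau> * z = p (t0 + T (Re z))" using qp by simp
      then show "p t0 + \<tau> * z \<in> range p" by simp
    qed
  qed
qed

end

text \<open>As the graph stays strictly between the horizontal edges, the vertical segment from it
  to an edge is an affine image of the open unit interval; so each side is a continuous image of a
  rectangle.\<close>

lemma connected_graph_sides:
  fixes h :: "real \<Rightarrow> real"
  assumes h: "continuous_on {-\<delta><..<\<delta>} h" "\<And>x. \<bar>x\<bar> < \<delta> \<Longrightarrow> \<bar>h x\<bar> < \<delta>"
  shows "connected {z \<in> open_square \<delta>. Im z > h (Re z)}" "connected {z \<in> open_square \<delta>. Im z < h (Re z)}"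
proof -
  define R :: "(real \<times> real) set" where "R = {-\<delta><..<\<delta>} \<times> {0<..<1}"
  have R: "connected R" unfolding R_def by (intro connected_Times) auto
  define f g where "f = (\<lambda>(x, s). Complex x (h x + s * (\<delta> - h x)))" and "g = (\<lambda>(x, s). Complex x (h x - s * (\<delta> + h x)))"
  have ch: "continuous_on R (\<lambda>x. h (fst x))"
    by (intro continuous_on_compose2[OF h(1)] continuous_intros) (auto simp: R_def)
  have "continuous_on R f" "continuous_on R g"
    unfolding f_def g_def case_prod_beta Complex_eq by (intro continuous_intros ch)+
  then have *: "connected (f ` R)" "connected (g ` R)" using R connected_continuous_image by blast+
  have "f ` R = {z \<in> open_square \<delta>. Im z > h (Re z)}"
  proof (intro set_eqI iffI)
    fix z assume "z \<in> f ` R"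
    then obtain x s where xs: "\<bar>x\<bar> < \<delta>" "0 < s" "s < 1" "z = Complex x (h x + s * (\<delta> - h x))" by (auto simp: R_def f_def)
    have "0 < s * (\<delta> - h x)" "s * (\<delta> - h x) < 1 * (\<delta> - h x)"
    proof -
      have "0 < \<delta> - h x" using h(2)[OF xs(1)] by linarith
      from mult_strict_right_mono[OF xs(3) this] mult_pos_pos[OF xs(2) this]
      show "0 < s * (\<delta> - h x)" "s * (\<delta> - h x) < 1 * (\<delta> - h x)" by auto
    qed
    moreover have "\<bar>c + u\<bar> < \<delta>" if "0 < u" "u < 1 * (\<delta> - c)" "\<bar>c\<bar> < \<delta>" for c u
      using that by (auto simp: abs_less_iff)
    ultimately have "\<bar>h x + s * (\<delta> - h x)\<bar> < \<delta>" using h(2)[OF xs(1)] by blast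
    then show "z \<in> {z \<in> open_square \<delta>. Im z > h (Re z)}"
      using \<open>0 < s * (\<delta> - h x)\<close> xs(1,4) by (simp add: open_square_def)
  next
    fix z assume "z \<in> {z \<in> open_square \<delta>. Im z > h (Re z)}"
    then have z: "\<bar>Re z\<bar> < \<delta>" "\<bar>Im z\<bar> < \<delta>" "Im z > h (Re z)" by (auto simp: open_square_def)
    define s where "s = (Im z - h (Re z)) / (\<delta> - h (Re z))"
    have pos: "\<delta> - h (Re z) > 0" using h(2)[OF z(1)] by linarith
    have "0 < s" unfolding s_def using z pos by (intro divide_pos_pos) linarith+
    moreover have "s < 1" unfolding s_def using z pos by (subst divide_less_eq_1_pos) linarith+
    moreover have "s * (\<delta> - h (Re z)) = Im z - h (Re z)" unfolding s_def using pos by simp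
    ultimately have "0 < s" "s < 1" "s * (\<delta> - h (Re z)) = Im z - h (Re z)" by auto
    then show "z \<in> f ` R" using z by (intro image_eqI[of _ _ "(Re z, s)"]) (auto simp: f_def R_def)
  qed
  moreover have "g ` R = {z \<in> open_square \<delta>. Im z < h (Re z)}"
  proof (intro set_eqI iffI)
    fix z assume "z \<in> g ` R"
    then obtain x s where xs: "\<bar>x\<bar> < \<delta>" "0 < s" "s < 1" "z = Complex x (h x - s * (\<delta> + h x))" by (auto simp: R_def g_def)
    have "0 < s * (\<delta> + h x)" "s * (\<delta> + h x) < 1 * (\<delta> + h x)"
    proof -
      have "0 < \<delta> + h x" using h(2)[OF xs(1)] by linarith
      from mult_strict_right_mono[OF xs(3) this] mult_pos_pos[OF xs(2) this]
      show "0 < s * (\<delta> + h x)" "s * (\<delta> + h x) < 1 * (\<delta> + h x)" by auto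
    qed
    moreover have "\<bar>c - u\<bar> < \<delta>" if "0 < u" "u < 1 * (\<delta> + c)" "\<bar>c\<bar> < \<delta>" for c u
      using that by (auto simp: abs_less_iff)
    ultimately have "\<bar>h x - s * (\<delta> + h x)\<bar> < \<delta>" using h(2)[OF xs(1)] by blast
    then show "z \<in> {z \<in> open_square \<delta>. Im z < h (Re z)}"
      using \<open>0 < s * (\<delta> + h x)\<close> xs(1,4) by (simp add: open_square_def)
  next
    fix z assume "z \<in> {z \<in> open_square \<delta>. Im z < h (Re z)}"
    then have z: "\<bar>Re z\<bar> < \<delta>" "\<bar>Im z\<bar> < \<delta>" "Im z < h (Re z)" by (auto simp: open_square_def)
    define s where "s = (h (Re z) - Im z) / (\<delta> + h (Re z))"
    have pos: "\<delta> + h (Re z) > 0" using h(2)[OF z(1)] by linarith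
    have "0 < s" unfolding s_def using z pos by (intro divide_pos_pos) linarith+
    moreover have "s < 1" unfolding s_def using z pos by (subst divide_less_eq_1_pos) linarith+
    moreover have "s * (\<delta> + h (Re z)) = h (Re z) - Im z" unfolding s_def using pos by simp
    ultimately have "0 < s" "s < 1" "s * (\<delta> + h (Re z)) = h (Re z) - Im z" by auto
    then show "z \<in> g ` R" using z by (intro image_eqI[of _ _ "(Re z, s)"]) (auto simp: g_def R_def)
  qed
  ultimately show "connected {z \<in> open_square \<delta>. Im z > h (Re z)}" "connected {z \<in> open_square \<delta>. Im z < h (Re z)}"
    using * by auto
qed

lemma C2_parametrization_regular:
  assumes "C2_parametrization \<phi> \<Gamma>"
  obtains p' p'' where "regular_curve (\<lambda>t. \<phi> (cis t)) p' p''" "range (\<lambda>t. \<phi> (cis t)) = \<Gamma>"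
proof -
  obtain \<psi> p' p'' where hom: "homeomorphism (sphere 0 1) \<Gamma> \<phi> \<psi>"
    and d: "\<And>t::real. ((\<lambda>s. \<phi> (cis s)) has_vector_derivative p' t) (at t)"
      "\<And>t::real. (p' has_vector_derivative p'' t) (at t)" "\<And>t. p' t \<noteq> 0"
    using assms unfolding C2_parametrization_def by blast
  have inj: "\<phi> (cis s) = \<phi> (cis t) \<longleftrightarrow> cis s = cis t" for s t
    using hom by (metis homeomorphism_apply1 mem_sphere_0 norm_cis)
  have "sphere 0 1 = range cis"
  proof (intro set_eqI iffI)
    fix z :: complex assume "z \<in> sphere 0 1"
    then have "cis (Arg z) = z" by (subst cis_Arg) (auto simp: sgn_div_norm)
    then show "z \<in> range cis" by (metis rangeI)
  qed auto
  then have "range (\<lambda>t. \<phi> (cis t)) = \<phi> ` sphere 0 1" by (auto simp: image_iff)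
  also have "\<dots> = \<Gamma>" using hom by (simp add: homeomorphism_def)
  finally show thesis using that[of p' p''] d inj by (simp add: regular_curve_def)
qed

section \<open>The two components near a point of the curve\<close>

context regular_curve
begin

lemma compact_range: "compact (range p)"
proof -
  have "p s \<in> p ` {0..2 * pi}" for s
  proof -
    obtain t where "p (0 + t) = p s" "- 0 \<le> t" "t < 2 * pi - 0" by (rule periodic_parameter)
    then show ?thesis by (intro image_eqI[of _ _ t]) auto
  qed
  then have "range p = p ` {0..2 * pi}" by blast
  then show ?thesis using compact_continuous_image[OF cont_p compact_Icc] by metis
qed

lemma connected_range: "connected (range p)"
  by (intro connected_continuous_image cont_p) simp

lemma jordan_curve:
  "open (inside (range p))" "connected (inside (range p))" "open (outside (range p))" "connected (outside (range p))"
  "bounded (inside (range p))" "inside (range p) \<inter> outside (range p) = {}" 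
  "inside (range p) \<union> outside (range p) = - range p"
  "frontier (inside (range p)) = range p" "frontier (outside (range p)) = range p"
proof -
  define c where "c = (\<lambda>x. p (2 * pi * x))"
  have "simple_path (circlepath (0::complex) 1)" by (simp add: simple_path_circlepath)
  then have lf: "loop_free (circlepath (0::complex) 1)" unfolding simple_path_def by blast
  have cp: "circlepath 0 1 x = cis (2 * pi * x)" for x
    by (simp add: circlepath cis_conv_exp mult_ac)
  have "loop_free c"
    using lf unfolding loop_free_def c_def cp p_eq_iff .
  moreover have "path c" unfolding path_def c_def
    by (intro continuous_on_compose2[OF cont_p[of UNIV]] continuous_intros) auto
  ultimately have sp: "simple_path c" by (simp add: simple_path_def)
  have cl: "pathfinish c = pathstart c"
    using p_eq_iff[of "2 * pi" 0] by (simp add: pathfinish_def pathstart_def c_def)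
  have "p s \<in> path_image c" for s
  proof -
    obtain t where t: "p (0 + t) = p s" "- 0 \<le> t" "t < 2 * pi - 0" by (rule periodic_parameter)
    then show ?thesis unfolding path_image_def c_def by (intro image_eqI[of _ _ "t / (2 * pi)"]) auto
  qed
  then have "path_image c = range p" by (auto simp: path_image_def c_def)
  then show "open (inside (range p))" "connected (inside (range p))" "open (outside (range p))" "connected (outside (range p))"
    "bounded (inside (range p))" "inside (range p) \<inter> outside (range p) = {}" 
    "inside (range p) \<union> outside (range p) = - range p"
    "frontier (inside (range p)) = range p" "frontier (outside (range p)) = range p"
    using Jordan_inside_outside[OF sp cl] by auto
qed

text \<open>A point other than 0 of the closed disc of radius \<open>r\<close> touching the real
  axis at 0 from above satisfies \<open>Im z \<ge> |z|^2 / (2 r)\<close>, which exceeds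
  \<open>C (Re z)^2\<close> once \<open>2 r C < 1\<close>. So small touching discs lie on either
  side of the graph \<open>|h x| \<le> C x^2\<close>.\<close>

lemma two_sided_balls:
  obtains n r where "norm n = 1" "r > 0"
    "cball (p t0 + of_real r * n) r - {p t0} \<subseteq> inside (range p)"
    "cball (p t0 - of_real r * n) r - {p t0} \<subseteq> outside (range p)"
proof -
  define \<tau> where "\<tau> = p' t0 / of_real (norm (p' t0))"
  have \<tau>: "norm \<tau> = 1" "\<tau> \<noteq> 0" using p'_nonzero[of t0] by (auto simp: \<tau>_def norm_divide)
  obtain \<delta>0 C h where g: "\<delta>0 > 0" "C > 0" "continuous_on {-\<delta>0<..<\<delta>0} h"
    "\<And>x. \<bar>x\<bar> < \<delta>0 \<Longrightarrow> \<bar>h x\<bar> \<le> C * x\<^sup>2"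
    "\<And>z. z \<in> open_square \<delta>0 \<Longrightarrow> p t0 + \<tau> * z \<in> range p \<longleftrightarrow> Im z = h (Re z)"
    unfolding \<tau>_def by (rule local_graph[of t0]) blast
  \<comment> \<open>\<open>\<delta> \<le> 1 / (2 C)\<close> gives
    \<open>|h x| \<le> |x| / 2\<close>, so the graph stays within the square over its whole
    base.\<close>
  define \<delta> where "\<delta> = min \<delta>0 (1 / (2 * C))"
  have \<delta>: "\<delta> > 0" "\<delta> \<le> \<delta>0" "\<delta> \<le> 1 / (2 * C)" using g by (auto simp: \<delta>_def)
  have hC: "\<bar>h x\<bar> \<le> C * x\<^sup>2" and h\<delta>: "\<bar>h x\<bar> < \<delta>" if "\<bar>x\<bar> < \<delta>" for x
  proof -
    show *: "\<bar>h x\<bar> \<le> C * x\<^sup>2" using g(4)[of x] that \<delta> by simp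
    have "C * x\<^sup>2 = C * \<bar>x\<bar> * \<bar>x\<bar>" by (simp add: power2_eq_square)
    also have "\<dots> \<le> C * (1 / (2 * C)) * \<bar>x\<bar>" using that \<delta> g(2) by (intro mult_right_mono mult_left_mono) auto
    also have "\<dots> = \<bar>x\<bar> / 2" using g(2) by simp
    finally show "\<bar>h x\<bar> < \<delta>" using * that \<delta>(1) by linarith
  qed
  have hcont: "continuous_on {-\<delta><..<\<delta>} h" by (rule continuous_on_subset[OF g(3)]) (use \<delta> in auto)
  have sq: "open_square \<delta> \<subseteq> open_square \<delta>0" using \<delta> by (auto simp: open_square_def)
  define E where "E = (\<lambda>z. p t0 + \<tau> * z)"
  define Ap Am where "Ap = {z \<in> open_square \<delta>. Im z > h (Re z)}" and "Am = {z \<in> open_square \<delta>. Im z < h (Re z)}"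
  have cE: "connected (E ` A)" if "connected A" for A
    unfolding E_def using that by (intro connected_continuous_image continuous_intros)
  have conn: "connected (E ` Ap)" "connected (E ` Am)"
    using connected_graph_sides[OF hcont h\<delta>] cE by (auto simp: Ap_def Am_def)
  have dis: "E ` Ap \<inter> range p = {}" "E ` Am \<inter> range p = {}"
    using g(5) sq by (fastforce simp: E_def Ap_def Am_def)+
  have side: "A \<subseteq> inside (range p) \<or> A \<subseteq> outside (range p)" if "connected A" "A \<inter> range p = {}" for A
    using connected_Int_frontier[OF that(1), of "inside (range p)"] jordan_curve(7,8) that(2) by blast
  have opE: "open (E ` open_square \<delta>)"
  proof -
    have "E ` open_square \<delta> = (\<lambda>z. (z - p t0) / \<tau>) -` open_square \<delta>"
      using \<tau> by (force simp: E_def image_iff field_simps)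
    then show ?thesis
      by (simp only:) (intro open_vimage open_open_square continuous_intros, use \<tau> in auto)
  qed
  have E0: "p t0 \<in> E ` open_square \<delta>" using \<delta> by (intro image_eqI[of _ _ 0]) (auto simp: E_def open_square_def)
  have part: "E ` open_square \<delta> \<subseteq> E ` Ap \<union> E ` Am \<union> range p"
    using g(5) sq by (fastforce simp: E_def Ap_def Am_def)
  have meets: "(E ` Ap \<union> E ` Am) \<inter> V \<noteq> {}" if V: "frontier V = range p" "V \<inter> range p = {}" for V
  proof -
    have "p t0 \<in> closure V" using V(1) by (auto simp: frontier_def)
    then have "E ` open_square \<delta> \<inter> V \<noteq> {}"
      using opE E0 by (meson closure_iff_nhds_not_empty disjoint_iff order_refl)
    then show ?thesis using part V(2) by blast
  qed
  have "inside (range p) \<inter> range p = {}" "outside (range p) \<inter> range p = {}"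
    using jordan_curve(7) by blast+
  then have m: "(E ` Ap \<union> E ` Am) \<inter> inside (range p) \<noteq> {}" "(E ` Ap \<union> E ` Am) \<inter> outside (range p) \<noteq> {}"
    using meets jordan_curve(8,9) by blast+
  \<comment> \<open>Each side of the graph is connected and avoids the curve, so it lies in one
    component; both components accumulate at \<open>p t0\<close>, so the two sides cannot share
    one.\<close>
  have split: "(E ` Ap \<subseteq> inside (range p) \<and> E ` Am \<subseteq> outside (range p)) \<or>
      (E ` Ap \<subseteq> outside (range p) \<and> E ` Am \<subseteq> inside (range p))"
    using side[OF conn(1) dis(1)] side[OF conn(2) dis(2)] m jordan_curve(6) by blast
  define r where "r = min (\<delta> / 4) (1 / (4 * C))"
  have r: "r > 0" "2 * r < \<delta>" "2 * r * C < 1" using \<delta> g(2) by (auto simp: r_def min_def field_simps)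
  have key: "\<bar>Re z\<bar> < \<delta> \<and> \<bar>Im z\<bar> < \<delta> \<and> \<bar>h (Re z)\<bar> < s * Im z"
    if z: "norm (z - s * \<i> * of_real r) \<le> r" "z \<noteq> 0" and s: "s = 1 \<or> s = -1" for z and s :: real
  proof -
    have "(norm (z - s * \<i> * of_real r))\<^sup>2 \<le> r\<^sup>2" using z(1) by (intro power_mono) auto
    then have le: "(norm z)\<^sup>2 \<le> 2 * r * (s * Im z)"
      using s unfolding cmod_power2 by (auto simp: power2_eq_square algebra_simps)
    have nz: "(norm z)\<^sup>2 > 0" using z(2) by simp
    have "norm z \<le> 2 * r"
      using norm_triangle_ineq[of "z - s * \<i> * of_real r" "s * \<i> * of_real r"] z(1) s r by (auto simp: norm_mult)
    then have sm: "\<bar>Re z\<bar> < \<delta>" "\<bar>Im z\<bar> < \<delta>"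
      using abs_Re_le_cmod[of z] abs_Im_le_cmod[of z] r by auto
    have pos: "s * Im z > 0" using le nz r by (smt (verit) mult_nonneg_nonpos)
    have "(Re z)\<^sup>2 \<le> (norm z)\<^sup>2" unfolding cmod_power2 by simp
    then have "C * (Re z)\<^sup>2 \<le> C * (2 * r * (s * Im z))" using le g(2) by (intro mult_left_mono) auto
    also have "\<dots> = (2 * r * C) * (s * Im z)" by simp
    also have "\<dots> < 1 * (s * Im z)" using r(3) pos by (intro mult_strict_right_mono)
    finally show ?thesis using hC[OF sm(1)] sm by auto
  qed
  have ballE: "\<exists>z. w = E z \<and> norm (z - s * \<i> * of_real r) \<le> r \<and> z \<noteq> 0"
    if "w \<in> cball (p t0 + of_real r * (of_real s * \<i> * \<tau>)) r - {p t0}" for w and s :: real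
  proof (intro exI[of _ "(w - p t0) / \<tau>"] conjI)
    have "(w - p t0) / \<tau> - s * \<i> * of_real r = (w - (p t0 + of_real r * (of_real s * \<i> * \<tau>))) / \<tau>"
      using \<tau> by (simp add: field_simps)
    then have "norm ((w - p t0) / \<tau> - s * \<i> * of_real r) = norm (w - (p t0 + of_real r * (of_real s * \<i> * \<tau>)))"
      using \<tau> by (simp add: norm_divide)
    then show "norm ((w - p t0) / \<tau> - s * \<i> * of_real r) \<le> r"
      using that by (simp add: dist_norm norm_minus_commute)
  qed (use that \<tau> in \<open>auto simp: E_def\<close>)
  have up: "cball (p t0 + of_real r * (of_real 1 * \<i> * \<tau>)) r - {p t0} \<subseteq> E ` Ap"
  proof
    fix w assume "w \<in> cball (p t0 + of_real r * (of_real 1 * \<i> * \<tau>)) r - {p t0}"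
    from ballE[OF this] obtain z where z: "w = E z" "norm (z - of_real 1 * \<i> * of_real r) \<le> r" "z \<noteq> 0" by blast
    then show "w \<in> E ` Ap" using key[OF z(2,3)] by (auto simp: Ap_def open_square_def)
  qed
  have down: "cball (p t0 + of_real r * (of_real (-1) * \<i> * \<tau>)) r - {p t0} \<subseteq> E ` Am"
  proof
    fix w assume "w \<in> cball (p t0 + of_real r * (of_real (-1) * \<i> * \<tau>)) r - {p t0}"
    from ballE[OF this] obtain z where z: "w = E z" "norm (z - of_real (-1) * \<i> * of_real r) \<le> r" "z \<noteq> 0" by blast
    then show "w \<in> E ` Am" using key[OF z(2,3)] by (auto simp: Am_def open_square_def)
  qed
  have up': "cball (p t0 + of_real r * (\<i> * \<tau>)) r - {p t0} \<subseteq> E ` Ap" using up by simp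
  have down': "cball (p t0 - of_real r * (\<i> * \<tau>)) r - {p t0} \<subseteq> E ` Am" using down by simp
  have n: "norm (\<i> * \<tau>) = 1" "norm (- (\<i> * \<tau>)) = 1" using \<tau> by (auto simp: norm_mult)
  from split show thesis
  proof
    assume "E ` Ap \<subseteq> inside (range p) \<and> E ` Am \<subseteq> outside (range p)"
    then show thesis using subset_trans[OF up'] subset_trans[OF down'] r n by (intro that[of "\<i> * \<tau>" r]) auto
  next
    assume a: "E ` Ap \<subseteq> outside (range p) \<and> E ` Am \<subseteq> inside (range p)"
    show thesis
    proof (rule that[of "- (\<i> * \<tau>)" r])
      show "cball (p t0 + of_real r * - (\<i> * \<tau>)) r - {p t0} \<subseteq> inside (range p)"
        using subset_trans[OF down'] a by simp
      show "cball (p t0 - of_real r * - (\<i> * \<tau>)) r - {p t0} \<subseteq> outside (range p)"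
        using subset_trans[OF up'] a by simp
    qed (use r n in auto)
  qed
qed

text \<open>A connected set off the curve lies in \<open>D\<close> or misses it, as the frontier of
  \<open>D\<close> is on the curve. So \<open>D\<close> meets a small square in unions of sides of
  the graph, and the test points \<open>\<i> s\<close> in \<open>D\<close> and
  \<open>- \<i> s\<close> outside \<open>D\<close> show that it is exactly one side.\<close>

lemma connected_small_squares:
  assumes p0: "p t0 = 0" and upper: "\<And>t. Im (p t) \<ge> 0"
    and D: "D \<inter> range p = {}" "frontier D \<subseteq> range p" "\<And>z. z \<in> D \<Longrightarrow> Im z > 0"
    and \<rho>: "\<rho> > 0" "ball (\<i> * of_real \<rho>) \<rho> \<subseteq> D"
  shows "\<exists>\<delta>0>0. \<forall>\<delta>. 0 < \<delta> \<longrightarrow> \<delta> < \<delta>0 \<longrightarrow> connected (D \<inter> open_square \<delta>)"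
proof -
  define \<tau> where "\<tau> = p' t0 / of_real (norm (p' t0))"
  have dIm: "((\<lambda>t. Im (p t)) has_real_derivative Im (p' t0)) (at t0)"
    using p[of t0] by (simp add: has_vector_derivative_complex_iff)
  \<comment> \<open>\<open>Im (p t)\<close> has its minimum 0 at \<open>t0\<close>, so the tangent
    there is real and the rotation \<open>\<tau>\<close> is \<open>1\<close> or
    \<open>-1\<close>.\<close>
  have Im0: "Im (p' t0) = 0"
    by (rule DERIV_local_min[OF dIm zero_less_one]) (use p0 upper in auto)
  then have "p' t0 = of_real (Re (p' t0))" "Re (p' t0) \<noteq> 0" using p'_nonzero[of t0] by (auto simp: complex_eq_iff)
  then have \<tau>: "\<tau> = 1 \<or> \<tau> = -1"
    unfolding \<tau>_def by (cases "Re (p' t0) > 0") (auto simp: cmod_eq_Re Im0 complex_eq_iff)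
  obtain \<delta>0 C h where g: "\<delta>0 > 0" "C > 0" "continuous_on {-\<delta>0<..<\<delta>0} h"
    "\<And>x. \<bar>x\<bar> < \<delta>0 \<Longrightarrow> \<bar>h x\<bar> \<le> C * x\<^sup>2"
    "\<And>z. z \<in> open_square \<delta>0 \<Longrightarrow> p t0 + \<tau> * z \<in> range p \<longleftrightarrow> Im z = h (Re z)"
    unfolding \<tau>_def by (rule local_graph[of t0]) blast
  show ?thesis
  proof (intro exI[of _ "min \<delta>0 (1 / (2 * C))"] conjI allI impI)
    show "min \<delta>0 (1 / (2 * C)) > 0" using g by simp
    fix \<delta> assume \<delta>: "0 < \<delta>" "\<delta> < min \<delta>0 (1 / (2 * C))"
    have h\<delta>: "\<bar>h x\<bar> < \<delta>" if "\<bar>x\<bar> < \<delta>" for x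
    proof -
      have *: "\<bar>h x\<bar> \<le> C * x\<^sup>2" using g(4)[of x] that \<delta> by simp
      have "C * x\<^sup>2 = C * \<bar>x\<bar> * \<bar>x\<bar>" by (simp add: power2_eq_square)
      also have "\<dots> \<le> C * (1 / (2 * C)) * \<bar>x\<bar>" using that \<delta> g(2) by (intro mult_right_mono mult_left_mono) auto
      also have "\<dots> = \<bar>x\<bar> / 2" using g(2) by simp
      finally show "\<bar>h x\<bar> < \<delta>" using * that \<delta>(1) by linarith
    qed
    have hcont: "continuous_on {-\<delta><..<\<delta>} h" by (rule continuous_on_subset[OF g(3)]) (use \<delta> in auto)
    have sq: "open_square \<delta> \<subseteq> open_square \<delta>0" using \<delta> by (auto simp: open_square_def)
    define Ap Am where "Ap = {z \<in> open_square \<delta>. Im z > h (Re z)}" and "Am = {z \<in> open_square \<delta>. Im z < h (Re z)}"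
    have cE: "connected ((*) \<tau> ` A)" if "connected A" for A
      using that by (intro connected_continuous_image continuous_intros)
    have conn: "connected ((*) \<tau> ` Ap)" "connected ((*) \<tau> ` Am)"
      using connected_graph_sides[OF hcont h\<delta>] cE by (auto simp: Ap_def Am_def)
    have dis: "(*) \<tau> ` Ap \<inter> range p = {}" "(*) \<tau> ` Am \<inter> range p = {}"
      using g(5) sq p0 by (fastforce simp: Ap_def Am_def)+
    have side: "A \<subseteq> D \<or> A \<inter> D = {}" if "connected A" "A \<inter> range p = {}" for A
      using connected_Int_frontier[OF that(1), of D] D(2) that(2) by blast
    have \<tau>sq: "\<tau> * z \<in> open_square \<delta> \<longleftrightarrow> z \<in> open_square \<delta>" "\<tau> * (\<tau> * z) = z" for z
      using \<tau> by (auto simp: open_square_def)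
    have part: "open_square \<delta> - range p = (*) \<tau> ` Ap \<union> (*) \<tau> ` Am"
    proof (intro set_eqI iffI)
      fix z assume z: "z \<in> open_square \<delta> - range p"
      define w where "w = \<tau> * z"
      have zw: "z = \<tau> * w" "w \<in> open_square \<delta>" using z \<tau>sq by (auto simp: w_def)
      then have "Im w \<noteq> h (Re w)" using g(5)[of w] sq z p0 by auto
      then have "w \<in> Ap \<union> Am" using zw by (auto simp: Ap_def Am_def)
      then show "z \<in> (*) \<tau> ` Ap \<union> (*) \<tau> ` Am" using zw(1) by blast
    next
      fix z assume "z \<in> (*) \<tau> ` Ap \<union> (*) \<tau> ` Am"
      then show "z \<in> open_square \<delta> - range p" using dis \<tau>sq by (auto simp: Ap_def Am_def)
    qed
    define s where "s = min \<rho> (\<delta> / 2)"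
    have s: "0 < s" "s < \<delta>" "s \<le> \<rho>" using \<rho> \<delta> by (auto simp: s_def)
    have "dist (\<i> * of_real \<rho>) (\<i> * of_real s) = norm (\<i> * of_real (\<rho> - s))"
      by (simp add: dist_norm right_diff_distrib)
    also have "\<dots> = \<bar>\<rho> - s\<bar>" by (simp only: norm_mult norm_of_real norm_ii mult_1)
    finally have inD: "\<i> * of_real s \<in> D" using s \<rho> by (intro subsetD[OF \<rho>(2)]) auto
    have notD: "- (\<i> * of_real s) \<notin> D" using D(3)[of "- (\<i> * of_real s)"] s by auto
    have h0: "h 0 = 0" using g(4)[of 0] g(1) by simp
    have up: "\<i> * of_real s \<in> Ap" "- (\<i> * of_real s) \<in> Am" using s h0 by (auto simp: Ap_def Am_def open_square_def)
    define PA PM where "PA = (*) \<tau> ` Ap" and "PM = (*) \<tau> ` Am"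
    note conn = conn[folded PA_def PM_def] and dis = dis[folded PA_def PM_def] and part = part[folded PA_def PM_def]
    have DP: "D \<inter> open_square \<delta> = D \<inter> (PA \<union> PM)" unfolding part[symmetric] using D(1) by blast
    have sides: "PA \<subseteq> D \<or> PA \<inter> D = {}" "PM \<subseteq> D \<or> PM \<inter> D = {}"
      by (rule side[OF conn(1) dis(1)], rule side[OF conn(2) dis(2)])
    have pts: "\<tau> * (\<i> * of_real s) \<in> PA" "\<tau> * - (\<i> * of_real s) \<in> PM"
      unfolding PA_def PM_def by (rule imageI[OF up(1)], rule imageI[OF up(2)])
    have "D \<inter> open_square \<delta> = PA \<or> D \<inter> open_square \<delta> = PM"
      using \<tau>
    proof
      assume t: "\<tau> = 1"
      have "\<not> PA \<inter> D = {}" "\<not> PM \<subseteq> D" using pts inD notD t by auto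
      then show ?thesis unfolding DP using sides by blast
    next
      assume t: "\<tau> = -1"
      have "\<not> PM \<inter> D = {}" "\<not> PA \<subseteq> D" using pts inD notD t by auto
      then show ?thesis unfolding DP using sides by blast
    qed
    then show "connected (D \<inter> open_square \<delta>)" using conn by auto
  qed
qed

end

section \<open>A side of the curve in half-plane coordinates\<close>

text \<open>
  \<open>S\<close> is the finite part of the side \<open>G\<close> under consideration, \<open>S'\<close> is the finite part of the
  other side, and \<open>n\<close> is the unit normal at \<open>p t0\<close> pointing towards \<open>G\<close>.
\<close>

locale curve_side = regular_curve +
  fixes t0 :: real and G :: "complex option set" and S S' :: "complex set" and n :: complex and r :: real
  assumes Some_in_G: "\<And>z. Some z \<in> G \<longleftrightarrow> z \<in> S"
    and open_S: "open S" and open_S': "open S'" and connected_S: "connected S"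
    and sides: "S \<inter> S' = {}" "S \<union> S' = - range p"
    and frontier_S: "frontier S = range p"
    and far: "\<exists>R. \<forall>z. norm z > R \<longrightarrow> (if None \<in> G then z \<in> S else z \<in> S')"
    and n: "norm n = 1" and r: "r > 0"
    and ball_S: "cball (p t0 + of_real r * n) r - {p t0} \<subseteq> S"
    and ball_S': "cball (p t0 - of_real r * n) r - {p t0} \<subseteq> S'"
begin

abbreviation "z0 \<equiv> p t0"

definition e :: complex where "e = z0 - 2 * of_real r * n"

text \<open>With this value the derivative of \<open>\<mu>\<close> at \<open>z0\<close> is
  \<open>\<i> / n\<close>: it has modulus 1, so slopes need no rescaling, and it turns
  \<open>n\<close> into the positive imaginary direction.\<close>

definition \<kappa> :: complex where "\<kappa> = 2 * \<i> * of_real r"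

text \<open>The exterior of the disc with diameter from \<open>e\<close> to \<open>z0\<close> is mapped to the upper half-plane,
  \<open>z0\<close> to 0, and infinity to \<open>\<kappa>\<close>.\<close>

definition \<mu> :: "complex \<Rightarrow> complex" where "\<mu> z = \<kappa> * (z - z0) / (z - e)"

definition \<nu> :: "complex \<Rightarrow> complex" where "\<nu> w = (e * w - \<kappa> * z0) / (w - \<kappa>)"

definition \<nu>E :: "complex \<Rightarrow> complex option" where
  "\<nu>E w = (if w = \<kappa> then None else Some (\<nu> w))"

text \<open>\<open>Some e\<close>, the pole of \<open>\<mu>\<close>, gets the default value 0 by
  division by zero, which is also the image of \<open>z0\<close>; this explains the conditions
  \<open>x \<noteq> Some e\<close>.\<close>

definition \<mu>E :: "complex option \<Rightarrow> complex" where
  "\<mu>E x = (case x of None \<Rightarrow> \<kappa> | Some z \<Rightarrow> \<mu> z)"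

definition D :: "complex set" where "D = {w. \<nu>E w \<in> G}"

lemma n_nonzero: "n \<noteq> 0" and \<kappa>_nonzero: "\<kappa> \<noteq> 0" and e_neq: "e \<noteq> z0" "z0 - e \<noteq> 0" "e - z0 \<noteq> 0"
  using n r by (auto simp: \<kappa>_def e_def)

lemma sides': "S \<inter> range p = {}" "S' \<inter> range p = {}" "z \<in> S \<or> z \<in> S' \<or> z \<in> range p"
  using sides by blast+

lemma e_in_S': "e \<in> S'"
proof -
  have "e \<in> cball (z0 - of_real r * n) r" using n r by (simp add: e_def dist_norm norm_mult)
  then show ?thesis using ball_S' e_neq by auto
qed

lemma e_notin: "e \<notin> S" "e \<notin> range p" using e_in_S' sides' sides(1) by blast+

lemma p_neq_e: "p t \<noteq> e" using e_notin(2) by (metis rangeI)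

lemma \<mu>_diff: "z \<noteq> e \<Longrightarrow> \<mu> z - \<kappa> = \<kappa> * (e - z0) / (z - e)"
  by (simp add: \<mu>_def divide_simps) (simp add: algebra_simps)

lemma \<mu>_neq: "z \<noteq> e \<Longrightarrow> \<mu> z \<noteq> \<kappa>"
  using \<mu>_diff[of z] \<kappa>_nonzero e_neq by auto

lemma \<nu>_\<mu>: "z \<noteq> e \<Longrightarrow> \<nu> (\<mu> z) = z"
proof -
  assume z: "z \<noteq> e"
  have "e * \<mu> z - \<kappa> * z0 = z * (\<kappa> * (e - z0) / (z - e))"
    using z by (simp add: \<mu>_def divide_simps) (simp add: algebra_simps)
  then show ?thesis unfolding \<nu>_def \<mu>_diff[OF z] using z \<kappa>_nonzero e_neq by simp
qed

lemma \<nu>_diff: "w \<noteq> \<kappa> \<Longrightarrow> \<nu> w - e = \<kappa> * (e - z0) / (w - \<kappa>)"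
  by (simp add: \<nu>_def divide_simps) (simp add: algebra_simps)

lemma \<nu>_neq: "w \<noteq> \<kappa> \<Longrightarrow> \<nu> w \<noteq> e"
  using \<nu>_diff[of w] \<kappa>_nonzero e_neq by auto

lemma \<mu>_\<nu>: "w \<noteq> \<kappa> \<Longrightarrow> \<mu> (\<nu> w) = w"
proof -
  assume w: "w \<noteq> \<kappa>"
  have "\<nu> w - z0 = w * (e - z0) / (w - \<kappa>)"
    using w by (simp add: \<nu>_def divide_simps) (simp add: algebra_simps)
  then show ?thesis unfolding \<mu>_def \<nu>_diff[OF w] using w \<kappa>_nonzero e_neq by simp
qed

lemma \<mu>E_\<nu>E: "\<mu>E (\<nu>E w) = w"
  by (simp add: \<mu>E_def \<nu>E_def \<mu>_\<nu>)

lemma \<nu>E_\<mu>E: "x \<noteq> Some e \<Longrightarrow> \<nu>E (\<mu>E x) = x"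
  by (cases x) (auto simp: \<mu>E_def \<nu>E_def \<nu>_\<mu> \<mu>_neq)

lemma e_notin_G: "Some e \<notin> G" using e_notin by (simp add: Some_in_G)

lemma \<mu>E_in_D: "x \<in> G \<Longrightarrow> \<mu>E x \<in> D"
  using \<nu>E_\<mu>E[of x] e_notin_G by (metis D_def mem_Collect_eq)

lemma D_eq: "D = {w. w \<noteq> \<kappa> \<and> \<nu> w \<in> S} \<union> (if None \<in> G then {\<kappa>} else {})"
  by (auto simp: D_def \<nu>E_def Some_in_G split: if_splits)

text \<open>The other side in the new coordinate, with \<open>\<kappa>\<close> if infinity belongs
  to it. No point of the plane corresponds to \<open>e\<close>, so \<open>D\<close>,
  \<open>D'\<close> and the image of the curve partition the plane, and \<open>D'\<close> is the
  open set that confines \<open>closure D\<close>.\<close>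

definition D' :: "complex set" where
  "D' = {w. w \<noteq> \<kappa> \<and> \<nu> w \<in> S'} \<union> (if None \<in> G then {} else {\<kappa>})"

lemma \<mu>_image: "e \<notin> A \<Longrightarrow> \<mu> ` A = {w. w \<noteq> \<kappa> \<and> \<nu> w \<in> A}"
proof (intro set_eqI iffI)
  fix w assume e: "e \<notin> A" and "w \<in> \<mu> ` A"
  then obtain z where z: "z \<in> A" "w = \<mu> z" by auto
  then have "z \<noteq> e" using e by blast
  then show "w \<in> {w. w \<noteq> \<kappa> \<and> \<nu> w \<in> A}" using z \<mu>_neq[of z] \<nu>_\<mu>[of z] by simp
next
  fix w assume "w \<in> {w. w \<noteq> \<kappa> \<and> \<nu> w \<in> A}"
  then show "w \<in> \<mu> ` A" using \<mu>_\<nu>[of w] by (intro image_eqI[of _ _ "\<nu> w"]) auto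
qed

lemma curve_image: "\<mu> ` range p = {w. w \<noteq> \<kappa> \<and> \<nu> w \<in> range p}"
  using \<mu>_image e_notin by blast

lemma partition: "D \<inter> D' = {}" "D \<inter> \<mu> ` range p = {}" "D' \<inter> \<mu> ` range p = {}" "D \<union> D' \<union> \<mu> ` range p = UNIV"
  unfolding D_eq D'_def curve_image using sides(1) sides'(1,2)
  by auto (use sides'(3) in blast)

lemma cont_\<nu>: "continuous_on (- {\<kappa>}) \<nu>" and cont_\<mu>: "continuous_on (- {e}) \<mu>"
  unfolding \<nu>_def[abs_def] \<mu>_def[abs_def] by (auto intro!: continuous_intros)

lemma near_\<kappa>: "\<exists>d>0. \<forall>w. w \<noteq> \<kappa> \<longrightarrow> dist w \<kappa> < d \<longrightarrow> norm (\<nu> w) > R"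
proof -
  define d where "d = norm (\<kappa> * (e - z0)) / (\<bar>R\<bar> + norm e + 1)"
  have pos: "\<bar>R\<bar> + norm e + 1 > 0" by (simp add: add_nonneg_pos)
  have "d > 0" using \<kappa>_nonzero e_neq pos by (simp add: d_def)
  moreover have "norm (\<nu> w) > R" if w: "w \<noteq> \<kappa>" "dist w \<kappa> < d" for w
  proof -
    have "norm (\<nu> w - e) = norm (\<kappa> * (e - z0)) / dist w \<kappa>"
      unfolding \<nu>_diff[OF w(1)] by (simp add: norm_divide dist_norm)
    moreover have "norm (\<kappa> * (e - z0)) / dist w \<kappa> > \<bar>R\<bar> + norm e + 1"
      using w pos unfolding d_def by (simp add: field_simps)
    ultimately show ?thesis using norm_triangle_ineq4[of "\<nu> w" e] by linarith
  qed
  ultimately show ?thesis by blast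
qed

lemma near_\<kappa>_side: "\<exists>d>0. \<forall>w. dist w \<kappa> < d \<longrightarrow> (if None \<in> G then w \<in> D else w \<in> D')"
proof -
  obtain R where R: "\<And>z. norm z > R \<Longrightarrow> (if None \<in> G then z \<in> S else z \<in> S')" using far by blast
  obtain d where "d > 0" "\<And>w. w \<noteq> \<kappa> \<Longrightarrow> dist w \<kappa> < d \<Longrightarrow> norm (\<nu> w) > R" using near_\<kappa> by blast
  then show ?thesis using R by (intro exI[of _ d]) (auto simp: D_eq D'_def)
qed

lemma open_preimage: "open A \<Longrightarrow> open {w. w \<noteq> \<kappa> \<and> \<nu> w \<in> A}"
  using continuous_open_preimage[OF cont_\<nu>, of A] by (simp add: open_Compl Int_def)

lemma open_D: "open D" and open_D': "open D'"
proof -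
  obtain d where d: "d > 0" "\<And>w. dist w \<kappa> < d \<Longrightarrow> (if None \<in> G then w \<in> D else w \<in> D')" using near_\<kappa>_side by blast
  have "D = {w. w \<noteq> \<kappa> \<and> \<nu> w \<in> S} \<union> (if None \<in> G then ball \<kappa> d else {})"
  proof (cases "None \<in> G")
    case True
    have "ball \<kappa> d \<subseteq> D" using d(2) True by (auto simp: dist_commute)
    moreover have "D = {w. w \<noteq> \<kappa> \<and> \<nu> w \<in> S} \<union> {\<kappa>}" using True by (simp add: D_eq)
    ultimately show ?thesis using True d(1) by auto
  qed (simp add: D_eq)
  then show "open D" using open_preimage[OF open_S] by (auto split: if_splits)
  have "D' = {w. w \<noteq> \<kappa> \<and> \<nu> w \<in> S'} \<union> (if None \<in> G then {} else ball \<kappa> d)"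
  proof (cases "None \<in> G")
    case False
    have "ball \<kappa> d \<subseteq> D'" using d(2) False by (auto simp: dist_commute)
    moreover have "D' = {w. w \<noteq> \<kappa> \<and> \<nu> w \<in> S'} \<union> {\<kappa>}" using False by (simp add: D'_def)
    ultimately show ?thesis using False d(1) by auto
  qed (simp add: D'_def)
  then show "open D'" using open_preimage[OF open_S'] by (auto split: if_splits)
qed

lemma closure_D: "closure D \<subseteq> D \<union> \<mu> ` range p"
proof -
  have "closure D \<subseteq> - D'"
    using partition(1) open_D' by (intro closure_minimal) auto
  then show ?thesis using partition(4) by blast
qed

lemma bounded_D: "bounded D"
proof -
  obtain c where c: "c > 0" "ball e c \<subseteq> S'" using open_S' e_in_S' openE by blast
  have "norm w \<le> norm \<kappa> * (1 + norm (e - z0) / c)" if "w \<in> D" for w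
  proof (cases "w = \<kappa>")
    case True
    have "norm \<kappa> * 1 \<le> norm \<kappa> * (1 + norm (e - z0) / c)" using c by (intro mult_left_mono) auto
    then show ?thesis using True by simp
  next
    case False
    then have "\<nu> w \<in> S" using that by (auto simp: D_eq split: if_splits)
    then have "norm (\<nu> w - e) \<ge> c" using c sides(1) by (force simp: dist_norm norm_minus_commute)
    have "w - \<kappa> = \<kappa> * (e - z0) / (\<nu> w - e)"
      using \<mu>_diff[OF \<nu>_neq[OF False]] \<mu>_\<nu>[OF False] by simp
    then have "norm (w - \<kappa>) = norm \<kappa> * norm (e - z0) / norm (\<nu> w - e)" by (simp add: norm_mult norm_divide)
    also have "\<dots> \<le> norm \<kappa> * norm (e - z0) / c"
      using c \<open>norm (\<nu> w - e) \<ge> c\<close> by (intro divide_left_mono mult_pos_pos mult_nonneg_nonneg) auto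
    finally show ?thesis using norm_triangle_sub[of w \<kappa>] by (simp add: algebra_simps)
  qed
  then show ?thesis unfolding bounded_iff by blast
qed

lemma curve_in_closure: "\<mu> ` range p \<subseteq> closure D"
proof
  fix w assume "w \<in> \<mu> ` range p"
  then obtain z where z: "z \<in> range p" "w = \<mu> z" by auto
  then have "z \<in> closure S" using frontier_S unfolding frontier_def by blast
  have "z \<noteq> e" using z(1) e_notin(2) by blast
  obtain f where f: "\<And>k. f k \<in> S" "f \<longlonglongrightarrow> z" using closure_sequential \<open>z \<in> closure S\<close> by blast
  have "(\<lambda>k. \<mu> (f k)) \<longlonglongrightarrow> \<mu> z"
    using f(2) \<open>z \<noteq> e\<close> unfolding \<mu>_def by (intro tendsto_intros) auto
  moreover have "\<mu> (f k) \<in> D" for k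
    using \<mu>E_in_D[of "Some (f k)"] f(1) by (simp add: \<mu>E_def Some_in_G)
  ultimately show "w \<in> closure D" unfolding closure_sequential z(2) by (intro exI[of _ "\<lambda>k. \<mu> (f k)"]) auto
qed

lemma frontier_D: "frontier D = \<mu> ` range p"
  using closure_D curve_in_closure partition(2) open_D by (auto simp: frontier_def interior_open)

lemma connected_D: "connected D"
proof -
  have im: "\<mu> ` S = {w. w \<noteq> \<kappa> \<and> \<nu> w \<in> S}" using \<mu>_image e_notin by blast
  have c: "connected (\<mu> ` S)"
    using e_notin by (intro connected_continuous_image connected_S continuous_on_subset[OF cont_\<mu>]) auto
  have "D \<subseteq> closure (\<mu> ` S)"
  proof
    fix w assume w: "w \<in> D"
    show "w \<in> closure (\<mu> ` S)"
    proof (cases "w = \<kappa>")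
      case False
      then have "w \<in> \<mu> ` S" unfolding im using w by (auto simp: D_eq split: if_splits)
      then show ?thesis by (rule subsetD[OF closure_subset])
    next
      case True
      then have inf: "None \<in> G" using w by (auto simp: D_eq split: if_splits)
      obtain d where d: "d > 0" "\<And>w. dist w \<kappa> < d \<Longrightarrow> w \<in> D" using near_\<kappa>_side inf by auto
      show ?thesis unfolding closure_approachable True
      proof (intro allI impI)
        fix \<epsilon> :: real assume "\<epsilon> > 0"
        define x where "x = \<kappa> + of_real (min \<epsilon> d / 2)"
        have "dist x \<kappa> = min \<epsilon> d / 2" using \<open>\<epsilon> > 0\<close> d(1) by (simp add: x_def dist_norm del: of_real_divide)
        then have "x \<in> D" "dist x \<kappa> < \<epsilon>" "x \<noteq> \<kappa>" using d \<open>\<epsilon> > 0\<close> by auto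
        then show "\<exists>y\<in>\<mu> ` S. dist y \<kappa> < \<epsilon>" unfolding im by (intro bexI[of _ x]) (auto simp: D_eq split: if_splits)
      qed
    qed
  qed
  moreover have "\<mu> ` S \<subseteq> D" unfolding im by (auto simp: D_eq)
  ultimately show ?thesis using connected_intermediate_closure[OF c] by blast
qed

text \<open>A bounded connected open set with connected frontier is simply connected, and the
  frontier of \<open>D\<close> is a continuous image of the curve.\<close>

lemma simply_connected_D: "simply_connected D"
proof -
  have "connected (\<mu> ` range p)"
    using e_notin by (intro connected_continuous_image connected_range continuous_on_subset[OF cont_\<mu>]) auto
  then show ?thesis
    using simply_connected_eq_frontier_properties[OF open_D] connected_D bounded_D frontier_D by simp
qed

lemma \<mu>_Im:
  assumes "z \<noteq> e"
  shows "Im (\<mu> z) > 0 \<longleftrightarrow> norm (z - (z0 - of_real r * n)) > r"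
proof -
  define u where "u = (z - z0) / n"
  have z: "z = z0 + u * n" using n_nonzero by (simp add: u_def)
  have u0: "u + 2 * of_real r \<noteq> 0" using assms by (auto simp: z e_def algebra_simps add_eq_0_iff)
  have "z - e = n * (u + 2 * of_real r)" by (simp add: z e_def algebra_simps)
  then have "\<mu> z = \<kappa> * (u / (u + 2 * of_real r))" using n_nonzero by (simp add: \<mu>_def z)
  also have "u / (u + 2 * of_real r) = of_real (1 / (norm (u + 2 * of_real r))\<^sup>2) * (u * cnj (u + 2 * of_real r))"
    by (subst complex_div_cnj) simp
  finally have "\<mu> z = \<i> * ((2 * r / (norm (u + 2 * of_real r))\<^sup>2) *\<^sub>R (u * cnj (u + 2 * of_real r)))"
    by (simp add: \<kappa>_def scaleR_conv_of_real)
  then have *: "Im (\<mu> z) = (2 * r / (norm (u + 2 * of_real r))\<^sup>2) * Re (u * cnj (u + 2 * of_real r))"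
    by simp
  have **: "2 * r / (norm (u + 2 * of_real r))\<^sup>2 > 0" using r u0 by simp
  have "Im (\<mu> z) > 0 \<longleftrightarrow> Re (u * cnj (u + 2 * of_real r)) > 0"
    unfolding * using ** by (metis mult_pos_pos zero_less_mult_pos)
  also have "\<dots> \<longleftrightarrow> r\<^sup>2 < (norm (u + of_real r))\<^sup>2"
    unfolding cmod_power2 by (simp add: power2_eq_square algebra_simps)
  also have "\<dots> \<longleftrightarrow> r < norm (u + of_real r)"
    using r power_strict_mono[of r "norm (u + of_real r)" 2] power_less_imp_less_base[of r 2 "norm (u + of_real r)"] by auto
  also have "norm (u + of_real r) = norm (z - (z0 - of_real r * n))"
  proof -
    have "z - (z0 - of_real r * n) = (u + of_real r) * n" by (simp add: z algebra_simps)
    then show ?thesis using n by (simp add: norm_mult)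
  qed
  finally show ?thesis .
qed

lemma curve_Im: "z \<in> range p \<Longrightarrow> z \<noteq> z0 \<Longrightarrow> Im (\<mu> z) > 0"
proof -
  assume z: "z \<in> range p" "z \<noteq> z0"
  then have "z \<notin> cball (z0 - of_real r * n) r" using ball_S' sides' by blast
  moreover have "z \<noteq> e" using z(1) e_notin(2) by blast
  ultimately show ?thesis by (subst \<mu>_Im) (auto simp: dist_norm norm_minus_commute)
qed

lemma \<mu>_z0: "\<mu> z0 = 0" by (simp add: \<mu>_def)

lemma D_upper: "w \<in> D \<Longrightarrow> Im w > 0"
proof (cases "w = \<kappa>")
  case True then show ?thesis using r by (simp add: \<kappa>_def)
next
  case False
  assume "w \<in> D"
  then have S: "\<nu> w \<in> S" using False by (auto simp: D_eq split: if_splits)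
  have "\<nu> w \<notin> cball (z0 - of_real r * n) r" using S ball_S' sides' sides(1) by blast
  then have "Im (\<mu> (\<nu> w)) > 0" using \<nu>_neq[OF False] by (subst \<mu>_Im) (auto simp: dist_norm norm_minus_commute)
  then show ?thesis by (simp add: \<mu>_\<nu>[OF False])
qed

text \<open>\<open>\<mu>\<close> sends the disc in \<open>S\<close> with diameter from
  \<open>z0\<close> to \<open>z0 + 2 r n\<close> onto the disc with diameter from 0 to
  \<open>\<i> r\<close>; this is where the radius \<open>r / 2\<close> comes from.\<close>

lemma ball_D: "ball (\<i> * of_real (r / 2)) (r / 2) \<subseteq> D"
proof
  fix w assume w: "w \<in> ball (\<i> * of_real (r / 2)) (r / 2)"
  define v where "v = - \<i> * w"
  have wv: "w = \<i> * v" by (simp add: v_def)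
  have "norm (w - \<i> * of_real (r / 2)) < r / 2" using w by (simp add: dist_norm norm_minus_commute)
  then have "(norm (w - \<i> * of_real (r / 2)))\<^sup>2 < (r / 2)\<^sup>2" by (intro power_strict_mono) auto
  then have v1: "(norm v)\<^sup>2 < r * Re v" unfolding cmod_power2 wv by (simp add: power2_eq_square algebra_simps)
  have v2: "2 * of_real r - v \<noteq> 0"
  proof
    assume "2 * of_real r - v = 0"
    then have "v = of_real (2 * r)" by simp
    then show False using v1 r by (simp add: power2_eq_square)
  qed
  have w\<kappa>: "w \<noteq> \<kappa>" using v2 by (auto simp: wv \<kappa>_def)
  define u where "u = 2 * of_real r * v / (2 * of_real r - v)"
  have nu: "\<nu> w = z0 + u * n"
  proof -
    define X where "X = 2 * of_real r - v"
    have X: "X \<noteq> 0" using v2 by (simp add: X_def)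
    have den: "w - \<kappa> = - \<i> * X" by (simp add: X_def wv \<kappa>_def algebra_simps)
    have num: "e * w - \<kappa> * z0 = - \<i> * (X * z0 + 2 * of_real r * v * n)"
      unfolding X_def wv \<kappa>_def e_def by (simp add: algebra_simps)
    have "\<nu> w = (X * z0 + 2 * of_real r * v * n) / X"
      unfolding \<nu>_def den num by simp
    then show ?thesis using X by (simp add: u_def X_def[symmetric] add_divide_distrib)
  qed
  have "norm (u - of_real r) < r"
  proof -
    have "u - of_real r = (2 * of_real r * v - of_real r * (2 * of_real r - v)) / (2 * of_real r - v)"
      unfolding u_def using v2 by (simp add: diff_divide_distrib)
    also have "2 * of_real r * v - of_real r * (2 * of_real r - v) = of_real r * (3 * v - 2 * of_real r)"
      by (simp add: algebra_simps)
    finally have "u - of_real r = of_real r * ((3 * v - 2 * of_real r) / (2 * of_real r - v))"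
      by simp
    then have "norm (u - of_real r) = r * (norm (3 * v - 2 * of_real r) / norm (2 * of_real r - v))"
      using r by (simp add: norm_mult norm_divide)
    moreover have "(norm (3 * v - 2 * of_real r))\<^sup>2 < (norm (2 * of_real r - v))\<^sup>2"
      using v1 unfolding cmod_power2 by (simp add: power2_eq_square algebra_simps)
    then have "norm (3 * v - 2 * of_real r) < norm (2 * of_real r - v)"
      using power_less_imp_less_base norm_ge_zero by blast
    then have "norm (3 * v - 2 * of_real r) / norm (2 * of_real r - v) < 1" using v2 by simp
    from mult_strict_left_mono[OF this r]
    have "r * (norm (3 * v - 2 * of_real r) / norm (2 * of_real r - v)) < r" by simp
    ultimately show ?thesis by (simp only:)
  qed
  moreover have "norm (\<nu> w - (z0 + of_real r * n)) = norm (u - of_real r)"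
  proof -
    have "\<nu> w - (z0 + of_real r * n) = (u - of_real r) * n" by (simp add: nu algebra_simps)
    then show ?thesis using n by (simp add: norm_mult)
  qed
  ultimately have "\<nu> w \<in> cball (z0 + of_real r * n) r" "\<nu> w \<noteq> z0"
    using n r by (auto simp: dist_norm norm_minus_commute norm_mult)
  then have "\<nu> w \<in> S" using ball_S by blast
  then show "w \<in> D" using w\<kappa> by (simp add: D_eq)
qed

lemma \<mu>_on_normal:
  assumes "s > 0"
  shows "\<mu> (z0 + of_real s * n) = \<i> * of_real (2 * r * s / (2 * r + s))"
proof -
  have "z0 + of_real s * n - e = n * of_real (2 * r + s)" by (simp add: e_def algebra_simps)
  then show ?thesis using n_nonzero r assms
    by (simp add: \<mu>_def \<kappa>_def divide_simps del: of_real_add)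
qed

lemma \<mu>_has_derivative: "z \<noteq> e \<Longrightarrow> (\<mu> has_field_derivative \<kappa> * (z0 - e) / (z - e)\<^sup>2) (at z)"
  unfolding \<mu>_def[abs_def]
  by (auto intro!: derivative_eq_intros simp: divide_simps power2_eq_square) (simp add: algebra_simps)

lemma \<mu>_curve: "regular_curve (\<lambda>t. \<mu> (p t)) (\<lambda>t. p' t * (\<kappa> * (z0 - e) / (p t - e)\<^sup>2))
    (\<lambda>t. p'' t * (\<kappa> * (z0 - e) / (p t - e)\<^sup>2) + p' t * (p' t * (- 2 * \<kappa> * (z0 - e) / (p t - e) ^ 3)))"
proof
  note ne = p_neq_e
  show "((\<lambda>t. \<mu> (p t)) has_vector_derivative p' t * (\<kappa> * (z0 - e) / (p t - e)\<^sup>2)) (at t)" for t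
    using field_vector_diff_chain_at[OF p \<mu>_has_derivative[OF ne]] by (simp add: o_def)
  show "((\<lambda>t. p' t * (\<kappa> * (z0 - e) / (p t - e)\<^sup>2)) has_vector_derivative
      p'' t * (\<kappa> * (z0 - e) / (p t - e)\<^sup>2) + p' t * (p' t * (- 2 * \<kappa> * (z0 - e) / (p t - e) ^ 3))) (at t)" for t
  proof -
    have "((\<lambda>z. \<kappa> * (z0 - e) / (z - e)\<^sup>2) has_field_derivative - 2 * \<kappa> * (z0 - e) / (p t - e) ^ 3) (at (p t))"
      using ne[of t] by (auto intro!: derivative_eq_intros simp: power2_eq_square power3_eq_cube divide_simps)
    from field_vector_diff_chain_at[OF p this]
    have "((\<lambda>t. \<kappa> * (z0 - e) / (p t - e)\<^sup>2) has_vector_derivative p' t * (- 2 * \<kappa> * (z0 - e) / (p t - e) ^ 3)) (at t)"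
      by (simp add: o_def)
    from has_vector_derivative_mult[OF p'[of t] this] show ?thesis by (simp add: add.commute)
  qed
  show "p' t * (\<kappa> * (z0 - e) / (p t - e)\<^sup>2) \<noteq> 0" for t
    using p'_nonzero[of t] \<kappa>_nonzero e_neq ne[of t] by simp
  show "\<mu> (p s) = \<mu> (p t) \<longleftrightarrow> cis s = cis t" for s t
    using p_eq_iff[of s t] \<nu>_\<mu>[OF ne[of s]] \<nu>_\<mu>[OF ne[of t]] by metis
qed

sublocale H: half_plane_domain D "r / 2"
proof
  show "open D" "simply_connected D" "bounded D" by (rule open_D simply_connected_D bounded_D)+
  show "Im z > 0" if "z \<in> D" for z using D_upper[OF that] .
  show "z = 0" if "z \<in> closure D" "Im z \<le> 0" for z
  proof -
    have "z \<notin> D" using D_upper[of z] that(2) by auto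
    then have "z \<in> \<mu> ` range p" using that(1) closure_D by blast
    then obtain x where x: "x \<in> range p" "z = \<mu> x" by blast
    then show ?thesis using curve_Im[OF x(1)] that(2) \<mu>_z0 by (cases "x = z0") auto
  qed
  show "r / 2 > 0" using r by simp
  show "ball (\<i> * of_real (r / 2)) (r / 2) \<subseteq> D" by (rule ball_D)
  interpret R: regular_curve "\<lambda>t. \<mu> (p t)" "\<lambda>t. p' t * (\<kappa> * (z0 - e) / (p t - e)\<^sup>2)"
    "\<lambda>t. p'' t * (\<kappa> * (z0 - e) / (p t - e)\<^sup>2) + p' t * (p' t * (- 2 * \<kappa> * (z0 - e) / (p t - e) ^ 3))"
    by (rule \<mu>_curve)
  have rg: "range (\<lambda>t. \<mu> (p t)) = \<mu> ` range p" by auto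
  show "\<exists>\<delta>0>0. \<forall>\<delta>. 0 < \<delta> \<longrightarrow> \<delta> < \<delta>0 \<longrightarrow> connected (D \<inter> open_square \<delta>)"
  proof (rule R.connected_small_squares[of t0 D "r / 2"])
    show "\<mu> (p t0) = 0" by (rule \<mu>_z0)
    show "Im (\<mu> (p t)) \<ge> 0" for t using curve_Im[of "p t"] \<mu>_z0 by (cases "p t = z0") auto
    show "D \<inter> range (\<lambda>t. \<mu> (p t)) = {}" "frontier D \<subseteq> range (\<lambda>t. \<mu> (p t))"
      using partition(2) frontier_D rg by auto
  qed (use D_upper ball_D r in auto)
qed

end

section \<open>Harmonic functions and Green's functions\<close>

lemma has_derivative_ln_norm:
  assumes f: "(f has_field_derivative f') (at z)" and nz: "f z \<noteq> (0::complex)"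
  shows "((\<lambda>z. ln (norm (f z))) has_derivative (\<lambda>h. Re (f' / f z * h))) (at z)"
proof -
  have f2: "(f has_derivative (\<lambda>h. f' * h)) (at z)" using f by (simp add: has_field_derivative_def)
  have "((\<lambda>z. norm (f z)) has_derivative (\<lambda>h. inner (f' * h) (sgn (f z)))) (at z)"
    by (rule has_derivative_compose[OF f2 has_derivative_norm[OF nz]])
  moreover have "(ln has_derivative (\<lambda>y. inverse (norm (f z)) * y)) (at (norm (f z)))"
    using DERIV_ln[of "norm (f z)"] nz by (simp add: has_field_derivative_def)
  ultimately have "((\<lambda>z. ln (norm (f z))) has_derivative (\<lambda>h. inverse (norm (f z)) * inner (f' * h) (sgn (f z)))) (at z)"
    by (rule has_derivative_compose)
  moreover have "inverse (norm c) * inner w (sgn c) = Re (w / c)" for w c :: complex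
  proof -
    have "inverse (norm c) * inner w (sgn c) = inner w c / (norm c)\<^sup>2"
      by (simp add: sgn_div_norm power2_eq_square field_simps)
    also have "\<dots> = Re (w / c)" by (simp add: Re_divide inner_complex_def cmod_power2)
    finally show ?thesis .
  qed
  ultimately show ?thesis by simp
qed

text \<open>The partial derivatives are \<open>Re F\<close> and \<open>- Im F\<close> for
  \<open>F = f' / f\<close>, so Laplace's equation is the Cauchy-Riemann relation for
  \<open>F\<close>.\<close>

lemma harmonic_on_ln_norm:
  assumes S: "open S" and f: "f holomorphic_on S" "\<And>z. z \<in> S \<Longrightarrow> f z \<noteq> 0"
    and u: "\<And>z. z \<in> S \<Longrightarrow> u z = ln (norm (f z))"
  shows "harmonic_on u S"
proof -
  define F where "F = (\<lambda>z. deriv f z / f z)"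
  have F: "F holomorphic_on S" unfolding F_def by (intro holomorphic_intros f S)
  then have F': "deriv F holomorphic_on S" by (rule holomorphic_deriv[OF _ S])
  have dF: "(F has_derivative (\<lambda>h. deriv F z * h)) (at z)" if "z \<in> S" for z
    using holomorphic_derivI[OF F S that] by (simp add: has_field_derivative_def)
  have du: "(u has_derivative (\<lambda>h. Re (F z) * Re h + (- Im (F z)) * Im h)) (at z)" if "z \<in> S" for z
  proof -
    have "((\<lambda>z. ln (norm (f z))) has_derivative (\<lambda>h. Re (F z * h))) (at z)"
      unfolding F_def by (rule has_derivative_ln_norm[OF holomorphic_derivI[OF f(1) S that] f(2)[OF that]])
    then have "(u has_derivative (\<lambda>h. Re (F z * h))) (at z)"
      by (rule has_derivative_transform_within_open[OF _ S that]) (simp add: u)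
    then show ?thesis by simp
  qed
  have dx: "((\<lambda>z. Re (F z)) has_derivative (\<lambda>h. Re (deriv F z) * Re h + (- Im (deriv F z)) * Im h)) (at z)" if "z \<in> S" for z
    using has_derivative_Re[OF dF[OF that]] by simp
  have dy: "((\<lambda>z. - Im (F z)) has_derivative (\<lambda>h. (- Im (deriv F z)) * Re h + (- Re (deriv F z)) * Im h)) (at z)" if "z \<in> S" for z
    using has_derivative_minus[OF has_derivative_Im[OF dF[OF that]]] by (simp add: algebra_simps)
  have cont: "continuous_on S (\<lambda>z. Re (deriv F z))" "continuous_on S (\<lambda>z. - Im (deriv F z))" "continuous_on S (\<lambda>z. - Re (deriv F z))"
    using holomorphic_on_imp_continuous_on[OF F'] by (auto intro!: continuous_intros)
  show ?thesis unfolding harmonic_on_def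
  proof (intro conjI S)
    show "\<exists>ux uy uxx uxy uyx uyy.
        (\<forall>z\<in>S. (u has_derivative (\<lambda>h. ux z * Re h + uy z * Im h)) (at z) \<and>
           (ux has_derivative (\<lambda>h. uxx z * Re h + uxy z * Im h)) (at z) \<and>
           (uy has_derivative (\<lambda>h. uyx z * Re h + uyy z * Im h)) (at z) \<and>
           uxx z + uyy z = 0) \<and>
        continuous_on S uxx \<and> continuous_on S uxy \<and> continuous_on S uyx \<and> continuous_on S uyy"
      apply (rule exI[of _ "\<lambda>z. Re (F z)"], rule exI[of _ "\<lambda>z. - Im (F z)"])
      apply (rule exI[of _ "\<lambda>z. Re (deriv F z)"], rule exI[of _ "\<lambda>z. - Im (deriv F z)"])
      apply (rule exI[of _ "\<lambda>z. - Im (deriv F z)"], rule exI[of _ "\<lambda>z. - Re (deriv F z)"])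
      apply (intro conjI ballI du dx dy cont; simp)
      done
  qed
qed

lemma harmonic_on_linear:
  assumes "harmonic_on u S" "harmonic_on v S"
  shows "harmonic_on (\<lambda>z. c * u z + d * v z) S"
proof -
  obtain ux uy uxx uxy uyx uyy where u: "\<And>z. z \<in> S \<Longrightarrow> (u has_derivative (\<lambda>h. ux z * Re h + uy z * Im h)) (at z)"
     "\<And>z. z \<in> S \<Longrightarrow> (ux has_derivative (\<lambda>h. uxx z * Re h + uxy z * Im h)) (at z)"
     "\<And>z. z \<in> S \<Longrightarrow> (uy has_derivative (\<lambda>h. uyx z * Re h + uyy z * Im h)) (at z)"
     "\<And>z. z \<in> S \<Longrightarrow> uxx z + uyy z = 0"
     "continuous_on S uxx" "continuous_on S uxy" "continuous_on S uyx" "continuous_on S uyy" and S: "open S"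
    using assms(1) unfolding harmonic_on_def by blast
  obtain vx vy vxx vxy vyx vyy where v: "\<And>z. z \<in> S \<Longrightarrow> (v has_derivative (\<lambda>h. vx z * Re h + vy z * Im h)) (at z)"
     "\<And>z. z \<in> S \<Longrightarrow> (vx has_derivative (\<lambda>h. vxx z * Re h + vxy z * Im h)) (at z)"
     "\<And>z. z \<in> S \<Longrightarrow> (vy has_derivative (\<lambda>h. vyx z * Re h + vyy z * Im h)) (at z)"
     "\<And>z. z \<in> S \<Longrightarrow> vxx z + vyy z = 0"
     "continuous_on S vxx" "continuous_on S vxy" "continuous_on S vyx" "continuous_on S vyy"
    using assms(2) unfolding harmonic_on_def by blast
  have lin: "((\<lambda>z. c * p z + d * q z) has_derivative (\<lambda>h. (c * p1 + d * q1) * Re h + (c * p2 + d * q2) * Im h)) (at z)"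
    if "(p has_derivative (\<lambda>h. p1 * Re h + p2 * Im h)) (at z)" "(q has_derivative (\<lambda>h. q1 * Re h + q2 * Im h)) (at z)"
    for p q :: "complex \<Rightarrow> real" and p1 p2 q1 q2 z
    using has_derivative_add[OF has_derivative_mult_right[OF that(1), of c] has_derivative_mult_right[OF that(2), of d]]
    by (simp add: algebra_simps)
  have lap: "(c * uxx z + d * vxx z) + (c * uyy z + d * vyy z) = 0" if "z \<in> S" for z
  proof -
    have "(c * uxx z + d * vxx z) + (c * uyy z + d * vyy z) = c * (uxx z + uyy z) + d * (vxx z + vyy z)"
      by (simp add: algebra_simps)
    then show ?thesis using u(4)[OF that] v(4)[OF that] by simp
  qed
  show ?thesis unfolding harmonic_on_def
  proof (intro conjI S)
    show "\<exists>wx wy wxx wxy wyx wyy.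
        (\<forall>z\<in>S. ((\<lambda>z. c * u z + d * v z) has_derivative (\<lambda>h. wx z * Re h + wy z * Im h)) (at z) \<and>
           (wx has_derivative (\<lambda>h. wxx z * Re h + wxy z * Im h)) (at z) \<and>
           (wy has_derivative (\<lambda>h. wyx z * Re h + wyy z * Im h)) (at z) \<and>
           wxx z + wyy z = 0) \<and>
        continuous_on S wxx \<and> continuous_on S wxy \<and> continuous_on S wyx \<and> continuous_on S wyy"
      apply (rule exI[of _ "\<lambda>z. c * ux z + d * vx z"], rule exI[of _ "\<lambda>z. c * uy z + d * vy z"])
      apply (rule exI[of _ "\<lambda>z. c * uxx z + d * vxx z"], rule exI[of _ "\<lambda>z. c * uxy z + d * vxy z"])
      apply (rule exI[of _ "\<lambda>z. c * uyx z + d * vyx z"], rule exI[of _ "\<lambda>z. c * uyy z + d * vyy z"])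
      apply (intro conjI ballI lin u v lap continuous_on_add continuous_on_mult_left; assumption?)
      done
  qed
qed

lemma harmonic_on_isCont: "harmonic_on u S \<Longrightarrow> z \<in> S \<Longrightarrow> isCont u z"
  unfolding harmonic_on_def by (auto intro: has_derivative_continuous)

lemma no_local_max_1d:
  fixes f f' :: "real \<Rightarrow> real"
  assumes \<delta>: "\<delta> > 0" and f: "\<And>t. \<bar>t\<bar> < \<delta> \<Longrightarrow> (f has_real_derivative f' t) (at t)"
    and f': "(f' has_real_derivative c) (at 0)" "c > 0"
    and mx: "\<And>t. \<bar>t\<bar> < \<delta> \<Longrightarrow> f t \<le> f 0"
  shows False
proof -
  have "f' 0 = 0" by (rule DERIV_local_max[OF f[of 0] \<delta>]) (use mx \<delta> in auto)
  obtain d where d: "d > 0" "\<And>h. h > 0 \<Longrightarrow> h < d \<Longrightarrow> f' 0 < f' (0 + h)"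
    using DERIV_pos_inc_right[OF f'] by auto
  define t where "t = min \<delta> d / 2"
  have t: "0 < t" "t < \<delta>" "t < d" using \<delta> d(1) by (auto simp: t_def)
  obtain z where z: "0 < z" "z < t" "f t - f 0 = (t - 0) * f' z"
    using MVT2[OF t(1), of f f'] f t by force
  have "f' z > 0" using d(2)[of z] z t \<open>f' 0 = 0\<close> by simp
  then have "f t - f 0 > 0" unfolding z(3) using t by simp
  then show False using mx[of t] t by simp
qed

text \<open>Along the line through \<open>y\<close> in direction \<open>w\<close> the second
  derivative is \<open>c w\<close>. Adding the directions 1 and \<open>\<i>\<close> cancels the
  harmonic part and leaves \<open>4 \<epsilon> |deriv m y|^2 > 0\<close>, so one of the two is
  positive. The function \<open>m\<close> is meant as a coordinate read in a chart.\<close>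

lemma no_local_max:
  assumes h: "harmonic_on h S" and y: "y \<in> S" and m: "m holomorphic_on S" "deriv m y \<noteq> 0" and \<epsilon>: "\<epsilon> > 0"
    and d: "d > 0" and mx: "\<And>z. dist z y < d \<Longrightarrow> h z + \<epsilon> * (norm (m z))\<^sup>2 \<le> h y + \<epsilon> * (norm (m y))\<^sup>2"
  shows False
proof -
  obtain hx hy hxx hxy hyx hyy where hh: "\<And>z. z \<in> S \<Longrightarrow> (h has_derivative (\<lambda>w. hx z * Re w + hy z * Im w)) (at z)"
     "\<And>z. z \<in> S \<Longrightarrow> (hx has_derivative (\<lambda>w. hxx z * Re w + hxy z * Im w)) (at z)"
     "\<And>z. z \<in> S \<Longrightarrow> (hy has_derivative (\<lambda>w. hyx z * Re w + hyy z * Im w)) (at z)"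
     "\<And>z. z \<in> S \<Longrightarrow> hxx z + hyy z = 0" and S: "open S"
    using h unfolding harmonic_on_def by blast
  obtain d1 where d1: "d1 > 0" "ball y d1 \<subseteq> S" using S y openE by blast
  define \<delta> where "\<delta> = min d d1"
  have \<delta>: "\<delta> > 0" using d d1 by (simp add: \<delta>_def)
  define m1 m2 where "m1 = deriv m" and "m2 = deriv m1"
  have m1h: "m1 holomorphic_on S" unfolding m1_def by (rule holomorphic_deriv[OF m(1) S])
  have dm: "(m has_field_derivative m1 z) (at z)" and dm1: "(m1 has_field_derivative m2 z) (at z)" if "z \<in> S" for z
    using holomorphic_derivI[OF m(1) S that] holomorphic_derivI[OF m1h S that] by (auto simp: m1_def m2_def)
  define c where "c = (\<lambda>w. (hxx y * Re w + hxy y * Im w) * Re w + (hyx y * Re w + hyy y * Im w) * Im w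
     + 2 * \<epsilon> * (Re (w * m1 y) * Re (w * m1 y) + Im (w * m1 y) * Im (w * m1 y) + Re (m y) * Re (w * (w * m2 y)) + Im (m y) * Im (w * (w * m2 y))))"
  have *: "c w \<le> 0" if w: "norm w = 1" for w
  proof (rule ccontr)
    assume "\<not> c w \<le> 0"
    define l where "l = (\<lambda>t. y + of_real t * w)"
    have inS: "l t \<in> S" "dist (l t) y < d" if "\<bar>t\<bar> < \<delta>" for t
    proof -
      have "dist (l t) y = \<bar>t\<bar>" using w by (simp add: l_def dist_norm norm_mult)
      then show "l t \<in> S" "dist (l t) y < d" using that d1(2) by (auto simp: \<delta>_def dist_commute subset_iff)
    qed
    have l0: "l 0 = y" by (simp add: l_def)
    have dl: "(l has_vector_derivative w) (at t)" for t unfolding l_def by (auto intro!: derivative_eq_intros)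
    have real_chain: "((\<lambda>t. k (l t)) has_real_derivative kx * Re w + ky * Im w) (at t)"
      if "(k has_derivative (\<lambda>w. kx * Re w + ky * Im w)) (at (l t))" for k kx ky t
    proof -
      have "((\<lambda>t. k (l t)) has_derivative (\<lambda>s. kx * Re (s *\<^sub>R w) + ky * Im (s *\<^sub>R w))) (at t)"
        using has_derivative_compose[OF dl[of t, unfolded has_vector_derivative_def] that] by simp
      then show ?thesis unfolding has_field_derivative_def by (rule has_derivative_eq_rhs) (auto simp: algebra_simps)
    qed
    have cplx_chain: "((\<lambda>t. k (l t)) has_vector_derivative w * k') (at t)"
      if "(k has_field_derivative k') (at (l t))" for k k' t
      using field_vector_diff_chain_at[OF dl that] by (simp add: o_def)
    define X Y X1 Y1 where "X = (\<lambda>t. Re (m (l t)))" and "Y = (\<lambda>t. Im (m (l t)))"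
      and "X1 = (\<lambda>t. Re (w * m1 (l t)))" and "Y1 = (\<lambda>t. Im (w * m1 (l t)))"
    have XY: "(X has_real_derivative X1 t) (at t)" "(Y has_real_derivative Y1 t) (at t)" if "\<bar>t\<bar> < \<delta>" for t
      using cplx_chain[OF dm[OF inS(1)[OF that]]] by (auto simp: has_vector_derivative_complex_iff X_def Y_def X1_def Y1_def)
    have "((\<lambda>t. w * m1 (l t)) has_vector_derivative w * (w * m2 y)) (at 0)"
      using cplx_chain[OF dm1[OF inS(1)[of 0]]] \<delta> by (intro has_vector_derivative_mult_right) (simp add: l0)
    then have XY1: "(X1 has_real_derivative Re (w * (w * m2 y))) (at 0)" "(Y1 has_real_derivative Im (w * (w * m2 y))) (at 0)"
      by (auto simp: has_vector_derivative_complex_iff X1_def Y1_def)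
    have nm: "(norm (m (l t)))\<^sup>2 = X t * X t + Y t * Y t" for t
      unfolding cmod_power2 by (simp add: X_def Y_def power2_eq_square)
    define f f' where "f = (\<lambda>t. h (l t) + \<epsilon> * (X t * X t + Y t * Y t))"
      and "f' = (\<lambda>t. (hx (l t) * Re w + hy (l t) * Im w) + \<epsilon> * (2 * (X t * X1 t + Y t * Y1 t)))"
    show False
    proof (rule no_local_max_1d[OF \<delta>, of f f' "c w"])
      fix t assume t: "\<bar>t\<bar> < \<delta>"
      have "(f has_real_derivative (hx (l t) * Re w + hy (l t) * Im w) + \<epsilon> * ((X1 t * X t + X1 t * X t) + (Y1 t * Y t + Y1 t * Y t))) (at t)"
        unfolding f_def using inS(1)[OF t] XY[OF t]
        by (intro DERIV_add real_chain hh(1) DERIV_cmult DERIV_mult) auto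
      then show "(f has_real_derivative f' t) (at t)" unfolding f'_def by (simp add: algebra_simps)
      show "f t \<le> f 0" unfolding f_def nm[symmetric] l0 by (rule mx[OF inS(2)[OF t]])
    next
      have y0: "l 0 \<in> S" using y l0 by simp
      have hx0: "((\<lambda>t. hx (l t)) has_real_derivative hxx y * Re w + hxy y * Im w) (at 0)"
        using real_chain[OF hh(2)[OF y0]] by (simp add: l0)
      have hy0: "((\<lambda>t. hy (l t)) has_real_derivative hyx y * Re w + hyy y * Im w) (at 0)"
        using real_chain[OF hh(3)[OF y0]] by (simp add: l0)
      have XY0: "(X has_real_derivative X1 0) (at 0)" "(Y has_real_derivative Y1 0) (at 0)" using XY[of 0] \<delta> by auto
      have "(f' has_real_derivative ((hxx y * Re w + hxy y * Im w) * Re w + (hyx y * Re w + hyy y * Im w) * Im w)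
         + \<epsilon> * (2 * ((X1 0 * X1 0 + Re (w * (w * m2 y)) * X 0) + (Y1 0 * Y1 0 + Im (w * (w * m2 y)) * Y 0)))) (at 0)"
        unfolding f'_def by (intro DERIV_add DERIV_cmult DERIV_cmult_right DERIV_mult hx0 hy0 XY0 XY1)
      moreover have "((hxx y * Re w + hxy y * Im w) * Re w + (hyx y * Re w + hyy y * Im w) * Im w)
         + \<epsilon> * (2 * ((X1 0 * X1 0 + Re (w * (w * m2 y)) * X 0) + (Y1 0 * Y1 0 + Im (w * (w * m2 y)) * Y 0))) = c w"
        unfolding c_def X1_def Y1_def X_def Y_def l0 by (simp only: ac_simps)
      ultimately show "(f' has_real_derivative c w) (at 0)" by simp
      show "c w > 0" using \<open>\<not> c w \<le> 0\<close> by simp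
    qed
  qed
  have "c 1 + c \<i> = (hxx y + hyy y) + 4 * \<epsilon> * ((Re (m1 y))\<^sup>2 + (Im (m1 y))\<^sup>2)"
    by (simp add: c_def power2_eq_square algebra_simps)
  moreover have "hxx y + hyy y = 0" by (rule hh(4)[OF y])
  moreover have "(Re (m1 y))\<^sup>2 + (Im (m1 y))\<^sup>2 > 0"
    using m(2) by (simp add: m1_def sum_power2_gt_zero_iff complex_eq_iff)
  then have "4 * \<epsilon> * ((Re (m1 y))\<^sup>2 + (Im (m1 y))\<^sup>2) > 0" using \<epsilon> by simp
  ultimately show False using *[of 1] *[of \<i>] by simp
qed

lemma openin_extended_plane_iff:
  "openin extended_plane T \<longleftrightarrow> open (Some -` T) \<and> (None \<in> T \<longrightarrow> bounded (- (Some -` T)))"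
proof
  assume "openin extended_plane T"
  then consider U where "open U" "T = Some ` U" | C where "compact C" "T = insert None (Some ` (- C))"
    by (auto simp: openin_Alexandroff_compactification Compl_eq_Diff_UNIV)
  then show "open (Some -` T) \<and> (None \<in> T \<longrightarrow> bounded (- (Some -` T)))"
  proof cases
    case 1
    then have "Some -` T = U" by auto
    then show ?thesis using 1 by auto
  next
    case 2
    then have "Some -` T = - C" by auto
    then show ?thesis using 2 by (auto simp: compact_imp_closed compact_imp_bounded open_Compl)
  qed
next
  assume a: "open (Some -` T) \<and> (None \<in> T \<longrightarrow> bounded (- (Some -` T)))"
  show "openin extended_plane T"
  proof (cases "None \<in> T")
    case True
    have "T = insert None (Some ` (UNIV - (- (Some -` T))))"
    proof (rule set_eqI)
      fix x show "x \<in> T \<longleftrightarrow> x \<in> insert None (Some ` (UNIV - (- (Some -` T))))" using True by (cases x) auto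
    qed
    moreover have "compact (- (Some -` T))" using a True by (simp add: compact_eq_bounded_closed closed_Compl)
    ultimately show ?thesis
      unfolding openin_Alexandroff_compactification by (metis compactin_euclidean_iff compact_imp_closed closed_closedin topspace_euclidean)
  next
    case False
    have "T = Some ` (Some -` T)"
    proof (rule set_eqI)
      fix x show "x \<in> T \<longleftrightarrow> x \<in> Some ` (Some -` T)" using False by (cases x) auto
    qed
    then show ?thesis using a unfolding openin_Alexandroff_compactification by (metis open_openin)
  qed
qed

section \<open>Green's function of a side from Blaschke factors\<close>

context curve_side
begin

lemma continuous_\<nu>E: "openin extended_plane T \<Longrightarrow> open {w. \<nu>E w \<in> T}"
proof -
  assume "openin extended_plane T"
  then have T: "open (Some -` T)" "None \<in> T \<Longrightarrow> bounded (- (Some -` T))" by (auto simp: openin_extended_plane_iff)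
  have o: "open {w. w \<noteq> \<kappa> \<and> \<nu> w \<in> Some -` T}" by (rule open_preimage[OF T(1)])
  show ?thesis
  proof (cases "None \<in> T")
    case False
    then have "{w. \<nu>E w \<in> T} = {w. w \<noteq> \<kappa> \<and> \<nu> w \<in> Some -` T}" by (auto simp: \<nu>E_def split: if_splits)
    then show ?thesis using o by simp
  next
    case True
    obtain R where R: "\<And>z. z \<in> - (Some -` T) \<Longrightarrow> norm z \<le> R" using T(2)[OF True] unfolding bounded_iff by blast
    obtain d where d: "d > 0" "\<And>w. w \<noteq> \<kappa> \<Longrightarrow> dist w \<kappa> < d \<Longrightarrow> norm (\<nu> w) > R" using near_\<kappa> by blast
    have sub: "\<nu>E w \<in> T" if "dist w \<kappa> < d" for w
      using d(2)[OF _ that] R[of "\<nu> w"] True by (cases "w = \<kappa>") (auto simp: \<nu>E_def)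
    have "{w. \<nu>E w \<in> T} = {w. w \<noteq> \<kappa> \<and> \<nu> w \<in> Some -` T} \<union> ball \<kappa> d"
    proof (intro set_eqI iffI)
      fix w assume "w \<in> {w. \<nu>E w \<in> T}"
      then show "w \<in> {w. w \<noteq> \<kappa> \<and> \<nu> w \<in> Some -` T} \<union> ball \<kappa> d"
        using d(1) by (cases "w = \<kappa>") (auto simp: \<nu>E_def)
    next
      fix w assume "w \<in> {w. w \<noteq> \<kappa> \<and> \<nu> w \<in> Some -` T} \<union> ball \<kappa> d"
      then show "w \<in> {w. \<nu>E w \<in> T}" using sub[of w] by (auto simp: \<nu>E_def dist_commute)
    qed
    then show ?thesis using o by auto
  qed
qed

lemma in_G_iff: "x \<in> G \<longleftrightarrow> x \<noteq> Some e \<and> \<mu>E x \<in> D"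
  using e_notin_G \<mu>E_in_D \<nu>E_\<mu>E by (metis D_def mem_Collect_eq)

lemma frontier_of_G: "extended_plane frontier_of G = Some ` range p"
proof -
  obtain R where R: "\<And>z. norm z > R \<Longrightarrow> (if None \<in> G then z \<in> S else z \<in> S')" using far by blast
  have oG: "openin extended_plane G"
  proof -
    have "Some -` G = S" using Some_in_G by auto
    moreover have "bounded (- S)" if "None \<in> G"
      unfolding bounded_iff using R that by (metis ComplD linorder_not_less)
    ultimately show ?thesis using open_S by (simp add: openin_extended_plane_iff)
  qed
  have op: "openin extended_plane (- (G \<union> Some ` range p))"
  proof -
    have "Some -` (- (G \<union> Some ` range p)) = S'"
    proof (rule set_eqI)
      fix z show "z \<in> Some -` (- (G \<union> Some ` range p)) \<longleftrightarrow> z \<in> S'"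
        using Some_in_G[of z] sides(1) sides'(1,2) sides'(3)[of z] by blast
    qed
    moreover have "bounded (- S')" if "None \<notin> G"
      unfolding bounded_iff using R that by (metis ComplD linorder_not_less)
    ultimately show ?thesis using open_S' by (auto simp: openin_extended_plane_iff)
  qed
  have c1: "x \<in> extended_plane closure_of G" if x: "x \<in> Some ` range p" for x
    unfolding in_closure_of
  proof (intro conjI allI impI)
    fix T assume T: "x \<in> T \<and> openin extended_plane T"
    obtain z where z: "z \<in> range p" "x = Some z" using x by auto
    have "z \<in> closure S" using z frontier_S by (auto simp: frontier_def)
    moreover have "open (Some -` T)" "z \<in> Some -` T" using T z by (auto simp: openin_extended_plane_iff)
    ultimately have "S \<inter> Some -` T \<noteq> {}" by (metis IntI empty_iff open_Int_closure_eq_empty inf_commute)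
    then show "\<exists>y. y \<in> G \<and> y \<in> T" using Some_in_G by blast
  next
    show "x \<in> topspace extended_plane" using x by auto
  qed
  have c2: "x \<in> G \<union> Some ` range p" if x: "x \<in> extended_plane closure_of G" for x
  proof (rule ccontr)
    assume "x \<notin> G \<union> Some ` range p"
    then obtain y where "y \<in> G" "y \<in> - (G \<union> Some ` range p)"
      using op x unfolding in_closure_of by (metis ComplI)
    then show False by simp
  qed
  have c3: "Some z \<notin> G" if "z \<in> range p" for z using that sides'(1) Some_in_G by blast
  show ?thesis unfolding frontier_of_def interior_of_openin[OF oG]
  proof (intro equalityI subsetI)
    fix x assume "x \<in> extended_plane closure_of G - G"
    then show "x \<in> Some ` range p" using c2[of x] by (metis DiffE UnE)
  next
    fix x assume x: "x \<in> Some ` range p"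
    then have "x \<notin> G" using c3 by (metis imageE)
    then show "x \<in> extended_plane closure_of G - G" using c1[OF x] by simp
  qed
qed

text \<open>At the pole the value is 0 through the convention \<open>ln 0 = 0\<close>, which is what
  \<open>is_Green_function\<close> prescribes there.\<close>

definition gr :: "complex option \<Rightarrow> complex option \<Rightarrow> real" where
  "gr a x = (if x \<in> G then - ln (norm (blaschke D (\<mu>E a) (\<mu>E x))) else 0)"

text \<open>Harmonicity on the extended plane is tested in two charts, which this predicate treats
  alike: \<open>m\<close> is the half-plane coordinate \<open>\<mu>E\<close> read in the chart
  \<open>c\<close>, and \<open>W\<close> leaves out at most the parameter of
  \<open>e\<close>.\<close>

definition chart :: "(complex \<Rightarrow> complex option) \<Rightarrow> (complex \<Rightarrow> complex) \<Rightarrow> complex set \<Rightarrow> bool" where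
  "chart c m W \<longleftrightarrow> open W \<and> m holomorphic_on W \<and> (\<forall>w\<in>W. deriv m w \<noteq> 0) \<and>
     (\<forall>w. c w \<noteq> Some e \<longleftrightarrow> w \<in> W) \<and> (\<forall>w\<in>W. \<mu>E (c w) = m w)"

lemma chart_Some: "chart Some \<mu> (- {e})"
proof -
  have d: "(\<mu> has_field_derivative \<kappa> * (z0 - e) / (z - e)\<^sup>2) (at z)" if "z \<in> - {e}" for z
    using \<mu>_has_derivative that by simp
  have "\<mu> holomorphic_on - {e}" unfolding \<mu>_def[abs_def] by (intro holomorphic_intros) auto
  moreover have "deriv \<mu> z \<noteq> 0" if "z \<in> - {e}" for z
    using DERIV_imp_deriv[OF d[OF that]] that \<kappa>_nonzero e_neq by simp
  ultimately show ?thesis by (auto simp: chart_def \<mu>E_def)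
qed

lemma chart_inversion: "chart inversion_chart (\<lambda>w. \<kappa> * (1 - z0 * w) / (1 - e * w)) {w. 1 - e * w \<noteq> 0}"
proof -
  define W where "W = {w. 1 - e * w \<noteq> 0}"
  have d: "((\<lambda>w. \<kappa> * (1 - z0 * w) / (1 - e * w)) has_field_derivative \<kappa> * (e - z0) / (1 - e * w)\<^sup>2) (at w)"
    if "w \<in> W" for w
    using that unfolding W_def
    by (auto intro!: derivative_eq_intros simp: divide_simps power2_eq_square) (simp_all add: algebra_simps)
  have "open W" unfolding W_def by (intro open_Collect_neq continuous_intros)
  moreover have "(\<lambda>w. \<kappa> * (1 - z0 * w) / (1 - e * w)) holomorphic_on W"
    unfolding W_def by (intro holomorphic_intros) auto
  moreover have "deriv (\<lambda>w. \<kappa> * (1 - z0 * w) / (1 - e * w)) w \<noteq> 0" if "w \<in> W" for w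
    using DERIV_imp_deriv[OF d[OF that]] that \<kappa>_nonzero e_neq by (simp add: W_def)
  moreover have "inversion_chart w \<noteq> Some e \<longleftrightarrow> w \<in> W" for w
    by (auto simp: W_def inversion_chart_def field_simps)
  moreover have "\<mu>E (inversion_chart w) = \<kappa> * (1 - z0 * w) / (1 - e * w)" if "w \<in> W" for w
    using that by (auto simp: W_def inversion_chart_def \<mu>E_def \<mu>_def divide_simps) 
  ultimately show ?thesis unfolding chart_def W_def[symmetric] by blast
qed

lemma chart_cover: "\<exists>c m W w. chart c m W \<and> c w = x \<and> c \<in> {Some, inversion_chart}"
proof (cases x)
  case None
  then have "inversion_chart 0 = x" by (simp add: inversion_chart_def)
  then show ?thesis using chart_inversion by blast
next
  case (Some z) then show ?thesis using chart_Some by blast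
qed

lemma chart_preimage:
  assumes c: "chart c m W" and "a \<in> G"
  shows "c w \<in> G - {a} \<longleftrightarrow> w \<in> W \<and> m w \<in> D - {\<mu>E a}"
proof -
  have "c w = a" if "w \<in> W" "m w = \<mu>E a"
    using that c \<nu>E_\<mu>E[of "c w"] \<nu>E_\<mu>E[of a] \<open>a \<in> G\<close> e_notin_G unfolding chart_def by metis
  moreover have "c w = a \<Longrightarrow> w \<in> W \<and> m w = \<mu>E a" using c \<open>a \<in> G\<close> e_notin_G unfolding chart_def by metis
  moreover have "c w \<in> G \<longleftrightarrow> w \<in> W \<and> m w \<in> D"
    using c unfolding chart_def in_G_iff[of "c w"] by metis
  ultimately show ?thesis by blast
qed

lemma harmonic_on_gr_chart:
  assumes c: "chart c m W" and a: "a \<in> G"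
  shows "harmonic_on (gr a \<circ> c) (c -` (G - {a}))"
proof -
  have eq: "c -` (G - {a}) = {w \<in> W. m w \<in> D - {\<mu>E a}}" using chart_preimage[OF c a] by auto
  have aD: "\<mu>E a \<in> D" by (rule \<mu>E_in_D[OF a])
  have m: "open W" "m holomorphic_on W" using c by (auto simp: chart_def)
  have op: "open (c -` (G - {a}))" unfolding eq
    using continuous_open_preimage[OF holomorphic_on_imp_continuous_on[OF m(2)] m(1), of "D - {\<mu>E a}"] open_D
    by (simp add: Int_def vimage_def open_delete)
  have nz: "blaschke D (\<mu>E a) (m w) \<noteq> 0" if "w \<in> c -` (G - {a})" for w
    using that aD H.D.blaschke_eq_0_iff unfolding eq by auto
  show ?thesis
  proof (rule harmonic_on_ln_norm[OF op, where f = "\<lambda>w. inverse (blaschke D (\<mu>E a) (m w))"])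
    have "(blaschke D (\<mu>E a) \<circ> m) holomorphic_on c -` (G - {a})"
      by (rule holomorphic_on_compose_gen[OF holomorphic_on_subset[OF m(2)] H.D.blaschke_holomorphic[OF aD]])
         (auto simp: eq)
    then show "(\<lambda>w. inverse (blaschke D (\<mu>E a) (m w))) holomorphic_on c -` (G - {a})"
      using nz by (intro holomorphic_intros) (auto simp: o_def)
  next
    fix w assume w: "w \<in> c -` (G - {a})"
    then have "w \<in> W" "c w \<in> G" unfolding eq using w by auto
    then show "(gr a \<circ> c) w = ln (norm (inverse (blaschke D (\<mu>E a) (m w))))"
      using nz[OF w] c by (simp add: gr_def chart_def norm_inverse ln_inverse)
  qed (use nz in auto)
qed

lemma gr_boundary:
  assumes a: "a \<in> G" and \<xi>: "\<xi> \<in> range p"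
  shows "(gr a \<longlongrightarrow> 0) (atin_within extended_plane (Some \<xi>) G)"
  unfolding tendsto_iff eventually_atin_within
proof (intro allI impI disjI2)
  fix \<epsilon> :: real assume \<epsilon>: "\<epsilon> > 0"
  have aD: "\<mu>E a \<in> D" by (rule \<mu>E_in_D[OF a])
  have fr: "\<mu> \<xi> \<in> frontier D" using \<xi> frontier_D by blast
  have K: "compact {\<mu>E a}" "{\<mu>E a} \<subseteq> D" "1 - exp (- \<epsilon>) > 0" using aD \<epsilon> by auto
  obtain d where d: "d > 0" "\<And>z. z \<in> D \<Longrightarrow> dist z (\<mu> \<xi>) < d \<Longrightarrow> norm (blaschke D (\<mu>E a) z) > exp (- \<epsilon>)"
    using H.D.blaschke_frontier[OF K fr] by auto
  define T where "T = Some ` {z \<in> - {e}. \<mu> z \<in> ball (\<mu> \<xi>) d}"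
  have "open {z \<in> - {e}. \<mu> z \<in> ball (\<mu> \<xi>) d}"
    using continuous_open_preimage[OF cont_\<mu> open_Compl[OF closed_singleton] open_ball[of "\<mu> \<xi>" d]]
    by (simp add: Int_def vimage_def)
  then have "openin extended_plane T" unfolding T_def openin_Alexandroff_compactification by (auto simp: open_openin[symmetric])
  moreover have "\<xi> \<in> {z \<in> - {e}. \<mu> z \<in> ball (\<mu> \<xi>) d}" using d(1) \<xi> e_notin(2) by (metis (mono_tags, lifting) ComplI centre_in_ball mem_Collect_eq singletonD)
  then have "Some \<xi> \<in> T" unfolding T_def by (rule imageI)
  moreover have "dist (gr a x) 0 < \<epsilon>" if xT: "x \<in> T" "x \<in> G" for x
  proof -
    obtain z where z: "x = Some z" "z \<noteq> e" "dist (\<mu> z) (\<mu> \<xi>) < d" using xT(1) by (auto simp: T_def dist_commute)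
    have zD: "\<mu>E x \<in> D" by (rule \<mu>E_in_D[OF xT(2)])
    then have l: "exp (- \<epsilon>) < norm (blaschke D (\<mu>E a) (\<mu>E x))" using d(2)[of "\<mu>E x"] z by (simp add: \<mu>E_def)
    have pos: "norm (blaschke D (\<mu>E a) (\<mu>E x)) > 0" using l exp_gt_zero[of "- \<epsilon>"] by linarith
    have "ln (exp (- \<epsilon>)) < ln (norm (blaschke D (\<mu>E a) (\<mu>E x)))"
      using l pos by (subst ln_less_cancel_iff) auto
    moreover have "ln (norm (blaschke D (\<mu>E a) (\<mu>E x))) < 0"
      using H.D.norm_blaschke[OF aD zD] pos by simp
    ultimately show ?thesis using xT(2) by (simp add: gr_def dist_real_def)
  qed
  ultimately show "\<exists>T. openin extended_plane T \<and> Some \<xi> \<in> T \<and> (\<forall>x\<in>T. x \<in> G \<and> x \<noteq> Some \<xi> \<longrightarrow> dist (gr a x) 0 < \<epsilon>)"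
    by blast
qed

lemma gr_pole_Some:
  assumes a: "Some w \<in> G"
  shows "(\<lambda>z. gr (Some w) (Some z) + ln (norm (z - w))) \<in> O[at w](\<lambda>_. 1)"
proof -
  define c where "c = blaschke_cofactor D (\<mu> w)"
  have w: "w \<in> S" "w \<noteq> e" using a Some_in_G e_notin by auto
  have wD: "\<mu> w \<in> D" using \<mu>E_in_D[OF a] by (simp add: \<mu>E_def)
  \<comment> \<open>Green's function with the logarithmic singularity removed: the Blaschke factor
    is \<open>z - w\<close> times a factor that does not vanish at \<open>w\<close>, and
    \<open>f\<close> is minus the logarithm of the modulus of that factor.\<close>
  define f where "f = (\<lambda>z. - ln (norm (\<kappa> * (z0 - e) / ((z - e) * (w - e)) * c (\<mu> z))))"
  have diff: "\<mu> z - \<mu> w = (z - w) * (\<kappa> * (z0 - e) / ((z - e) * (w - e)))" if "z \<noteq> e" for z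
    using that w(2) by (simp add: \<mu>_def divide_simps) (simp add: algebra_simps)
  have cc: "isCont c (\<mu> w)"
    unfolding c_def using holomorphic_on_imp_continuous_on[OF H.D.blaschke_cofactor_holomorphic[OF wD]] wD open_D
    by (simp add: continuous_on_eq_continuous_at)
  have "isCont \<mu> w" using \<mu>_has_derivative[OF w(2)] by (rule DERIV_isCont)
  then have c\<mu>: "isCont (\<lambda>z. c (\<mu> z)) w" using cc by (rule isCont_o2)
  have cw: "c (\<mu> w) \<noteq> 0" unfolding c_def by (rule H.D.blaschke_cofactor_nonzero[OF wD wD])
  have "isCont f w" unfolding f_def
    using w(2) cw \<kappa>_nonzero e_neq by (intro continuous_intros c\<mu>) auto
  then have f: "(f \<longlongrightarrow> f w) (at w)" by (simp add: isCont_def)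
  have "\<forall>\<^sub>F z in at w. z \<in> S - {e}"
    using w open_S by (intro eventually_at_in_open') (auto simp: open_delete)
  moreover have "\<forall>\<^sub>F z in at w. c (\<mu> z) \<noteq> 0"
    using c\<mu> cw by (auto simp: isCont_def intro: tendsto_imp_eventually_ne)
  ultimately have "\<forall>\<^sub>F z in at w. f z = (gr (Some w) (Some z) + ln (norm (z - w))) / 1"
    using eventually_neq_at_within[of w]
  proof eventually_elim
    case (elim z)
    define X where "X = \<kappa> * (z0 - e) / ((z - e) * (w - e)) * c (\<mu> z)"
    have "blaschke D (\<mu> w) (\<mu> z) = (z - w) * X"
      unfolding H.D.blaschke_eq c_def X_def using diff[of z] elim by simp
    moreover have "X \<noteq> 0" unfolding X_def using elim w(2) \<kappa>_nonzero e_neq by simp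
    ultimately show ?case using elim Some_in_G[of z] unfolding gr_def f_def \<mu>E_def X_def[symmetric]
      by (simp add: norm_mult ln_mult)
  qed
  then have "((\<lambda>z. (gr (Some w) (Some z) + ln (norm (z - w))) / 1) \<longlongrightarrow> f w) (at w)"
    using tendsto_cong f by fast
  then show ?thesis by (rule bigoI_tendsto) simp
qed

lemma \<mu>_at_infinity: "(\<mu> \<longlongrightarrow> \<kappa>) at_infinity"
proof -
  have "((\<lambda>z. \<kappa> + \<kappa> * (e - z0) / (z - e)) \<longlongrightarrow> \<kappa> + 0) at_infinity"
  proof (intro tendsto_add tendsto_const tendsto_divide_0[OF tendsto_const])
    show "filterlim (\<lambda>z. z - e) at_infinity at_infinity"
      using tendsto_add_filterlim_at_infinity'[OF filterlim_ident tendsto_const[of "- e"]] by simp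
  qed
  moreover have "\<forall>\<^sub>F z in at_infinity. \<kappa> + \<kappa> * (e - z0) / (z - e) = \<mu> z"
    using eventually_not_equal_at_infinity[of e] by eventually_elim (use \<mu>_diff in \<open>auto simp: algebra_simps\<close>)
  ultimately show ?thesis using tendsto_cong by fastforce
qed

lemma gr_pole_None:
  assumes a: "None \<in> G"
  shows "(\<lambda>z. gr None (Some z) - ln (norm z)) \<in> O[at_infinity](\<lambda>_. 1)"
proof -
  define c where "c = blaschke_cofactor D \<kappa>"
  have wD: "\<kappa> \<in> D" using \<mu>E_in_D[OF a] by (simp add: \<mu>E_def)
  define f where "f = (\<lambda>z. - ln (norm (\<kappa> * (e - z0) * (1 + e / (z - e)) * c (\<mu> z))))"
  have cc: "isCont c \<kappa>"
    unfolding c_def using holomorphic_on_imp_continuous_on[OF H.D.blaschke_cofactor_holomorphic[OF wD]] wD open_D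
    by (simp add: continuous_on_eq_continuous_at)
  have c\<mu>: "((\<lambda>z. c (\<mu> z)) \<longlongrightarrow> c \<kappa>) at_infinity" by (rule isCont_tendsto_compose[OF cc \<mu>_at_infinity])
  have cw: "c \<kappa> \<noteq> 0" unfolding c_def by (rule H.D.blaschke_cofactor_nonzero[OF wD wD])
  have e0: "((\<lambda>z. 1 + e / (z - e)) \<longlongrightarrow> 1 + 0) at_infinity"
  proof (intro tendsto_add tendsto_const tendsto_divide_0[OF tendsto_const])
    show "filterlim (\<lambda>z. z - e) at_infinity at_infinity"
      using tendsto_add_filterlim_at_infinity'[OF filterlim_ident tendsto_const[of "- e"]] by simp
  qed
  have "(f \<longlongrightarrow> - ln (norm (\<kappa> * (e - z0) * (1 + 0) * c \<kappa>))) at_infinity" unfolding f_def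
    using cw \<kappa>_nonzero e_neq by (intro tendsto_intros c\<mu> e0) auto
  moreover have "\<forall>\<^sub>F z in at_infinity. f z = (gr None (Some z) - ln (norm z)) / 1"
  proof -
    obtain R where "\<And>z. norm z > R \<Longrightarrow> z \<in> S" using far a by auto
    then have "\<forall>\<^sub>F z in at_infinity. z \<in> S" unfolding eventually_at_infinity by (meson gt_ex less_le_trans)
    moreover have "\<forall>\<^sub>F z in at_infinity. c (\<mu> z) \<noteq> 0" by (rule tendsto_imp_eventually_ne[OF c\<mu> cw])
    ultimately show ?thesis using eventually_not_equal_at_infinity[of e] eventually_not_equal_at_infinity[of 0]
    proof eventually_elim
      case (elim z)
      define X where "X = \<kappa> * (e - z0) * (1 + e / (z - e)) * c (\<mu> z)"
      have "1 + e / (z - e) = z / (z - e)" using elim by (simp add: divide_simps)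
      then have "blaschke D \<kappa> (\<mu> z) = X / z" "X \<noteq> 0"
        unfolding H.D.blaschke_eq c_def X_def using \<mu>_diff[of z] elim \<kappa>_nonzero e_neq by (simp_all add: c_def)
      then show ?case using elim Some_in_G[of z] unfolding gr_def f_def \<mu>E_def X_def[symmetric]
        by (simp add: norm_divide ln_div)
    qed
  qed
  ultimately have "((\<lambda>z. (gr None (Some z) - ln (norm z)) / 1) \<longlongrightarrow> - ln (norm (\<kappa> * (e - z0) * (1 + 0) * c \<kappa>))) at_infinity"
    using tendsto_cong by fast
  then show ?thesis by (rule bigoI_tendsto) simp
qed

lemma is_Green_function_gr: "a \<in> G \<Longrightarrow> is_Green_function G a (gr a)"
proof -
  assume a: "a \<in> G"
  have "gr a z = 0" if "z \<notin> G - {a}" for z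
    using that H.D.blaschke_eq_0_iff[OF \<mu>E_in_D[OF a] \<mu>E_in_D[OF a]] by (auto simp: gr_def)
  moreover have "(gr a \<longlongrightarrow> 0) (atin_within extended_plane \<zeta> G)" if "\<zeta> \<in> extended_plane frontier_of G" for \<zeta>
    using that gr_boundary[OF a] unfolding frontier_of_G by blast
  moreover have "harmonic_on_extended (gr a) (G - {a})"
    unfolding harmonic_on_extended_def
    using harmonic_on_gr_chart[OF chart_Some a] harmonic_on_gr_chart[OF chart_inversion a] by simp
  moreover have "case a of Some w \<Rightarrow> (\<lambda>z. gr a (Some z) + ln (norm (z - w))) \<in> O[at w](\<lambda>_. 1)
      | None \<Rightarrow> (\<lambda>z. gr a (Some z) - ln (norm z)) \<in> O[at_infinity](\<lambda>_. 1)"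
    using gr_pole_Some gr_pole_None a by (auto split: option.split)
  ultimately show ?thesis unfolding is_Green_function_def by blast
qed


section \<open>Uniqueness of Green's function and its normal derivative\<close>

lemma gr_small_near_frontier:
  assumes g: "is_Green_function G a g" and \<xi>: "\<xi> \<in> frontier D" and \<epsilon>: "\<epsilon> > 0"
  obtains d where "d > 0" "\<And>w. w \<in> D \<Longrightarrow> dist w \<xi> < d \<Longrightarrow> \<bar>g (\<nu>E w)\<bar> < \<epsilon>"
proof -
  obtain x where x: "x \<in> range p" "\<xi> = \<mu> x" using \<xi> frontier_D by blast
  then have "x \<noteq> e" using e_notin(2) by blast
  have \<nu>\<xi>: "\<nu>E \<xi> = Some x" using \<nu>E_\<mu>E[of "Some x"] \<open>x \<noteq> e\<close> by (simp add: x \<mu>E_def)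
  have "(g \<longlongrightarrow> 0) (atin_within extended_plane (Some x) G)"
    using g x unfolding is_Green_function_def frontier_of_G by blast
  then obtain T where T: "openin extended_plane T" "Some x \<in> T" "\<And>y. y \<in> T \<Longrightarrow> y \<in> G \<Longrightarrow> y \<noteq> Some x \<Longrightarrow> \<bar>g y\<bar> < \<epsilon>"
    using \<epsilon> unfolding tendsto_iff eventually_atin_within dist_real_def by auto
  have "open {w. \<nu>E w \<in> T}" "\<xi> \<in> {w. \<nu>E w \<in> T}" using continuous_\<nu>E[OF T(1)] T(2) \<nu>\<xi> by auto
  then obtain d where d: "d > 0" "ball \<xi> d \<subseteq> {w. \<nu>E w \<in> T}" using openE by blast
  have "\<bar>g (\<nu>E w)\<bar> < \<epsilon>" if w: "w \<in> D" "dist w \<xi> < d" for w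
  proof (rule T(3))
    show "\<nu>E w \<in> T" using d w by (auto simp: dist_commute)
    show "\<nu>E w \<in> G" using w(1) by (simp add: D_def)
    show "\<nu>E w \<noteq> Some x" using \<open>\<nu>E w \<in> G\<close> x sides'(1) Some_in_G by auto
  qed
  then show thesis using that d(1) by blast
qed

lemma Green_difference_bounded:
  assumes g: "is_Green_function G a g" and h: "is_Green_function G a h" and a: "a \<in> G"
  obtains C d where "d > 0" "\<And>w. w \<noteq> \<mu>E a \<Longrightarrow> dist w (\<mu>E a) < d \<Longrightarrow> \<bar>g (\<nu>E w) - h (\<nu>E w)\<bar> \<le> C"
proof -
  have bd: "\<exists>C. \<forall>\<^sub>F z in F. \<bar>k z\<bar> \<le> C" if "k \<in> O[F](\<lambda>_. 1)" for k :: "complex \<Rightarrow> real" and F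
    using that by (auto elim!: landau_o.bigE)
  have "\<exists>C. \<forall>\<^sub>F w in at (\<mu>E a). \<bar>g (\<nu>E w) - h (\<nu>E w)\<bar> \<le> C"
  proof (cases a)
    case (Some b)
    have b: "b \<noteq> e" using a e_notin_G Some by auto
    have "(\<lambda>z. (g (Some z) + ln (norm (z - b))) - (h (Some z) + ln (norm (z - b)))) \<in> O[at b](\<lambda>_. 1)"
      using g h unfolding is_Green_function_def Some by (intro sum_in_bigo(2)[where f = "\<lambda>z. g (Some z) + ln (norm (z - b))"]) simp_all
    then obtain C where C: "\<forall>\<^sub>F z in at b. \<bar>g (Some z) - h (Some z)\<bar> \<le> C" using bd by force
    have "\<mu> b \<in> - {\<kappa>}" using \<mu>_neq[OF b] by simp
    then have "isCont \<nu> (\<mu> b)" using cont_\<nu> by (simp add: continuous_on_eq_continuous_at open_Compl)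
    then have "(\<nu> \<longlongrightarrow> b) (at (\<mu> b))" using \<nu>_\<mu>[OF b] by (simp add: isCont_def)
    moreover have ne: "\<forall>\<^sub>F w in at (\<mu> b). w \<noteq> \<kappa>" by (rule eventually_neq_at_within)
    moreover have ne2: "\<forall>\<^sub>F w in at (\<mu> b). w \<noteq> \<mu> b" by (rule eventually_neq_at_within)
    moreover have "\<forall>\<^sub>F w in at (\<mu> b). \<nu> w \<noteq> b" using ne ne2 by eventually_elim (use \<mu>_\<nu> in auto)
    ultimately have "filterlim \<nu> (at b) (at (\<mu> b))" by (simp add: filterlim_at)
    from eventually_compose_filterlim[OF C this]
    have "\<forall>\<^sub>F w in at (\<mu> b). \<bar>g (Some (\<nu> w)) - h (Some (\<nu> w))\<bar> \<le> C" .
    from this ne have "\<forall>\<^sub>F w in at (\<mu> b). \<bar>g (\<nu>E w) - h (\<nu>E w)\<bar> \<le> C" by eventually_elim (simp add: \<nu>E_def)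
    then show ?thesis by (auto simp: Some \<mu>E_def)
  next
    case None
    have "(\<lambda>z. (g (Some z) - ln (norm z)) - (h (Some z) - ln (norm z))) \<in> O[at_infinity](\<lambda>_. 1)"
      using g h unfolding is_Green_function_def None by (intro sum_in_bigo(2)[where f = "\<lambda>z. g (Some z) - ln (norm z)"]) simp_all
    then obtain C where C: "\<forall>\<^sub>F z in at_infinity. \<bar>g (Some z) - h (Some z)\<bar> \<le> C" using bd by force
    have "filterlim \<nu> at_infinity (at \<kappa>)"
      unfolding filterlim_at_infinity[of 0, OF order_refl] eventually_at
    proof (intro allI impI)
      fix R :: real
      show "\<exists>d>0. \<forall>x\<in>UNIV. x \<noteq> \<kappa> \<and> dist x \<kappa> < d \<longrightarrow> R \<le> norm (\<nu> x)" using near_\<kappa>[of R] by (meson less_imp_le)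
    qed
    from eventually_compose_filterlim[OF C this]
    have "\<forall>\<^sub>F w in at \<kappa>. \<bar>g (Some (\<nu> w)) - h (Some (\<nu> w))\<bar> \<le> C" .
    moreover have "\<forall>\<^sub>F w in at \<kappa>. w \<noteq> \<kappa>" by (rule eventually_neq_at_within)
    ultimately have "\<forall>\<^sub>F w in at \<kappa>. \<bar>g (\<nu>E w) - h (\<nu>E w)\<bar> \<le> C" by eventually_elim (simp add: \<nu>E_def)
    then show ?thesis by (auto simp: None \<mu>E_def)
  qed
  then show thesis using that unfolding eventually_at by blast
qed

lemma gr_large_near_pole:
  assumes a: "a \<in> G"
  obtains d where "d > 0" "\<And>w. w \<in> D \<Longrightarrow> w \<noteq> \<mu>E a \<Longrightarrow> dist w (\<mu>E a) < d \<Longrightarrow> gr a (\<nu>E w) > M"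
proof -
  have aD: "\<mu>E a \<in> D" by (rule \<mu>E_in_D[OF a])
  have "isCont (blaschke D (\<mu>E a)) (\<mu>E a)"
    using holomorphic_on_imp_continuous_on[OF H.D.blaschke_holomorphic[OF aD]] aD open_D
    by (simp add: continuous_on_eq_continuous_at)
  moreover have "blaschke D (\<mu>E a) (\<mu>E a) = 0" using H.D.blaschke_eq_0_iff[OF aD aD] by simp
  ultimately obtain d where d: "d > 0" "\<And>w. dist w (\<mu>E a) < d \<Longrightarrow> norm (blaschke D (\<mu>E a) w) < exp (- M)"
    unfolding continuous_at_eps_delta dist_norm by (metis diff_zero exp_gt_zero)
  have "gr a (\<nu>E w) > M" if w: "w \<in> D" "w \<noteq> \<mu>E a" "dist w (\<mu>E a) < d" for w
  proof -
    have "blaschke D (\<mu>E a) w \<noteq> 0" using H.D.blaschke_eq_0_iff[OF aD w(1)] w(2) by simp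
    then have "ln (norm (blaschke D (\<mu>E a) w)) < ln (exp (- M))"
      using d(2)[OF w(3)] by (subst ln_less_cancel_iff) auto
    then show ?thesis using w(1) by (simp add: gr_def \<mu>E_\<nu>E D_def)
  qed
  then show thesis using that d(1) by blast
qed

lemma Green_continuous:
  assumes h: "is_Green_function G a h" and w: "\<nu>E w \<in> G - {a}"
  shows "isCont (\<lambda>w. h (\<nu>E w)) w"
proof (cases "w = \<kappa>")
  case False
  have "isCont (h \<circ> Some) (\<nu> w)"
    using h w False harmonic_on_isCont[of "h \<circ> Some" "Some -` (G - {a})" "\<nu> w"]
    unfolding is_Green_function_def harmonic_on_extended_def by (simp add: \<nu>E_def)
  moreover have "isCont \<nu> w" using cont_\<nu> False by (simp add: continuous_on_eq_continuous_at open_Compl)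
  ultimately have "isCont (\<lambda>w. (h \<circ> Some) (\<nu> w)) w" by (rule isCont_o2[rotated])
  moreover have "\<forall>\<^sub>F x in nhds w. (h \<circ> Some) (\<nu> x) = h (\<nu>E x)"
  proof -
    have "\<forall>\<^sub>F x in nhds w. x \<in> - {\<kappa>}" using False by (intro eventually_nhds_in_open) auto
    then show ?thesis by eventually_elim (simp add: \<nu>E_def)
  qed
  ultimately show ?thesis using isCont_cong by fast
next
  case True
  \<comment> \<open>\<open>q\<close> is \<open>1 / \<nu>\<close>, the parameter in the inversion
    chart, written so that it is continuous at \<open>\<kappa>\<close>.\<close>
  define q where "q = (\<lambda>w. (w - \<kappa>) / (e * w - \<kappa> * z0))"
  have d0: "e * \<kappa> - \<kappa> * z0 \<noteq> 0" using \<kappa>_nonzero e_neq by (simp add: mult.commute)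
  have "isCont (h \<circ> inversion_chart) 0"
    using h w True harmonic_on_isCont[of "h \<circ> inversion_chart" "inversion_chart -` (G - {a})" 0]
    unfolding is_Green_function_def harmonic_on_extended_def by (simp add: \<nu>E_def inversion_chart_def)
  moreover have cq: "isCont q \<kappa>" unfolding q_def using d0 by (intro continuous_intros) auto
  moreover have "q \<kappa> = 0" by (simp add: q_def)
  ultimately have "isCont (h \<circ> inversion_chart) (q \<kappa>)" by (simp only:)
  then have "isCont (\<lambda>w. (h \<circ> inversion_chart) (q w)) \<kappa>" by (rule isCont_o2[OF cq])
  moreover have "\<forall>\<^sub>F x in nhds \<kappa>. (h \<circ> inversion_chart) (q x) = h (\<nu>E x)"
  proof -
    have "\<forall>\<^sub>F x in nhds \<kappa>. x \<in> {x. e * x - \<kappa> * z0 \<noteq> 0}"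
      using d0 by (intro eventually_nhds_in_open open_Collect_neq continuous_intros) auto
    then show ?thesis by eventually_elim (auto simp: \<nu>E_def inversion_chart_def q_def \<nu>_def)
  qed
  ultimately show ?thesis unfolding True using isCont_cong by fast
qed

text \<open>The difference of two Green functions vanishes at the frontier and is bounded near the
  pole, so it obeys a maximum principle that tolerates the pole; the sign \<open>s\<close> covers
  both inequalities at once.\<close>

lemma Green_le:
  assumes g: "is_Green_function G a g" and a: "a \<in> G" and s: "s = 1 \<or> s = - 1" and x: "x \<in> G - {a}"
  shows "s * (g x - gr a x) \<le> 0"
proof (rule ccontr)
  define \<alpha> where "\<alpha> = \<mu>E a"
  define v where "v = (\<lambda>x. s * (g x - gr a x))"
  assume "\<not> s * (g x - gr a x) \<le> 0"
  then have vx: "v x > 0" by (simp add: v_def)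
  have aD: "\<alpha> \<in> D" unfolding \<alpha>_def by (rule \<mu>E_in_D[OF a])
  define w1 where "w1 = \<mu>E x"
  have w1: "w1 \<in> D" "\<nu>E w1 = x" using x \<mu>E_in_D[of x] \<nu>E_\<mu>E[of x] e_notin_G by (auto simp: w1_def)
  have w1a: "w1 \<noteq> \<alpha>" using \<nu>E_\<mu>E[of a] a e_notin_G w1(2) x by (auto simp: \<alpha>_def)
  obtain B where B: "B > 0" "\<And>w. w \<in> D \<Longrightarrow> norm w \<le> B" using bounded_D bounded_pos by blast
  \<comment> \<open>\<open>\<epsilon>\<close> keeps the quadratic term below
    \<open>\<theta> / 2\<close> on \<open>D\<close>, and \<open>\<eta>\<close> keeps
    \<open>\<eta> gr a x\<close> below \<open>\<theta> / 2\<close>. Thus \<open>V\<close> is at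
    least \<open>\<theta>\<close> at the image of \<open>x\<close>, where
    \<open>v x = 2 \<theta>\<close>, while it stays below \<open>\<theta>\<close> near the frontier
    and near the pole.\<close>
  define \<theta> where "\<theta> = v x / 2"
  define \<epsilon> where "\<epsilon> = \<theta> / (2 * B\<^sup>2)"
  define \<eta> where "\<eta> = \<theta> / (2 * (\<bar>gr a x\<bar> + 1))"
  have \<theta>: "\<theta> > 0" using vx by (simp add: \<theta>_def)
  have \<epsilon>: "\<epsilon> > 0" using \<theta> B by (simp add: \<epsilon>_def)
  have \<eta>: "\<eta> > 0" using \<theta> by (simp add: \<eta>_def add_nonneg_pos)
  \<comment> \<open>Subtracting \<open>\<eta> gr\<close> makes \<open>V\<close> negative at the pole; adding \<open>\<epsilon> |w|\<^sup>2\<close> makes it strictly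
    subharmonic, so that the second derivative test excludes an interior maximum.\<close>
  define V where "V = (\<lambda>w. v (\<nu>E w) - \<eta> * gr a (\<nu>E w) + \<epsilon> * (norm w)\<^sup>2)"
  have quad: "\<epsilon> * (norm w)\<^sup>2 \<le> \<theta> / 2" if "w \<in> D" for w
  proof -
    have "\<epsilon> * (norm w)\<^sup>2 \<le> \<epsilon> * B\<^sup>2" using B(2)[OF that] \<epsilon> by (intro mult_left_mono power_mono) auto
    also have "\<dots> = \<theta> / 2" using B(1) by (simp add: \<epsilon>_def)
    finally show ?thesis .
  qed
  have sv: "\<bar>v y\<bar> = \<bar>g y - gr a y\<bar>" for y using s by (auto simp: v_def abs_mult)
  have gpos: "gr a (\<nu>E w) \<ge> 0" if "w \<in> D" for w
  proof -
    have "norm (blaschke D \<alpha> w) < 1" by (rule H.D.norm_blaschke[OF aD that])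
    then have "ln (norm (blaschke D \<alpha> w)) \<le> 0"
      by (cases "norm (blaschke D \<alpha> w) = 0") (auto simp: ln_le_zero_iff)
    then show ?thesis using that by (simp add: gr_def \<mu>E_\<nu>E D_def \<alpha>_def)
  qed
  have cont_lift: "isCont (\<lambda>w. h (\<nu>E w)) w" if h: "is_Green_function G a h" and w: "w \<in> D - {\<alpha>}" for h w
  proof (rule Green_continuous[OF h])
    show "\<nu>E w \<in> G - {a}" using w \<mu>E_\<nu>E[of w] by (auto simp: D_def \<alpha>_def)
  qed
  \<comment> \<open>This superlevel set is compact inside \<open>D\<close> without the pole, so a
    maximum of \<open>V\<close> on it is a genuine interior maximum.\<close>
  define M where "M = {w \<in> D - {\<alpha>}. V w \<ge> \<theta>}"
  have "w1 \<in> M"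
  proof -
    have "\<eta> * gr a x \<le> \<eta> * (\<bar>gr a x\<bar> + 1)" using \<eta> by (intro mult_left_mono) auto
    also have "\<dots> = \<theta> / 2"
    proof -
      have "\<bar>gr a x\<bar> + 1 \<noteq> 0" by linarith
      then show ?thesis unfolding \<eta>_def by (metis mult.commute nonzero_mult_divide_mult_cancel_right2 times_divide_eq_left)
    qed
    finally have "\<eta> * gr a x \<le> \<theta> / 2" .
    moreover have "0 \<le> \<epsilon> * (norm w1)\<^sup>2" using \<epsilon> by simp
    moreover have "v x = 2 * \<theta>" by (simp add: \<theta>_def)
    ultimately have "V w1 \<ge> \<theta>" using \<theta> unfolding V_def w1(2) by linarith
    then show ?thesis using w1 w1a by (simp add: M_def)
  qed
  have contV: "isCont V w" if "w \<in> D - {\<alpha>}" for w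
    unfolding V_def v_def by (intro continuous_intros cont_lift[OF g that] cont_lift[OF is_Green_function_gr[OF a] that])
  have far_M: "\<exists>d>0. ball w d \<inter> M = {}" if w: "w \<notin> M" for w
  proof -
    consider "w \<notin> closure D" | "w \<in> frontier D" | "w = \<alpha>" | "w \<in> D - {\<alpha>}"
      using open_D by (auto simp: frontier_def interior_open)
    then show ?thesis
    proof cases
      case 1
      then obtain d where "d > 0" "ball w d \<subseteq> - closure D" by (meson ComplI closed_closure open_Compl openE)
      then show ?thesis using closure_subset[of D] by (intro exI[of _ d]) (auto simp: M_def)
    next
      case 2
      obtain d1 where d1: "d1 > 0" "\<And>y. y \<in> D \<Longrightarrow> dist y w < d1 \<Longrightarrow> \<bar>g (\<nu>E y)\<bar> < \<theta> / 8"
        using gr_small_near_frontier[OF g 2, of "\<theta> / 8"] \<theta> by auto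
      obtain d2 where d2: "d2 > 0" "\<And>y. y \<in> D \<Longrightarrow> dist y w < d2 \<Longrightarrow> \<bar>gr a (\<nu>E y)\<bar> < \<theta> / 8"
        using gr_small_near_frontier[OF is_Green_function_gr[OF a] 2, of "\<theta> / 8"] \<theta> by auto
      have "V y < \<theta>" if y: "y \<in> D" "dist y w < min d1 d2" for y
      proof -
        have "0 \<le> \<eta> * gr a (\<nu>E y)" using \<eta> gpos[OF y(1)] by simp
        moreover have "\<bar>v (\<nu>E y)\<bar> \<le> \<bar>g (\<nu>E y)\<bar> + \<bar>gr a (\<nu>E y)\<bar>" unfolding sv by linarith
        ultimately show ?thesis using d1(2)[of y] d2(2)[of y] quad[OF y(1)] y \<theta> unfolding V_def by auto
      qed
      then show ?thesis using d1(1) d2(1) by (intro exI[of _ "min d1 d2"]) (force simp: M_def dist_commute)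
    next
      case 3
      obtain C d1 where d1: "d1 > 0" "\<And>y. y \<noteq> \<alpha> \<Longrightarrow> dist y \<alpha> < d1 \<Longrightarrow> \<bar>g (\<nu>E y) - gr a (\<nu>E y)\<bar> \<le> C"
        using Green_difference_bounded[OF g is_Green_function_gr[OF a] a] unfolding \<alpha>_def by metis
      obtain d2 where d2: "d2 > 0" "\<And>y. y \<in> D \<Longrightarrow> y \<noteq> \<alpha> \<Longrightarrow> dist y \<alpha> < d2 \<Longrightarrow> gr a (\<nu>E y) > C / \<eta>"
        using gr_large_near_pole[OF a, of "C / \<eta>"] unfolding \<alpha>_def by metis
      have "V y < \<theta>" if y: "y \<in> D" "y \<noteq> \<alpha>" "dist y \<alpha> < min d1 d2" for y
      proof -
        have "C < \<eta> * gr a (\<nu>E y)" using d2(2)[of y] y \<eta> by (simp add: field_simps)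
        moreover have "\<bar>v (\<nu>E y)\<bar> \<le> C" unfolding sv using d1(2)[of y] y by simp
        ultimately show ?thesis using quad[OF y(1)] \<theta> unfolding V_def by linarith
      qed
      then show ?thesis using d1(1) d2(1) 3 by (intro exI[of _ "min d1 d2"]) (force simp: M_def dist_commute)
    next
      case 4
      then have "V w < \<theta>" using w by (auto simp: M_def)
      then have "0 < \<theta> - V w" by simp
      then obtain d where "d > 0" "\<And>y. dist y w < d \<Longrightarrow> dist (V y) (V w) < \<theta> - V w"
        using contV[OF 4] unfolding continuous_at_eps_delta by metis
      then have "V y < \<theta>" if "dist y w < d" for y using that by (force simp: dist_real_def)
      then show ?thesis using \<open>d > 0\<close> by (intro exI[of _ d]) (force simp: M_def dist_commute)
    qed
  qed
  have "open (- M)" unfolding open_contains_ball using far_M by (metis ComplD disjoint_eq_subset_Compl)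
  moreover have "bounded M" using bounded_D by (rule bounded_subset) (auto simp: M_def)
  ultimately have "compact M" by (simp add: compact_eq_bounded_closed closed_def)
  moreover have "continuous_on M V"
    using contV by (auto intro!: continuous_at_imp_continuous_on simp: M_def)
  ultimately obtain y where y: "y \<in> M" "\<And>w. w \<in> M \<Longrightarrow> V w \<le> V y"
    using continuous_attains_sup[of M V] \<open>w1 \<in> M\<close> by blast
  have ymax: "V w \<le> V y" if "w \<in> D - {\<alpha>}" for w
    using y that by (cases "w \<in> M") (auto simp: M_def)
  have yD: "y \<in> D - {\<alpha>}" using y(1) by (simp add: M_def)
  obtain c m W w0 where c: "chart c m W" "c w0 = \<nu>E y" "c \<in> {Some, inversion_chart}" using chart_cover by metis
  have yG: "\<nu>E y \<in> G - {a}" using yD \<mu>E_\<nu>E[of y] by (auto simp: D_def \<alpha>_def)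
  define Q where "Q = c -` (G - {a})"
  define k where "k = (\<lambda>w. s * ((g \<circ> c) w) + (- s - \<eta>) * ((gr a \<circ> c) w))"
  have w0: "w0 \<in> Q" using yG c(2) by (simp add: Q_def)
  have Qeq: "Q = {w \<in> W. m w \<in> D - {\<alpha>}}" using chart_preimage[OF c(1) a] by (auto simp: Q_def \<alpha>_def)
  have "harmonic_on (g \<circ> c) Q" using g c(3) unfolding is_Green_function_def harmonic_on_extended_def Q_def by auto
  then have hk: "harmonic_on k Q" unfolding k_def Q_def
    by (rule harmonic_on_linear[OF _ harmonic_on_gr_chart[OF c(1) a], unfolded Q_def])
  have kV: "k w + \<epsilon> * (norm (m w))\<^sup>2 = V (m w)" if "w \<in> W" for w
  proof -
    have "\<nu>E (m w) = c w" using c(1) that \<nu>E_\<mu>E[of "c w"] unfolding chart_def by metis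
    then show ?thesis by (simp add: k_def V_def v_def algebra_simps)
  qed
  have "open Q" using hk by (simp add: harmonic_on_def)
  then obtain d where d: "d > 0" "ball w0 d \<subseteq> Q" using w0 openE by blast
  have mw0: "m w0 = y" using c(1,2) w0 \<mu>E_\<nu>E[of y] unfolding chart_def Qeq by (metis (no_types, lifting) mem_Collect_eq)
  show False
  proof (rule no_local_max[OF hk w0 _ _ \<epsilon> d(1), of m])
    show "m holomorphic_on Q" "deriv m w0 \<noteq> 0"
      using c(1) w0 unfolding chart_def Qeq by (auto intro: holomorphic_on_subset)
    fix z assume "dist z w0 < d"
    then have z: "z \<in> Q" using d(2) by (auto simp: dist_commute)
    then have "V (m z) \<le> V (m w0)" unfolding mw0 by (intro ymax) (auto simp: Qeq)
    then show "k z + \<epsilon> * (norm (m z))\<^sup>2 \<le> k w0 + \<epsilon> * (norm (m w0))\<^sup>2"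
      using kV[of z] kV[of w0] z w0 by (simp add: Qeq)
  qed
qed

lemma Green_function_eq: "a \<in> G \<Longrightarrow> Green_function G a = gr a"
  unfolding Green_function_def
proof (rule the_equality)
  assume a: "a \<in> G"
  show "is_Green_function G a (gr a)" by (rule is_Green_function_gr[OF a])
  show "g = gr a" if g: "is_Green_function G a g" for g
  proof
    fix x
    show "g x = gr a x"
    proof (cases "x \<in> G - {a}")
      case True
      then show ?thesis using Green_le[OF g a, of 1 x] Green_le[OF g a, of "- 1" x] by simp
    next
      case False
      then show ?thesis using g is_Green_function_gr[OF a] unfolding is_Green_function_def by metis
    qed
  qed
qed

lemma Green_normal_derivative_eq:
  assumes a: "a \<in> G" and nn: "unit_normal \<Gamma> G z0 = n"
  shows "Green_normal_derivative \<Gamma> G a z0 = H.green_slope (\<mu>E a)"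
proof -
  have aD: "\<mu>E a \<in> D" by (rule \<mu>E_in_D[OF a])
  define \<phi> where "\<phi> = (\<lambda>s. gr a (Some (z0 + of_real s * n)))"
  \<comment> \<open>The height on the imaginary axis of the image of \<open>z0 + s n\<close>. As
    \<open>\<sigma> s / s\<close> tends to 1, the difference quotients in \<open>s\<close> and in
    \<open>\<sigma> s\<close> have the same limit.\<close>
  define \<sigma> where "\<sigma> = (\<lambda>s. 2 * r * s / (2 * r + s))"
  define f where "f = (\<lambda>s. - ln (norm (blaschke D (\<mu>E a) (\<i> * of_real s))))"
  have "(\<sigma> \<longlongrightarrow> 2 * r * 0 / (2 * r + 0)) (at_right 0)" unfolding \<sigma>_def using r by (intro tendsto_intros) auto
  moreover have "\<forall>\<^sub>F s in at_right 0. \<sigma> s > 0"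
    using eventually_at_right_less[of 0] by eventually_elim (use r in \<open>simp add: \<sigma>_def\<close>)
  ultimately have "filterlim \<sigma> (at_right 0) (at_right 0)" unfolding filterlim_at
    by (auto simp: less_imp_neq elim: eventually_mono)
  from filterlim_compose[OF H.green_slope_tendsto[OF aD] this]
  have "((\<lambda>s. f (\<sigma> s) / \<sigma> s) \<longlongrightarrow> H.green_slope (\<mu>E a)) (at_right 0)" by (simp add: f_def)
  moreover have "((\<lambda>s. 2 * r / (2 * r + s)) \<longlongrightarrow> 2 * r / (2 * r + 0)) (at_right 0)"
    using r by (intro tendsto_intros) auto
  ultimately have "((\<lambda>s. f (\<sigma> s) / \<sigma> s * (2 * r / (2 * r + s))) \<longlongrightarrow> H.green_slope (\<mu>E a) * (2 * r / (2 * r + 0))) (at_right 0)"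
    by (rule tendsto_mult)
  moreover have "\<forall>\<^sub>F s in at_right 0. f (\<sigma> s) / \<sigma> s * (2 * r / (2 * r + s)) = (\<phi> s - \<phi> 0) / s"
  proof -
    have "\<forall>\<^sub>F s in at_right 0. s \<in> {0<..<r}" by (rule eventually_at_right_real[OF r])
    then show ?thesis
    proof eventually_elim
      case (elim s)
      have "z0 + of_real s * n \<in> S"
      proof -
        have "z0 + of_real s * n - (z0 + of_real r * n) = of_real (s - r) * n" by (simp add: algebra_simps)
        then have "dist (z0 + of_real s * n) (z0 + of_real r * n) = \<bar>s - r\<bar>"
          using n by (simp only: dist_norm norm_mult norm_of_real mult_1_right)
        then have "z0 + of_real s * n \<in> cball (z0 + of_real r * n) r" using elim by (simp add: dist_commute)
        moreover have "z0 + of_real s * n \<noteq> z0" using elim n_nonzero by simp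
        ultimately show ?thesis using ball_S by blast
      qed
      then have "\<phi> s = f (\<sigma> s)" using elim \<mu>_on_normal[of s]
        by (simp add: \<phi>_def gr_def Some_in_G \<mu>E_def f_def \<sigma>_def)
      moreover have "\<phi> 0 = 0" using sides'(1) Some_in_G[of z0] by (auto simp: \<phi>_def gr_def)
      ultimately show ?case using elim r by (simp add: \<sigma>_def)
    qed
  qed
  ultimately have "((\<lambda>s. (\<phi> s - \<phi> 0) / s) \<longlongrightarrow> H.green_slope (\<mu>E a)) (at_right 0)"
    using tendsto_cong r by fastforce
  then have "(\<phi> has_field_derivative H.green_slope (\<mu>E a)) (at 0 within {0..})"
    unfolding has_field_derivative_iff at_within_Ici_at_right by simp
  then have "(\<phi> has_vector_derivative H.green_slope (\<mu>E a)) (at 0 within {0..})"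
    by (simp add: has_real_derivative_iff_has_vector_derivative)
  moreover have "at (0::real) within {0..} \<noteq> bot" by (simp add: at_within_Ici_at_right)
  ultimately have "vector_derivative \<phi> (at 0 within {0..}) = H.green_slope (\<mu>E a)"
    by (intro vector_derivative_within)
  then show ?thesis unfolding Green_normal_derivative_def nn Green_function_eq[OF a] \<phi>_def .
qed

end

section \<open>Rational functions with prescribed poles\<close>

lemma poly_eq_sum_le:
  fixes L :: "'a :: {comm_semiring_0, semiring_1} poly"
  assumes "degree L \<le> m"
  shows "poly L x = (\<Sum>i\<le>m. coeff L i * x ^ i)"
  unfolding poly_altdef using assms
  by (intro sum.mono_neutral_left) (auto simp: coeff_eq_0)

lemma coprime_root_poly:
  assumes "N \<noteq> 0" "\<And>b. b \<in> set bs \<Longrightarrow> poly N b \<noteq> 0"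
  shows "coprime N (root_poly bs)"
proof (rule coprimeI)
  fix d assume d: "d dvd N" "d dvd root_poly bs"
  have "constant (poly d)"
  proof (rule ccontr)
    assume "\<not> constant (poly d)"
    then obtain z where "poly d z = 0" using Fundamental_Theorem_Algebra.fundamental_theorem_of_algebra by blast
    then have "poly N z = 0" "poly (root_poly bs) z = 0"
      using d by (metis dvd_def mult_zero_left poly_mult)+
    then show False using assms(2) by simp
  qed
  then have "degree d = 0" by (simp add: constant_degree)
  moreover have "d \<noteq> 0" using d(1) assms(1) by auto
  ultimately show "is_unit d" by (simp add: is_unit_iff_degree)
qed

lemma poly_root_poly_Cons: "poly (root_poly (b # bs)) z = (z - b) * poly (root_poly bs) z"
  by (simp add: poly_root_poly del: root_poly_simps)

lemma lead_coeff_root_poly [simp]: "lead_coeff (root_poly bs) = 1"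
  by (induction bs) (simp_all add: lead_coeff_mult del: degree_root_poly mult_pCons_left)

text \<open>\<open>root_poly bs\<close> is monic and has no root in common with \<open>N\<close>, so
  the pair is already the normalised representative.\<close>

lemma quot_of_fract_root_poly:
  assumes "N \<noteq> 0" "\<And>b. b \<in> set bs \<Longrightarrow> poly N b \<noteq> 0"
  shows "quot_of_fract (Fract N (root_poly bs)) = (N, root_poly bs)"
proof -
  have "unit_factor (root_poly bs) = 1"
    unfolding unit_factor_poly_def lead_coeff_root_poly by (simp add: one_pCons)
  then have "(N, root_poly bs) \<in> normalized_fracts"
    using coprime_root_poly[OF assms] by (simp add: normalized_fracts_def)
  from quot_of_fract_quot_to_fract'[OF this] show ?thesis by (simp add: quot_to_fract_def)
qed

lemma order_root_poly: "order w (root_poly bs) = count_list bs w"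
proof (induction bs)
  case (Cons b bs)
  have "root_poly (b # bs) \<noteq> 0" by (rule root_poly_nonzero)
  then have "order w (root_poly (b # bs)) = order w [:- b, 1:] + order w (root_poly bs)"
    unfolding root_poly_simps by (rule order_mult)
  moreover have "order w [:- b, 1:] = (if b = w then 1 else 0)"
  proof (cases "b = w")
    case True then show ?thesis using order_power_n_n[of w 1] by simp
  next
    case False then show ?thesis by (simp add: order_0I)
  qed
  ultimately show ?case using Cons by simp
qed (simp add: order_0I)

definition finite_points :: "complex option list \<Rightarrow> complex list" where
  "finite_points xs = map the (filter (\<lambda>x. x \<noteq> None) xs)"

lemma finite_points_simps [simp]:
  "finite_points [] = []" "finite_points (Some z # xs) = z # finite_points xs" "finite_points (None # xs) = finite_points xs"
  "finite_points (xs @ ys) = finite_points xs @ finite_points ys"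
  by (simp_all add: finite_points_def)

lemma set_finite_points: "z \<in> set (finite_points xs) \<longleftrightarrow> Some z \<in> set xs"
  by (force simp: finite_points_def image_iff)

lemma count_finite_points: "count_list (finite_points xs) z = count_list xs (Some z)"
proof (induction xs)
  case (Cons x xs) then show ?case by (cases x) auto
qed simp

lemma length_finite_points: "length xs = length (finite_points xs) + count_list xs None"
proof (induction xs)
  case (Cons x xs) then show ?case by (cases x) auto
qed simp

text \<open>The order at infinity is \<open>degree N\<close> minus the number of finite points. Full
  degree turns this into the number of entries \<open>None\<close>; if there are none, the truncated
  subtraction gives 0.\<close>

lemma rational_with_poles:
  assumes N: "N \<noteq> 0" "\<And>z. Some z \<in> set xs \<Longrightarrow> poly N z \<noteq> 0"
    "degree N \<le> length xs" "None \<in> set xs \<Longrightarrow> degree N = length xs"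
  defines "R \<equiv> Fract N (root_poly (finite_points xs))"
  shows "R \<noteq> 0" "pole_order R x = count_list xs x" "rat_eval R z = poly N z / poly (root_poly (finite_points xs)) z"
proof -
  have q: "quot_of_fract R = (N, root_poly (finite_points xs))"
    unfolding R_def using N by (intro quot_of_fract_root_poly) (auto simp: set_finite_points)
  show "R \<noteq> 0" using q N(1) by auto
  show "rat_eval R z = poly N z / poly (root_poly (finite_points xs)) z"
    by (simp add: rat_eval_def rat_num_def rat_den_def q)
  show "pole_order R x = count_list xs x"
  proof (cases x)
    case None
    have "degree N - length (finite_points xs) = count_list xs None"
    proof (cases "None \<in> set xs")
      case True then show ?thesis using N(4) length_finite_points[of xs] by simp
    next
      case False
      then have "count_list xs None = 0" by (simp add: count_list_0_iff)
      then show ?thesis using N(3) length_finite_points[of xs] by simp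
    qed
    then show ?thesis by (simp add: None pole_order_def rat_num_def rat_den_def q)
  qed (simp add: pole_order_def rat_den_def q order_root_poly count_finite_points)
qed

lemma total_degree_eq:
  assumes "\<And>x. pole_order R x = count_list xs x"
  shows "total_degree R = length xs"
proof -
  have "{a. 0 < count_list xs a} = set xs" by (auto simp: count_list_0_iff zero_less_iff_neq_zero)
  then show ?thesis unfolding total_degree_def assms by (simp add: sum_count_set)
qed

text \<open>The fallback for small \<open>n\<close>, where only the poles matter: a power of a
  linear factor with its root off the list is a numerator of full degree.\<close>

lemma rational_with_poles_exists: "\<exists>R. R \<noteq> 0 \<and> (\<forall>x. pole_order R x = count_list xs x)"
proof -
  obtain c where c: "c \<notin> set (finite_points xs)"
    using ex_new_if_finite[OF infinite_UNIV_char_0] by blast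
  define N where "N = [:- c, 1:] ^ length xs"
  have "N \<noteq> 0" "degree N = length xs" by (simp_all add: N_def degree_power_eq)
  moreover have "poly N z \<noteq> 0" if "Some z \<in> set xs" for z
    using that c by (auto simp: N_def set_finite_points)
  ultimately show ?thesis using rational_with_poles[of N xs] by auto
qed

section \<open>Transfer from half-plane coordinates to the original plane\<close>

context curve_side
begin

text \<open>The homogenisation of \<open>L\<close> in the coordinate \<open>\<mu>\<close>: clearing denominators in \<open>L \<circ> \<mu>\<close>.\<close>

definition pullback :: "nat \<Rightarrow> complex poly \<Rightarrow> complex poly" where
  "pullback m L = (\<Sum>i\<le>m. smult (coeff L i * \<kappa> ^ i) ([:- z0, 1:] ^ i * [:- e, 1:] ^ (m - i)))"

lemma poly_pullback:
  assumes "degree L \<le> m" "z \<noteq> e"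
  shows "poly (pullback m L) z = (z - e) ^ m * poly L (\<mu> z)"
proof -
  have "poly (pullback m L) z = (\<Sum>i\<le>m. coeff L i * \<kappa> ^ i * ((z - z0) ^ i * (z - e) ^ (m - i)))"
    by (simp add: pullback_def poly_sum)
  also have "\<dots> = (\<Sum>i\<le>m. (z - e) ^ m * (coeff L i * \<mu> z ^ i))"
  proof (rule sum.cong[OF refl])
    fix i assume "i \<in> {..m}"
    then have "(z - e) ^ m = (z - e) ^ i * (z - e) ^ (m - i)" by (simp add: power_add[symmetric])
    then show "coeff L i * \<kappa> ^ i * ((z - z0) ^ i * (z - e) ^ (m - i)) = (z - e) ^ m * (coeff L i * \<mu> z ^ i)"
      using assms(2) by (simp add: \<mu>_def power_divide power_mult_distrib)
  qed
  also have "\<dots> = (z - e) ^ m * poly L (\<mu> z)"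
    using poly_eq_sum_le[OF assms(1)] by (simp add: sum_distrib_left)
  finally show ?thesis .
qed

lemma degree_pullback: "degree (pullback m L) \<le> m"
  unfolding pullback_def
proof (rule degree_sum_le)
  fix i assume "i \<in> {..m}"
  then have "degree ([:- z0, 1:] ^ i * [:- e, 1:] ^ (m - i)) = m"
    by (subst degree_mult_eq) (auto simp: degree_power_eq)
  then show "degree (smult (coeff L i * \<kappa> ^ i) ([:- z0, 1:] ^ i * [:- e, 1:] ^ (m - i))) \<le> m"
    using degree_smult_le[of "coeff L i * \<kappa> ^ i" "[:- z0, 1:] ^ i * [:- e, 1:] ^ (m - i)"] by linarith
qed simp

text \<open>\<open>\<kappa>\<close> is the image of infinity, so non-vanishing of \<open>L\<close>
  there means full degree of the pullback, that is, the full pole order at infinity.\<close>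

lemma coeff_pullback:
  assumes "degree L \<le> m"
  shows "coeff (pullback m L) m = poly L \<kappa>"
proof -
  have "coeff ([:- z0, 1:] ^ i * [:- e, 1:] ^ (m - i)) m = 1" if "i \<le> m" for i
  proof -
    have "degree ([:- z0, 1:] ^ i * [:- e, 1:] ^ (m - i)) = m"
      using that by (subst degree_mult_eq) (auto simp: degree_power_eq)
    moreover have "lead_coeff ([:- z0, 1:] ^ i * [:- e, 1:] ^ (m - i)) = 1"
      by (simp add: lead_coeff_mult lead_coeff_power)
    ultimately show ?thesis by simp
  qed
  then show ?thesis unfolding pullback_def using poly_eq_sum_le[OF assms]
    by (simp add: coeff_sum)
qed

text \<open>The constant ratio of \<open>(z - e) (\<mu> z - \<mu>E x)\<close> to
  \<open>z - a\<close> for a finite point \<open>a\<close>, or to 1 for infinity. The ratios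
  multiply to a constant that rescales the numerator.\<close>

definition pole_factor :: "complex option \<Rightarrow> complex" where
  "pole_factor x = (case x of None \<Rightarrow> \<kappa> * (e - z0) | Some a \<Rightarrow> \<kappa> * (z0 - e) / (a - e))"

lemma pole_factor_nonzero: "x \<noteq> Some e \<Longrightarrow> pole_factor x \<noteq> 0"
  using \<kappa>_nonzero e_neq by (auto simp: pole_factor_def split: option.split)

lemma poly_root_poly_\<mu>:
  assumes "Some e \<notin> set as" "z \<noteq> e"
  shows "(z - e) ^ length as * poly (root_poly (map \<mu>E as)) (\<mu> z) =
    (\<Prod>x\<leftarrow>as. pole_factor x) * poly (root_poly (finite_points as)) z"
  using assms(1)
proof (induction as)
  case (Cons x as)
  have *: "(z - e) * (\<mu> z - \<mu>E x) = pole_factor x * (case x of None \<Rightarrow> 1 | Some a \<Rightarrow> z - a)"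
  proof (cases x)
    case None
    then show ?thesis using \<mu>_diff[OF assms(2)] assms(2) by (simp add: \<mu>E_def pole_factor_def)
  next
    case (Some a)
    then have "a \<noteq> e" using Cons.prems by auto
    then show ?thesis using assms(2)
      by (simp add: Some \<mu>E_def pole_factor_def \<mu>_def divide_simps) (simp add: algebra_simps)
  qed
  have "poly (root_poly (finite_points (x # as))) z = (case x of None \<Rightarrow> 1 | Some a \<Rightarrow> z - a) * poly (root_poly (finite_points as)) z"
    by (cases x) (simp_all add: poly_root_poly left_diff_distrib)
  moreover have "(z - e) ^ length (x # as) * poly (root_poly (map \<mu>E (x # as))) (\<mu> z)
     = ((z - e) * (\<mu> z - \<mu>E x)) * ((z - e) ^ length as * poly (root_poly (map \<mu>E as)) (\<mu> z))"
    unfolding list.map poly_root_poly_Cons length_Cons power_Suc by (simp only: ac_simps)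
  moreover have "(z - e) ^ length as * poly (root_poly (map \<mu>E as)) (\<mu> z) =
    (\<Prod>x\<leftarrow>as. pole_factor x) * poly (root_poly (finite_points as)) z"
    using Cons by simp
  ultimately show ?case unfolding * list.map prod_list.Cons by (simp only: ac_simps)
qed simp

lemma norm_deriv_\<mu>_z0: "norm (\<kappa> * (z0 - e) / (z0 - e)\<^sup>2) = 1"
  using n n_nonzero r by (simp add: e_def \<kappa>_def norm_mult norm_divide norm_power power2_eq_square)

text \<open>Composition with \<open>\<mu>\<close> carries poles at \<open>\<mu>E x\<close> to poles
  at \<open>x\<close>, including infinity. As \<open>|deriv \<mu> z0| = 1\<close>, the modulus of
  the derivative is kept too, and the points \<open>bs\<close> on the other side only cost
  \<open>\<theta>\<close>.\<close>

lemma transfer_principal_parts: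
  assumes as: "as \<noteq> []" "set as \<subseteq> G" and bs: "\<And>x. x \<in> set bs \<Longrightarrow> x \<notin> G \<and> x \<notin> Some ` range p"
    and L: "degree L \<le> length as" "\<And>x. x \<in> set as \<Longrightarrow> poly L (\<mu>E x) \<noteq> 0" and \<theta>: "\<theta> > 0"
  obtains R where "R \<noteq> 0" "\<And>x. pole_order R x = count_list (as @ bs) x"
    "\<And>z. z \<in> range p \<Longrightarrow> norm (rat_eval R z) \<le> norm (poly L (\<mu> z) / poly (root_poly (map \<mu>E as)) (\<mu> z)) + \<theta>"
    "norm (deriv (\<lambda>w. poly L w / poly (root_poly (map \<mu>E as)) w) 0) - \<theta> \<le> norm (deriv (rat_eval R) z0)"
proof -
  define C where "C = (\<Prod>x\<leftarrow>as. pole_factor x)"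
  have eas: "Some e \<notin> set as" using as(2) e_notin_G by blast
  have C: "C \<noteq> 0" unfolding C_def using eas pole_factor_nonzero by (auto simp: prod_list_zero_iff) (metis pole_factor_nonzero)
  define N1 where "N1 = smult (1 / C) (pullback (length as) L)"
  define q1 q2 where "q1 = root_poly (finite_points as)" and "q2 = root_poly (finite_points bs)"
  \<comment> \<open>\<open>z0\<close> is on the curve and hence none of the points in
    \<open>bs\<close>, so \<open>U / q2\<close> has the full pole order at each finite one; the
    degree \<open>length bs\<close> gives the right order at infinity as well.\<close>
  define U where "U = [:- z0, 1:] ^ length bs"
  define \<Phi> where "\<Phi> = (\<lambda>w. poly L w / poly (root_poly (map \<mu>E as)) w)"
  define T where "T = (\<lambda>z. poly U z / poly q2 z)"
  have f: "poly N1 z / poly q1 z = \<Phi> (\<mu> z)" if "z \<noteq> e" for z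
  proof -
    have "\<Phi> (\<mu> z) = ((z - e) ^ length as * poly L (\<mu> z)) / ((z - e) ^ length as * poly (root_poly (map \<mu>E as)) (\<mu> z))"
      using that by (simp add: \<Phi>_def)
    also have "\<dots> = poly (pullback (length as) L) z / (C * poly q1 z)"
      unfolding C_def q1_def poly_root_poly_\<mu>[OF eas that] poly_pullback[OF L(1) that] ..
    finally show ?thesis by (simp add: N1_def)
  qed
  have z0: "z0 \<notin> S" "z0 \<in> range p" "z0 \<noteq> e" using sides'(1) p_neq_e by auto
  have curve: "poly q1 z \<noteq> 0" "poly q2 z \<noteq> 0" "z \<noteq> e" if "z \<in> range p" for z
  proof -
    have "Some z \<notin> G" using that sides'(1) Some_in_G by blast
    then show "poly q1 z \<noteq> 0" using as(2) by (auto simp: q1_def set_finite_points)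
    show "poly q2 z \<noteq> 0" using bs that by (auto simp: q2_def set_finite_points)
    show "z \<noteq> e" using that e_notin(2) by metis
  qed
  have "continuous_on (range p) T" unfolding T_def using curve by (intro continuous_intros) auto
  then have "bounded (T ` range p)" using compact_range by (meson compact_continuous_image compact_imp_bounded)
  then obtain B where B: "B > 0" "\<And>z. z \<in> range p \<Longrightarrow> norm (T z) \<le> B" unfolding bounded_pos by blast
  define t1 where "t1 = norm (deriv T z0)"
  \<comment> \<open>\<open>B\<close> bounds \<open>T\<close> on the curve and \<open>t1\<close> its
    derivative at \<open>z0\<close>, so \<open>\<eta> T\<close> changes neither the values nor the
    derivative by more than \<open>\<theta>\<close>.\<close>
  define \<eta> where "\<eta> = \<theta> / (B + t1 + 1)"
  have t1: "t1 \<ge> 0" by (simp add: t1_def)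
  have \<eta>: "\<eta> > 0" "\<eta> * B \<le> \<theta>" "\<eta> * t1 \<le> \<theta>"
    using \<theta> B(1) t1 by (auto simp: \<eta>_def field_simps add_nonneg_nonneg)
  \<comment> \<open>The poles of the other side enter with a tiny coefficient \<open>\<eta>\<close>, so they have the right orders
    without affecting the estimates.\<close>
  define N where "N = N1 * q2 + smult (of_real \<eta>) (U * q1)"
  have q: "root_poly (finite_points (as @ bs)) = q1 * q2" by (simp add: q1_def q2_def root_poly_def)
  have disj: "x \<notin> set bs" if "x \<in> set as" for x using that as bs by blast
  have Nas: "poly N z \<noteq> 0" if z: "Some z \<in> set as" for z
  proof -
    have "z \<noteq> e" using z eas by auto
    have "poly q1 z = 0" using z by (simp add: q1_def set_finite_points)
    moreover have "poly q2 z \<noteq> 0" using disj[OF z] by (simp add: q2_def set_finite_points)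
    moreover have "poly N1 z \<noteq> 0"
      using L(2)[OF z] \<open>z \<noteq> e\<close> C poly_pullback[OF L(1), of z] by (simp add: N1_def \<mu>E_def)
    ultimately show ?thesis by (simp add: N_def)
  qed
  have Nbs: "poly N z \<noteq> 0" if z: "Some z \<in> set bs" for z
  proof -
    have "poly q2 z = 0" using z by (simp add: q2_def set_finite_points)
    moreover have "poly q1 z \<noteq> 0" using disj[of "Some z"] z by (auto simp: q1_def set_finite_points)
    moreover have "poly U z \<noteq> 0" using bs[OF z] z0(2) by (auto simp: U_def)
    ultimately show ?thesis using \<eta>(1) by (simp add: N_def)
  qed
  have dN1: "degree N1 \<le> length as" using degree_pullback[of "length as" L] C by (simp add: N1_def)
  have d1: "degree (N1 * q2) \<le> length as + length (finite_points bs)"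
    using degree_mult_le[of N1 q2] dN1 by (simp add: q2_def)
  have U: "U \<noteq> 0" "degree U = length bs" by (simp_all add: U_def degree_power_eq)
  have d2: "degree (smult (of_real \<eta>) (U * q1)) = length bs + length (finite_points as)"
    using U \<eta>(1) by (simp add: degree_mult_eq q1_def)
  have dN: "degree N \<le> length (as @ bs)"
    unfolding N_def using d1 d2 length_finite_points[of as] length_finite_points[of bs]
    by (intro degree_add_le) auto
  \<comment> \<open>Infinity occurs in only one of the two lists. The summand that carries it has
    full degree and the other a smaller one, so leading terms cannot cancel.\<close>
  have dN': "degree N = length (as @ bs)" if inf: "None \<in> set (as @ bs)"
  proof (cases "None \<in> set as")
    case True
    then have "count_list as None > 0" by (simp add: count_list_0_iff zero_less_iff_neq_zero)
    then have lt: "length (finite_points as) < length as" using length_finite_points[of as] by linarith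
    have "None \<notin> set bs" using disj[OF True] .
    then have eq: "length (finite_points bs) = length bs" using length_finite_points[of bs] by (simp add: count_list_0_iff)
    have c: "coeff N1 (length as) \<noteq> 0"
      using L(2)[OF True] C coeff_pullback[OF L(1)] by (simp add: N1_def \<mu>E_def)
    then have "N1 \<noteq> 0" "degree N1 = length as" using dN1 le_degree[OF c] by auto
    then have "degree (N1 * q2) = length as + length bs" using eq by (simp add: degree_mult_eq q2_def)
    moreover have "degree (smult (of_real \<eta>) (U * q1)) < degree (N1 * q2)" unfolding d2 calculation using lt by simp
    ultimately show ?thesis unfolding N_def by (simp add: degree_add_eq_left)
  next
    case False
    then have "None \<in> set bs" using inf by simp
    then have "count_list bs None > 0" by (simp add: count_list_0_iff zero_less_iff_neq_zero)
    then have lt: "length (finite_points bs) < length bs" using length_finite_points[of bs] by linarith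
    have eq: "length (finite_points as) = length as" using False length_finite_points[of as] by (simp add: count_list_0_iff)
    have "degree (N1 * q2) < degree (smult (of_real \<eta>) (U * q1))" unfolding d2 using d1 lt eq by simp
    then show ?thesis unfolding N_def using d2 eq by (simp add: degree_add_eq_right)
  qed
  have N0: "N \<noteq> 0"
  proof -
    obtain x where x: "x \<in> set as" using as(1) by (cases as) auto
    show ?thesis
    proof (cases x)
      case None then show ?thesis using dN' x as(1) by auto
    next
      case (Some z) then show ?thesis using Nas[of z] x by auto
    qed
  qed
  define R where "R = Fract N (root_poly (finite_points (as @ bs)))"
  have Nn: "poly N z \<noteq> 0" if "Some z \<in> set (as @ bs)" for z using that Nas Nbs by auto
  have R: "R \<noteq> 0" "pole_order R x = count_list (as @ bs) x"
    "rat_eval R z = poly N z / poly (root_poly (finite_points (as @ bs))) z" for x z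
    unfolding R_def by (rule rational_with_poles[OF N0 Nn dN dN']; assumption)+
  have ev: "rat_eval R z = \<Phi> (\<mu> z) + of_real \<eta> * T z" if "poly q1 z \<noteq> 0" "poly q2 z \<noteq> 0" "z \<noteq> e" for z
    unfolding R(3) q f[OF that(3), symmetric] using that(1,2) by (simp add: N_def T_def field_simps)
  show thesis
  proof (rule that[of R])
    show "R \<noteq> 0" "\<And>x. pole_order R x = count_list (as @ bs) x" using R by auto
    fix z assume z: "z \<in> range p"
    have "norm (rat_eval R z) \<le> norm (\<Phi> (\<mu> z)) + norm (of_real \<eta> * T z)"
      unfolding ev[OF curve[OF z]] by (rule norm_triangle_ineq)
    also have "norm (of_real \<eta> * T z) \<le> \<eta> * B" using B(2)[OF z] \<eta>(1) by (simp add: norm_mult)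
    finally show "norm (rat_eval R z) \<le> norm (poly L (\<mu> z) / poly (root_poly (map \<mu>E as)) (\<mu> z)) + \<theta>"
      using \<eta>(2) unfolding \<Phi>_def by linarith
  next
    define A where "A = {z. poly q1 z \<noteq> 0} \<inter> {z. poly q2 z \<noteq> 0} \<inter> {z. z \<noteq> e}"
    have A: "open A" unfolding A_def by (intro open_Int open_Collect_neq continuous_intros)
    have z0A: "z0 \<in> A" using curve[OF z0(2)] by (simp add: A_def)
    have "0 \<notin> set (map \<mu>E as)"
    proof
      assume "0 \<in> set (map \<mu>E as)"
      then have "0 \<in> D" using \<mu>E_in_D as(2) by force
      then show False using D_upper by force
    qed
    then have nz: "poly (root_poly (map \<mu>E as)) 0 \<noteq> 0" by simp
    have "\<Phi> field_differentiable at 0" unfolding \<Phi>_def using nz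
      by (intro field_differentiable_divide) (auto simp: field_differentiable_def intro: poly_DERIV)
    then have d\<Phi>: "(\<Phi> has_field_derivative deriv \<Phi> 0) (at (\<mu> z0))" by (simp add: \<mu>_z0 field_differentiable_derivI)
    have "T field_differentiable at z0" unfolding T_def using curve[OF z0(2)]
      by (intro field_differentiable_divide) (auto simp: field_differentiable_def intro: poly_DERIV)
    then have dT: "(T has_field_derivative deriv T z0) (at z0)" by (rule field_differentiable_derivI)
    have "((\<lambda>z. \<Phi> (\<mu> z) + of_real \<eta> * T z) has_field_derivative
        deriv \<Phi> 0 * (\<kappa> * (z0 - e) / (z0 - e)\<^sup>2) + of_real \<eta> * deriv T z0) (at z0)"
      by (intro DERIV_add DERIV_cmult dT DERIV_chain2[OF d\<Phi> \<mu>_has_derivative[OF z0(3)]])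
    then have "(rat_eval R has_field_derivative
        deriv \<Phi> 0 * (\<kappa> * (z0 - e) / (z0 - e)\<^sup>2) + of_real \<eta> * deriv T z0) (at z0)"
      by (rule has_field_derivative_transform_within_open[OF _ A z0A]) (simp add: ev A_def)
    then have "deriv (rat_eval R) z0 = deriv \<Phi> 0 * (\<kappa> * (z0 - e) / (z0 - e)\<^sup>2) + of_real \<eta> * deriv T z0"
      by (rule DERIV_imp_deriv)
    moreover have "norm (deriv \<Phi> 0 * (\<kappa> * (z0 - e) / (z0 - e)\<^sup>2)) = norm (deriv \<Phi> 0)"
      unfolding norm_mult[of "deriv \<Phi> 0"] norm_deriv_\<mu>_z0 by simp
    moreover have "norm (of_real \<eta> * deriv T z0) \<le> \<theta>" using \<eta> by (simp add: norm_mult t1_def)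
    moreover have "norm A - \<theta> \<le> norm B" if "B = A' + Y" "norm A' = norm A" "norm Y \<le> \<theta>" for A A' B Y :: complex
      using norm_diff_ineq[of A' Y] that by simp
    ultimately show "norm (deriv (\<lambda>w. poly L w / poly (root_poly (map \<mu>E as)) w) 0) - \<theta> \<le> norm (deriv (rat_eval R) z0)"
      unfolding \<Phi>_def by blast
  qed
qed

end

section \<open>Both sides of the curve\<close>

lemma normal_segment:
  fixes z n :: complex
  assumes "norm n = 1" "0 < s" "s < r"
  shows "z + of_real s * n \<in> cball (z + of_real r * n) r - {z}"
proof -
  have "z + of_real s * n - (z + of_real r * n) = of_real (s - r) * n" by (simp add: algebra_simps)
  then have "dist (z + of_real s * n) (z + of_real r * n) = \<bar>s - r\<bar>"
    using assms(1) by (simp only: dist_norm norm_mult norm_of_real mult_1_right)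
  then show ?thesis using assms by (auto simp: dist_commute)
qed

lemma orthogonal_unit_vectors:
  fixes m n d :: complex
  assumes "norm m = 1" "norm n = 1" "d \<noteq> 0" "m \<bullet> d = 0" "n \<bullet> d = 0"
  shows "m = n \<or> m = - n"
proof -
  define w where "w = m * cnj n"
  have *: "Re m * Re d + Im m * Im d = 0" "Re n * Re d + Im n * Im d = 0"
    using assms(4,5) by (auto simp: inner_complex_def)
  have "Im w * Re d = Im m * (Re n * Re d + Im n * Im d) - Im n * (Re m * Re d + Im m * Im d)"
    by (simp add: w_def algebra_simps)
  then have 1: "Im w * Re d = 0" unfolding * by simp
  have "Im w * Im d = Re n * (Re m * Re d + Im m * Im d) - Re m * (Re n * Re d + Im n * Im d)"
    by (simp add: w_def algebra_simps)
  then have 2: "Im w * Im d = 0" unfolding * by simp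
  have "Im w = 0" using 1 2 assms(3) by (auto simp: complex_eq_iff)
  moreover have "norm w = 1" using assms by (simp add: w_def norm_mult)
  ultimately have "\<bar>Re w\<bar> = 1" by (simp add: cmod_eq_Re)
  then have "w = 1 \<or> w = - 1" using \<open>Im w = 0\<close> by (auto simp: complex_eq_iff abs_if split: if_splits)
  moreover have "w * n = m"
    using assms(2) complex_norm_square[of n] by (simp add: w_def mult.assoc mult.commute[of "cnj n"])
  ultimately show ?thesis by auto
qed

section \<open>The unit normal, and uniformity over the closed set of poles\<close>

context curve_side
begin

text \<open>The definition of the unit normal admits every parametrization of the curve, so
  orthogonality is proved for an arbitrary one.\<close>

lemma tangent_orthogonal:
  assumes \<phi>: "C2_parametrization \<phi> (range p)" and t: "\<phi> (cis t) = z0"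
    and d: "((\<lambda>s. \<phi> (cis s)) has_vector_derivative d) (at t)"
  shows "n \<bullet> d = 0" "d \<noteq> 0"
proof -
  obtain p1 where "\<And>t. ((\<lambda>s. \<phi> (cis s)) has_vector_derivative p1 t) (at t)" "\<And>t. p1 t \<noteq> 0"
    using \<phi> unfolding C2_parametrization_def by blast
  then show "d \<noteq> 0" using d vector_derivative_unique_at by metis
  define c where "c = z0 + of_real r * n"
  \<comment> \<open>The curve stays outside a disc on the side of \<open>n\<close> which it touches at \<open>z0\<close>.\<close>
  define h where "h = (\<lambda>s. (\<phi> (cis s) - c) \<bullet> (\<phi> (cis s) - c))"
  have "((\<lambda>s. \<phi> (cis s) - c) has_derivative (\<lambda>s. s *\<^sub>R d)) (at t)"
    using d unfolding has_vector_derivative_def by (auto intro!: derivative_eq_intros)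
  from has_derivative_inner[OF this this]
  have "(h has_derivative (\<lambda>s. 2 * ((\<phi> (cis t) - c) \<bullet> d) * s)) (at t)"
    unfolding h_def by (rule has_derivative_eq_rhs) (auto simp: inner_commute)
  then have "(h has_real_derivative 2 * ((\<phi> (cis t) - c) \<bullet> d)) (at t)"
    by (simp add: has_field_derivative_def)
  moreover have "h t \<le> h s" for s
  proof -
    have "\<phi> (cis s) \<in> range p" using \<phi> unfolding C2_parametrization_def homeomorphism_def by auto
    then have "\<phi> (cis s) \<notin> cball c r - {z0}" using ball_S sides'(1) unfolding c_def by blast
    moreover have "norm (z0 - c) = r" using n r by (simp add: c_def norm_mult)
    ultimately have "norm (\<phi> (cis s) - c) \<ge> norm (\<phi> (cis t) - c)"
      unfolding t by (cases "\<phi> (cis s) = z0") (auto simp: dist_norm norm_minus_commute)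
    then show ?thesis unfolding h_def power2_norm_eq_inner[symmetric] by (intro power_mono) auto
  qed
  ultimately have "2 * ((\<phi> (cis t) - c) \<bullet> d) = 0" by (intro DERIV_local_min[of h _ t 1]) auto
  moreover have "\<phi> (cis t) - c = - (r *\<^sub>R n)" by (simp add: t c_def scaleR_conv_of_real)
  ultimately show "n \<bullet> d = 0" using r by simp
qed

lemma unit_normal_eq:
  assumes \<phi>: "C2_parametrization \<phi> (range p)" and t: "\<phi> (cis t) = z0"
  shows "unit_normal (range p) G z0 = n"
  unfolding unit_normal_def
proof (rule the_equality)
  obtain d where d: "((\<lambda>s. \<phi> (cis s)) has_vector_derivative d) (at t)"
    using \<phi> unfolding C2_parametrization_def by blast
  have small: "\<forall>\<^sub>F s in at_right 0. s \<in> {0<..<r}" by (rule eventually_at_right_real[OF r])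
  then have ev: "\<forall>\<^sub>F s in at_right 0. Some (z0 + of_real s * n) \<in> G"
  proof eventually_elim
    case (elim s)
    then show ?case using normal_segment[OF n, of s r z0] ball_S by (auto simp: Some_in_G)
  qed
  have ev': "\<forall>\<^sub>F s in at_right 0. Some (z0 + of_real s * - n) \<notin> G"
    using small
  proof eventually_elim
    case (elim s)
    then have "z0 + of_real s * - n \<in> S'" using normal_segment[of "- n" s r z0] n ball_S' by auto
    then show ?case using sides(1) by (auto simp: Some_in_G)
  qed
  show "is_unit_normal_towards (range p) G z0 n"
    unfolding is_unit_normal_towards_def using n ev \<phi> t d tangent_orthogonal(1)[OF \<phi> t d] by blast
  show "m = n" if m: "is_unit_normal_towards (range p) G z0 m" for m
  proof -
    obtain \<psi> u d' where u: "norm m = 1" "C2_parametrization \<psi> (range p)" "\<psi> (cis u) = z0"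
      "((\<lambda>s. \<psi> (cis s)) has_vector_derivative d') (at u)" "m \<bullet> d' = 0"
      and evm: "\<forall>\<^sub>F s in at_right 0. Some (z0 + of_real s * m) \<in> G"
      using m unfolding is_unit_normal_towards_def by blast
    have "m = n \<or> m = - n"
      using orthogonal_unit_vectors[OF u(1) n _ u(5)] tangent_orthogonal[OF u(2-4)] by blast
    moreover have "m \<noteq> - n"
    proof
      assume "m = - n"
      with eventually_conj[OF evm ev'] have "\<forall>\<^sub>F s::real in at_right 0. False" by (simp add: eventually_mono)
      then show False by simp
    qed
    ultimately show ?thesis by blast
  qed
qed

text \<open>The preimage of \<open>Z\<close> under \<open>\<nu>E\<close> is closed and misses the
  image of the curve, which is the frontier of \<open>D\<close>; so its part in
  \<open>closure D\<close> is a compact subset of \<open>D\<close>. All bounds uniform over the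
  array rest on this set.\<close>

lemma poles_compact:
  assumes Z: "closedin extended_plane Z" "Z \<inter> Some ` range p = {}"
  obtains K where "compact K" "K \<subseteq> D" "\<And>x. x \<in> Z \<Longrightarrow> x \<in> G \<Longrightarrow> \<mu>E x \<in> K"
proof -
  define K where "K = closure D \<inter> {w. \<nu>E w \<in> Z}"
  have "openin extended_plane (topspace extended_plane - Z)" using Z(1) by (simp add: closedin_def)
  then have "open {w. \<nu>E w \<in> topspace extended_plane - Z}" by (rule continuous_\<nu>E)
  moreover have "x \<in> topspace extended_plane" for x :: "complex option" by (cases x) auto
  then have "{w. \<nu>E w \<in> topspace extended_plane - Z} = - {w. \<nu>E w \<in> Z}" by blast
  ultimately have "closed {w. \<nu>E w \<in> Z}" by (simp add: closed_def)
  then have "compact K" unfolding K_def using bounded_D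
    by (simp add: compact_Int_closed compact_closure)
  moreover have "K \<subseteq> D"
  proof
    fix w assume w: "w \<in> K"
    have "w \<notin> \<mu> ` range p"
    proof
      assume "w \<in> \<mu> ` range p"
      then obtain z where z: "z \<in> range p" "w = \<mu> z" by blast
      then have "z \<noteq> e" using e_notin(2) by blast
      then have "\<nu>E w = Some z" using \<nu>E_\<mu>E[of "Some z"] z by (simp add: \<mu>E_def)
      then show False using w z Z(2) by (auto simp: K_def)
    qed
    then show "w \<in> D" using w closure_D by (auto simp: K_def)
  qed
  moreover have "\<mu>E x \<in> K" if "x \<in> Z" "x \<in> G" for x
  proof -
    have "\<nu>E (\<mu>E x) = x" using \<nu>E_\<mu>E[of x] that e_notin_G by metis
    then show ?thesis using \<mu>E_in_D[OF that(2)] that(1) closure_subset[of D] by (auto simp: K_def)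
  qed
  ultimately show thesis using that by blast
qed

lemma side_slopes:
  assumes Z: "closedin extended_plane Z" "Z \<inter> Some ` range p = {}" and nn: "unit_normal (range p) G z0 = n"
  obtains c C where "c > 0" "\<And>x. x \<in> Z \<Longrightarrow> x \<in> G \<Longrightarrow>
    c \<le> Green_normal_derivative (range p) G x z0 \<and> Green_normal_derivative (range p) G x z0 \<le> C"
proof -
  obtain K where K: "compact K" "K \<subseteq> D" "\<And>x. x \<in> Z \<Longrightarrow> x \<in> G \<Longrightarrow> \<mu>E x \<in> K"
    using poles_compact[OF Z] by metis
  obtain c where "c > 0" "\<And>a. a \<in> K \<Longrightarrow> c \<le> H.green_slope a" using H.green_slope_lower[OF K(1,2)] by blast
  moreover obtain C where "\<And>a. a \<in> K \<Longrightarrow> H.green_slope a \<le> C" using H.green_slope_upper[OF K(1,2)] by blast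
  ultimately show thesis using that[of c C] K(3) Green_normal_derivative_eq[OF _ nn] by simp
qed

text \<open>In \<open>1 + 2 * \<delta>\<close> one \<open>\<delta>\<close> comes from the principal
  parts, the other from attaching the poles \<open>bs\<close> of the other side, which also costs
  the \<open>\<delta>\<close> subtracted in the derivative.\<close>

lemma side_rational:
  assumes Z: "closedin extended_plane Z" "Z \<inter> Some ` range p = {}" and nn: "unit_normal (range p) G z0 = n"
    and \<delta>: "\<delta> > 0"
  obtains m0 :: nat where "\<And>as bs. \<lbrakk>set as \<subseteq> Z \<inter> G; set bs \<subseteq> Z - G; length as > m0\<rbrakk> \<Longrightarrow>
    \<exists>R. R \<noteq> 0 \<and> (\<forall>x. pole_order R x = count_list (as @ bs) x) \<and>
      (\<forall>z\<in>range p. norm (rat_eval R z) \<le> 1 + 2 * \<delta>) \<and>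
      (1 - \<delta>) * (\<Sum>x\<leftarrow>as. Green_normal_derivative (range p) G x z0) - \<delta> \<le> norm (deriv (rat_eval R) z0)"
proof -
  obtain K where K: "compact K" "K \<subseteq> D" "\<And>x. x \<in> Z \<Longrightarrow> x \<in> G \<Longrightarrow> \<mu>E x \<in> K"
    using poles_compact[OF Z] by metis
  obtain m0 where m0: "\<And>as. \<lbrakk>set as \<subseteq> K; length as \<ge> m0\<rbrakk> \<Longrightarrow>
    \<exists>L. degree L \<le> length as - 1 \<and> (\<forall>a\<in>set as. poly L a \<noteq> 0) \<and>
      (\<forall>\<xi>\<in>frontier D. norm (poly L \<xi> / poly (root_poly as) \<xi>) \<le> 1 + \<delta>) \<and>
      (1 - \<delta>) * (\<Sum>a\<leftarrow>as. H.green_slope a) \<le> norm (deriv (\<lambda>z. poly L z / poly (root_poly as) z) 0)"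
    by (rule H.near_extremal_principal_parts[OF K(1,2) \<delta>]) blast
  show thesis
  proof (rule that[of m0])
    fix as bs assume as: "set as \<subseteq> Z \<inter> G" and bs: "set bs \<subseteq> Z - G" and len: "length as > m0"
    have "set (map \<mu>E as) \<subseteq> K" "length (map \<mu>E as) \<ge> m0" using as K(3) len by auto
    from m0[OF this] obtain L where L: "degree L \<le> length as - 1" "\<And>a. a \<in> set as \<Longrightarrow> poly L (\<mu>E a) \<noteq> 0"
      "\<And>\<xi>. \<xi> \<in> frontier D \<Longrightarrow> norm (poly L \<xi> / poly (root_poly (map \<mu>E as)) \<xi>) \<le> 1 + \<delta>"
      "(1 - \<delta>) * (\<Sum>a\<leftarrow>map \<mu>E as. H.green_slope a) \<le> norm (deriv (\<lambda>z. poly L z / poly (root_poly (map \<mu>E as)) z) 0)"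
      by auto
    have 1: "as \<noteq> []" "set as \<subseteq> G" "degree L \<le> length as" using len as L(1) by auto
    have 2: "x \<notin> G \<and> x \<notin> Some ` range p" if "x \<in> set bs" for x using bs Z(2) that by blast
    obtain R where R: "R \<noteq> 0" "\<And>x. pole_order R x = count_list (as @ bs) x"
      "\<And>z. z \<in> range p \<Longrightarrow> norm (rat_eval R z) \<le> norm (poly L (\<mu> z) / poly (root_poly (map \<mu>E as)) (\<mu> z)) + \<delta>"
      "norm (deriv (\<lambda>w. poly L w / poly (root_poly (map \<mu>E as)) w) 0) - \<delta> \<le> norm (deriv (rat_eval R) z0)"
    proof (rule transfer_principal_parts[OF 1(1,2) _ 1(3) _ \<delta>])
      show "x \<notin> G \<and> x \<notin> Some ` range p" if "x \<in> set bs" for x by (rule 2[OF that])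
      show "poly L (\<mu>E x) \<noteq> 0" if "x \<in> set as" for x by (rule L(2)[OF that])
      fix R assume "R \<noteq> 0" "\<And>x. pole_order R x = count_list (as @ bs) x"
        "\<And>z. z \<in> range p \<Longrightarrow> norm (rat_eval R z) \<le> norm (poly L (\<mu> z) / poly (root_poly (map \<mu>E as)) (\<mu> z)) + \<delta>"
        "norm (deriv (\<lambda>w. poly L w / poly (root_poly (map \<mu>E as)) w) 0) - \<delta> \<le> norm (deriv (rat_eval R) z0)"
      then show thesis by (rule that)
    qed
    have "(\<Sum>a\<leftarrow>map \<mu>E as. H.green_slope a) = (\<Sum>x\<leftarrow>as. Green_normal_derivative (range p) G x z0)"
      using 1(2) Green_normal_derivative_eq[OF _ nn] by (simp add: o_def subset_iff cong: map_cong)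
    from L(4)[unfolded this]
    have "(1 - \<delta>) * (\<Sum>x\<leftarrow>as. Green_normal_derivative (range p) G x z0) - \<delta> \<le> norm (deriv (rat_eval R) z0)"
      by (rule order_trans[OF diff_right_mono R(4)])
    moreover have "norm (rat_eval R z) \<le> 1 + 2 * \<delta>" if z: "z \<in> range p" for z
    proof -
      have "\<mu> z \<in> frontier D" unfolding frontier_D using z by blast
      then show ?thesis using R(3)[OF z] L(3) by fastforce
    qed
    ultimately show "\<exists>R. R \<noteq> 0 \<and> (\<forall>x. pole_order R x = count_list (as @ bs) x) \<and>
      (\<forall>z\<in>range p. norm (rat_eval R z) \<le> 1 + 2 * \<delta>) \<and>
      (1 - \<delta>) * (\<Sum>x\<leftarrow>as. Green_normal_derivative (range p) G x z0) - \<delta> \<le> norm (deriv (rat_eval R) z0)"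
      using R(1,2) by blast
  qed
qed

end

context regular_curve
begin

lemma far_outside: "\<exists>R. \<forall>z. norm z > R \<longrightarrow> z \<in> outside (range p)"
proof -
  have "bounded (inside (range p) \<union> range p)" using jordan_curve(5) compact_range by (simp add: compact_imp_bounded)
  then obtain R where R: "\<And>z. z \<in> inside (range p) \<union> range p \<Longrightarrow> norm z \<le> R" unfolding bounded_iff by blast
  have "z \<in> outside (range p)" if "norm z > R" for z
  proof -
    have "z \<notin> inside (range p) \<union> range p" using R[of z] that by linarith
    then show ?thesis using jordan_curve(7) by blast
  qed
  then show ?thesis by blast
qed

lemma both_sides:
  obtains n r where "curve_side p p' p'' t0 (G_minus (range p)) (inside (range p)) (outside (range p)) n r"
    "curve_side p p' p'' t0 (G_plus (range p)) (outside (range p)) (inside (range p)) (- n) r"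
proof -
  obtain n r where nr: "norm n = 1" "r > 0"
    "cball (p t0 + of_real r * n) r - {p t0} \<subseteq> inside (range p)"
    "cball (p t0 - of_real r * n) r - {p t0} \<subseteq> outside (range p)" by (rule two_sided_balls)
  note reg = regular_curve_axioms
  have sides': "outside (range p) \<inter> inside (range p) = {}" "outside (range p) \<union> inside (range p) = - range p"
    using jordan_curve(6,7) by blast+
  have nr': "norm (- n) = 1"
    "cball (p t0 + of_real r * - n) r - {p t0} \<subseteq> outside (range p)"
    "cball (p t0 - of_real r * - n) r - {p t0} \<subseteq> inside (range p)"
    using nr by simp_all
  show thesis
  proof (rule that[of n r])
    show "curve_side p p' p'' t0 (G_minus (range p)) (inside (range p)) (outside (range p)) n r"
      by (intro curve_side.intro[OF reg] curve_side_axioms.intro jordan_curve nr)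
         (use far_outside in \<open>auto simp: G_minus_def\<close>)
    show "curve_side p p' p'' t0 (G_plus (range p)) (outside (range p)) (inside (range p)) (- n) r"
      by (intro curve_side.intro[OF reg] curve_side_axioms.intro jordan_curve sides' nr' nr(2))
         (use far_outside in \<open>auto simp: G_plus_def\<close>)
  qed
qed

end

section \<open>Choosing the rational functions\<close>

text \<open>For each \<open>n\<close> the largest \<open>k \<le> n\<close> is taken for which the
  tolerance \<open>1 / (k + 1)\<close> is achievable; \<open>start\<close> provides
  \<open>k = 0\<close>, and \<open>ev\<close> forces these \<open>k\<close> to infinity.\<close>

lemma diagonal_choice:
  fixes Good :: "nat \<Rightarrow> real \<Rightarrow> 'a \<Rightarrow> bool"
  assumes start: "\<And>n. n \<ge> 1 \<Longrightarrow> \<exists>R. Good n 1 R"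
    and ev: "\<And>\<epsilon>. 0 < \<epsilon> \<Longrightarrow> \<epsilon> \<le> 1 \<Longrightarrow> \<exists>n0. \<forall>n\<ge>n0. \<exists>R. Good n \<epsilon> R"
  shows "\<exists>R \<epsilon>. \<epsilon> \<longlonglongrightarrow> 0 \<and> (\<forall>n\<ge>1. Good n (\<epsilon> n) (R n))"
proof -
  define E where "E = (\<lambda>n. {k. k \<le> n \<and> (\<exists>R. Good n (1 / real (Suc k)) R)})"
  define K where "K = (\<lambda>n. Max (E n))"
  define \<epsilon> where "\<epsilon> = (\<lambda>n. 1 / real (Suc (K n)))"
  have fin: "finite (E n)" for n unfolding E_def by simp
  have "\<exists>R. Good n (\<epsilon> n) R" if "n \<ge> 1" for n
  proof -
    have "0 \<in> E n" using start[OF that] by (simp add: E_def)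
    then have "K n \<in> E n" unfolding K_def using fin by (intro Max_in) auto
    then show ?thesis by (simp add: E_def \<epsilon>_def)
  qed
  then obtain R where R: "\<And>n. n \<ge> 1 \<Longrightarrow> Good n (\<epsilon> n) (R n)" by metis
  have "filterlim K at_top sequentially" unfolding filterlim_at_top
  proof
    fix k :: nat
    obtain n0 where n0: "\<And>n. n \<ge> n0 \<Longrightarrow> \<exists>R. Good n (1 / real (Suc k)) R"
      using ev[of "1 / real (Suc k)"] by auto
    have "k \<le> K n" if "n \<ge> max k n0" for n
      unfolding K_def using n0[of n] that fin by (intro Max_ge) (auto simp: E_def)
    then show "\<forall>\<^sub>F n in sequentially. k \<le> K n" unfolding eventually_sequentially by blast
  qed
  from filterlim_compose[OF LIMSEQ_Suc[OF lim_1_over_n] this]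
  have "\<epsilon> \<longlonglongrightarrow> 0" by (simp add: \<epsilon>_def)
  then show ?thesis using R by blast
qed

lemma rat_sup_norm_bounds:
  assumes "z0 \<in> \<Gamma>" and "\<And>z. z \<in> \<Gamma> \<Longrightarrow> pole_order R (Some z) = 0" and "\<And>z. z \<in> \<Gamma> \<Longrightarrow> norm (rat_eval R z) \<le> B"
  shows "0 \<le> rat_sup_norm \<Gamma> R" "rat_sup_norm \<Gamma> R \<le> ereal B"
proof -
  have "0 \<le> ereal (norm (rat_eval R z0))" by simp
  also have "\<dots> \<le> rat_sup_norm \<Gamma> R"
    unfolding rat_sup_norm_def using assms(1,2) by (intro SUP_upper2[of z0]) auto
  finally show "0 \<le> rat_sup_norm \<Gamma> R" .
  show "rat_sup_norm \<Gamma> R \<le> ereal B"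
    unfolding rat_sup_norm_def using assms(2,3) by (intro SUP_least) auto
qed

lemma sum_list_filter_map_upt:
  "(\<Sum>x\<leftarrow>filter P (map h [1..<Suc n]). f x) = (\<Sum>j | j \<in> {1..n} \<and> P (h j). f (h j))"
  for f :: "'a \<Rightarrow> real"
proof -
  have "(\<Sum>x\<leftarrow>filter P (map h [1..<Suc n]). f x) = (\<Sum>j\<leftarrow>filter (P \<circ> h) [1..<Suc n]. f (h j))"
    by (simp only: filter_map map_map o_def)
  also have "\<dots> = (\<Sum>j\<in>set (filter (P \<circ> h) [1..<Suc n]). f (h j))"
    by (rule sum_list_distinct_conv_sum_set) (simp add: distinct_filter del: upt_Suc)
  also have "set (filter (P \<circ> h) [1..<Suc n]) = {j. j \<in> {1..n} \<and> P (h j)}" by (auto simp del: upt_Suc)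
  finally show ?thesis .
qed

lemma count_list_map_upt: "count_list (map h [1..<Suc n]) b = card {j \<in> {1..n}. h j = b}"
proof -
  have "count_list xs b = length (filter (\<lambda>x. x = b) xs)" for xs :: "'a list"
    by (induction xs) auto
  then have "count_list (map h [1..<Suc n]) b = length (filter (\<lambda>j. h j = b) [1..<Suc n])"
    by (simp add: filter_map o_def del: upt_Suc)
  also have "\<dots> = card (set (filter (\<lambda>j. h j = b) [1..<Suc n]))"
    by (rule distinct_card[symmetric]) (simp add: distinct_filter del: upt_Suc)
  also have "set (filter (\<lambda>j. h j = b) [1..<Suc n]) = {j \<in> {1..n}. h j = b}" by (auto simp del: upt_Suc)
  finally show ?thesis .
qed

lemma count_list_filter_split:
  assumes "\<And>x. x \<in> set xs \<Longrightarrow> P x \<longleftrightarrow> \<not> Q x"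
  shows "count_list (filter P xs @ filter Q xs) b = count_list xs b"
  using assms by (induction xs) auto

text \<open>\<open>(1 - \<epsilon>) (1 + \<epsilon> / 2) \<le> 1 - \<epsilon> / 2\<close> takes care
  of the norm, and the additive loss \<open>\<epsilon> / 4\<close> is at most
  \<open>\<epsilon> M / 4\<close> because \<open>M \<ge> 1\<close>.\<close>

lemma scaled_inequality:
  assumes \<epsilon>: "0 < \<epsilon>" "\<epsilon> \<le> 1" and M: "M \<ge> 1"
    and A: "(1 - \<epsilon> / 4) * M - \<epsilon> / 4 \<le> A" and N: "0 \<le> N" "N \<le> ereal (1 + 2 * (\<epsilon> / 4))"
  shows "ereal (1 - \<epsilon>) * N * ereal M \<le> ereal A"
proof -
  have "ereal (1 - \<epsilon>) * N * ereal M \<le> ereal (1 - \<epsilon>) * ereal (1 + 2 * (\<epsilon> / 4)) * ereal M"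
    using N \<epsilon> M by (intro ereal_mult_right_mono ereal_mult_left_mono) auto
  also have "\<dots> = ereal ((1 - \<epsilon>) * (1 + 2 * (\<epsilon> / 4)) * M)" by simp
  also have "(1 - \<epsilon>) * (1 + 2 * (\<epsilon> / 4)) * M \<le> (1 - \<epsilon> / 2) * M"
  proof (rule mult_right_mono)
    have "(1 - \<epsilon>) * (1 + 2 * (\<epsilon> / 4)) = 1 - \<epsilon> / 2 - \<epsilon> * \<epsilon> / 2" by (simp add: field_simps)
    moreover have "\<epsilon> * \<epsilon> \<ge> 0" by simp
    ultimately show "(1 - \<epsilon>) * (1 + 2 * (\<epsilon> / 4)) \<le> 1 - \<epsilon> / 2" by linarith
  qed (use M in simp)
  also have "(1 - \<epsilon> / 2) * M \<le> A"
  proof -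
    have "\<epsilon> / 4 * 1 \<le> \<epsilon> / 4 * M" using \<epsilon> M by (intro mult_left_mono) auto
    moreover have "(1 - \<epsilon> / 2) * M = (1 - \<epsilon> / 4) * M - \<epsilon> / 4 * M" by (simp add: field_simps)
    ultimately show ?thesis using A by linarith
  qed
  finally show ?thesis by simp
qed

theorem theorem2p3:
  fixes \<Gamma> :: "complex set" and Z :: "complex option set"
    and a :: "nat \<Rightarrow> nat \<Rightarrow> complex option" and z0 :: complex
  assumes "C2_Jordan_curve \<Gamma>"
    and "closedin extended_plane Z" and "Z \<noteq> {}" and "Z \<inter> Some ` \<Gamma> = {}"
    and "\<And>n j. 1 \<le> j \<Longrightarrow> j \<le> n \<Longrightarrow> a j n \<in> Z"
    and "z0 \<in> \<Gamma>"
  shows "\<exists>(R :: nat \<Rightarrow> complex poly fract) (\<epsilon> :: nat \<Rightarrow> real).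
    (\<forall>n\<ge>1. R n \<noteq> 0) \<and>
    (\<lambda>n. real (total_degree (R n)) - real n) \<in> o(\<lambda>n. real n) \<and>
    (\<forall>n\<ge>1. \<forall>b \<in> (\<lambda>j. a j n) ` {1..n}. pole_order (R n) b = card {j \<in> {1..n}. a j n = b}) \<and>
    \<epsilon> \<longlonglongrightarrow> 0 \<and>
    (\<forall>n\<ge>1.
       ereal (norm (deriv (rat_eval (R n)) z0)) \<ge>
         ereal (1 - \<epsilon> n) * rat_sup_norm \<Gamma> (R n) *
         ereal (max
           (\<Sum>j | j \<in> {1..n} \<and> a j n \<in> G_plus \<Gamma>.
              Green_normal_derivative \<Gamma> (G_plus \<Gamma>) (a j n) z0)
           (\<Sum>j | j \<in> {1..n} \<and> a j n \<in> G_minus \<Gamma>.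
              Green_normal_derivative \<Gamma> (G_minus \<Gamma>) (a j n) z0)))"
proof -
  obtain \<phi> where \<phi>: "C2_parametrization \<phi> \<Gamma>" using assms(1) unfolding C2_Jordan_curve_def by blast
  define p where "p = (\<lambda>t. \<phi> (cis t))"
  obtain p' p'' where reg: "regular_curve p p' p''" and \<Gamma>: "\<Gamma> = range p"
    using C2_parametrization_regular[OF \<phi>] unfolding p_def by metis
  interpret regular_curve p p' p'' by (rule reg)
  obtain t0 where t0: "p t0 = z0" using assms(6) \<Gamma> by auto
  obtain n r where "curve_side p p' p'' t0 (G_minus (range p)) (inside (range p)) (outside (range p)) n r"
    "curve_side p p' p'' t0 (G_plus (range p)) (outside (range p)) (inside (range p)) (- n) r"
    by (rule both_sides)
  then interpret I: curve_side p p' p'' t0 "G_minus (range p)" "inside (range p)" "outside (range p)" n r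
    + O: curve_side p p' p'' t0 "G_plus (range p)" "outside (range p)" "inside (range p)" "- n" r
    by auto
  have \<phi>': "C2_parametrization \<phi> (range p)" "\<phi> (cis t0) = p t0" using \<phi> \<Gamma> by (simp_all add: p_def)
  have Z: "closedin extended_plane Z" "Z \<inter> Some ` range p = {}" using assms(2,4) \<Gamma> by auto
  have nI: "unit_normal (range p) (G_minus (range p)) (p t0) = n" by (rule I.unit_normal_eq[OF \<phi>'])
  have nO: "unit_normal (range p) (G_plus (range p)) (p t0) = - n" by (rule O.unit_normal_eq[OF \<phi>'])
  define GI GO where "GI = G_minus \<Gamma>" and "GO = G_plus \<Gamma>"
  define gI where "gI = (\<lambda>x. Green_normal_derivative \<Gamma> GI x z0)"
  define gO where "gO = (\<lambda>x. Green_normal_derivative \<Gamma> GO x z0)"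
  note defs = gI_def gO_def GI_def GO_def \<Gamma> t0[symmetric]
  have part: "x \<in> GO \<longleftrightarrow> x \<notin> GI" if "x \<in> Z" for x
  proof (cases x)
    case None then show ?thesis by (auto simp: GI_def GO_def G_minus_def G_plus_def)
  next
    case (Some z)
    then have "z \<notin> range p" using that Z(2) by blast
    then have "z \<in> outside (range p) \<longleftrightarrow> z \<notin> inside (range p)" using jordan_curve(6,7) by blast
    then show ?thesis using Some by (auto simp: GI_def GO_def G_minus_def G_plus_def \<Gamma>)
  qed
  obtain cI CI where cI: "cI > 0" "\<And>x. x \<in> Z \<Longrightarrow> x \<in> GI \<Longrightarrow> cI \<le> gI x \<and> gI x \<le> CI"
    using I.side_slopes[OF Z nI] unfolding defs by metis
  obtain cO CO where cO: "cO > 0" "\<And>x. x \<in> Z \<Longrightarrow> x \<in> GO \<Longrightarrow> cO \<le> gO x \<and> gO x \<le> CO"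
    using O.side_slopes[OF Z nO] unfolding defs by metis
  define c C where "c = min cI cO" and "C = max CI (max CO 1)"
  have c: "c > 0" "C > 0" using cI(1) cO(1) by (auto simp: c_def C_def)
  define xs where "xs = (\<lambda>n. map (\<lambda>j. a j n) [1..<Suc n])"
  define as where "as = (\<lambda>n. filter (\<lambda>x. x \<in> GI) (xs n))"
  define bs where "bs = (\<lambda>n. filter (\<lambda>x. x \<in> GO) (xs n))"
  have xsZ: "set (xs n) \<subseteq> Z" for n using assms(5) by (auto simp: xs_def simp del: upt_Suc)
  have sub: "set (as n) \<subseteq> Z \<inter> GI" "set (as n) \<subseteq> Z - GO" "set (bs n) \<subseteq> Z \<inter> GO" "set (bs n) \<subseteq> Z - GI" for n
    using xsZ part by (auto simp: as_def bs_def)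
  have cnt: "count_list (as n @ bs n) b = count_list (xs n) b" "count_list (bs n @ as n) b = count_list (xs n) b" for n b
    unfolding as_def bs_def by (rule count_list_filter_split; use xsZ[of n] part in blast)+
  have len: "length (as n) + length (bs n) = n" for n
  proof -
    have "bs n = filter (\<lambda>x. x \<notin> GI) (xs n)" unfolding bs_def using xsZ part by (auto intro: filter_cong)
    then show ?thesis using sum_length_filter_compl[of "\<lambda>x. x \<in> GI" "xs n"] by (simp add: as_def xs_def)
  qed
  have bounds: "c * length ys \<le> (\<Sum>x\<leftarrow>ys. g x) \<and> (\<Sum>x\<leftarrow>ys. g x) \<le> C * length ys"
    if "\<And>x. x \<in> set ys \<Longrightarrow> c \<le> g x \<and> g x \<le> C" for ys :: "complex option list" and g
    using that by (induction ys) (auto simp: algebra_simps add_mono)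
  define SI where "SI = (\<lambda>n. \<Sum>x\<leftarrow>as n. gI x)"
  define SO where "SO = (\<lambda>n. \<Sum>x\<leftarrow>bs n. gO x)"
  have SI: "c * length (as n) \<le> SI n" "SI n \<le> C * length (as n)" for n
    using bounds[of "as n" gI] sub(1)[of n] cI(2) unfolding SI_def c_def C_def by fastforce+
  have SO: "c * length (bs n) \<le> SO n" "SO n \<le> C * length (bs n)" for n
    using bounds[of "bs n" gO] sub(3)[of n] cO(2) unfolding SO_def c_def C_def by fastforce+
  define M where "M = (\<lambda>n. max (SO n) (SI n))"
  have M: "M n = max (\<Sum>j | j \<in> {1..n} \<and> a j n \<in> G_plus \<Gamma>. Green_normal_derivative \<Gamma> (G_plus \<Gamma>) (a j n) z0)
           (\<Sum>j | j \<in> {1..n} \<and> a j n \<in> G_minus \<Gamma>. Green_normal_derivative \<Gamma> (G_minus \<Gamma>) (a j n) z0)" for n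
    unfolding M_def SI_def SO_def as_def bs_def xs_def sum_list_filter_map_upt gI_def gO_def GI_def GO_def ..
  define Good where "Good = (\<lambda>n \<epsilon> R. R \<noteq> 0 \<and> (\<forall>x. pole_order R x = count_list (xs n) x) \<and>
    ereal (1 - \<epsilon>) * rat_sup_norm \<Gamma> R * ereal (M n) \<le> ereal (norm (deriv (rat_eval R) z0)))"
  \<comment> \<open>With tolerance 1 the lower bound carries the factor 0, so any function with the
    prescribed poles qualifies.\<close>
  have start: "\<exists>R. Good n 1 R" for n
    using rational_with_poles_exists[of "xs n"] by (auto simp: Good_def zero_ereal_def[symmetric])
  have ev: "\<exists>n0. \<forall>n\<ge>n0. \<exists>R. Good n \<epsilon> R" if \<epsilon>: "0 < \<epsilon>" "\<epsilon> \<le> 1" for \<epsilon>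
  proof -
    have \<epsilon>4: "\<epsilon> / 4 > 0" using \<epsilon> by simp
    obtain mI where mI: "\<And>as bs. \<lbrakk>set as \<subseteq> Z \<inter> GI; set bs \<subseteq> Z - GI; length as > mI\<rbrakk> \<Longrightarrow>
      \<exists>R. R \<noteq> 0 \<and> (\<forall>x. pole_order R x = count_list (as @ bs) x) \<and>
      (\<forall>z\<in>\<Gamma>. norm (rat_eval R z) \<le> 1 + 2 * (\<epsilon> / 4)) \<and>
      (1 - \<epsilon> / 4) * (\<Sum>x\<leftarrow>as. gI x) - \<epsilon> / 4 \<le> norm (deriv (rat_eval R) z0)"
      unfolding defs by (rule I.side_rational[OF Z nI \<epsilon>4]) blast
    obtain mO where mO: "\<And>as bs. \<lbrakk>set as \<subseteq> Z \<inter> GO; set bs \<subseteq> Z - GO; length as > mO\<rbrakk> \<Longrightarrow>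
      \<exists>R. R \<noteq> 0 \<and> (\<forall>x. pole_order R x = count_list (as @ bs) x) \<and>
      (\<forall>z\<in>\<Gamma>. norm (rat_eval R z) \<le> 1 + 2 * (\<epsilon> / 4)) \<and>
      (1 - \<epsilon> / 4) * (\<Sum>x\<leftarrow>as. gO x) - \<epsilon> / 4 \<le> norm (deriv (rat_eval R) z0)"
      unfolding defs by (rule O.side_rational[OF Z nO \<epsilon>4]) blast
    define m where "m = max mI mO"
    \<comment> \<open>For \<open>n \<ge> n0\<close>,
      \<open>c n \<le> SI n + SO n \<le> 2 M n\<close> gives \<open>M n > C (m + 1) + 1\<close>.
      Each sum is at most \<open>C\<close> times its number of terms, so the side with the larger
      sum has more than \<open>m\<close> poles.\<close>
    obtain n0 :: nat where n0: "real n0 > 2 * (C * (m + 1) + 1) / c" using reals_Archimedean2 by blast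
    have finish: "\<exists>R. Good n \<epsilon> R"
      if R: "R \<noteq> 0" "\<And>x. pole_order R x = count_list (xs n) x" "\<And>z. z \<in> \<Gamma> \<Longrightarrow> norm (rat_eval R z) \<le> 1 + 2 * (\<epsilon> / 4)"
        "(1 - \<epsilon> / 4) * M n - \<epsilon> / 4 \<le> norm (deriv (rat_eval R) z0)" and M1: "M n \<ge> 1" for R n
    proof -
      have "pole_order R (Some z) = 0" if "z \<in> \<Gamma>" for z
        using R(2)[of "Some z"] that xsZ[of n] assms(4) by (auto simp: count_list_0_iff)
      from scaled_inequality[OF \<epsilon> M1 R(4) rat_sup_norm_bounds[OF assms(6) this R(3)]]
      show ?thesis using R(1,2) unfolding Good_def by blast
    qed
    have "\<exists>R. Good n \<epsilon> R" if n: "n \<ge> n0" for n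
    proof -
      have "2 * (C * (m + 1) + 1) / c < real n" using n0 n by linarith
      then have big: "2 * (C * (m + 1) + 1) < c * real n" using c(1) by (simp add: field_simps)
      have "c * real n = c * length (as n) + c * length (bs n)" using len[of n] by (simp add: distrib_left[symmetric] flip: of_nat_add)
      then have "c * real n \<le> SI n + SO n" using SI(1)[of n] SO(1)[of n] by linarith
      moreover have "SI n \<le> M n" "SO n \<le> M n" by (simp_all add: M_def)
      moreover have "y < x" if "2 * y < u" "u \<le> s + t" "s \<le> x" "t \<le> x" for x y u s t :: real
        using that by linarith
      ultimately have Mbig: "C * (m + 1) + 1 < M n" using big by blast
      have "C * (m + 1) \<ge> 0" using c(2) by simp
      moreover have "1 \<le> x" if "0 \<le> y" "y + 1 < x" for x y :: real using that by linarith
      ultimately have M1: "1 \<le> M n" using Mbig by blast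
      show ?thesis
      proof (cases "SI n \<ge> SO n")
        case True
        then have eq: "M n = SI n" by (simp add: M_def)
        have "C * (m + 1) < C * length (as n)"
          by (rule order.strict_trans[OF less_add_one order_less_le_trans[OF Mbig[unfolded eq] SI(2)]])
        then have "real (m + 1) < length (as n)" using c(2) by (simp only: mult_less_cancel_left_pos)
        then have "length (as n) > mI" by (simp add: m_def)
        from mI[OF sub(1) sub(4) this] obtain R where "R \<noteq> 0" "\<And>x. pole_order R x = count_list (as n @ bs n) x"
          "\<And>z. z \<in> \<Gamma> \<Longrightarrow> norm (rat_eval R z) \<le> 1 + 2 * (\<epsilon> / 4)"
          "(1 - \<epsilon> / 4) * SI n - \<epsilon> / 4 \<le> norm (deriv (rat_eval R) z0)" unfolding SI_def by blast
        then show ?thesis using finish[of R n] M1 unfolding cnt eq by blast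
      next
        case False
        then have eq: "M n = SO n" by (simp add: M_def)
        have "C * (m + 1) < C * length (bs n)"
          by (rule order.strict_trans[OF less_add_one order_less_le_trans[OF Mbig[unfolded eq] SO(2)]])
        then have "real (m + 1) < length (bs n)" using c(2) by (simp only: mult_less_cancel_left_pos)
        then have "length (bs n) > mO" by (simp add: m_def)
        from mO[OF sub(3) sub(2) this] obtain R where "R \<noteq> 0" "\<And>x. pole_order R x = count_list (bs n @ as n) x"
          "\<And>z. z \<in> \<Gamma> \<Longrightarrow> norm (rat_eval R z) \<le> 1 + 2 * (\<epsilon> / 4)"
          "(1 - \<epsilon> / 4) * SO n - \<epsilon> / 4 \<le> norm (deriv (rat_eval R) z0)" unfolding SO_def by blast
        then show ?thesis using finish[of R n] M1 unfolding cnt eq by blast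
      qed
    qed
    then show ?thesis by blast
  qed
  obtain R \<epsilon> where lim: "\<epsilon> \<longlonglongrightarrow> 0" and R: "\<And>n. n \<ge> 1 \<Longrightarrow> Good n (\<epsilon> n) (R n)"
    using diagonal_choice[of Good, OF start ev] by blast
  have deg: "total_degree (R n) = n" if "n \<ge> 1" for n
    using total_degree_eq[of "R n" "xs n"] R[OF that] by (simp add: Good_def xs_def)
  have "(\<lambda>n. real (total_degree (R n)) - real n) \<in> o(\<lambda>n. real n)"
  proof -
    have "\<forall>\<^sub>F n in sequentially. real (total_degree (R n)) - real n = 0"
      using deg by (intro eventually_sequentiallyI[of 1]) simp
    from landau_o.small.in_cong[OF this] show ?thesis by simp
  qed
  moreover have "pole_order (R n) b = card {j \<in> {1..n}. a j n = b}" if "n \<ge> 1" for n b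
    using R[OF that] unfolding Good_def xs_def count_list_map_upt by blast
  ultimately show ?thesis using lim R unfolding Good_def M by blast
qed

end
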